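(* Let $\mathcal{A}$ be a length category and $M\in\mathcal{A}$ an object satisfying the following: (M1) The ext-quiver of $\mathcal{A}$ has no oriented cycle. (M2) The lattice of subobjects of $M$ is distributive and each object of $\mathcal{A}$ is a subquotient of a finite direct sum of copies of $M$. (M3) For each join-irreducible subobject $N\subseteq M$ the canonical map $\operatorname{End}(N)\to\operatorname{End}(N/\operatorname{rad}N)$ is surjective. Let $(M_x)_{x\in\Omega}$ be the set of join-irreducible subobjects of $M$. Then $(M_x)_{x\in\Omega}$ forms a representative set of the indecomposable projective objects of $\mathcal{A}$ (up to isomorphism), and the simple objects of $\mathcal{A}$ are up to isomorphism of the form $S_x=M_x/\operatorname{rad}M_x$ ($x\in\Omega$). Moreover, the assignment \[X\longmapsto\bigoplus_{x\in\Omega}\operatorname{Hom}(M_x,X)\] induces an equivalence $\mathcal{A}\xrightarrow{\sim}\operatorname{mod}A$, where $A=\bigoplus_{x,y\in\Omega}\operatorname{Hom}(M_x,M_y)$, and for all $x,y\in\Omega$ \[M_x\subseteq M_y\quad\Longleftrightarrow\quad\operatorname{Hom}(M_x,M_y)\neq 0\quad\Longleftrightarrow\quad[S_x]\le[S_y].\]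
   Context: A length category is an abelian category such that any chain of subobjects of a given object is finite and the isomorphism classes of objects form a set. The ext-quiver of $\mathcal{A}$ has as vertices the isomorphism classes $[S]$ of simple objects, and there is an arrow $[S]\to[T]$ if $\operatorname{Ext}^1(T,S)\neq 0$. Loops count as oriented cycles; paths of length $0$ are allowed. If there are no oriented cycles, then setting $[S]\le[T]$ if there is a path from $[S]$ to $[T]$ defines a partial order. A subobject $N\subseteq M$ is join-irreducible if it is join-irreducible in the lattice of subobjects of $M$, i.e. $N\neq 0$ and $N=N_1+N_2$ implies $N=N_1$ or $N=N_2$. The radical $\operatorname{rad}N$ is the intersection of all maximal subobjects of $N$; each endomorphism of $N$ preserves it, which gives the canonical map $\operatorname{End}(N)\to\operatorname{End}(N/\operatorname{rad}N)$. The relation $M_x\subseteq M_y$ is inclusion of subobjects of $M$. The ring $A=\bigoplus_{x,y\in\Omega}\operatorname{Hom}(M_x,M_y)$ has multiplication given by composition, i.e. it is the endomorphism ring of $\bigoplus_{x\in\Omega}M_x$ (the set $\Omega$ is finite since a finite length object with distributive subobject lattice has only finitely many subobjects). It acts from the right on $\bigoplus_{x}\operatorname{Hom}(M_x,X)$ by precomposition, and $\operatorname{mod}A$ denotes the category of finitely presented right $A$-modules. *)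

theory Defs
  imports "HOL-Algebra.Ring" "HOL-Algebra.Lattice"
begin

section \<open>Categories, functors, equivalences\<close>

text \<open>Objects and arrows are elements of types, so (isomorphism classes of) objects always form
  a set. Hom-sets are disjoint: an arrow determines its domain and codomain.\<close>

record ('o, 'm) category =
  Obj :: "'o set"
  Arr :: "'m set"
  Dom :: "'m \<Rightarrow> 'o"
  Cod :: "'m \<Rightarrow> 'o"
  Ident :: "'o \<Rightarrow> 'm"
  Cmp :: "'m \<Rightarrow> 'm \<Rightarrow> 'm"  (infixr \<open>\<cdot>\<index>\<close> 75)

definition Hom :: "('o, 'm, 'z) category_scheme \<Rightarrow> 'o \<Rightarrow> 'o \<Rightarrow> 'm set" where
  "Hom C X Y = {f \<in> Arr C. Dom C f = X \<and> Cod C f = Y}"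

locale category =
  fixes C (structure)
  assumes dom_obj: "f \<in> Arr C \<Longrightarrow> Dom C f \<in> Obj C"
    and cod_obj: "f \<in> Arr C \<Longrightarrow> Cod C f \<in> Obj C"
    and ident_hom: "X \<in> Obj C \<Longrightarrow> Ident C X \<in> Hom C X X"
    and comp_hom: "\<lbrakk>f \<in> Hom C X Y; g \<in> Hom C Y Z\<rbrakk> \<Longrightarrow> g \<cdot> f \<in> Hom C X Z"
    and comp_assoc: "\<lbrakk>f \<in> Hom C W X; g \<in> Hom C X Y; h \<in> Hom C Y Z\<rbrakk> \<Longrightarrow> (h \<cdot> g) \<cdot> f = h \<cdot> (g \<cdot> f)"
    and ident_left: "f \<in> Hom C X Y \<Longrightarrow> Ident C Y \<cdot> f = f"
    and ident_right: "f \<in> Hom C X Y \<Longrightarrow> f \<cdot> Ident C X = f"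

definition iso_arr :: "('o, 'm, 'z) category_scheme \<Rightarrow> 'm \<Rightarrow> bool" where
  "iso_arr C f \<longleftrightarrow> f \<in> Arr C \<and>
     (\<exists>g \<in> Hom C (Cod C f) (Dom C f).
        g \<cdot>\<^bsub>C\<^esub> f = Ident C (Dom C f) \<and> f \<cdot>\<^bsub>C\<^esub> g = Ident C (Cod C f))"

definition isomorphic :: "('o, 'm, 'z) category_scheme \<Rightarrow> 'o \<Rightarrow> 'o \<Rightarrow> bool" where
  "isomorphic C X Y \<longleftrightarrow> (\<exists>f \<in> Hom C X Y. iso_arr C f)"

definition iso_class :: "('o, 'm, 'z) category_scheme \<Rightarrow> 'o \<Rightarrow> 'o set" where
  "iso_class C X = {Y \<in> Obj C. isomorphic C X Y}"

definition mono_arr :: "('o, 'm, 'z) category_scheme \<Rightarrow> 'm \<Rightarrow> bool" where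
  "mono_arr C f \<longleftrightarrow> f \<in> Arr C \<and>
     (\<forall>W. \<forall>g \<in> Hom C W (Dom C f). \<forall>h \<in> Hom C W (Dom C f). f \<cdot>\<^bsub>C\<^esub> g = f \<cdot>\<^bsub>C\<^esub> h \<longrightarrow> g = h)"

definition epi_arr :: "('o, 'm, 'z) category_scheme \<Rightarrow> 'm \<Rightarrow> bool" where
  "epi_arr C f \<longleftrightarrow> f \<in> Arr C \<and>
     (\<forall>W. \<forall>g \<in> Hom C (Cod C f) W. \<forall>h \<in> Hom C (Cod C f) W. g \<cdot>\<^bsub>C\<^esub> f = h \<cdot>\<^bsub>C\<^esub> f \<longrightarrow> g = h)"

locale cat_functor = dom: category C + cod: category D
  for C :: "('o, 'm, 'z) category_scheme" and D :: "('p, 'n, 'y) category_scheme" +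
  fixes Fo :: "'o \<Rightarrow> 'p" and Fa :: "'m \<Rightarrow> 'n"
  assumes obj_map: "X \<in> Obj C \<Longrightarrow> Fo X \<in> Obj D"
    and arr_map: "f \<in> Hom C X Y \<Longrightarrow> Fa f \<in> Hom D (Fo X) (Fo Y)"
    and map_ident: "X \<in> Obj C \<Longrightarrow> Fa (Ident C X) = Ident D (Fo X)"
    and map_comp: "\<lbrakk>f \<in> Hom C X Y; g \<in> Hom C Y Z\<rbrakk> \<Longrightarrow> Fa (g \<cdot>\<^bsub>C\<^esub> f) = Fa g \<cdot>\<^bsub>D\<^esub> Fa f"

definition natural_iso ::
  "('o, 'm, 'z) category_scheme \<Rightarrow> ('p, 'n, 'y) category_scheme \<Rightarrow>
   ('o \<Rightarrow> 'p) \<Rightarrow> ('m \<Rightarrow> 'n) \<Rightarrow> ('o \<Rightarrow> 'p) \<Rightarrow> ('m \<Rightarrow> 'n) \<Rightarrow> ('o \<Rightarrow> 'n) \<Rightarrow> bool" where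
  "natural_iso C D Fo Fa Go Ga \<eta> \<longleftrightarrow>
     (\<forall>X \<in> Obj C. \<eta> X \<in> Hom D (Fo X) (Go X) \<and> iso_arr D (\<eta> X)) \<and>
     (\<forall>X Y. \<forall>f \<in> Hom C X Y. \<eta> Y \<cdot>\<^bsub>D\<^esub> Fa f = Ga f \<cdot>\<^bsub>D\<^esub> \<eta> X)"

definition category_equivalence ::
  "('o, 'm, 'z) category_scheme \<Rightarrow> ('p, 'n, 'y) category_scheme \<Rightarrow>
   ('o \<Rightarrow> 'p) \<Rightarrow> ('m \<Rightarrow> 'n) \<Rightarrow> bool" where
  "category_equivalence C D Fo Fa \<longleftrightarrow> cat_functor C D Fo Fa \<and>
     (\<exists>Go Ga \<eta> \<epsilon>. cat_functor D C Go Ga \<and>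
        natural_iso C C id id (Go \<circ> Fo) (Ga \<circ> Fa) \<eta> \<and>
        natural_iso D D (Fo \<circ> Go) (Fa \<circ> Ga) id id \<epsilon>)"


section \<open>Abelian categories\<close>

record ('o, 'm) additive_category = "('o, 'm) category" +
  hadd :: "'m \<Rightarrow> 'm \<Rightarrow> 'm"
  hzero :: "'o \<Rightarrow> 'o \<Rightarrow> 'm"

text \<open>The additive group of arrows, as a HOL-Algebra structure; the multiplicative fields are junk.\<close>

definition hom_group :: "('o, 'm, 'z) additive_category_scheme \<Rightarrow> 'o \<Rightarrow> 'o \<Rightarrow> 'm ring" where
  "hom_group C X Y = \<lparr>carrier = Hom C X Y, mult = undefined, one = undefined,
     zero = hzero C X Y, add = hadd C\<rparr>"

locale preadditive = category C for C :: "('o, 'm, 'z) additive_category_scheme" (structure) +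
  assumes hom_abelian_group: "\<lbrakk>X \<in> Obj C; Y \<in> Obj C\<rbrakk> \<Longrightarrow> abelian_group (hom_group C X Y)"
    and comp_add_right: "\<lbrakk>f \<in> Hom C X Y; f' \<in> Hom C X Y; g \<in> Hom C Y Z\<rbrakk>
      \<Longrightarrow> g \<cdot> hadd C f f' = hadd C (g \<cdot> f) (g \<cdot> f')"
    and comp_add_left: "\<lbrakk>f \<in> Hom C X Y; g \<in> Hom C Y Z; g' \<in> Hom C Y Z\<rbrakk>
      \<Longrightarrow> hadd C g g' \<cdot> f = hadd C (g \<cdot> f) (g' \<cdot> f)"

definition zero_obj :: "('o, 'm, 'z) category_scheme \<Rightarrow> 'o \<Rightarrow> bool" where
  "zero_obj C X \<longleftrightarrow> X \<in> Obj C \<and>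
     (\<forall>Y \<in> Obj C. (\<exists>!f. f \<in> Hom C X Y) \<and> (\<exists>!f. f \<in> Hom C Y X))"

text \<open>Finite direct sums as biproduct diagrams, with injections \<open>\<iota>\<close> and projections \<open>\<pi>\<close>.
  For \<open>I = {}\<close> the last condition says that \<open>Ident C D\<close> is zero, i.e. that \<open>D\<close> is a zero object.\<close>

definition direct_sum :: "('o, 'm, 'z) additive_category_scheme \<Rightarrow> 'i set \<Rightarrow> ('i \<Rightarrow> 'o) \<Rightarrow>
    'o \<Rightarrow> ('i \<Rightarrow> 'm) \<Rightarrow> ('i \<Rightarrow> 'm) \<Rightarrow> bool" where
  "direct_sum C I X D \<iota> \<pi> \<longleftrightarrow> finite I \<and> D \<in> Obj C \<and>
     (\<forall>k \<in> I. X k \<in> Obj C \<and> \<iota> k \<in> Hom C (X k) D \<and> \<pi> k \<in> Hom C D (X k)) \<and>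
     (\<forall>j \<in> I. \<forall>k \<in> I.
        \<pi> j \<cdot>\<^bsub>C\<^esub> \<iota> k = (if j = k then Ident C (X k) else hzero C (X k) (X j))) \<and>
     (\<Oplus>\<^bsub>hom_group C D D\<^esub>k\<in>I. \<iota> k \<cdot>\<^bsub>C\<^esub> \<pi> k) = Ident C D"

definition is_kernel :: "('o, 'm, 'z) additive_category_scheme \<Rightarrow> 'm \<Rightarrow> 'm \<Rightarrow> bool" where
  "is_kernel C f k \<longleftrightarrow> f \<in> Arr C \<and> k \<in> Arr C \<and> Cod C k = Dom C f \<and>
     f \<cdot>\<^bsub>C\<^esub> k = hzero C (Dom C k) (Cod C f) \<and>
     (\<forall>W. \<forall>h \<in> Hom C W (Dom C f). f \<cdot>\<^bsub>C\<^esub> h = hzero C W (Cod C f) \<longrightarrow>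
        (\<exists>!u. u \<in> Hom C W (Dom C k) \<and> k \<cdot>\<^bsub>C\<^esub> u = h))"

definition is_cokernel :: "('o, 'm, 'z) additive_category_scheme \<Rightarrow> 'm \<Rightarrow> 'm \<Rightarrow> bool" where
  "is_cokernel C f q \<longleftrightarrow> f \<in> Arr C \<and> q \<in> Arr C \<and> Dom C q = Cod C f \<and>
     q \<cdot>\<^bsub>C\<^esub> f = hzero C (Dom C f) (Cod C q) \<and>
     (\<forall>W. \<forall>h \<in> Hom C (Cod C f) W. h \<cdot>\<^bsub>C\<^esub> f = hzero C (Dom C f) W \<longrightarrow>
        (\<exists>!u. u \<in> Hom C (Cod C q) W \<and> u \<cdot>\<^bsub>C\<^esub> q = h))"

locale abelian_category = preadditive +
  assumes direct_sums_exist: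
      "(\<And>k. k < n \<Longrightarrow> X k \<in> Obj C) \<Longrightarrow> \<exists>D \<iota> \<pi>. direct_sum C {..<n::nat} X D \<iota> \<pi>"
    and kernels_exist: "f \<in> Arr C \<Longrightarrow> \<exists>k. is_kernel C f k"
    and cokernels_exist: "f \<in> Arr C \<Longrightarrow> \<exists>q. is_cokernel C f q"
    and mono_is_kernel: "mono_arr C f \<Longrightarrow> \<exists>g. is_kernel C g f"
    and epi_is_cokernel: "epi_arr C f \<Longrightarrow> \<exists>g. is_cokernel C g f"


section \<open>Subobjects and length categories\<close>

text \<open>The lattice of subobjects of \<open>X\<close>, in the setoid style of HOL-Algebra: the elements are the
  monomorphisms into \<open>X\<close> and \<open>.=\<close> identifies those representing the same subobject.\<close>

definition subobjects :: "('o, 'm, 'z) category_scheme \<Rightarrow> 'o \<Rightarrow> 'm gorder" where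
  "subobjects C X = \<lparr>carrier = {m. mono_arr C m \<and> Cod C m = X},
     eq = (\<lambda>m n. \<exists>u \<in> Hom C (Dom C m) (Dom C n). iso_arr C u \<and> n \<cdot>\<^bsub>C\<^esub> u = m),
     le = (\<lambda>m n. \<exists>u \<in> Hom C (Dom C m) (Dom C n). n \<cdot>\<^bsub>C\<^esub> u = m)\<rparr>"

definition distributive_lattice :: "('a, 'z) gorder_scheme \<Rightarrow> bool" where
  "distributive_lattice L \<longleftrightarrow> weak_lattice L \<and>
     (\<forall>x \<in> carrier L. \<forall>y \<in> carrier L. \<forall>z \<in> carrier L.
        x \<sqinter>\<^bsub>L\<^esub> (y \<squnion>\<^bsub>L\<^esub> z) .=\<^bsub>L\<^esub> (x \<sqinter>\<^bsub>L\<^esub> y) \<squnion>\<^bsub>L\<^esub> (x \<sqinter>\<^bsub>L\<^esub> z))"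

definition join_irreducible :: "('a, 'z) gorder_scheme \<Rightarrow> 'a \<Rightarrow> bool" where
  "join_irreducible L x \<longleftrightarrow> x \<in> carrier L \<and> x .\<noteq>\<^bsub>L\<^esub> \<bottom>\<^bsub>L\<^esub> \<and>
     (\<forall>y \<in> carrier L. \<forall>z \<in> carrier L. x .=\<^bsub>L\<^esub> y \<squnion>\<^bsub>L\<^esub> z \<longrightarrow> x .=\<^bsub>L\<^esub> y \<or> x .=\<^bsub>L\<^esub> z)"

definition maximal_proper :: "('a, 'z) gorder_scheme \<Rightarrow> 'a \<Rightarrow> bool" where
  "maximal_proper L x \<longleftrightarrow> x \<in> carrier L \<and> x .\<noteq>\<^bsub>L\<^esub> \<top>\<^bsub>L\<^esub> \<and>
     (\<forall>y \<in> carrier L. x \<sqsubseteq>\<^bsub>L\<^esub> y \<longrightarrow> y .=\<^bsub>L\<^esub> x \<or> y .=\<^bsub>L\<^esub> \<top>\<^bsub>L\<^esub>)"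

text \<open>A chain is finite if it contains finitely many subobjects, i.e. finitely many classes of
  monomorphisms.\<close>

locale length_category = abelian_category +
  assumes finite_chains:
    "\<lbrakk>X \<in> Obj C; K \<subseteq> carrier (subobjects C X);
      \<And>m n. \<lbrakk>m \<in> K; n \<in> K\<rbrakk> \<Longrightarrow> m \<sqsubseteq>\<^bsub>subobjects C X\<^esub> n \<or> n \<sqsubseteq>\<^bsub>subobjects C X\<^esub> m\<rbrakk>
     \<Longrightarrow> finite ((\<lambda>m. class_of\<^bsub>subobjects C X\<^esub> m) ` K)"

definition subquotient :: "('o, 'm, 'z) category_scheme \<Rightarrow> 'o \<Rightarrow> 'o \<Rightarrow> bool" where
  "subquotient C X Y \<longleftrightarrow> (\<exists>m q. mono_arr C m \<and> Cod C m = Y \<and> epi_arr C q \<and> Dom C q = Dom C m \<and> Cod C q = X)"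

definition simple_obj :: "('o, 'm, 'z) category_scheme \<Rightarrow> 'o \<Rightarrow> bool" where
  "simple_obj C S \<longleftrightarrow> S \<in> Obj C \<and> \<not> zero_obj C S \<and>
     (\<forall>m. mono_arr C m \<and> Cod C m = S \<longrightarrow> zero_obj C (Dom C m) \<or> iso_arr C m)"

definition projective_obj :: "('o, 'm, 'z) category_scheme \<Rightarrow> 'o \<Rightarrow> bool" where
  "projective_obj C P \<longleftrightarrow> P \<in> Obj C \<and>
     (\<forall>e. epi_arr C e \<longrightarrow> (\<forall>f \<in> Hom C P (Cod C e). \<exists>g \<in> Hom C P (Dom C e). e \<cdot>\<^bsub>C\<^esub> g = f))"

definition indecomposable_obj :: "('o, 'm, 'z) additive_category_scheme \<Rightarrow> 'o \<Rightarrow> bool" where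
  "indecomposable_obj C X \<longleftrightarrow> X \<in> Obj C \<and> \<not> zero_obj C X \<and>
     (\<forall>Y \<iota> \<pi>. direct_sum C {0, 1 :: nat} Y X \<iota> \<pi> \<longrightarrow> zero_obj C (Y 0) \<or> zero_obj C (Y 1))"

text \<open>\<open>rad C N\<close> is a monomorphism representing the radical of \<open>N\<close>, \<open>top_proj C N\<close> is the projection
  from \<open>N\<close> to \<open>N / rad N\<close>, and \<open>top_obj C N\<close> is \<open>N / rad N\<close>.\<close>

definition rad :: "('o, 'm, 'z) category_scheme \<Rightarrow> 'o \<Rightarrow> 'm" where
  "rad C N = \<Sqinter>\<^bsub>subobjects C N\<^esub> {m. maximal_proper (subobjects C N) m}"

definition top_proj :: "('o, 'm, 'z) additive_category_scheme \<Rightarrow> 'o \<Rightarrow> 'm" where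
  "top_proj C N = (SOME q. is_cokernel C (rad C N) q)"

definition top_obj :: "('o, 'm, 'z) additive_category_scheme \<Rightarrow> 'o \<Rightarrow> 'o" where
  "top_obj C N = Cod C (top_proj C N)"

definition top_map :: "('o, 'm, 'z) additive_category_scheme \<Rightarrow> 'o \<Rightarrow> 'm \<Rightarrow> 'm" where
  "top_map C N e = (THE h. h \<in> Hom C (top_obj C N) (top_obj C N) \<and>
     h \<cdot>\<^bsub>C\<^esub> top_proj C N = top_proj C N \<cdot>\<^bsub>C\<^esub> e)"


section \<open>The ext-quiver\<close>

definition extensions ::
  "('o, 'm, 'z) additive_category_scheme \<Rightarrow> 'o \<Rightarrow> 'o \<Rightarrow> ('m \<times> 'm) set" where
  "extensions C T S =
     {(f, g). is_kernel C g f \<and> is_cokernel C f g \<and> Dom C f = S \<and> Cod C g = T}"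

text \<open>The connecting arrow \<open>h\<close> is automatically an isomorphism (five lemma).\<close>

definition ext_rel ::
  "('o, 'm, 'z) additive_category_scheme \<Rightarrow> 'o \<Rightarrow> 'o \<Rightarrow> (('m \<times> 'm) \<times> ('m \<times> 'm)) set" where
  "ext_rel C T S = {((f, g), (f', g')). (f, g) \<in> extensions C T S \<and> (f', g') \<in> extensions C T S \<and>
     (\<exists>h \<in> Hom C (Cod C f) (Cod C f'). h \<cdot>\<^bsub>C\<^esub> f = f' \<and> g' \<cdot>\<^bsub>C\<^esub> h = g)}"

definition Ext1 ::
  "('o, 'm, 'z) additive_category_scheme \<Rightarrow> 'o \<Rightarrow> 'o \<Rightarrow> ('m \<times> 'm) set set" where
  "Ext1 C T S = extensions C T S // ext_rel C T S"

text \<open>The class of split extensions, the neutral element for the Baer sum.\<close>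

definition Ext1_zero ::
  "('o, 'm, 'z) additive_category_scheme \<Rightarrow> 'o \<Rightarrow> 'o \<Rightarrow> ('m \<times> 'm) set" where
  "Ext1_zero C T S =
     {(f, g) \<in> extensions C T S. \<exists>s \<in> Hom C T (Dom C g). g \<cdot>\<^bsub>C\<^esub> s = Ident C T}"

text \<open>The arrows of the ext-quiver. Its oriented cycles are the cycles of this relation, and
  its paths (including those of length 0) are given by the reflexive transitive closure.\<close>

definition ext_quiver :: "('o, 'm, 'z) additive_category_scheme \<Rightarrow> ('o set \<times> 'o set) set" where
  "ext_quiver C = {(iso_class C S, iso_class C T) | S T.
     simple_obj C S \<and> simple_obj C T \<and> Ext1 C T S \<noteq> {Ext1_zero C T S}}"


section \<open>Right modules and their finitely presented ones\<close>

record ('a, 'b) rmodule = "'b ring" +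
  act :: "'b \<Rightarrow> 'a \<Rightarrow> 'b"

text \<open>As for \<open>module\<close> in HOL-Algebra, the multiplicative fields of \<open>N\<close> play no role.\<close>

locale right_module = R: ring R + N: abelian_group N
  for R :: "('a, 'z) ring_scheme" and N :: "('a, 'b, 'y) rmodule_scheme" +
  assumes act_closed: "\<lbrakk>x \<in> carrier N; a \<in> carrier R\<rbrakk> \<Longrightarrow> act N x a \<in> carrier N"
    and act_add_left: "\<lbrakk>x \<in> carrier N; y \<in> carrier N; a \<in> carrier R\<rbrakk>
      \<Longrightarrow> act N (x \<oplus>\<^bsub>N\<^esub> y) a = act N x a \<oplus>\<^bsub>N\<^esub> act N y a"
    and act_add_right: "\<lbrakk>x \<in> carrier N; a \<in> carrier R; b \<in> carrier R\<rbrakk>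
      \<Longrightarrow> act N x (a \<oplus>\<^bsub>R\<^esub> b) = act N x a \<oplus>\<^bsub>N\<^esub> act N x b"
    and act_mult: "\<lbrakk>x \<in> carrier N; a \<in> carrier R; b \<in> carrier R\<rbrakk>
      \<Longrightarrow> act N x (a \<otimes>\<^bsub>R\<^esub> b) = act N (act N x a) b"
    and act_one: "x \<in> carrier N \<Longrightarrow> act N x \<one>\<^bsub>R\<^esub> = x"

definition rmodule_hom ::
  "('a, 'z) ring_scheme \<Rightarrow> ('a, 'b) rmodule \<Rightarrow> ('a, 'c) rmodule \<Rightarrow> ('b \<Rightarrow> 'c) set" where
  "rmodule_hom R N N' = {f \<in> carrier N \<rightarrow>\<^sub>E carrier N'.
     (\<forall>x \<in> carrier N. \<forall>y \<in> carrier N. f (x \<oplus>\<^bsub>N\<^esub> y) = f x \<oplus>\<^bsub>N'\<^esub> f y) \<and>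
     (\<forall>x \<in> carrier N. \<forall>a \<in> carrier R. f (act N x a) = act N' (f x) a)}"

definition free_rmodule :: "('a, 'z) ring_scheme \<Rightarrow> nat \<Rightarrow> ('a, nat \<Rightarrow> 'a) rmodule" where
  "free_rmodule R n = \<lparr>carrier = {..<n} \<rightarrow>\<^sub>E carrier R, mult = undefined, one = undefined,
     zero = (\<lambda>k\<in>{..<n}. \<zero>\<^bsub>R\<^esub>), add = (\<lambda>v w. \<lambda>k\<in>{..<n}. v k \<oplus>\<^bsub>R\<^esub> w k),
     act = (\<lambda>v a. \<lambda>k\<in>{..<n}. v k \<otimes>\<^bsub>R\<^esub> a)\<rparr>"

definition finitely_presented :: "('a, 'z) ring_scheme \<Rightarrow> ('a, 'b) rmodule \<Rightarrow> bool" where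
  "finitely_presented R N \<longleftrightarrow> right_module R N \<and>
     (\<exists>m n. \<exists>g \<in> rmodule_hom R (free_rmodule R m) (free_rmodule R n).
        \<exists>p \<in> rmodule_hom R (free_rmodule R n) N.
          p ` carrier (free_rmodule R n) = carrier N \<and>
          g ` carrier (free_rmodule R m) = {v \<in> carrier (free_rmodule R n). p v = \<zero>\<^bsub>N\<^esub>})"

text \<open>The category of finitely presented right modules with elements in a type \<open>'b\<close>. An arrow is
  a homomorphism tagged with its domain and codomain.\<close>

definition fp_modules :: "('a, 'z) ring_scheme \<Rightarrow>
    (('a, 'b) rmodule, ('a, 'b) rmodule \<times> ('b \<Rightarrow> 'b) \<times> ('a, 'b) rmodule) category" where
  "fp_modules R = \<lparr>Obj = {N. finitely_presented R N},
     Arr = {(N, f, N'). finitely_presented R N \<and> finitely_presented R N' \<and> f \<in> rmodule_hom R N N'},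
     Dom = (\<lambda>(N, f, N'). N),
     Cod = (\<lambda>(N, f, N'). N'),
     Ident = (\<lambda>N. (N, (\<lambda>x\<in>carrier N. x), N)),
     Cmp = (\<lambda>(N', g, N'') (N, f, _). (N, compose (carrier N) g f, N''))\<rparr>"


section \<open>The ring \<open>A\<close> and the functor\<close>

text \<open>An element of \<open>A\<close> is a matrix whose entry \<open>a x y\<close> is an arrow from \<open>P x\<close> to \<open>P y\<close>; it is
  regarded as an endomorphism of the direct sum of the \<open>P x\<close>, and \<open>a \<otimes> b\<close> is \<open>a\<close> after \<open>b\<close>.
  The index set \<open>\<Omega>\<close> is meant to be finite.\<close>

definition hom_ring :: "('o, 'm, 'z) additive_category_scheme \<Rightarrow> 'x set \<Rightarrow> ('x \<Rightarrow> 'o) \<Rightarrow>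
    ('x \<Rightarrow> 'x \<Rightarrow> 'm) ring" where
  "hom_ring C \<Omega> P = \<lparr>carrier = (\<Pi>\<^sub>E x\<in>\<Omega>. \<Pi>\<^sub>E y\<in>\<Omega>. Hom C (P x) (P y)),
     mult = (\<lambda>a b. \<lambda>x\<in>\<Omega>. \<lambda>z\<in>\<Omega>. \<Oplus>\<^bsub>hom_group C (P x) (P z)\<^esub>y\<in>\<Omega>. a y z \<cdot>\<^bsub>C\<^esub> b x y),
     one = (\<lambda>x\<in>\<Omega>. \<lambda>y\<in>\<Omega>. if x = y then Ident C (P x) else hzero C (P x) (P y)),
     zero = (\<lambda>x\<in>\<Omega>. \<lambda>y\<in>\<Omega>. hzero C (P x) (P y)),
     add = (\<lambda>a b. \<lambda>x\<in>\<Omega>. \<lambda>y\<in>\<Omega>. hadd C (a x y) (b x y))\<rparr>"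

text \<open>The right \<open>A\<close>-module \<open>\<Oplus>\<^sub>x Hom (P x) X\<close>. Its elements are the families \<open>\<phi>\<close> with
  \<open>\<phi> x \<in> Hom (P x) X\<close>, tagged by \<open>Inl\<close>: the type \<open>'u\<close> is arbitrary, so that the ambient category of
  modules may be taken in an arbitrarily large universe.\<close>

definition hom_module :: "('o, 'm, 'z) additive_category_scheme \<Rightarrow> 'x set \<Rightarrow> ('x \<Rightarrow> 'o) \<Rightarrow> 'o \<Rightarrow>
    ('x \<Rightarrow> 'x \<Rightarrow> 'm, ('x \<Rightarrow> 'm) + 'u) rmodule" where
  "hom_module C \<Omega> P X = \<lparr>carrier = Inl ` (\<Pi>\<^sub>E x\<in>\<Omega>. Hom C (P x) X),
     mult = undefined, one = undefined,
     zero = Inl (\<lambda>x\<in>\<Omega>. hzero C (P x) X),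
     add = (\<lambda>\<phi> \<psi>. Inl (\<lambda>x\<in>\<Omega>. hadd C (projl \<phi> x) (projl \<psi> x))),
     act = (\<lambda>\<phi> a. Inl (\<lambda>x\<in>\<Omega>. \<Oplus>\<^bsub>hom_group C (P x) X\<^esub>y\<in>\<Omega>. projl \<phi> y \<cdot>\<^bsub>C\<^esub> a x y))\<rparr>"

definition hom_module_map :: "('o, 'm, 'z) additive_category_scheme \<Rightarrow> 'x set \<Rightarrow> ('x \<Rightarrow> 'o) \<Rightarrow> 'm \<Rightarrow>
    ('x \<Rightarrow> 'x \<Rightarrow> 'm, ('x \<Rightarrow> 'm) + 'u) rmodule \<times>
    (('x \<Rightarrow> 'm) + 'u \<Rightarrow> ('x \<Rightarrow> 'm) + 'u) \<times>
    ('x \<Rightarrow> 'x \<Rightarrow> 'm, ('x \<Rightarrow> 'm) + 'u) rmodule" where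
  "hom_module_map C \<Omega> P f =
     (hom_module C \<Omega> P (Dom C f),
      (\<lambda>\<phi>\<in>carrier (hom_module C \<Omega> P (Dom C f)). Inl (\<lambda>x\<in>\<Omega>. f \<cdot>\<^bsub>C\<^esub> projl \<phi> x)),
      hom_module C \<Omega> P (Cod C f))"

end

theory Submission
  imports Defs
begin

text \<open>
  Call an object local if it has a simple quotient \<open>t : N \<rightarrow> S\<close> such that every \<open>g\<close> with \<open>t g \<noteq> 0\<close> is
  epi. The join-irreducible subobjects of \<open>M\<close> are the local ones, and by distributivity they are
  join-prime. If two of them have isomorphic tops, join-primeness makes them comparable; a strict
  inclusion between join-irreducible subobjects yields a path in the ext-quiver between the tops, so
  by (M1) the two are equal. By (M2) and (M3) every local object is then a quotient of some \<open>M\<^sub>x\<close>: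
  a local subobject of \<open>M\<^sup>n\<close> has all its nonzero components with the same image \<open>M\<^sub>x\<close>, and these
  components agree up to endomorphisms of \<open>M\<^sub>x\<close>. This gives projectivity of \<open>M\<^sub>x\<close>: a local cover of
  \<open>M\<^sub>x\<close> in a pullback is a quotient of \<open>M\<^sub>x\<close>, and an epimorphic endomorphism of \<open>M\<^sub>x\<close> is invertible.
  Conversely, a nonsplit extension of simple objects is local, hence a quotient of a projective
  \<open>M\<^sub>y\<close>, which turns paths into nonzero morphisms. The sum \<open>G\<close> of the finitely many \<open>M\<^sub>x\<close> is a projective
  generator with endomorphism ring \<open>A\<close>, so \<open>Hom(G, -)\<close> is an equivalence onto \<open>mod A\<close>.
\<close>

section \<open>Categories\<close>

text \<open>There are no elements to chase. Two devices stand in for them: the relation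
  \<open>fac\<close>, which says that an arrow lands in a subobject without forming its image, and
  \<open>epi_pullback\<close>, which lifts an arrow along an epimorphism after an epic cover of its
  source. The hinge of the proof is \<open>null_if_top_null\<close>: by distributivity and (M1), a
  local object whose top is that of \<open>M_x\<close> has no nonzero arrow to \<open>M_x\<close>
  that vanishes on the top, so arrows from it to \<open>M_x\<close> are determined by their effect
  on the tops. (M3) then provides endomorphisms of \<open>M_x\<close> with a prescribed effect. An
  epic endomorphism of \<open>M_x\<close>, for instance, is inverted by lifting the inverse of what
  it does on the top. Inductions on length are likewise run as choices of minimal or maximal
  subobjects, because length enters only through the finiteness of chains.\<close>

context category
begin

lemma in_Hom [simp]: "f \<in> Hom C X Y \<longleftrightarrow> f \<in> Arr C \<and> Dom C f = X \<and> Cod C f = Y"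
  by (simp add: Hom_def)

lemma comp_arr [simp]:
  assumes "f \<in> Arr C" "g \<in> Arr C" "Dom C g = Cod C f"
  shows "g \<cdot> f \<in> Arr C" "Dom C (g \<cdot> f) = Dom C f" "Cod C (g \<cdot> f) = Cod C g"
  using comp_hom[of f "Dom C f" "Cod C f" g "Cod C g"] assms by auto

lemma comp_assoc' [simp]:
  assumes "f \<in> Arr C" "g \<in> Arr C" "h \<in> Arr C" "Dom C g = Cod C f" "Dom C h = Cod C g"
  shows "(h \<cdot> g) \<cdot> f = h \<cdot> (g \<cdot> f)"
  using comp_assoc[of f "Dom C f" "Cod C f" g "Cod C g" h "Cod C h"] assms by auto

lemma dom_cod_obj [simp]:
  assumes "f \<in> Arr C" shows "Dom C f \<in> Obj C" "Cod C f \<in> Obj C"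
  using assms dom_obj cod_obj by auto

lemma ident_arr [simp]:
  assumes "X \<in> Obj C"
  shows "Ident C X \<in> Arr C" "Dom C (Ident C X) = X" "Cod C (Ident C X) = X"
  using ident_hom[OF assms] by auto

lemma ident_comp [simp]:
  assumes "f \<in> Arr C"
  shows "Cod C f = Y \<Longrightarrow> Ident C Y \<cdot> f = f" "Dom C f = X \<Longrightarrow> f \<cdot> Ident C X = f"
  using ident_left[of f "Dom C f" "Cod C f"] ident_right[of f "Dom C f" "Cod C f"] assms by auto

text \<open>The simplifier nests composites to the right, so an equation
  \<open>g \<cdot> f = g' \<cdot> f'\<close> no longer matches inside
  \<open>g \<cdot> (f \<cdot> h)\<close>; this form applies a commutative square there.\<close>

lemma comp_cong_left:
  assumes "g \<cdot> f = g' \<cdot> f'" "f \<in> Arr C" "g \<in> Arr C" "f' \<in> Arr C" "g' \<in> Arr C" "h \<in> Arr C"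
    "Dom C g = Cod C f" "Dom C g' = Cod C f'" "Dom C f = Cod C h" "Dom C f' = Cod C h"
  shows "g \<cdot> (f \<cdot> h) = g' \<cdot> (f' \<cdot> h)"
proof -
  have "g \<cdot> (f \<cdot> h) = (g \<cdot> f) \<cdot> h" using assms(2-) by simp
  also have "\<dots> = (g' \<cdot> f') \<cdot> h" using assms(1) by simp
  also have "\<dots> = g' \<cdot> (f' \<cdot> h)" using assms(2-) by simp
  finally show ?thesis .
qed

lemma iso_arrI:
  assumes "f \<in> Arr C" "g \<in> Arr C" "Dom C g = Cod C f" "Cod C g = Dom C f"
    "g \<cdot> f = Ident C (Dom C f)" "f \<cdot> g = Ident C (Cod C f)"
  shows "iso_arr C f"
  unfolding iso_arr_def using assms by (intro conjI bexI[of _ g]) simp_all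

lemma iso_arrE:
  assumes "iso_arr C f"
  obtains g where "f \<in> Arr C" "g \<in> Arr C" "Dom C g = Cod C f" "Cod C g = Dom C f"
    "g \<cdot> f = Ident C (Dom C f)" "f \<cdot> g = Ident C (Cod C f)" "iso_arr C g"
proof -
  obtain g where g: "f \<in> Arr C" "g \<in> Arr C" "Dom C g = Cod C f" "Cod C g = Dom C f"
    "g \<cdot> f = Ident C (Dom C f)" "f \<cdot> g = Ident C (Cod C f)"
  proof -
    from assms have "f \<in> Arr C" by (simp add: iso_arr_def)
    moreover from assms obtain g where "g \<in> Hom C (Cod C f) (Dom C f)"
      "g \<cdot> f = Ident C (Dom C f)" "f \<cdot> g = Ident C (Cod C f)" unfolding iso_arr_def by blast
    ultimately show thesis using that[of g] by simp
  qed
  then have "iso_arr C g" by (intro iso_arrI[where g = f]) auto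
  with g show thesis using that by blast
qed

lemma iso_arr_ident [simp]: "X \<in> Obj C \<Longrightarrow> iso_arr C (Ident C X)"
  by (rule iso_arrI[where g = "Ident C X"]) auto

lemma iso_arr_comp:
  assumes "iso_arr C f" "iso_arr C g" "Dom C g = Cod C f"
  shows "iso_arr C (g \<cdot> f)"
proof -
  obtain f' where f: "f \<in> Arr C" "f' \<in> Arr C" "Dom C f' = Cod C f" "Cod C f' = Dom C f"
    "f' \<cdot> f = Ident C (Dom C f)" "f \<cdot> f' = Ident C (Cod C f)" using assms(1) by (rule iso_arrE) blast
  obtain g' where g: "g \<in> Arr C" "g' \<in> Arr C" "Dom C g' = Cod C g" "Cod C g' = Dom C g"
    "g' \<cdot> g = Ident C (Dom C g)" "g \<cdot> g' = Ident C (Cod C g)" using assms(2) by (rule iso_arrE) blast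
  have a: "g' \<cdot> (g \<cdot> f) = f"
    using comp_assoc'[of f g g'] f g assms(3) by (simp del: comp_assoc')
  have b: "f \<cdot> (f' \<cdot> g') = g'"
    using comp_assoc'[of g' f' f] f g assms(3) by (simp del: comp_assoc')
  show ?thesis
    by (rule iso_arrI[where g = "f' \<cdot> g'"]) (simp_all add: f g assms(3) a b)
qed

lemma isomorphic_refl: "X \<in> Obj C \<Longrightarrow> isomorphic C X X"
  unfolding isomorphic_def using iso_arr_ident[of X] by (auto intro!: bexI[of _ "Ident C X"])

lemma isomorphicI: "iso_arr C f \<Longrightarrow> isomorphic C (Dom C f) (Cod C f)"
  unfolding isomorphic_def by (rule bexI[of _ f]) (auto simp: iso_arr_def)

lemma isomorphic_sym:
  assumes "isomorphic C X Y" shows "isomorphic C Y X"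
proof -
  obtain f where f: "f \<in> Hom C X Y" "iso_arr C f" using assms unfolding isomorphic_def by blast
  obtain g where "Dom C g = Cod C f" "Cod C g = Dom C f" "iso_arr C g"
    using f(2) by (rule iso_arrE) blast
  then show ?thesis using isomorphicI[of g] f by simp
qed

lemma isomorphic_trans:
  assumes "isomorphic C X Y" "isomorphic C Y Z" shows "isomorphic C X Z"
proof -
  obtain f g where "iso_arr C f" "iso_arr C g" "f \<in> Hom C X Y" "g \<in> Hom C Y Z"
    using assms unfolding isomorphic_def by blast
  moreover from this have "iso_arr C (g \<cdot> f)" by (intro iso_arr_comp) simp_all
  ultimately have "iso_arr C (g \<cdot> f)" "g \<cdot> f \<in> Hom C X Z" by simp_all
  then show ?thesis unfolding isomorphic_def by blast
qed

lemma isomorphic_obj: "isomorphic C X Y \<Longrightarrow> X \<in> Obj C" "isomorphic C X Y \<Longrightarrow> Y \<in> Obj C"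
  unfolding isomorphic_def by auto

lemma iso_class_eq_iff:
  assumes "X \<in> Obj C" "Y \<in> Obj C"
  shows "iso_class C X = iso_class C Y \<longleftrightarrow> isomorphic C X Y"
  unfolding iso_class_def using assms isomorphic_refl isomorphic_sym isomorphic_trans by blast

lemma mono_arr_arr: "mono_arr C f \<Longrightarrow> f \<in> Arr C"
  by (simp add: mono_arr_def)

lemma epi_arr_arr: "epi_arr C f \<Longrightarrow> f \<in> Arr C"
  by (simp add: epi_arr_def)

lemma mono_arrD:
  assumes "mono_arr C f" "g \<in> Arr C" "h \<in> Arr C" "Dom C g = Dom C h"
    "Cod C g = Dom C f" "Cod C h = Dom C f" "f \<cdot> g = f \<cdot> h"
  shows "g = h"
proof -
  have "g \<in> Hom C (Dom C g) (Dom C f)" "h \<in> Hom C (Dom C g) (Dom C f)" using assms by simp_all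
  then show ?thesis using assms(1,7) unfolding mono_arr_def by blast
qed

lemma epi_arrD:
  assumes "epi_arr C f" "g \<in> Arr C" "h \<in> Arr C" "Cod C g = Cod C h"
    "Dom C g = Cod C f" "Dom C h = Cod C f" "g \<cdot> f = h \<cdot> f"
  shows "g = h"
proof -
  have "g \<in> Hom C (Cod C f) (Cod C g)" "h \<in> Hom C (Cod C f) (Cod C g)" using assms by simp_all
  then show ?thesis using assms(1,7) unfolding epi_arr_def by blast
qed

lemma split_mono:
  assumes "f \<in> Arr C" "g \<in> Arr C" "Dom C g = Cod C f" "g \<cdot> f = Ident C (Dom C f)"
  shows "mono_arr C f"
  unfolding mono_arr_def
proof (intro conjI allI ballI impI)
  fix W h k assume h: "h \<in> Hom C W (Dom C f)" and k: "k \<in> Hom C W (Dom C f)" and e: "f \<cdot> h = f \<cdot> k"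
  have c: "Cod C g = Dom C f" using assms by (metis comp_arr(3) dom_cod_obj(1) ident_arr(3))
  have "h = (g \<cdot> f) \<cdot> h" using assms h by simp
  also have "\<dots> = g \<cdot> (f \<cdot> h)" using h assms by (subst comp_assoc') auto
  also have "\<dots> = g \<cdot> (f \<cdot> k)" using e by simp
  also have "\<dots> = (g \<cdot> f) \<cdot> k" using k assms by (subst comp_assoc') auto
  also have "\<dots> = k" using assms k by simp
  finally show "h = k" .
qed (use assms in auto)

lemma split_epi:
  assumes "f \<in> Arr C" "g \<in> Arr C" "Dom C g = Cod C f" "g \<cdot> f = Ident C (Dom C f)"
  shows "epi_arr C g"
  unfolding epi_arr_def
proof (intro conjI allI ballI impI)
  have c: "Cod C g = Dom C f" using assms by (metis comp_arr(3) dom_cod_obj(1) ident_arr(3))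
  fix W h k assume h: "h \<in> Hom C (Cod C g) W" and k: "k \<in> Hom C (Cod C g) W" and e: "h \<cdot> g = k \<cdot> g"
  have "h = h \<cdot> (g \<cdot> f)" using assms h c by simp
  also have "\<dots> = (h \<cdot> g) \<cdot> f" using h assms by simp
  also have "\<dots> = (k \<cdot> g) \<cdot> f" using e by simp
  also have "\<dots> = k \<cdot> (g \<cdot> f)" using k assms by simp
  also have "\<dots> = k" using assms k c by simp
  finally show "h = k" .
qed (use assms in auto)

lemma iso_arr_mono: "iso_arr C f \<Longrightarrow> mono_arr C f"
  by (erule iso_arrE) (rule split_mono)

lemma iso_arr_epi:
  assumes "iso_arr C f" shows "epi_arr C f"
proof -
  obtain g where "f \<in> Arr C" "g \<in> Arr C" "Dom C g = Cod C f" "Cod C g = Dom C f"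
    "f \<cdot> g = Ident C (Cod C f)" using assms by (rule iso_arrE) blast
  then show ?thesis using split_epi[of g f] by simp
qed

text \<open>A right inverse of a monomorphism is a left inverse too: cancel \<open>f\<close> from
  \<open>f \<cdot> (g \<cdot> f) = f\<close>.\<close>

lemma mono_split_epi_iso:
  assumes "mono_arr C f" "g \<in> Arr C" "Dom C g = Cod C f" "Cod C g = Dom C f"
    "f \<cdot> g = Ident C (Cod C f)"
  shows "iso_arr C f"
proof (rule iso_arrI[where g = g])
  note f = mono_arr_arr[OF assms(1)]
  have "f \<cdot> (g \<cdot> f) = (f \<cdot> g) \<cdot> f" using assms f by (subst comp_assoc') auto
  also have "\<dots> = f \<cdot> Ident C (Dom C f)" using assms f by simp
  finally show "g \<cdot> f = Ident C (Dom C f)"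
    by (rule mono_arrD[OF assms(1), rotated -1]) (use assms f in auto)
qed (use assms mono_arr_arr in auto)

lemma mono_arr_comp:
  assumes "mono_arr C f" "mono_arr C g" "Dom C g = Cod C f"
  shows "mono_arr C (g \<cdot> f)"
  unfolding mono_arr_def
proof (intro conjI allI ballI impI)
  note f = mono_arr_arr[OF assms(1)] and g = mono_arr_arr[OF assms(2)]
  show "g \<cdot> f \<in> Arr C" using f g assms by simp
  fix W h k assume h: "h \<in> Hom C W (Dom C (g \<cdot> f))" and k: "k \<in> Hom C W (Dom C (g \<cdot> f))"
    and "(g \<cdot> f) \<cdot> h = (g \<cdot> f) \<cdot> k"
  then have "g \<cdot> (f \<cdot> h) = g \<cdot> (f \<cdot> k)" using f g assms by simp
  then have "f \<cdot> h = f \<cdot> k" by (rule mono_arrD[OF assms(2), rotated -1]) (use f g assms h k in auto)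
  then show "h = k" by (rule mono_arrD[OF assms(1), rotated -1]) (use f g assms h k in auto)
qed

lemma epi_arr_comp:
  assumes "epi_arr C f" "epi_arr C g" "Dom C g = Cod C f"
  shows "epi_arr C (g \<cdot> f)"
  unfolding epi_arr_def
proof (intro conjI allI ballI impI)
  note f = epi_arr_arr[OF assms(1)] and g = epi_arr_arr[OF assms(2)]
  show "g \<cdot> f \<in> Arr C" using f g assms by simp
  fix W h k assume h: "h \<in> Hom C (Cod C (g \<cdot> f)) W" and k: "k \<in> Hom C (Cod C (g \<cdot> f)) W"
    and e: "h \<cdot> (g \<cdot> f) = k \<cdot> (g \<cdot> f)"
  have "(h \<cdot> g) \<cdot> f = (k \<cdot> g) \<cdot> f" using f g assms h k e by simp
  then have "h \<cdot> g = k \<cdot> g" by (rule epi_arrD[OF assms(1), rotated -1]) (use f g assms h k in auto)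
  then show "h = k" by (rule epi_arrD[OF assms(2), rotated -1]) (use f g assms h k in auto)
qed

lemma mono_arr_of_comp:
  assumes "mono_arr C (g \<cdot> f)" "f \<in> Arr C" "g \<in> Arr C" "Dom C g = Cod C f"
  shows "mono_arr C f"
  unfolding mono_arr_def
proof (intro conjI allI ballI impI)
  fix W h k assume h: "h \<in> Hom C W (Dom C f)" and k: "k \<in> Hom C W (Dom C f)" and e: "f \<cdot> h = f \<cdot> k"
  then have "(g \<cdot> f) \<cdot> h = (g \<cdot> f) \<cdot> k" using assms by simp
  then show "h = k" by (rule mono_arrD[OF assms(1), rotated -1]) (use assms h k in auto)
qed (use assms in auto)

lemma epi_arr_of_comp:
  assumes "epi_arr C (g \<cdot> f)" "f \<in> Arr C" "g \<in> Arr C" "Dom C g = Cod C f"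
  shows "epi_arr C g"
  unfolding epi_arr_def
proof (intro conjI allI ballI impI)
  fix W h k assume h: "h \<in> Hom C (Cod C g) W" and k: "k \<in> Hom C (Cod C g) W" and e: "h \<cdot> g = k \<cdot> g"
  then have "h \<cdot> (g \<cdot> f) = k \<cdot> (g \<cdot> f)" using assms comp_cong_left[OF e, of f] by auto
  then show "h = k" by (rule epi_arrD[OF assms(1), rotated -1]) (use assms h k in auto)
qed (use assms in auto)

text \<open>\<open>f\<close> is arbitrary, not only a monomorphism: for \<open>m\<close> mono this
  amounts to the image of \<open>f\<close> lying in the subobject \<open>m\<close>, and for two
  monomorphisms it is the order of \<open>subobjects\<close>.\<close>

definition fac where
  "fac f m \<longleftrightarrow> f \<in> Arr C \<and> m \<in> Arr C \<and> (\<exists>u \<in> Hom C (Dom C f) (Dom C m). m \<cdot> u = f)"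

lemma facE:
  assumes "fac f m"
  obtains u where "u \<in> Arr C" "Dom C u = Dom C f" "Cod C u = Dom C m" "m \<cdot> u = f" "Cod C f = Cod C m"
proof -
  obtain u where "u \<in> Hom C (Dom C f) (Dom C m)" "m \<cdot> u = f" "m \<in> Arr C"
    using assms unfolding fac_def by blast
  moreover from this have "Cod C (m \<cdot> u) = Cod C m" by (intro comp_arr) simp_all
  ultimately show thesis using that[of u] by simp
qed

lemma facI: "m \<in> Arr C \<Longrightarrow> u \<in> Arr C \<Longrightarrow> Cod C u = Dom C m \<Longrightarrow> fac (m \<cdot> u) m"
  unfolding fac_def by auto

lemma fac_refl: "m \<in> Arr C \<Longrightarrow> fac m m"
  using facI[of m "Ident C (Dom C m)"] by simp

lemma fac_trans:
  assumes "fac f g" "fac g h" shows "fac f h"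
proof -
  obtain u where u: "u \<in> Arr C" "Dom C u = Dom C f" "Cod C u = Dom C g" "g \<cdot> u = f"
    using assms(1) by (rule facE) blast
  obtain v where v: "v \<in> Arr C" "Dom C v = Dom C g" "Cod C v = Dom C h" "h \<cdot> v = g"
    using assms(2) by (rule facE) blast
  have "h \<in> Arr C" using assms by (simp add: fac_def)
  then have "(h \<cdot> v) \<cdot> u = h \<cdot> (v \<cdot> u)" using u v by (intro comp_assoc') simp_all
  then have "f = h \<cdot> (v \<cdot> u)" using u v by simp
  then show ?thesis using facI[of h "v \<cdot> u"] u v \<open>h \<in> Arr C\<close> by simp
qed

lemma fac_comp: "fac f m \<Longrightarrow> g \<in> Arr C \<Longrightarrow> Cod C g = Dom C f \<Longrightarrow> fac (f \<cdot> g) m"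
  using fac_trans[of "f \<cdot> g" f m] facI[of f g] by (simp add: fac_def)

lemma fac_comp_left:
  assumes "fac f m" "g \<in> Arr C" "Dom C g = Cod C m" shows "fac (g \<cdot> f) (g \<cdot> m)"
proof -
  obtain u where u: "u \<in> Arr C" "Dom C u = Dom C f" "Cod C u = Dom C m" "m \<cdot> u = f"
    using assms(1) by (rule facE) blast
  have "m \<in> Arr C" using assms by (simp add: fac_def)
  then have "g \<cdot> f = (g \<cdot> m) \<cdot> u" using u assms by simp
  then show ?thesis using facI[of "g \<cdot> m" u] u assms \<open>m \<in> Arr C\<close> by simp
qed

lemma fac_comp_left_mono:
  assumes "fac (g \<cdot> f) (g \<cdot> m)" "mono_arr C g" "f \<in> Arr C" "m \<in> Arr C" "Dom C g = Cod C m" "Dom C g = Cod C f"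
  shows "fac f m"
proof -
  have g: "g \<in> Arr C" using assms mono_arr_arr by auto
  obtain u where u: "u \<in> Arr C" "Dom C u = Dom C f" "Cod C u = Dom C m" "(g \<cdot> m) \<cdot> u = g \<cdot> f"
    using assms(1) by (rule facE) (use assms g in auto)
  have "g \<cdot> (m \<cdot> u) = g \<cdot> f" using u assms g by simp
  then have "m \<cdot> u = f" by (rule mono_arrD[OF assms(2), rotated -1]) (use assms u in auto)
  then show ?thesis using facI[of m u] u assms by auto
qed

lemma fac_antisym:
  assumes "mono_arr C m" "mono_arr C n" "fac m n" "fac n m"
  obtains u where "iso_arr C u" "u \<in> Arr C" "Dom C u = Dom C m" "Cod C u = Dom C n" "n \<cdot> u = m"
proof -
  note m = mono_arr_arr[OF assms(1)] and n = mono_arr_arr[OF assms(2)]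
  obtain u where u: "u \<in> Arr C" "Dom C u = Dom C m" "Cod C u = Dom C n" "n \<cdot> u = m" "Cod C m = Cod C n"
    using assms(3) by (rule facE) blast
  obtain v where v: "v \<in> Arr C" "Dom C v = Dom C n" "Cod C v = Dom C m" "m \<cdot> v = n"
    using assms(4) by (rule facE) blast
  have "n \<cdot> (u \<cdot> v) = (n \<cdot> u) \<cdot> v" using u v n by (subst comp_assoc') auto
  also have "\<dots> = n \<cdot> Ident C (Dom C n)" using u v n by simp
  finally have "u \<cdot> v = Ident C (Dom C n)"
    by (rule mono_arrD[OF assms(2), rotated -1]) (use u v n in auto)
  moreover have "mono_arr C u" by (rule mono_arr_of_comp[of n u]) (use assms u n in auto)
  ultimately have "iso_arr C u" using mono_split_epi_iso[of u v] u v by simp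
  then show thesis using that u by blast
qed

lemma fac_ident:
  assumes "fac (Ident C X) m" "X \<in> Obj C" "mono_arr C m" shows "iso_arr C m"
proof -
  obtain u where "u \<in> Arr C" "Dom C u = X" "Cod C u = Dom C m" "m \<cdot> u = Ident C X" "X = Cod C m"
    using assms(1) by (rule facE) (use assms(2) in auto)
  then show ?thesis using mono_split_epi_iso[OF assms(3), of u] by simp
qed

lemma iso_fac:
  assumes "iso_arr C m" "f \<in> Arr C" "Cod C f = Cod C m" shows "fac f m"
proof -
  obtain g where g: "m \<in> Arr C" "g \<in> Arr C" "Dom C g = Cod C m" "Cod C g = Dom C m"
    "m \<cdot> g = Ident C (Cod C m)" using assms(1) by (rule iso_arrE) blast
  have "m \<cdot> (g \<cdot> f) = f" using comp_assoc'[of f g m] g assms by (simp del: comp_assoc')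
  then show ?thesis using facI[of m "g \<cdot> f"] g assms by simp
qed

end

section \<open>Preadditive categories\<close>

lemma hom_group_simps [simp]:
  "carrier (hom_group C X Y) = Hom C X Y" "\<zero>\<^bsub>hom_group C X Y\<^esub> = hzero C X Y"
  "f \<oplus>\<^bsub>hom_group C X Y\<^esub> g = hadd C f g"
  by (simp_all add: hom_group_def)

context preadditive
begin

lemma hzero_arr [simp]:
  assumes "X \<in> Obj C" "Y \<in> Obj C"
  shows "hzero C X Y \<in> Arr C" "Dom C (hzero C X Y) = X" "Cod C (hzero C X Y) = Y"
proof -
  interpret G: abelian_group "hom_group C X Y" using hom_abelian_group assms .
  show "hzero C X Y \<in> Arr C" "Dom C (hzero C X Y) = X" "Cod C (hzero C X Y) = Y"
    using G.zero_closed by simp_all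
qed

lemma hadd_arr [simp]:
  assumes "f \<in> Arr C" "g \<in> Arr C" "Dom C f = Dom C g" "Cod C f = Cod C g"
  shows "hadd C f g \<in> Arr C" "Dom C (hadd C f g) = Dom C g" "Cod C (hadd C f g) = Cod C g"
proof -
  interpret G: abelian_group "hom_group C (Dom C g) (Cod C g)" using hom_abelian_group assms by simp
  show "hadd C f g \<in> Arr C" "Dom C (hadd C f g) = Dom C g" "Cod C (hadd C f g) = Cod C g"
    using G.a_closed[of f g] assms by simp_all
qed

definition hneg where
  "hneg f = \<ominus>\<^bsub>hom_group C (Dom C f) (Cod C f)\<^esub> f"

definition hsub where
  "hsub f g = hadd C f (hneg g)"

text \<open>There is one zero arrow for each pair of objects; reading the pair off \<open>f\<close>
  lets kernels, cokernels and cancellation tests be stated without naming hom-sets.\<close>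

definition null where
  "null f \<longleftrightarrow> f = hzero C (Dom C f) (Cod C f)"

lemma hneg_arr [simp]:
  assumes "f \<in> Arr C"
  shows "hneg f \<in> Arr C" "Dom C (hneg f) = Dom C f" "Cod C (hneg f) = Cod C f"
proof -
  interpret G: abelian_group "hom_group C (Dom C f) (Cod C f)" using hom_abelian_group assms by simp
  show "hneg f \<in> Arr C" "Dom C (hneg f) = Dom C f" "Cod C (hneg f) = Cod C f"
    using G.a_inv_closed[of f] assms by (simp_all add: hneg_def)
qed

lemma hsub_arr [simp]:
  assumes "f \<in> Arr C" "g \<in> Arr C" "Dom C f = Dom C g" "Cod C f = Cod C g"
  shows "hsub f g \<in> Arr C" "Dom C (hsub f g) = Dom C g" "Cod C (hsub f g) = Cod C g"
  using assms by (simp_all add: hsub_def)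

lemma null_hzero [simp]: "X \<in> Obj C \<Longrightarrow> Y \<in> Obj C \<Longrightarrow> null (hzero C X Y)"
  by (simp add: null_def)

lemma nullI: "f = hzero C X Y \<Longrightarrow> X \<in> Obj C \<Longrightarrow> Y \<in> Obj C \<Longrightarrow> null f"
  by simp

lemma nullD: "null f \<Longrightarrow> Dom C f = X \<Longrightarrow> Cod C f = Y \<Longrightarrow> f = hzero C X Y"
  by (simp add: null_def)

lemma null_eq: "null f \<Longrightarrow> null g \<Longrightarrow> Dom C f = Dom C g \<Longrightarrow> Cod C f = Cod C g \<Longrightarrow> f = g"
  by (simp add: null_def)

lemma hadd_null:
  assumes "f \<in> Arr C" "g \<in> Arr C" "Dom C f = Dom C g" "Cod C f = Cod C g"
  shows "null f \<Longrightarrow> hadd C f g = g" "null g \<Longrightarrow> hadd C f g = f"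
proof -
  interpret G: abelian_group "hom_group C (Dom C g) (Cod C g)" using hom_abelian_group assms by simp
  show "null f \<Longrightarrow> hadd C f g = g" "null g \<Longrightarrow> hadd C f g = f"
    using G.l_zero[of g] G.r_zero[of f] assms by (simp_all add: null_def)
qed

lemma hadd_comm:
  assumes "f \<in> Arr C" "g \<in> Arr C" "Dom C f = Dom C g" "Cod C f = Cod C g"
  shows "hadd C f g = hadd C g f"
proof -
  interpret G: abelian_group "hom_group C (Dom C g) (Cod C g)" using hom_abelian_group assms by simp
  show ?thesis using G.a_comm[of f g] assms by simp
qed

lemma hadd_hsub_cancel:
  assumes "f \<in> Arr C" "g \<in> Arr C" "Dom C f = Dom C g" "Cod C f = Cod C g"
  shows "hsub (hadd C f g) g = f" "hsub (hadd C f g) f = g" "hadd C (hsub f g) g = f"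
proof -
  interpret G: abelian_group "hom_group C (Dom C g) (Cod C g)" using hom_abelian_group assms by simp
  show "hsub (hadd C f g) g = f"
    using G.a_assoc[of f g "hneg g"] G.r_neg[of g] G.r_zero[of f] assms
    by (simp add: hneg_def hsub_def) (metis hneg_def hneg_arr)
  show "hsub (hadd C f g) f = g"
    using G.a_assoc[of g f "hneg f"] G.r_neg[of f] G.r_zero[of g] assms hneg_arr[of f] hadd_comm[OF assms]
    by (simp add: hneg_def hsub_def)
  show "hadd C (hsub f g) g = f"
    using G.a_assoc[of f "hneg g" g] G.l_neg[of g] G.r_zero[of f] assms hneg_arr[of g]
    by (simp add: hneg_def hsub_def)
qed

text \<open>Zero is idempotent for addition, so by bilinearity its composite \<open>z\<close>
  satisfies \<open>z + z = z\<close> and cancels in the hom-group.\<close>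

lemma hzero_comp [simp]:
  assumes "f \<in> Arr C" "X \<in> Obj C"
  shows "Y = Dom C f \<Longrightarrow> f \<cdot> hzero C X Y = hzero C X (Cod C f)"
    "Y = Cod C f \<Longrightarrow> hzero C Y X \<cdot> f = hzero C (Dom C f) X"
proof -
  assume Y: "Y = Dom C f"
  interpret G: abelian_group "hom_group C X (Cod C f)" using hom_abelian_group assms by simp
  let ?z = "hzero C X Y"
  have z: "hadd C ?z ?z = ?z" using hadd_null[of ?z ?z] assms Y by simp
  have "f \<cdot> hadd C ?z ?z = hadd C (f \<cdot> ?z) (f \<cdot> ?z)"
    using assms Y by (intro comp_add_right) simp_all
  then have "f \<cdot> ?z \<oplus>\<^bsub>hom_group C X (Cod C f)\<^esub> f \<cdot> ?z = f \<cdot> ?z" using z by simp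
  then show "f \<cdot> ?z = hzero C X (Cod C f)"
    using G.add.l_cancel_one[of "f \<cdot> ?z" "f \<cdot> ?z"] assms Y by simp
next
  assume Y: "Y = Cod C f"
  interpret G: abelian_group "hom_group C (Dom C f) X" using hom_abelian_group assms by simp
  let ?z = "hzero C Y X"
  have z: "hadd C ?z ?z = ?z" using hadd_null[of ?z ?z] assms Y by simp
  have "hadd C ?z ?z \<cdot> f = hadd C (?z \<cdot> f) (?z \<cdot> f)"
    using assms Y by (intro comp_add_left) simp_all
  then have "?z \<cdot> f \<oplus>\<^bsub>hom_group C (Dom C f) X\<^esub> ?z \<cdot> f = ?z \<cdot> f" using z by simp
  then show "?z \<cdot> f = hzero C (Dom C f) X"
    using G.add.l_cancel_one[of "?z \<cdot> f" "?z \<cdot> f"] assms Y by simp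
qed

lemma null_comp:
  assumes "f \<in> Arr C" "g \<in> Arr C" "Dom C g = Cod C f"
  shows "null f \<Longrightarrow> null (g \<cdot> f)" "null g \<Longrightarrow> null (g \<cdot> f)"
proof -
  show "null (g \<cdot> f)" if "null f"
    using hzero_comp(1)[of g "Dom C f" "Cod C f"] that[unfolded null_def] assms
    by (metis comp_arr(2,3) dom_cod_obj(1) null_def)
  show "null (g \<cdot> f)" if "null g"
    using hzero_comp(2)[of f "Cod C g" "Dom C g"] that[unfolded null_def] assms
    by (metis comp_arr(2,3) dom_cod_obj(2) null_def)
qed

lemma comp_hadd:
  assumes "f \<in> Arr C" "g \<in> Arr C" "Dom C f = Dom C g" "Cod C f = Cod C g" "h \<in> Arr C"
  shows "Dom C h = Cod C g \<Longrightarrow> h \<cdot> hadd C f g = hadd C (h \<cdot> f) (h \<cdot> g)"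
    "Cod C h = Dom C g \<Longrightarrow> hadd C f g \<cdot> h = hadd C (f \<cdot> h) (g \<cdot> h)"
  using assms by (auto intro!: comp_add_right comp_add_left)

lemma hneg_unique:
  assumes "f \<in> Arr C" "g \<in> Arr C" "Dom C f = Dom C g" "Cod C f = Cod C g" "null (hadd C f g)"
  shows "g = hneg f"
proof -
  interpret G: abelian_group "hom_group C (Dom C g) (Cod C g)" using hom_abelian_group assms by simp
  have "hadd C g f = hzero C (Dom C g) (Cod C g)"
    using assms(5) hadd_comm[of f g] assms by (simp add: null_def)
  then show ?thesis using G.minus_equality[of g f] assms by (simp add: hneg_def)
qed

lemma null_hsub_self: "f \<in> Arr C \<Longrightarrow> null (hsub f f)"
proof -
  assume f: "f \<in> Arr C"
  interpret G: abelian_group "hom_group C (Dom C f) (Cod C f)" using hom_abelian_group f by simp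
  show ?thesis using G.r_neg[of f] f by (simp add: hsub_def hneg_def)
qed

lemma null_hsub_iff:
  assumes "f \<in> Arr C" "g \<in> Arr C" "Dom C f = Dom C g" "Cod C f = Cod C g"
  shows "null (hsub f g) \<longleftrightarrow> f = g"
proof
  assume "null (hsub f g)"
  then have "hadd C (hsub f g) g = g" using assms by (intro hadd_null) simp_all
  then show "f = g" using hadd_hsub_cancel(3)[OF assms] by (rule trans[OF sym, rotated])
next
  show "null (hsub f g)" if "f = g" unfolding that using assms(2) by (rule null_hsub_self)
qed

lemma comp_hneg:
  assumes "f \<in> Arr C" "h \<in> Arr C"
  shows "Dom C h = Cod C f \<Longrightarrow> h \<cdot> hneg f = hneg (h \<cdot> f)"
    "Cod C h = Dom C f \<Longrightarrow> hneg f \<cdot> h = hneg (f \<cdot> h)"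
proof -
  have n: "null (hadd C f (hneg f))" using null_hsub_self[of f] assms by (simp add: hsub_def)
  show "h \<cdot> hneg f = hneg (h \<cdot> f)" if "Dom C h = Cod C f"
    using hneg_unique[of "h \<cdot> f" "h \<cdot> hneg f"] comp_hadd(1)[of f "hneg f" h] null_comp(1)[OF _ _ _ n, of h] assms that by simp
  show "hneg f \<cdot> h = hneg (f \<cdot> h)" if "Cod C h = Dom C f"
    using hneg_unique[of "f \<cdot> h" "hneg f \<cdot> h"] comp_hadd(2)[of f "hneg f" h] null_comp(2)[OF _ _ _ n, of h] assms that by simp
qed

lemma comp_hsub:
  assumes "f \<in> Arr C" "g \<in> Arr C" "Dom C f = Dom C g" "Cod C f = Cod C g" "h \<in> Arr C"
  shows "Dom C h = Cod C g \<Longrightarrow> h \<cdot> hsub f g = hsub (h \<cdot> f) (h \<cdot> g)"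
    "Cod C h = Dom C g \<Longrightarrow> hsub f g \<cdot> h = hsub (f \<cdot> h) (g \<cdot> h)"
  using assms by (simp_all add: hsub_def comp_hadd comp_hneg)

text \<open>Applied to the difference of two arrows, the test on null composites gives cancellation;
  conversely a null composite is compared with that of the zero arrow.\<close>

lemma mono_iff:
  "mono_arr C f \<longleftrightarrow> f \<in> Arr C \<and> (\<forall>g\<in>Arr C. Cod C g = Dom C f \<longrightarrow> null (f \<cdot> g) \<longrightarrow> null g)"
proof safe
  assume m: "mono_arr C f"
  then show f: "f \<in> Arr C" by (rule mono_arr_arr)
  fix g assume g: "g \<in> Arr C" "Cod C g = Dom C f" "null (f \<cdot> g)"
  have "f \<cdot> g = hzero C (Dom C g) (Cod C f)" by (rule nullD[OF g(3)]) (use f g in simp_all)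
  then have "f \<cdot> g = f \<cdot> hzero C (Dom C g) (Dom C f)" using f g by simp
  then have "g = hzero C (Dom C g) (Dom C f)" by (rule mono_arrD[OF m, rotated -1]) (use f g in simp_all)
  then show "null g" by (rule nullI) (use f g in simp_all)
next
  assume f: "f \<in> Arr C" and n: "\<forall>g\<in>Arr C. Cod C g = Dom C f \<longrightarrow> null (f \<cdot> g) \<longrightarrow> null g"
  show "mono_arr C f" unfolding mono_arr_def
  proof (intro conjI allI ballI impI f)
    fix W g h assume g: "g \<in> Hom C W (Dom C f)" and h: "h \<in> Hom C W (Dom C f)" and e: "f \<cdot> g = f \<cdot> h"
    have "f \<cdot> hsub g h = hsub (f \<cdot> h) (f \<cdot> h)" using e f g h by (simp add: comp_hsub)
    then have "null (f \<cdot> hsub g h)" using f h null_hsub_self[of "f \<cdot> h"] by simp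
    then have "null (hsub g h)" by (rule n[rule_format, rotated -1]) (use f g h in simp_all)
    then show "g = h" by (rule null_hsub_iff[THEN iffD1, rotated -1]) (use g h in simp_all)
  qed
qed

lemma epi_iff:
  "epi_arr C f \<longleftrightarrow> f \<in> Arr C \<and> (\<forall>g\<in>Arr C. Dom C g = Cod C f \<longrightarrow> null (g \<cdot> f) \<longrightarrow> null g)"
proof safe
  assume m: "epi_arr C f"
  then show f: "f \<in> Arr C" by (rule epi_arr_arr)
  fix g assume g: "g \<in> Arr C" "Dom C g = Cod C f" "null (g \<cdot> f)"
  have "g \<cdot> f = hzero C (Dom C f) (Cod C g)" by (rule nullD[OF g(3)]) (use f g in simp_all)
  then have "g \<cdot> f = hzero C (Cod C f) (Cod C g) \<cdot> f" using f g by simp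
  then have "g = hzero C (Cod C f) (Cod C g)" by (rule epi_arrD[OF m, rotated -1]) (use f g in simp_all)
  then show "null g" by (rule nullI) (use f g in simp_all)
next
  assume f: "f \<in> Arr C" and n: "\<forall>g\<in>Arr C. Dom C g = Cod C f \<longrightarrow> null (g \<cdot> f) \<longrightarrow> null g"
  show "epi_arr C f" unfolding epi_arr_def
  proof (intro conjI allI ballI impI f)
    fix W g h assume g: "g \<in> Hom C (Cod C f) W" and h: "h \<in> Hom C (Cod C f) W" and e: "g \<cdot> f = h \<cdot> f"
    have "hsub g h \<cdot> f = hsub (h \<cdot> f) (h \<cdot> f)" using e f g h by (simp add: comp_hsub)
    then have "null (hsub g h \<cdot> f)" using f h null_hsub_self[of "h \<cdot> f"] by simp
    then have "null (hsub g h)" by (rule n[rule_format, rotated -1]) (use f g h in simp_all)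
    then show "g = h" by (rule null_hsub_iff[THEN iffD1, rotated -1]) (use g h in simp_all)
  qed
qed

lemma monoD: "mono_arr C f \<Longrightarrow> null (f \<cdot> g) \<Longrightarrow> g \<in> Arr C \<Longrightarrow> Cod C g = Dom C f \<Longrightarrow> null g"
  by (simp add: mono_iff)

lemma epiD: "epi_arr C f \<Longrightarrow> null (g \<cdot> f) \<Longrightarrow> g \<in> Arr C \<Longrightarrow> Dom C g = Cod C f \<Longrightarrow> null g"
  by (simp add: epi_iff)

lemma null_ident_comp:
  assumes "null (Ident C X)" "X \<in> Obj C" "f \<in> Arr C"
  shows "Dom C f = X \<Longrightarrow> null f" "Cod C f = X \<Longrightarrow> null f"
  using null_comp(1)[OF _ _ _ assms(1), of f] null_comp(2)[OF _ _ _ assms(1), of f] assms by simp_all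

lemma zero_obj_iff: "zero_obj C X \<longleftrightarrow> X \<in> Obj C \<and> null (Ident C X)"
proof safe
  assume z: "zero_obj C X"
  then show X: "X \<in> Obj C" by (simp add: zero_obj_def)
  then have "\<exists>!f. f \<in> Hom C X X" using z by (simp only: zero_obj_def)
  moreover have "Ident C X \<in> Hom C X X" "hzero C X X \<in> Hom C X X" using X by simp_all
  ultimately have "Ident C X = hzero C X X" by blast
  then show "null (Ident C X)" by (rule nullI) (use X in simp_all)
next
  assume X: "X \<in> Obj C" "null (Ident C X)"
  have "\<exists>!f. f \<in> Hom C X Y" "\<exists>!f. f \<in> Hom C Y X" if Y: "Y \<in> Obj C" for Y
  proof -
    have "f = hzero C X Y" if "f \<in> Hom C X Y" for f
      using null_ident_comp(1)[OF X(2,1), of f] that by (intro nullD) simp_all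
    moreover have "hzero C X Y \<in> Hom C X Y" using X Y by simp
    ultimately show "\<exists>!f. f \<in> Hom C X Y" by blast
    have "f = hzero C Y X" if "f \<in> Hom C Y X" for f
      using null_ident_comp(2)[OF X(2,1), of f] that by (intro nullD) simp_all
    moreover have "hzero C Y X \<in> Hom C Y X" using X Y by simp
    ultimately show "\<exists>!f. f \<in> Hom C Y X" by blast
  qed
  then show "zero_obj C X" using X by (simp add: zero_obj_def)
qed

lemma mono_null_zero: "mono_arr C f \<Longrightarrow> null f \<Longrightarrow> null (Ident C (Dom C f))"
  using monoD[of f "Ident C (Dom C f)"] mono_arr_arr[of f] by simp

lemma epi_null_zero: "epi_arr C f \<Longrightarrow> null f \<Longrightarrow> null (Ident C (Cod C f))"
  using epiD[of f "Ident C (Cod C f)"] epi_arr_arr[of f] by simp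

lemma null_fac:
  assumes "fac f g" "null g" shows "null f"
proof -
  obtain u where u: "u \<in> Arr C" "Cod C u = Dom C g" "g \<cdot> u = f" using assms(1) by (rule facE) blast
  have "g \<in> Arr C" using assms(1) by (simp add: fac_def)
  then have "null (g \<cdot> u)" using u(1,2) assms(2) by (intro null_comp(2)) simp_all
  then show ?thesis using u(3) by simp
qed

lemma comp_finsum:
  assumes "finite I" "g \<in> Hom C Y Z" "X \<in> Obj C" "\<And>k. k \<in> I \<Longrightarrow> f k \<in> Hom C X Y"
  shows "g \<cdot> (\<Oplus>\<^bsub>hom_group C X Y\<^esub>k\<in>I. f k) = (\<Oplus>\<^bsub>hom_group C X Z\<^esub>k\<in>I. g \<cdot> f k)"
proof -
  have Y: "Y \<in> Obj C" and Z: "Z \<in> Obj C" using assms(2) by auto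
  interpret G: abelian_group "hom_group C X Y" using hom_abelian_group assms(3) Y .
  interpret H: abelian_group "hom_group C X Z" using hom_abelian_group assms(3) Z .
  show ?thesis using assms(1,4)
  proof (induction I)
    case empty then show ?case using assms by simp
  next
    case (insert a I)
    have f: "f \<in> I \<rightarrow> Hom C X Y" "f a \<in> Hom C X Y" using insert by auto
    have s: "(\<Oplus>\<^bsub>hom_group C X Y\<^esub>k\<in>I. f k) \<in> Hom C X Y" using G.finsum_closed[of f I] f by simp
    have "(\<lambda>k. g \<cdot> f k) \<in> insert a I \<rightarrow> Hom C X Z" using insert(4) assms(2) by simp
    then show ?case using insert f s assms(2)
      by (simp add: G.finsum_insert H.finsum_insert comp_hadd del: in_Hom) (simp add: comp_hadd)
  qed
qed

lemma finsum_comp: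
  assumes "finite I" "g \<in> Hom C W X" "Y \<in> Obj C" "\<And>k. k \<in> I \<Longrightarrow> f k \<in> Hom C X Y"
  shows "(\<Oplus>\<^bsub>hom_group C X Y\<^esub>k\<in>I. f k) \<cdot> g = (\<Oplus>\<^bsub>hom_group C W Y\<^esub>k\<in>I. f k \<cdot> g)"
proof -
  have X: "X \<in> Obj C" and W: "W \<in> Obj C" using assms(2) by auto
  interpret G: abelian_group "hom_group C X Y" using hom_abelian_group X assms(3) .
  interpret H: abelian_group "hom_group C W Y" using hom_abelian_group W assms(3) .
  show ?thesis using assms(1,4)
  proof (induction I)
    case empty then show ?case using assms by simp
  next
    case (insert a I)
    have f: "f \<in> I \<rightarrow> Hom C X Y" "f a \<in> Hom C X Y" using insert by auto
    have s: "(\<Oplus>\<^bsub>hom_group C X Y\<^esub>k\<in>I. f k) \<in> Hom C X Y" using G.finsum_closed[of f I] f by simp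
    have "(\<lambda>k. f k \<cdot> g) \<in> insert a I \<rightarrow> Hom C W Y" using insert(4) assms(2) by simp
    then show ?case using insert f s assms(2)
      by (simp add: G.finsum_insert H.finsum_insert comp_hadd del: in_Hom) (simp add: comp_hadd)
  qed
qed

lemma finsum_hom_closed:
  assumes "X \<in> Obj C" "Y \<in> Obj C" "\<And>k. k \<in> I \<Longrightarrow> f k \<in> Hom C X Y"
  shows "(\<Oplus>\<^bsub>hom_group C X Y\<^esub>k\<in>I. f k) \<in> Hom C X Y"
proof -
  interpret G: abelian_group "hom_group C X Y" using hom_abelian_group assms(1,2) .
  have "f \<in> I \<rightarrow> Hom C X Y" using assms(3) by blast
  then show ?thesis using G.finsum_closed[of f I] by simp
qed

lemma finsum_hom_cong:
  assumes "X \<in> Obj C" "Y \<in> Obj C" "\<And>k. k \<in> I \<Longrightarrow> f k = g k" "\<And>k. k \<in> I \<Longrightarrow> g k \<in> Hom C X Y"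
  shows "(\<Oplus>\<^bsub>hom_group C X Y\<^esub>k\<in>I. f k) = (\<Oplus>\<^bsub>hom_group C X Y\<^esub>k\<in>I. g k)"
proof -
  interpret G: abelian_group "hom_group C X Y" using hom_abelian_group assms(1,2) .
  have "g \<in> I \<rightarrow> Hom C X Y" using assms(4) by blast
  then show ?thesis using G.finsum_cong'[of I I g f] assms(3) by simp
qed

lemma finsum_hom_delta:
  assumes "finite I" "X \<in> Obj C" "Y \<in> Obj C" "j \<in> I" "f j \<in> Hom C X Y"
    "\<And>k. k \<in> I \<Longrightarrow> k \<noteq> j \<Longrightarrow> f k = hzero C X Y"
  shows "(\<Oplus>\<^bsub>hom_group C X Y\<^esub>k\<in>I. f k) = f j"
proof -
  interpret G: abelian_group "hom_group C X Y" using hom_abelian_group assms(2,3) .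
  let ?g = "\<lambda>k. if j = k then f k else \<zero>\<^bsub>hom_group C X Y\<^esub>"
  have "(\<Oplus>\<^bsub>hom_group C X Y\<^esub>k\<in>I. f k) = (\<Oplus>\<^bsub>hom_group C X Y\<^esub>k\<in>I. ?g k)"
    using assms by (intro finsum_hom_cong) auto
  also have "\<dots> = ?g j"
  proof -
    have "I = insert j (I - {j})" using assms(4) by blast
    then have "(\<Oplus>\<^bsub>hom_group C X Y\<^esub>k\<in>I. ?g k) = ?g j \<oplus>\<^bsub>hom_group C X Y\<^esub> (\<Oplus>\<^bsub>hom_group C X Y\<^esub>k\<in>I - {j}. ?g k)"
      using G.finsum_insert[of "I - {j}" j ?g] assms by (auto simp del: hom_group_simps(3))
    also have "(\<Oplus>\<^bsub>hom_group C X Y\<^esub>k\<in>I - {j}. ?g k) = (\<Oplus>\<^bsub>hom_group C X Y\<^esub>k\<in>I - {j}. \<zero>\<^bsub>hom_group C X Y\<^esub>)"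
      using assms by (intro finsum_hom_cong) auto
    also have "\<dots> = \<zero>\<^bsub>hom_group C X Y\<^esub>" by (rule G.finsum_zero)
    finally show ?thesis using assms(5) G.r_zero[of "f j"] by (simp del: hom_group_simps(3))
  qed
  finally show ?thesis by simp
qed

lemma direct_sumD:
  assumes "direct_sum C I X D \<iota> \<pi>"
  shows "finite I" "D \<in> Obj C" "(\<Oplus>\<^bsub>hom_group C D D\<^esub>k\<in>I. \<iota> k \<cdot> \<pi> k) = Ident C D"
    "k \<in> I \<Longrightarrow> X k \<in> Obj C"
    "k \<in> I \<Longrightarrow> \<iota> k \<in> Arr C" "k \<in> I \<Longrightarrow> Dom C (\<iota> k) = X k" "k \<in> I \<Longrightarrow> Cod C (\<iota> k) = D"
    "k \<in> I \<Longrightarrow> \<pi> k \<in> Arr C" "k \<in> I \<Longrightarrow> Dom C (\<pi> k) = D" "k \<in> I \<Longrightarrow> Cod C (\<pi> k) = X k"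
    "j \<in> I \<Longrightarrow> k \<in> I \<Longrightarrow> \<pi> j \<cdot> \<iota> k = (if j = k then Ident C (X k) else hzero C (X k) (X j))"
  using assms unfolding direct_sum_def by simp_all

text \<open>Inserting the resolution of the identity of \<open>D\<close> writes any \<open>h\<close>
  out of \<open>D\<close> as the sum of the
  \<open>(h \<cdot> \<iota> k) \<cdot> \<pi> k\<close>.\<close>

lemma direct_sum_ext_left:
  assumes d: "direct_sum C I X D \<iota> \<pi>" and f: "f \<in> Hom C D Y" and g: "g \<in> Hom C D Y"
    and e: "\<And>k. k \<in> I \<Longrightarrow> f \<cdot> \<iota> k = g \<cdot> \<iota> k"
  shows "f = g"
proof -
  note D = direct_sumD[OF d]
  have Y: "Y \<in> Obj C" using f by auto
  have s: "h = (\<Oplus>\<^bsub>hom_group C D Y\<^esub>k\<in>I. (h \<cdot> \<iota> k) \<cdot> \<pi> k)" if h: "h \<in> Hom C D Y" for h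
  proof -
    have "h = h \<cdot> (\<Oplus>\<^bsub>hom_group C D D\<^esub>k\<in>I. \<iota> k \<cdot> \<pi> k)" using D h by simp
    also have "\<dots> = (\<Oplus>\<^bsub>hom_group C D Y\<^esub>k\<in>I. h \<cdot> (\<iota> k \<cdot> \<pi> k))" using D h by (intro comp_finsum) simp_all
    also have "\<dots> = (\<Oplus>\<^bsub>hom_group C D Y\<^esub>k\<in>I. (h \<cdot> \<iota> k) \<cdot> \<pi> k)"
      using D h Y by (intro finsum_hom_cong) simp_all
    finally show ?thesis .
  qed
  have "f = (\<Oplus>\<^bsub>hom_group C D Y\<^esub>k\<in>I. (f \<cdot> \<iota> k) \<cdot> \<pi> k)" by (rule s[OF f])
  also have "\<dots> = (\<Oplus>\<^bsub>hom_group C D Y\<^esub>k\<in>I. (g \<cdot> \<iota> k) \<cdot> \<pi> k)"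
    using e D f g Y by (intro finsum_hom_cong) simp_all
  also have "\<dots> = g" by (rule s[OF g, symmetric])
  finally show ?thesis .
qed

lemma direct_sum_ext_right:
  assumes d: "direct_sum C I X D \<iota> \<pi>" and f: "f \<in> Hom C Y D" and g: "g \<in> Hom C Y D"
    and e: "\<And>k. k \<in> I \<Longrightarrow> \<pi> k \<cdot> f = \<pi> k \<cdot> g"
  shows "f = g"
proof -
  note D = direct_sumD[OF d]
  have Y: "Y \<in> Obj C" using f by auto
  have s: "h = (\<Oplus>\<^bsub>hom_group C Y D\<^esub>k\<in>I. \<iota> k \<cdot> (\<pi> k \<cdot> h))" if h: "h \<in> Hom C Y D" for h
  proof -
    have "h = (\<Oplus>\<^bsub>hom_group C D D\<^esub>k\<in>I. \<iota> k \<cdot> \<pi> k) \<cdot> h" using D h by simp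
    also have "\<dots> = (\<Oplus>\<^bsub>hom_group C Y D\<^esub>k\<in>I. (\<iota> k \<cdot> \<pi> k) \<cdot> h)" using D h by (intro finsum_comp) simp_all
    also have "\<dots> = (\<Oplus>\<^bsub>hom_group C Y D\<^esub>k\<in>I. \<iota> k \<cdot> (\<pi> k \<cdot> h))"
      using D h Y by (intro finsum_hom_cong) simp_all
    finally show ?thesis .
  qed
  have "f = (\<Oplus>\<^bsub>hom_group C Y D\<^esub>k\<in>I. \<iota> k \<cdot> (\<pi> k \<cdot> f))" by (rule s[OF f])
  also have "\<dots> = (\<Oplus>\<^bsub>hom_group C Y D\<^esub>k\<in>I. \<iota> k \<cdot> (\<pi> k \<cdot> g))"
    using e D f g Y by (intro finsum_hom_cong) simp_all
  also have "\<dots> = g" by (rule s[OF g, symmetric])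
  finally show ?thesis .
qed

lemma direct_sum_copair:
  assumes d: "direct_sum C I X D \<iota> \<pi>" and Y: "Y \<in> Obj C" and f: "\<And>k. k \<in> I \<Longrightarrow> f k \<in> Hom C (X k) Y"
  shows "(\<Oplus>\<^bsub>hom_group C D Y\<^esub>k\<in>I. f k \<cdot> \<pi> k) \<in> Hom C D Y"
    "j \<in> I \<Longrightarrow> (\<Oplus>\<^bsub>hom_group C D Y\<^esub>k\<in>I. f k \<cdot> \<pi> k) \<cdot> \<iota> j = f j"
proof -
  note D = direct_sumD[OF d]
  show "(\<Oplus>\<^bsub>hom_group C D Y\<^esub>k\<in>I. f k \<cdot> \<pi> k) \<in> Hom C D Y"
    by (rule finsum_hom_closed) (use D f Y in simp_all)
  assume j: "j \<in> I"
  have "(\<Oplus>\<^bsub>hom_group C D Y\<^esub>k\<in>I. f k \<cdot> \<pi> k) \<cdot> \<iota> j = (\<Oplus>\<^bsub>hom_group C (X j) Y\<^esub>k\<in>I. (f k \<cdot> \<pi> k) \<cdot> \<iota> j)"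
    using D f Y j by (intro finsum_comp) simp_all
  also have "\<dots> = (f j \<cdot> \<pi> j) \<cdot> \<iota> j"
    using D f Y j by (intro finsum_hom_delta) simp_all
  also have "\<dots> = f j" using D f j by simp
  finally show "(\<Oplus>\<^bsub>hom_group C D Y\<^esub>k\<in>I. f k \<cdot> \<pi> k) \<cdot> \<iota> j = f j" .
qed

lemma direct_sum_pair:
  assumes d: "direct_sum C I X D \<iota> \<pi>" and Y: "Y \<in> Obj C" and f: "\<And>k. k \<in> I \<Longrightarrow> f k \<in> Hom C Y (X k)"
  shows "(\<Oplus>\<^bsub>hom_group C Y D\<^esub>k\<in>I. \<iota> k \<cdot> f k) \<in> Hom C Y D"
    "j \<in> I \<Longrightarrow> \<pi> j \<cdot> (\<Oplus>\<^bsub>hom_group C Y D\<^esub>k\<in>I. \<iota> k \<cdot> f k) = f j"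
proof -
  note D = direct_sumD[OF d]
  show "(\<Oplus>\<^bsub>hom_group C Y D\<^esub>k\<in>I. \<iota> k \<cdot> f k) \<in> Hom C Y D"
    by (rule finsum_hom_closed) (use D f Y in simp_all)
  assume j: "j \<in> I"
  have "\<pi> j \<cdot> (\<Oplus>\<^bsub>hom_group C Y D\<^esub>k\<in>I. \<iota> k \<cdot> f k) = (\<Oplus>\<^bsub>hom_group C Y (X j)\<^esub>k\<in>I. \<pi> j \<cdot> (\<iota> k \<cdot> f k))"
    using D f Y j by (intro comp_finsum) simp_all
  also have "\<dots> = \<pi> j \<cdot> (\<iota> j \<cdot> f j)"
  proof (rule finsum_hom_delta)
    show "\<pi> j \<cdot> (\<iota> k \<cdot> f k) = hzero C Y (X j)" if "k \<in> I" "k \<noteq> j" for k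
      using comp_assoc'[of "f k" "\<iota> k" "\<pi> j"] D f Y j that by (simp del: comp_assoc')
  qed (use D f Y j in simp_all)
  also have "\<dots> = f j" using comp_assoc'[of "f j" "\<iota> j" "\<pi> j"] D f j by (simp del: comp_assoc')
  finally show "\<pi> j \<cdot> (\<Oplus>\<^bsub>hom_group C Y D\<^esub>k\<in>I. \<iota> k \<cdot> f k) = f j" .
qed

end

section \<open>Abelian categories\<close>

context preadditive
begin

lemma is_kernelD:
  assumes "is_kernel C f k"
  shows "f \<in> Arr C" "k \<in> Arr C" "Cod C k = Dom C f" "null (f \<cdot> k)"
    "h \<in> Arr C \<Longrightarrow> Cod C h = Dom C f \<Longrightarrow> null (f \<cdot> h) \<Longrightarrow> fac h k" "mono_arr C k"
proof -
  show f: "f \<in> Arr C" and k: "k \<in> Arr C" and c: "Cod C k = Dom C f"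
    using assms by (simp_all add: is_kernel_def)
  have "f \<cdot> k = hzero C (Dom C k) (Cod C f)" using assms by (simp add: is_kernel_def)
  then show n: "null (f \<cdot> k)" by (rule nullI) (use f k in simp_all)
  have univ: "\<exists>!u. u \<in> Hom C (Dom C h) (Dom C k) \<and> k \<cdot> u = h"
    if h: "h \<in> Arr C" "Cod C h = Dom C f" "null (f \<cdot> h)" for h
  proof -
    have "f \<cdot> h = hzero C (Dom C h) (Cod C f)" by (rule nullD[OF h(3)]) (use f h in simp_all)
    moreover have "h \<in> Hom C (Dom C h) (Dom C f)" using h by simp
    ultimately show ?thesis using assms unfolding is_kernel_def by blast
  qed
  show "fac h k" if h: "h \<in> Arr C" "Cod C h = Dom C f" "null (f \<cdot> h)" for h
    using univ[OF h] h(1) k unfolding fac_def by blast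
  \<comment> \<open>Both \<open>g\<close> and the zero arrow lift the null arrow
    \<open>k \<cdot> g\<close> through \<open>k\<close>, so uniqueness in the universal property
    makes \<open>g\<close> null.\<close>
  show "mono_arr C k" unfolding mono_iff
  proof (intro conjI ballI impI k)
    fix g assume g: "g \<in> Arr C" "Cod C g = Dom C k" "null (k \<cdot> g)"
    have "null (f \<cdot> (k \<cdot> g))" by (rule null_comp(1)) (use f k c g in simp_all)
    then have u: "\<exists>!u. u \<in> Hom C (Dom C (k \<cdot> g)) (Dom C k) \<and> k \<cdot> u = k \<cdot> g"
      by (rule univ[rotated -1]) (use k c g in simp_all)
    let ?z = "hzero C (Dom C g) (Dom C k)"
    have "k \<cdot> ?z = hzero C (Dom C g) (Cod C k)" using k g by simp
    moreover have "k \<cdot> g = hzero C (Dom C g) (Cod C k)" by (rule nullD[OF g(3)]) (use k g in simp_all)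
    ultimately have "k \<cdot> ?z = k \<cdot> g" by simp
    moreover have "?z \<in> Hom C (Dom C (k \<cdot> g)) (Dom C k)" "g \<in> Hom C (Dom C (k \<cdot> g)) (Dom C k)"
      using k g by simp_all
    ultimately have "g = ?z" using u by blast
    then show "null g" by (rule nullI) (use k g in simp_all)
  qed
qed

lemma is_kernelI:
  assumes "f \<in> Arr C" "mono_arr C k" "Cod C k = Dom C f" "null (f \<cdot> k)"
    "\<And>h. h \<in> Arr C \<Longrightarrow> Cod C h = Dom C f \<Longrightarrow> null (f \<cdot> h) \<Longrightarrow> fac h k"
  shows "is_kernel C f k"
  unfolding is_kernel_def
proof (intro conjI allI ballI impI)
  note k = mono_arr_arr[OF assms(2)]
  show "f \<cdot> k = hzero C (Dom C k) (Cod C f)" by (rule nullD[OF assms(4)]) (use assms k in simp_all)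
  fix W h assume h: "h \<in> Hom C W (Dom C f)" "f \<cdot> h = hzero C W (Cod C f)"
  have "null (f \<cdot> h)" by (rule nullI[OF h(2)]) (use assms(1) h(1) in auto)
  then have "fac h k" by (rule assms(5)[rotated -1]) (use h in simp_all)
  then obtain u where u: "u \<in> Hom C W (Dom C k)" "k \<cdot> u = h"
    by (rule facE) (use h(1) in simp)
  moreover have "v = u" if "v \<in> Hom C W (Dom C k)" "k \<cdot> v = h" for v
    by (rule mono_arrD[OF assms(2)]) (use u that in simp_all)
  ultimately show "\<exists>!u. u \<in> Hom C W (Dom C k) \<and> k \<cdot> u = h" by blast
qed (use assms(1-3) mono_arr_arr in simp_all)

lemma is_cokernelD:
  assumes "is_cokernel C f q"
  shows "f \<in> Arr C" "q \<in> Arr C" "Dom C q = Cod C f" "null (q \<cdot> f)"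
    "h \<in> Arr C \<Longrightarrow> Dom C h = Cod C f \<Longrightarrow> null (h \<cdot> f) \<Longrightarrow> \<exists>u \<in> Hom C (Cod C q) (Cod C h). u \<cdot> q = h"
    "epi_arr C q"
proof -
  show f: "f \<in> Arr C" and q: "q \<in> Arr C" and c: "Dom C q = Cod C f"
    using assms by (simp_all add: is_cokernel_def)
  have "q \<cdot> f = hzero C (Dom C f) (Cod C q)" using assms by (simp add: is_cokernel_def)
  then show n: "null (q \<cdot> f)" by (rule nullI) (use f q in simp_all)
  have univ: "\<exists>!u. u \<in> Hom C (Cod C q) (Cod C h) \<and> u \<cdot> q = h"
    if h: "h \<in> Arr C" "Dom C h = Cod C f" "null (h \<cdot> f)" for h
  proof -
    have "h \<cdot> f = hzero C (Dom C f) (Cod C h)" by (rule nullD[OF h(3)]) (use f h in simp_all)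
    moreover have "h \<in> Hom C (Cod C f) (Cod C h)" using h by simp
    ultimately show ?thesis using assms unfolding is_cokernel_def by blast
  qed
  show "\<exists>u \<in> Hom C (Cod C q) (Cod C h). u \<cdot> q = h"
    if h: "h \<in> Arr C" "Dom C h = Cod C f" "null (h \<cdot> f)" for h
    using univ[OF h] by blast
  show "epi_arr C q" unfolding epi_iff
  proof (intro conjI ballI impI q)
    fix g assume g: "g \<in> Arr C" "Dom C g = Cod C q" "null (g \<cdot> q)"
    have "null ((g \<cdot> q) \<cdot> f)" by (rule null_comp(2)) (use f q c g in simp_all)
    then have u: "\<exists>!u. u \<in> Hom C (Cod C q) (Cod C (g \<cdot> q)) \<and> u \<cdot> q = g \<cdot> q"
      by (rule univ[rotated -1]) (use q c g in simp_all)
    let ?z = "hzero C (Cod C q) (Cod C g)"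
    have "?z \<cdot> q = hzero C (Dom C q) (Cod C g)" using q g by simp
    moreover have "g \<cdot> q = hzero C (Dom C q) (Cod C g)" by (rule nullD[OF g(3)]) (use q g in simp_all)
    ultimately have "?z \<cdot> q = g \<cdot> q" by simp
    moreover have "?z \<in> Hom C (Cod C q) (Cod C (g \<cdot> q))" "g \<in> Hom C (Cod C q) (Cod C (g \<cdot> q))"
      using q g by simp_all
    ultimately have "g = ?z" using u by blast
    then show "null g" by (rule nullI) (use q g in simp_all)
  qed
qed

lemma is_cokernelI:
  assumes "f \<in> Arr C" "epi_arr C q" "Dom C q = Cod C f" "null (q \<cdot> f)"
    "\<And>h. h \<in> Arr C \<Longrightarrow> Dom C h = Cod C f \<Longrightarrow> null (h \<cdot> f) \<Longrightarrow> \<exists>u \<in> Hom C (Cod C q) (Cod C h). u \<cdot> q = h"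
  shows "is_cokernel C f q"
  unfolding is_cokernel_def
proof (intro conjI allI ballI impI)
  note q = epi_arr_arr[OF assms(2)]
  show "q \<cdot> f = hzero C (Dom C f) (Cod C q)" by (rule nullD[OF assms(4)]) (use assms q in simp_all)
  fix W h assume h: "h \<in> Hom C (Cod C f) W" "h \<cdot> f = hzero C (Dom C f) W"
  have "null (h \<cdot> f)" by (rule nullI[OF h(2)]) (use assms(1) h(1) in auto)
  then have "\<exists>u \<in> Hom C (Cod C q) (Cod C h). u \<cdot> q = h" by (rule assms(5)[rotated -1]) (use h in simp_all)
  then obtain u where u: "u \<in> Hom C (Cod C q) W" "u \<cdot> q = h" using h(1) by auto
  moreover have "v = u" if "v \<in> Hom C (Cod C q) W" "v \<cdot> q = h" for v
    by (rule epi_arrD[OF assms(2)]) (use u that in simp_all)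
  ultimately show "\<exists>!u. u \<in> Hom C (Cod C q) W \<and> u \<cdot> q = h" by blast
qed (use assms(1-3) epi_arr_arr in simp_all)

end

section \<open>Kernels, cokernels, images and pullbacks\<close>

context abelian_category
begin

definition ker where "ker f = (SOME k. is_kernel C f k)"
definition coker where "coker f = (SOME q. is_cokernel C f q)"

lemma is_kernel_ker: "f \<in> Arr C \<Longrightarrow> is_kernel C f (ker f)"
  unfolding ker_def by (rule someI_ex) (rule kernels_exist)

lemma is_cokernel_coker: "f \<in> Arr C \<Longrightarrow> is_cokernel C f (coker f)"
  unfolding coker_def by (rule someI_ex) (rule cokernels_exist)

lemma ker_arr [simp]:
  assumes "f \<in> Arr C" shows "ker f \<in> Arr C" "Cod C (ker f) = Dom C f" "mono_arr C (ker f)" "null (f \<cdot> ker f)"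
  using is_kernelD[OF is_kernel_ker[OF assms]] by simp_all

lemma coker_arr [simp]:
  assumes "f \<in> Arr C" shows "coker f \<in> Arr C" "Dom C (coker f) = Cod C f" "epi_arr C (coker f)" "null (coker f \<cdot> f)"
  using is_cokernelD[OF is_cokernel_coker[OF assms]] by simp_all

lemma ker_fac:
  assumes "null (f \<cdot> h)" "f \<in> Arr C" "h \<in> Arr C" "Cod C h = Dom C f" shows "fac h (ker f)"
  using is_kernelD(5)[OF is_kernel_ker] assms by blast

lemma coker_fac:
  assumes "null (h \<cdot> f)" "f \<in> Arr C" "h \<in> Arr C" "Dom C h = Cod C f"
  obtains u where "u \<in> Arr C" "Dom C u = Cod C (coker f)" "Cod C u = Cod C h" "u \<cdot> coker f = h"
proof -
  have "\<exists>u \<in> Hom C (Cod C (coker f)) (Cod C h). u \<cdot> coker f = h"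
    by (rule is_cokernelD(5)[OF is_cokernel_coker]) (use assms in simp_all)
  then show thesis using that by auto
qed

text \<open>\<open>m\<close> is the kernel of some \<open>g\<close> by the abelian axiom, and
  \<open>g\<close> factors through \<open>coker m\<close>, so whatever \<open>coker m\<close> kills
  is killed by \<open>g\<close>. Thus \<open>m\<close> is the kernel of its cokernel, which turns
  containment in \<open>m\<close> into an equation.\<close>

lemma mono_fac:
  assumes "mono_arr C m" "h \<in> Arr C" "Cod C h = Cod C m" "null (coker m \<cdot> h)"
  shows "fac h m"
proof -
  note m = mono_arr_arr[OF assms(1)]
  obtain g where g: "is_kernel C g m" using mono_is_kernel assms(1) by blast
  note gD = is_kernelD[OF g]
  obtain u where u: "u \<in> Arr C" "Dom C u = Cod C (coker m)" "u \<cdot> coker m = g"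
    by (rule coker_fac[OF gD(4,2,1)]) (use gD in simp_all)
  have "null (u \<cdot> (coker m \<cdot> h))" by (rule null_comp(1)) (use u m assms in simp_all)
  also have "u \<cdot> (coker m \<cdot> h) = g \<cdot> h"
    using comp_assoc'[of h "coker m" u] u m assms by (simp del: comp_assoc')
  finally show ?thesis by (rule gD(5)[rotated -1]) (use assms gD in simp_all)
qed

lemma null_coker_fac:
  assumes "fac h m" shows "null (coker m \<cdot> h)"
proof -
  obtain u where u: "u \<in> Arr C" "Cod C u = Dom C m" "m \<cdot> u = h" using assms by (rule facE) blast
  have m: "m \<in> Arr C" using assms by (simp add: fac_def)
  have "null ((coker m \<cdot> m) \<cdot> u)" by (rule null_comp(2)) (use u m in simp_all)
  also have "(coker m \<cdot> m) \<cdot> u = coker m \<cdot> (m \<cdot> u)" by (rule comp_assoc') (use u m in simp_all)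
  finally show ?thesis using u by simp
qed

text \<open>Dual of \<open>mono_fac\<close>: an epimorphism is the cokernel of its kernel.\<close>

lemma epi_fac:
  assumes "null (h \<cdot> ker e)" "epi_arr C e" "h \<in> Arr C" "Dom C h = Dom C e"
  obtains u where "u \<in> Arr C" "Dom C u = Cod C e" "Cod C u = Cod C h" "u \<cdot> e = h"
proof -
  note e = epi_arr_arr[OF assms(2)]
  obtain g where g: "is_cokernel C g e" using epi_is_cokernel assms(2) by blast
  note gD = is_cokernelD[OF g]
  have "fac g (ker e)" by (rule ker_fac[OF gD(4,2,1)]) (use gD in simp)
  then obtain u where u: "u \<in> Arr C" "Dom C u = Dom C g" "Cod C u = Dom C (ker e)" "ker e \<cdot> u = g"
    by (rule facE) blast
  have "null ((h \<cdot> ker e) \<cdot> u)" by (rule null_comp(2)) (use u e assms in simp_all)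
  also have "(h \<cdot> ker e) \<cdot> u = h \<cdot> (ker e \<cdot> u)" by (rule comp_assoc') (use u e assms in simp_all)
  finally have "null (h \<cdot> g)" using u by simp
  then have "\<exists>u \<in> Hom C (Cod C e) (Cod C h). u \<cdot> e = h"
    by (rule gD(5)[rotated -1]) (use assms gD in simp_all)
  then show thesis using that by auto
qed

text \<open>The cokernel of an epimorphism is null, so the identity of the target lands in
  \<open>m\<close>.\<close>

lemma mono_epi_iso:
  assumes "mono_arr C m" "epi_arr C m" shows "iso_arr C m"
proof -
  note m = mono_arr_arr[OF assms(1)]
  have "null (coker m)" by (rule epiD[OF assms(2)]) (use m in simp_all)
  then have "fac (Ident C (Cod C m)) m" by (intro mono_fac) (use assms m in simp_all)
  then show ?thesis by (rule fac_ident) (use assms m in simp_all)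
qed

lemma image_factorization:
  assumes "f \<in> Arr C"
  obtains m e where "mono_arr C m" "epi_arr C e" "m \<in> Arr C" "e \<in> Arr C" "Dom C e = Dom C f"
    "Cod C m = Cod C f" "Dom C m = Cod C e" "m \<cdot> e = f"
proof -
  let ?m = "ker (coker f)"
  have m: "mono_arr C ?m" "?m \<in> Arr C" "Cod C ?m = Cod C f" using assms by simp_all
  have "fac f ?m" by (rule ker_fac) (use assms in simp_all)
  then obtain e where e: "e \<in> Arr C" "Dom C e = Dom C f" "Cod C e = Dom C ?m" "?m \<cdot> e = f"
    by (rule facE) blast
  \<comment> \<open>If \<open>g\<close> kills \<open>e\<close>, then \<open>f\<close> already lands
    in \<open>?m \<cdot> ker g\<close>. The cokernel of the latter then factors through
    \<open>coker f\<close>, which kills \<open>?m\<close>, so \<open>?m\<close> lands in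
    \<open>?m \<cdot> ker g\<close> as well; hence \<open>ker g\<close> is an isomorphism and
    \<open>g\<close> is null.\<close>
  have "epi_arr C e" unfolding epi_iff
  proof (intro conjI ballI impI)
    fix g assume g: "g \<in> Arr C" "Dom C g = Cod C e" "null (g \<cdot> e)"
    let ?k = "ker g"
    have k: "?k \<in> Arr C" "mono_arr C ?k" "Cod C ?k = Dom C ?m" using g e by simp_all
    have "fac e ?k" by (rule ker_fac) (use g e in simp_all)
    then have "fac (?m \<cdot> e) (?m \<cdot> ?k)" by (rule fac_comp_left) (use m k in simp_all)
    then have "null (coker (?m \<cdot> ?k) \<cdot> f)" unfolding e(4) by (rule null_coker_fac)
    then obtain u where u: "u \<in> Arr C" "Dom C u = Cod C (coker f)" "u \<cdot> coker f = coker (?m \<cdot> ?k)"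
      by (rule coker_fac) (use assms m k in simp_all)
    have "null (u \<cdot> (coker f \<cdot> ?m))" by (rule null_comp(1)) (use u m assms in simp_all)
    also have "u \<cdot> (coker f \<cdot> ?m) = coker (?m \<cdot> ?k) \<cdot> ?m"
      using comp_assoc'[of ?m "coker f" u] u m assms by (simp del: comp_assoc')
    finally have "fac ?m (?m \<cdot> ?k)"
      by (intro mono_fac mono_arr_comp) (use m k in simp_all)
    then have "fac (?m \<cdot> Ident C (Dom C ?m)) (?m \<cdot> ?k)" using m by simp
    then have "fac (Ident C (Dom C ?m)) ?k" by (rule fac_comp_left_mono) (use m k in simp_all)
    then have "iso_arr C ?k" by (rule fac_ident) (use m k in simp_all)
    then show "null g" by (rule epiD[OF iso_arr_epi, of ?k g]) (use g k e in simp_all)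
  qed (use e in simp)
  then show thesis using that[of ?m e] m e by simp
qed

lemma binary_sum:
  assumes "X \<in> Obj C" "Y \<in> Obj C"
  obtains D i1 i2 p1 p2 where "D \<in> Obj C" "i1 \<in> Hom C X D" "i2 \<in> Hom C Y D" "p1 \<in> Hom C D X" "p2 \<in> Hom C D Y"
    "p1 \<cdot> i1 = Ident C X" "p2 \<cdot> i2 = Ident C Y" "p1 \<cdot> i2 = hzero C Y X" "p2 \<cdot> i1 = hzero C X Y"
    "hadd C (i1 \<cdot> p1) (i2 \<cdot> p2) = Ident C D"
proof -
  let ?X = "\<lambda>k::nat. if k = 0 then X else Y"
  obtain D \<iota> \<pi> where d: "direct_sum C {..<2} ?X D \<iota> \<pi>" 
    using direct_sums_exist[of 2 ?X] assms by (metis (mono_tags))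
  note dD = direct_sumD[OF d]
  show thesis
  proof (rule that[of D "\<iota> 0" "\<iota> 1" "\<pi> 0" "\<pi> 1"])
    show p: "\<pi> 0 \<cdot> \<iota> 0 = Ident C X" "\<pi> 1 \<cdot> \<iota> 1 = Ident C Y" "\<pi> 0 \<cdot> \<iota> 1 = hzero C Y X" "\<pi> 1 \<cdot> \<iota> 0 = hzero C X Y"
      using dD(11)[of 0 0] dD(11)[of 1 1] dD(11)[of 0 1] dD(11)[of 1 0] by simp_all
    have a: "\<iota> 0 \<in> Hom C X D" "\<iota> 1 \<in> Hom C Y D" "\<pi> 0 \<in> Hom C D X" "\<pi> 1 \<in> Hom C D Y"
      using dD(5-10)[of 0] dD(5-10)[of 1] by simp_all
    show "hadd C (\<iota> 0 \<cdot> \<pi> 0) (\<iota> 1 \<cdot> \<pi> 1) = Ident C D"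
    proof (rule direct_sum_ext_left[OF d])
      have "hadd C (\<iota> 0 \<cdot> \<pi> 0) (\<iota> 1 \<cdot> \<pi> 1) \<cdot> \<iota> 0 = Ident C D \<cdot> \<iota> 0"
        "hadd C (\<iota> 0 \<cdot> \<pi> 0) (\<iota> 1 \<cdot> \<pi> 1) \<cdot> \<iota> 1 = Ident C D \<cdot> \<iota> 1"
        using a p assms dD(2) by (simp_all add: comp_hadd hadd_null)
      then show "hadd C (\<iota> 0 \<cdot> \<pi> 0) (\<iota> 1 \<cdot> \<pi> 1) \<cdot> \<iota> k = Ident C D \<cdot> \<iota> k" if "k \<in> {..<2}" for k
        using that by (cases "k = 0"; cases "k = 1") auto
    qed (use a dD(2) in simp_all)
    show "\<iota> 0 \<in> Hom C X D" "\<iota> 1 \<in> Hom C Y D" "\<pi> 0 \<in> Hom C D X" "\<pi> 1 \<in> Hom C D Y"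
      using dD(5-10)[of 0] dD(5-10)[of 1] by simp_all
    show "D \<in> Obj C" using dD by simp
  qed
qed

text \<open>The pullback is the kernel of \<open>f \<cdot> p1 - g \<cdot> p2\<close> on the
  biproduct. Only the stability of epimorphisms is recorded, not the universal property:
  \<open>g'\<close> lifts \<open>g\<close> along \<open>f\<close> over an epic cover
  \<open>p\<close> of its source, which is the substitute for choosing preimages of
  elements.\<close>

lemma epi_pullback:
  assumes "epi_arr C f" "g \<in> Arr C" "Cod C g = Cod C f"
  obtains p g' where "epi_arr C p" "p \<in> Arr C" "g' \<in> Arr C" "Cod C p = Dom C g" "Dom C g' = Dom C p"
    "Cod C g' = Dom C f" "f \<cdot> g' = g \<cdot> p"
proof -
  note f = epi_arr_arr[OF assms(1)]
  obtain D i1 i2 p1 p2 where D: "D \<in> Obj C" "i1 \<in> Hom C (Dom C f) D" "i2 \<in> Hom C (Dom C g) D"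
    "p1 \<in> Hom C D (Dom C f)" "p2 \<in> Hom C D (Dom C g)"
    "p1 \<cdot> i1 = Ident C (Dom C f)" "p2 \<cdot> i2 = Ident C (Dom C g)"
    "p1 \<cdot> i2 = hzero C (Dom C g) (Dom C f)" "p2 \<cdot> i1 = hzero C (Dom C f) (Dom C g)"
    by (rule binary_sum[of "Dom C f" "Dom C g"]) (use f assms in auto)
  let ?d = "hsub (f \<cdot> p1) (g \<cdot> p2)"
  have d: "?d \<in> Arr C" "Dom C ?d = D" "Cod C ?d = Cod C f" using D f assms by simp_all
  have di: "?d \<cdot> i1 = f"
  proof -
    have "?d \<cdot> i1 = hsub ((f \<cdot> p1) \<cdot> i1) ((g \<cdot> p2) \<cdot> i1)" using D f assms by (simp add: comp_hsub)
    also have "\<dots> = hsub f (hzero C (Dom C f) (Cod C f))" using D f assms by simp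
    also have "\<dots> = f" using hadd_hsub_cancel(3)[of f "hzero C (Dom C f) (Cod C f)"]
        hadd_null(2)[of "hsub f (hzero C (Dom C f) (Cod C f))" "hzero C (Dom C f) (Cod C f)"] f by simp
    finally show ?thesis .
  qed
  have ed: "epi_arr C ?d" by (rule epi_arr_of_comp[of ?d i1]) (use assms(1) d D di in simp_all)
  let ?k = "ker ?d"
  have k: "?k \<in> Arr C" "Cod C ?k = D" using d by simp_all
  have kn: "null (?d \<cdot> ?k)" using d by simp
  have "?d \<cdot> ?k = hsub ((f \<cdot> p1) \<cdot> ?k) ((g \<cdot> p2) \<cdot> ?k)" using D f assms k by (simp add: comp_hsub)
  then have "null (hsub ((f \<cdot> p1) \<cdot> ?k) ((g \<cdot> p2) \<cdot> ?k))" using kn by simp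
  then have sq: "(f \<cdot> p1) \<cdot> ?k = (g \<cdot> p2) \<cdot> ?k"
    by (rule null_hsub_iff[THEN iffD1, rotated -1]) (use D f assms k in simp_all)
  have "epi_arr C (p2 \<cdot> ?k)" unfolding epi_iff
  proof (intro conjI ballI impI)
    show "p2 \<cdot> ?k \<in> Arr C" using k D by simp
    fix h assume h: "h \<in> Arr C" "Dom C h = Cod C (p2 \<cdot> ?k)" "null (h \<cdot> (p2 \<cdot> ?k))"
    have hD: "Dom C h = Dom C g" using h(2) k D by simp
    have "null ((h \<cdot> p2) \<cdot> ?k)" using h(3) h(1) hD k D by simp
    then obtain u where u: "u \<in> Arr C" "Dom C u = Cod C ?d" "Cod C u = Cod C (h \<cdot> p2)" "u \<cdot> ?d = h \<cdot> p2"
      by (rule epi_fac[OF _ ed]) (use h(1) hD D d in simp_all)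
    \<comment> \<open>Restricting \<open>u \<cdot> ?d = h \<cdot> p2\<close> to the first summand
      gives \<open>u \<cdot> f = 0\<close>, since \<open>p2\<close> vanishes there; so
      \<open>u\<close> is null, and with it \<open>h \<cdot> p2\<close>.\<close>
    have "u \<cdot> f = u \<cdot> (?d \<cdot> i1)" unfolding di ..
    also have "\<dots> = (u \<cdot> ?d) \<cdot> i1" by (rule comp_assoc'[symmetric]) (use u d D in simp_all)
    also have "\<dots> = h \<cdot> (p2 \<cdot> i1)" unfolding u(4) by (rule comp_assoc') (use h(1) hD D in simp_all)
    also have "\<dots> = hzero C (Dom C f) (Cod C h)" using D h(1) hD f by simp
    finally have "null (u \<cdot> f)" by (rule nullI) (use h(1) f in simp_all)
    then have "null u" by (rule epiD[OF assms(1)]) (use u d in simp_all)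
    then have "null (u \<cdot> ?d)" by (rule null_comp(2)[rotated -1]) (use u d in simp_all)
    then have "null (h \<cdot> p2)" unfolding u(4) .
    then have "null ((h \<cdot> p2) \<cdot> i2)" by (rule null_comp(2)[rotated -1]) (use h(1) hD D in simp_all)
    then show "null h" using h(1) hD D by simp
  qed
  then show thesis by (rule that[of "p2 \<cdot> ?k" "p1 \<cdot> ?k"]) (use sq D f assms k in simp_all)
qed

lemma mono_if_ker_null:
  assumes "f \<in> Arr C" "null (ker f)" shows "mono_arr C f"
  unfolding mono_iff
proof (intro conjI ballI impI)
  fix g assume "g \<in> Arr C" "Cod C g = Dom C f" "null (f \<cdot> g)"
  then have "fac g (ker f)" using assms by (intro ker_fac) simp_all
  then show "null g" by (rule null_fac) (rule assms)
qed (rule assms)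

lemma epi_if_coker_null:
  assumes "f \<in> Arr C" "null (coker f)" shows "epi_arr C f"
  unfolding epi_iff
proof (intro conjI ballI impI)
  fix g assume g: "g \<in> Arr C" "Dom C g = Cod C f" "null (g \<cdot> f)"
  obtain u where u: "u \<in> Arr C" "Dom C u = Cod C (coker f)" "u \<cdot> coker f = g"
    by (rule coker_fac[OF g(3) assms(1) g(1,2)])
  have "null (u \<cdot> coker f)" by (rule null_comp(1)) (use u assms in simp_all)
  then show "null g" using u by simp
qed (rule assms)

section \<open>Simple objects, Schur's lemma and local objects\<close>

lemma simple_objD:
  assumes "simple_obj C S"
  shows "S \<in> Obj C" "\<not> null (Ident C S)"
    "mono_arr C m \<Longrightarrow> Cod C m = S \<Longrightarrow> \<not> null m \<Longrightarrow> iso_arr C m"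
proof -
  show S: "S \<in> Obj C" "\<not> null (Ident C S)" using assms unfolding simple_obj_def zero_obj_iff by auto
  assume m: "mono_arr C m" "Cod C m = S" "\<not> null m"
  have "zero_obj C (Dom C m) \<or> iso_arr C m" using assms m(1,2) by (simp add: simple_obj_def)
  moreover have "\<not> zero_obj C (Dom C m)"
    unfolding zero_obj_iff using m(3) null_ident_comp(1)[of "Dom C m" m] mono_arr_arr[OF m(1)] by auto
  ultimately show "iso_arr C m" by simp
qed

lemma simple_epi:
  assumes "simple_obj C (Cod C g)" "g \<in> Arr C" "\<not> null g" shows "epi_arr C g"
proof -
  obtain m e where m: "mono_arr C m" "epi_arr C e" "m \<in> Arr C" "e \<in> Arr C"
    "Cod C m = Cod C g" "Dom C m = Cod C e" "m \<cdot> e = g" by (rule image_factorization[OF assms(2)])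
  have "\<not> null m" using null_comp(2)[of e m] m assms(3) by auto
  then have "iso_arr C m" using simple_objD(3)[OF assms(1) m(1,5)] by simp
  then have "epi_arr C (m \<cdot> e)" by (intro epi_arr_comp iso_arr_epi m)
  then show ?thesis using m by simp
qed

lemma simple_mono:
  assumes "simple_obj C (Dom C g)" "g \<in> Arr C" "\<not> null g" shows "mono_arr C g"
proof (rule mono_if_ker_null[OF assms(2)], rule ccontr)
  assume "\<not> null (ker g)"
  then have "iso_arr C (ker g)" by (rule simple_objD(3)[OF assms(1), rotated -1]) (use assms in simp_all)
  then have "null g" by (intro epiD[OF iso_arr_epi, of "ker g" g]) (use assms in simp_all)
  then show False using assms by simp
qed

lemma simple_iso:
  assumes "simple_obj C (Dom C g)" "simple_obj C (Cod C g)" "g \<in> Arr C" "\<not> null g" shows "iso_arr C g"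
  by (rule mono_epi_iso[OF simple_mono simple_epi]) (rule assms)+

text \<open>A nonnull monomorphism that is epi is invertible. Testing with arbitrary arrows spares
  an image factorization at each use.\<close>

lemma simple_objI:
  assumes "S \<in> Obj C" "\<not> null (Ident C S)"
    "\<And>g. g \<in> Arr C \<Longrightarrow> Cod C g = S \<Longrightarrow> \<not> null g \<Longrightarrow> epi_arr C g"
  shows "simple_obj C S"
  unfolding simple_obj_def zero_obj_iff
proof (intro conjI allI impI)
  fix m assume m: "mono_arr C m \<and> Cod C m = S"
  then have a: "m \<in> Arr C" "mono_arr C m" "Cod C m = S" by (auto dest: mono_arr_arr)
  show "Dom C m \<in> Obj C \<and> null (Ident C (Dom C m)) \<or> iso_arr C m"
  proof (cases "null m")
    case True then show ?thesis using mono_null_zero[OF a(2)] a by simp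
  next
    case False then show ?thesis using mono_epi_iso[OF a(2) assms(3)[OF a(1,3)]] by simp
  qed
qed (use assms in simp_all)

lemma simple_isomorphic:
  assumes "simple_obj C S" "isomorphic C S T" shows "simple_obj C T"
proof -
  obtain f where f: "f \<in> Hom C S T" "iso_arr C f" using assms(2) unfolding isomorphic_def by blast
  obtain g where g: "g \<in> Arr C" "Dom C g = T" "Cod C g = S" "g \<cdot> f = Ident C S" "f \<cdot> g = Ident C T" "iso_arr C g"
    using f(2) by (rule iso_arrE) (use f(1) in auto)
  show ?thesis
  proof (rule simple_objI)
    show T: "T \<in> Obj C" using g by auto
    show "\<not> null (Ident C T)"
    proof
      assume "null (Ident C T)"
      then have "null g" by (rule null_ident_comp(1)) (use T g in simp_all)
      then have "null (g \<cdot> f)" by (rule null_comp(2)[rotated -1]) (use f g in simp_all)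
      then show False using g simple_objD[OF assms(1)] by simp
    qed
    fix h assume h: "h \<in> Arr C" "Cod C h = T" "\<not> null h"
    have fgh: "f \<cdot> (g \<cdot> h) = h" using comp_assoc'[of h g f] f g h by (simp del: comp_assoc')
    have "\<not> null (g \<cdot> h)" using null_comp(1)[of "g \<cdot> h" f] fgh f g h by auto
    then have "epi_arr C (g \<cdot> h)" by (intro simple_epi) (use assms g h in simp_all)
    then have "epi_arr C (f \<cdot> (g \<cdot> h))" by (intro epi_arr_comp[OF _ iso_arr_epi[OF f(2)]]) (use f g h in simp_all)
    then show "epi_arr C h" using fgh by simp
  qed
qed

text \<open>The projection \<open>t\<close> of a local object onto its simple top, characterized without mentioning the
  radical: \<open>t\<close> is a superfluous epimorphism. This form needs no sums of subobjects.\<close>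

definition local_top where
  "local_top t \<longleftrightarrow> epi_arr C t \<and> simple_obj C (Cod C t) \<and>
     (\<forall>g\<in>Arr C. Cod C g = Dom C t \<longrightarrow> \<not> null (t \<cdot> g) \<longrightarrow> epi_arr C g)"

lemma local_topD:
  assumes "local_top t"
  shows "t \<in> Arr C" "epi_arr C t" "simple_obj C (Cod C t)" "\<not> null t" "\<not> null (Ident C (Dom C t))"
    "g \<in> Arr C \<Longrightarrow> Cod C g = Dom C t \<Longrightarrow> \<not> null (t \<cdot> g) \<Longrightarrow> epi_arr C g"
proof -
  show t: "epi_arr C t" "simple_obj C (Cod C t)" "t \<in> Arr C"
    using assms epi_arr_arr unfolding local_top_def by auto
  show "g \<in> Arr C \<Longrightarrow> Cod C g = Dom C t \<Longrightarrow> \<not> null (t \<cdot> g) \<Longrightarrow> epi_arr C g"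
    using assms unfolding local_top_def by blast
  show n: "\<not> null t" using epi_null_zero[OF t(1)] simple_objD[OF t(2)] by auto
  show "\<not> null (Ident C (Dom C t))" using null_ident_comp(1)[of "Dom C t" t] n t by auto
qed

lemma local_topI:
  assumes "t \<in> Arr C" "simple_obj C (Cod C t)" "\<not> null t"
    "\<And>g. g \<in> Arr C \<Longrightarrow> Cod C g = Dom C t \<Longrightarrow> \<not> null (t \<cdot> g) \<Longrightarrow> epi_arr C g"
  shows "local_top t"
  unfolding local_top_def using assms simple_epi by blast

lemma local_top_unique:
  assumes "local_top t" "s \<in> Arr C" "Dom C s = Dom C t" "simple_obj C (Cod C s)"
  obtains u where "u \<in> Arr C" "Dom C u = Cod C t" "Cod C u = Cod C s" "u \<cdot> t = s" "\<not> null s \<Longrightarrow> iso_arr C u"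
proof (cases "null s")
  note t = local_topD[OF assms(1)]
  case True
  have "s = hzero C (Dom C t) (Cod C s)" by (rule nullD[OF True]) (use assms in simp_all)
  then show thesis by (intro that[of "hzero C (Cod C t) (Cod C s)"]) (use t assms True in simp_all)
next
  note t = local_topD[OF assms(1)]
  case False
  have s: "epi_arr C s" by (rule simple_epi) (use assms False in simp_all)
  have "null (t \<cdot> ker s)"
  proof (rule ccontr)
    assume "\<not> null (t \<cdot> ker s)"
    then have "epi_arr C (ker s)" by (rule t(6)[rotated -1]) (use assms in simp_all)
    then have "null s" by (rule epiD) (use assms in simp_all)
    then show False using False by simp
  qed
  then obtain v where v: "v \<in> Arr C" "Dom C v = Cod C s" "Cod C v = Cod C t" "v \<cdot> s = t"
    by (rule epi_fac[OF _ s]) (use t assms in simp_all)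
  have "\<not> null v" using null_comp(2)[of s v] v t assms by auto
  then have "iso_arr C v" by (intro simple_iso) (use v t assms in simp_all)
  then obtain u where u: "u \<in> Arr C" "Dom C u = Cod C v" "Cod C u = Dom C v" "u \<cdot> v = Ident C (Dom C v)" "iso_arr C u"
    by (rule iso_arrE) blast
  have "u \<cdot> t = u \<cdot> (v \<cdot> s)" using v by simp
  also have "\<dots> = s" using comp_assoc'[of s v u] u v assms by (simp del: comp_assoc')
  finally show thesis using that[of u] u v by simp
qed

lemma local_top_quotient:
  assumes "local_top t" "epi_arr C e" "Dom C e = Dom C t" "\<not> null e"
  obtains t' where "local_top t'" "t' \<in> Arr C" "Dom C t' = Cod C e" "Cod C t' = Cod C t" "t' \<cdot> e = t"
proof -
  note t = local_topD[OF assms(1)] and e = epi_arr_arr[OF assms(2)]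
  have "null (t \<cdot> ker e)"
  proof (rule ccontr)
    assume "\<not> null (t \<cdot> ker e)"
    then have "epi_arr C (ker e)" by (rule t(6)[rotated -1]) (use assms e in simp_all)
    then have "null e" by (rule epiD) (use e in simp_all)
    then show False using assms by simp
  qed
  then obtain t' where t': "t' \<in> Arr C" "Dom C t' = Cod C e" "Cod C t' = Cod C t" "t' \<cdot> e = t"
    by (rule epi_fac[OF _ assms(2)]) (use t assms in simp_all)
  have "local_top t'"
  proof (rule local_topI)
    show "\<not> null t'" using null_comp(2)[of e t'] t' e t by auto
    fix g assume g: "g \<in> Arr C" "Cod C g = Dom C t'" "\<not> null (t' \<cdot> g)"
    obtain p g' where p: "epi_arr C p" "p \<in> Arr C" "g' \<in> Arr C" "Cod C p = Dom C g" "Dom C g' = Dom C p"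
      "Cod C g' = Dom C e" "e \<cdot> g' = g \<cdot> p" by (rule epi_pullback[OF assms(2) g(1)]) (use g t' in simp_all)
    have "t \<cdot> g' = t' \<cdot> (e \<cdot> g')" using comp_assoc'[of g' e t'] t' p e by (simp del: comp_assoc')
    also have "\<dots> = t' \<cdot> (g \<cdot> p)" using p by simp
    also have "\<dots> = (t' \<cdot> g) \<cdot> p" by (rule comp_assoc'[symmetric]) (use t' p g in simp_all)
    finally have eq: "t \<cdot> g' = (t' \<cdot> g) \<cdot> p" .
    have "\<not> null ((t' \<cdot> g) \<cdot> p)"
    proof
      assume "null ((t' \<cdot> g) \<cdot> p)"
      then have "null (t' \<cdot> g)" by (rule epiD[OF p(1)]) (use t' p g in simp_all)
      then show False using g by simp
    qed
    then have "\<not> null (t \<cdot> g')" using eq by simp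
    then have "epi_arr C g'" by (rule t(6)[rotated -1]) (use p assms in simp_all)
    then have "epi_arr C (e \<cdot> g')" by (rule epi_arr_comp) (use p assms in simp_all)
    then have "epi_arr C (g \<cdot> p)" using p by simp
    then show "epi_arr C g" by (rule epi_arr_of_comp) (use p g in simp_all)
  qed (use t t' in simp_all)
  then show thesis using that t' by blast
qed

lemma local_top_simple:
  assumes "simple_obj C S" shows "local_top (Ident C S)"
  by (rule local_topI) (use simple_objD[OF assms] assms in \<open>auto intro!: simple_epi\<close>)

lemma local_top_iso:
  assumes "local_top t" "iso_arr C u" "Dom C u = Cod C t" shows "local_top (u \<cdot> t)"
proof (rule local_topI)
  note t = local_topD[OF assms(1)]
  have u: "u \<in> Arr C" using assms(2) by (simp add: iso_arr_def)
  show "u \<cdot> t \<in> Arr C" using t u assms by simp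
  have "isomorphic C (Cod C t) (Cod C u)" using isomorphicI[OF assms(2)] assms(3) by simp
  then show "simple_obj C (Cod C (u \<cdot> t))" using simple_isomorphic[OF t(3)] u t assms by simp
  show "\<not> null (u \<cdot> t)" using monoD[OF iso_arr_mono[OF assms(2)], of t] t assms by auto
  fix g assume g: "g \<in> Arr C" "Cod C g = Dom C (u \<cdot> t)" "\<not> null ((u \<cdot> t) \<cdot> g)"
  have gd: "Cod C g = Dom C t" using g t u assms by simp
  have "\<not> null (t \<cdot> g)" using null_comp(1)[of "t \<cdot> g" u] g(1,3) gd t u assms by auto
  then show "epi_arr C g" using t(6)[OF g(1) gd] by simp
qed

end

section \<open>Subobjects and chain conditions\<close>

context category
begin

lemma subobjects_carrier [simp]:
  "m \<in> carrier (subobjects C X) \<longleftrightarrow> mono_arr C m \<and> Cod C m = X"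
  by (simp add: subobjects_def)

lemma subobjects_le [simp]:
  assumes "mono_arr C m" "mono_arr C n"
  shows "m \<sqsubseteq>\<^bsub>subobjects C X\<^esub> n \<longleftrightarrow> fac m n"
  using assms mono_arr_arr by (simp add: subobjects_def fac_def)

lemma subobjects_eq [simp]:
  assumes "mono_arr C m" "mono_arr C n"
  shows "m .=\<^bsub>subobjects C X\<^esub> n \<longleftrightarrow> fac m n \<and> fac n m"
proof
  note m = mono_arr_arr[OF assms(1)] and n = mono_arr_arr[OF assms(2)]
  assume "m .=\<^bsub>subobjects C X\<^esub> n"
  then obtain u where u: "u \<in> Hom C (Dom C m) (Dom C n)" "iso_arr C u" "n \<cdot> u = m"
    unfolding subobjects_def by auto
  obtain v where v: "v \<in> Arr C" "Dom C v = Dom C n" "Cod C v = Dom C m" "u \<cdot> v = Ident C (Dom C n)"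
    using u(2) by (rule iso_arrE) (use u(1) in auto)
  have "m \<cdot> v = n" using comp_assoc'[of v u n] u v n by (simp del: comp_assoc')
  then show "fac m n \<and> fac n m" using facI[of n u] facI[of m v] u v m n by simp
next
  assume f: "fac m n \<and> fac n m"
  obtain u where "iso_arr C u" "u \<in> Arr C" "Dom C u = Dom C m" "Cod C u = Dom C n" "n \<cdot> u = m"
    by (rule fac_antisym[OF assms]) (use f in auto)
  then show "m .=\<^bsub>subobjects C X\<^esub> n" unfolding subobjects_def by (auto intro!: bexI[of _ u])
qed

lemma facD: "fac f m \<Longrightarrow> f \<in> Arr C" "fac f m \<Longrightarrow> m \<in> Arr C" "fac f m \<Longrightarrow> Cod C f = Cod C m"
proof -
  show "fac f m \<Longrightarrow> f \<in> Arr C" "fac f m \<Longrightarrow> m \<in> Arr C" by (simp_all add: fac_def)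
  show "fac f m \<Longrightarrow> Cod C f = Cod C m" by (erule facE) simp
qed

lemma class_of_eqD:
  assumes "class_of\<^bsub>subobjects C X\<^esub> m = class_of\<^bsub>subobjects C X\<^esub> n" "mono_arr C m" "mono_arr C n" "Cod C n = X"
  shows "fac m n" "fac n m"
proof -
  have "n \<in> class_of\<^bsub>subobjects C X\<^esub> n"
    using assms fac_refl[OF mono_arr_arr[of n]] by (simp add: eq_class_of_def)
  then have "n \<in> class_of\<^bsub>subobjects C X\<^esub> m" using assms by simp
  then show "fac m n" "fac n m" using assms by (simp_all add: eq_class_of_def)
qed

end

context abelian_category
begin

lemma null_hadd: "f \<in> Arr C \<Longrightarrow> g \<in> Arr C \<Longrightarrow> Dom C f = Dom C g \<Longrightarrow> Cod C f = Cod C g \<Longrightarrow>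
    null f \<Longrightarrow> null g \<Longrightarrow> null (hadd C f g)"
  by (simp add: hadd_null)

lemma null_hsub:
  assumes "f \<in> Arr C" "g \<in> Arr C" "Dom C f = Dom C g" "Cod C f = Cod C g" "null f" "null g"
  shows "null (hsub f g)"
  using null_hsub_iff[of f g] null_eq[of f g] assms by blast

text \<open>Landing in \<open>m\<close> means being killed by \<open>coker m\<close>, and that
  condition is additive.\<close>

lemma fac_hadd:
  assumes "mono_arr C m" "fac f m" "fac g m" "Dom C f = Dom C g"
  shows "fac (hadd C f g) m"
proof -
  have a: "f \<in> Arr C" "g \<in> Arr C" "m \<in> Arr C" "Cod C f = Cod C m" "Cod C g = Cod C m"
    using facD[OF assms(2)] facD[OF assms(3)] by simp_all
  have "null (hadd C (coker m \<cdot> f) (coker m \<cdot> g))"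
    by (rule null_hadd) (use a assms null_coker_fac in simp_all)
  then have "null (coker m \<cdot> hadd C f g)" using a assms by (simp add: comp_hadd)
  then show ?thesis by (rule mono_fac[OF assms(1), rotated -1]) (use a assms in simp_all)
qed

lemma fac_hsub:
  assumes "mono_arr C m" "fac f m" "fac g m" "Dom C f = Dom C g"
  shows "fac (hsub f g) m"
proof -
  have a: "f \<in> Arr C" "g \<in> Arr C" "m \<in> Arr C" "Cod C f = Cod C m" "Cod C g = Cod C m"
    using facD[OF assms(2)] facD[OF assms(3)] by simp_all
  have "null (hsub (coker m \<cdot> f) (coker m \<cdot> g))"
    by (rule null_hsub) (use a assms null_coker_fac in simp_all)
  then have "null (coker m \<cdot> hsub f g)" using a assms by (simp add: comp_hsub)
  then show ?thesis by (rule mono_fac[OF assms(1), rotated -1]) (use a assms in simp_all)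
qed

text \<open>Containment in \<open>m\<close> is an equation after composition with
  \<open>coker m\<close>, and \<open>e\<close> can be cancelled from it.\<close>

lemma fac_epi_cancel:
  assumes "mono_arr C m" "epi_arr C e" "fac (f \<cdot> e) m" "f \<in> Arr C" "Dom C f = Cod C e"
  shows "fac f m"
proof -
  note e = epi_arr_arr[OF assms(2)] and m = mono_arr_arr[OF assms(1)]
  have c: "Cod C f = Cod C m" using assms(3) by (rule facE) (use e assms in simp)
  have "null (coker m \<cdot> (f \<cdot> e))" using assms(3) by (rule null_coker_fac)
  then have "null ((coker m \<cdot> f) \<cdot> e)" using e m assms c by simp
  then have "null (coker m \<cdot> f)" by (rule epiD[OF assms(2)]) (use e m assms c in simp_all)
  then show ?thesis by (rule mono_fac[OF assms(1), rotated -1]) (use assms c in simp_all)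
qed

lemma fac_null:
  assumes "mono_arr C m" "null f" "f \<in> Arr C" "Cod C f = Cod C m" shows "fac f m"
  by (rule mono_fac) (use assms mono_arr_arr in \<open>auto intro: null_comp\<close>)

lemma fac_null_iff: "mono_arr C m \<Longrightarrow> mono_arr C z \<Longrightarrow> null z \<Longrightarrow> Cod C m = Cod C z \<Longrightarrow> fac m z \<longleftrightarrow> null m"
  using fac_null[of z m] null_fac[of m z] mono_arr_arr by blast

end

section \<open>Chain conditions, local covers and the radical\<close>

context length_category
begin

text \<open>Stated for \<open>fac\<close> and its converse at once, so that it gives both chain conditions.\<close>

lemma extremal_subobject:
  assumes X: "X \<in> Obj C" and K: "K \<noteq> {}" "\<And>m. m \<in> K \<Longrightarrow> mono_arr C m \<and> Cod C m = X"
    and r: "r = fac \<or> r = (\<lambda>x y. fac y x)"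
  shows "\<exists>m\<in>K. \<forall>n\<in>K. r n m \<longrightarrow> r m n"
proof (rule ccontr)
  assume "\<not> ?thesis"
  then have step: "\<exists>n. n \<in> K \<and> r n m \<and> \<not> r m n" if "m \<in> K" for m using that by blast
  obtain m0 where m0: "m0 \<in> K" using K by blast
  \<comment> \<open>Dependent choice gives a strictly \<open>r\<close>-descending sequence; its
    classes are pairwise distinct and come from a chain, against
    \<open>finite_chains\<close>.\<close>
  obtain s :: "nat \<Rightarrow> _" where s: "\<And>k. s k \<in> K" "\<And>k. r (s (Suc k)) (s k) \<and> \<not> r (s k) (s (Suc k))"
    using dependent_nat_choice[of "\<lambda>_ m. m \<in> K" "\<lambda>_ m n. r n m \<and> \<not> r m n"] m0 step by metis
  have rr: "r (s k) (s k)" for k using r K(2)[OF s(1)] fac_refl mono_arr_arr by blast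
  have rt: "r x z" if "r x y" "r y z" for x y z using r that fac_trans by blast
  have dec: "r (s l) (s k)" if "k \<le> l" for k l
    using that by (induction rule: dec_induct) (use rr rt s(2) in blast)+
  have nd: "\<not> r (s k) (s l)" if "k < l" for k l
    using dec[of "Suc k" l] s(2)[of k] rt that by (meson Suc_leI)
  let ?c = "\<lambda>m. class_of\<^bsub>subobjects C X\<^esub> m"
  have "finite (?c ` range s)"
  proof (rule finite_chains[OF X])
    show "range s \<subseteq> carrier (subobjects C X)" using s(1) K(2) by auto
    fix m n assume "m \<in> range s" "n \<in> range s"
    then obtain k l where kl: "m = s k" "n = s l" by blast
    have "r (s k) (s l) \<or> r (s l) (s k)" using dec[of k l] dec[of l k] by (cases "k \<le> l") auto
    then show "m \<sqsubseteq>\<^bsub>subobjects C X\<^esub> n \<or> n \<sqsubseteq>\<^bsub>subobjects C X\<^esub> m"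
      using r K(2)[OF s(1)[of k]] K(2)[OF s(1)[of l]] kl by auto
  qed
  moreover have "inj (\<lambda>k. ?c (s k))"
  proof (rule linorder_injI)
    fix k l :: nat assume "k < l"
    show "?c (s k) \<noteq> ?c (s l)"
    proof
      assume "?c (s k) = ?c (s l)"
      then have "fac (s k) (s l)" "fac (s l) (s k)" using class_of_eqD K(2) s(1) by blast+
      then show False using nd[OF \<open>k < l\<close>] r by blast
    qed
  qed
  ultimately show False
    using finite_imageD[of "\<lambda>k. ?c (s k)" UNIV] by (simp add: image_image)
qed

lemma minimal_subobject:
  assumes "X \<in> Obj C" "K \<noteq> {}" "\<And>m. m \<in> K \<Longrightarrow> mono_arr C m \<and> Cod C m = X"
  obtains m where "m \<in> K" "\<And>n. n \<in> K \<Longrightarrow> fac n m \<Longrightarrow> fac m n"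
  using extremal_subobject[OF assms, of fac] by blast

lemma maximal_subobject:
  assumes "X \<in> Obj C" "K \<noteq> {}" "\<And>m. m \<in> K \<Longrightarrow> mono_arr C m \<and> Cod C m = X"
  obtains m where "m \<in> K" "\<And>n. n \<in> K \<Longrightarrow> fac m n \<Longrightarrow> fac n m"
  using extremal_subobject[OF assms, of "\<lambda>x y. fac y x"] by blast

lemma minimal_cover:
  assumes "local_top t" "epi_arr C p" "Cod C p = Dom C t"
  obtains v where "mono_arr C v" "v \<in> Arr C" "Cod C v = Dom C p" "epi_arr C (p \<cdot> v)" "local_top (t \<cdot> (p \<cdot> v))"
proof -
  note t = local_topD[OF assms(1)] and p = epi_arr_arr[OF assms(2)]
  let ?K = "{m. mono_arr C m \<and> Cod C m = Dom C p \<and> epi_arr C (p \<cdot> m)}"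
  have X: "Dom C p \<in> Obj C" using p by simp
  have "Ident C (Dom C p) \<in> ?K" using p assms iso_arr_mono[OF iso_arr_ident[OF X]] by simp
  then have ne: "?K \<noteq> {}" by blast
  obtain v where v: "v \<in> ?K" "\<And>n. n \<in> ?K \<Longrightarrow> fac n v \<Longrightarrow> fac v n"
    by (rule minimal_subobject[OF X ne]) auto
  have vD: "mono_arr C v" "v \<in> Arr C" "Cod C v = Dom C p" "epi_arr C (p \<cdot> v)"
    using v(1) mono_arr_arr by auto
  have "local_top (t \<cdot> (p \<cdot> v))"
  proof (rule local_topI)
    show "t \<cdot> (p \<cdot> v) \<in> Arr C" using vD t p assms by simp
    show "simple_obj C (Cod C (t \<cdot> (p \<cdot> v)))" using vD t p assms by simp
    show "\<not> null (t \<cdot> (p \<cdot> v))" using epiD[OF vD(4), of t] vD t p assms by auto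
    fix g assume g: "g \<in> Arr C" "Cod C g = Dom C (t \<cdot> (p \<cdot> v))" "\<not> null ((t \<cdot> (p \<cdot> v)) \<cdot> g)"
    have gc: "Cod C g = Dom C v" using g(2) vD t p assms by simp
    have "\<not> null (t \<cdot> ((p \<cdot> v) \<cdot> g))" using g(1,3) gc vD t p assms by simp
    then have e: "epi_arr C ((p \<cdot> v) \<cdot> g)" by (rule t(6)[rotated -1]) (use g(1) gc vD p assms in simp_all)
    obtain j e' where j: "mono_arr C j" "epi_arr C e'" "j \<in> Arr C" "e' \<in> Arr C" "Dom C e' = Dom C g"
      "Cod C j = Cod C g" "Dom C j = Cod C e'" "j \<cdot> e' = g" by (rule image_factorization[OF g(1)])
    have "(p \<cdot> (v \<cdot> j)) \<cdot> e' = (p \<cdot> v) \<cdot> (j \<cdot> e')" using j(3-7) gc vD p by simp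
    then have "epi_arr C ((p \<cdot> (v \<cdot> j)) \<cdot> e')" using e j(8) by simp
    then have "epi_arr C (p \<cdot> (v \<cdot> j))" by (rule epi_arr_of_comp) (use j gc vD p in simp_all)
    then have "v \<cdot> j \<in> ?K" using mono_arr_comp[OF j(1) vD(1)] j(3-7) gc vD by simp
    moreover have "fac (v \<cdot> j) v" by (rule facI) (use j gc vD in simp_all)
    ultimately have "fac v (v \<cdot> j)" using v(2) by blast
    then have "fac (v \<cdot> Ident C (Dom C v)) (v \<cdot> j)" using vD by simp
    then have "fac (Ident C (Dom C v)) j" by (rule fac_comp_left_mono) (use vD j gc in simp_all)
    then have "iso_arr C j" by (rule fac_ident) (use vD j in simp_all)
    then have "epi_arr C (j \<cdot> e')" by (intro epi_arr_comp iso_arr_epi j)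
    then show "epi_arr C g" using j by simp
  qed
  then show thesis using that vD by blast
qed

text \<open>The chain condition provides a maximal proper subobject \<open>m\<close>, and its
  cokernel is the required quotient.\<close>

lemma simple_quotient:
  assumes "X \<in> Obj C" "\<not> null (Ident C X)"
  obtains q where "epi_arr C q" "q \<in> Arr C" "Dom C q = X" "simple_obj C (Cod C q)"
proof -
  let ?K = "{m. mono_arr C m \<and> Cod C m = X \<and> \<not> iso_arr C m}"
  let ?z = "ker (Ident C X)"
  have z: "?z \<in> Arr C" "mono_arr C ?z" "Cod C ?z = X" "null ?z"
    using assms ker_arr[of "Ident C X"] by simp_all
  have "\<not> iso_arr C ?z"
  proof
    assume "iso_arr C ?z"
    then have "null (Ident C (Cod C ?z))" using epi_null_zero[OF iso_arr_epi] z by blast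
    then show False using assms z by simp
  qed
  then have ne: "?K \<noteq> {}" using z by blast
  obtain m where m: "m \<in> ?K" "\<And>n. n \<in> ?K \<Longrightarrow> fac m n \<Longrightarrow> fac n m"
    by (rule maximal_subobject[OF assms(1) ne]) auto
  have mD: "mono_arr C m" "m \<in> Arr C" "Cod C m = X" "\<not> iso_arr C m" using m(1) mono_arr_arr by auto
  let ?q = "coker m"
  have q: "?q \<in> Arr C" "epi_arr C ?q" "Dom C ?q = X" "null (?q \<cdot> m)" using mD by simp_all
  have "simple_obj C (Cod C ?q)"
  proof (rule simple_objI)
    show "Cod C ?q \<in> Obj C" using q by simp
    show "\<not> null (Ident C (Cod C ?q))"
    proof
      assume "null (Ident C (Cod C ?q))"
      then have "null ?q" by (rule null_ident_comp(2)) (use q in simp_all)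
      then have "epi_arr C m" by (rule epi_if_coker_null[OF mD(2)])
      then show False using mono_epi_iso mD by blast
    qed
    fix g assume g: "g \<in> Arr C" "Cod C g = Cod C ?q" "\<not> null g"
    let ?c = "coker g"
    have c: "?c \<in> Arr C" "Dom C ?c = Cod C ?q" "null (?c \<cdot> g)" using g by simp_all
    \<comment> \<open>This is the preimage under the quotient map of the image of \<open>g\<close>.
      It contains \<open>m\<close>, so it is everything or \<open>m\<close>: in the first case
      \<open>coker g\<close> is null, in the second \<open>g\<close> becomes null after the cover
      \<open>p\<close>.\<close>
    let ?k = "ker (?c \<cdot> ?q)"
    have cq: "?c \<cdot> ?q \<in> Arr C" "Dom C (?c \<cdot> ?q) = X" using c q by simp_all
    have k: "?k \<in> Arr C" "mono_arr C ?k" "Cod C ?k = X" "null ((?c \<cdot> ?q) \<cdot> ?k)"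
      using cq ker_arr[OF cq(1)] by (simp_all del: comp_assoc')
    have "null (?c \<cdot> (?q \<cdot> m))" by (rule null_comp(1)) (use q c mD in simp_all)
    then have "null ((?c \<cdot> ?q) \<cdot> m)" using q c mD by simp
    then have mk: "fac m ?k" by (rule ker_fac) (use cq mD in simp_all)
    show "epi_arr C g"
    proof (cases "iso_arr C ?k")
      case True
      have "null (?c \<cdot> ?q)" by (rule epiD[OF iso_arr_epi[OF True] k(4) cq(1)]) (use cq k in simp)
      then have "null ?c" by (rule epiD[OF q(2)]) (use q c in simp_all)
      then show ?thesis by (rule epi_if_coker_null[OF g(1)])
    next
      case False
      then have km: "fac ?k m" using m(2)[of ?k] mk k by blast
      obtain p g' where p: "epi_arr C p" "p \<in> Arr C" "g' \<in> Arr C" "Cod C p = Dom C g" "Dom C g' = Dom C p"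
        "Cod C g' = Dom C ?q" "?q \<cdot> g' = g \<cdot> p" by (rule epi_pullback[OF q(2) g(1,2)])
      have "null ((?c \<cdot> g) \<cdot> p)" by (rule null_comp(2)) (use c p g in simp_all)
      moreover have "(?c \<cdot> g) \<cdot> p = ?c \<cdot> (?q \<cdot> g')" unfolding p(7) by (rule comp_assoc') (use c p g in simp_all)
      ultimately have "null (?c \<cdot> (?q \<cdot> g'))" by simp
      then have "null ((?c \<cdot> ?q) \<cdot> g')" using c q p(3,6) by simp
      then have "fac g' ?k" by (rule ker_fac) (use c q p in simp_all)
      then have "fac g' m" using km by (rule fac_trans)
      then have "null (?q \<cdot> g')" by (rule null_coker_fac)
      then have "null (g \<cdot> p)" using p by simp
      then have "null g" by (rule epiD[OF p(1)]) (use g p in simp_all)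
      then show ?thesis using g by simp
    qed
  qed
  then show thesis using that q by blast
qed

text \<open>Local subobjects detect nonzero arrows: the image of \<open>q\<close> has a simple
  quotient, and a minimal subobject of the source mapping onto that quotient is local and survives
  under \<open>q\<close>.\<close>

lemma local_subobject:
  assumes "q \<in> Arr C" "\<not> null q"
  obtains v t where "mono_arr C v" "v \<in> Arr C" "Cod C v = Dom C q" "local_top t" "Dom C t = Dom C v" "\<not> null (q \<cdot> v)"
proof -
  obtain j p where j: "mono_arr C j" "epi_arr C p" "j \<in> Arr C" "p \<in> Arr C" "Dom C p = Dom C q"
    "Cod C j = Cod C q" "Dom C j = Cod C p" "j \<cdot> p = q" by (rule image_factorization[OF assms(1)])
  have "\<not> null p" using null_comp(1)[of p j] j assms(2) by auto
  then have nz: "\<not> null (Ident C (Cod C p))" using null_ident_comp(2)[of "Cod C p" p] j by auto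
  have "Cod C p \<in> Obj C" using j by simp
  then obtain s where s: "epi_arr C s" "s \<in> Arr C" "Dom C s = Cod C p" "simple_obj C (Cod C s)"
    by (rule simple_quotient[OF _ nz])
  have sp: "epi_arr C (s \<cdot> p)" by (rule epi_arr_comp) (use s j in simp_all)
  have li: "local_top (Ident C (Cod C s))" using s by (intro local_top_simple)
  obtain v where v: "mono_arr C v" "v \<in> Arr C" "Cod C v = Dom C (s \<cdot> p)" "epi_arr C ((s \<cdot> p) \<cdot> v)"
    "local_top (Ident C (Cod C s) \<cdot> ((s \<cdot> p) \<cdot> v))"
    by (rule minimal_cover[OF li sp]) (use s j in simp_all)
  have vc: "Cod C v = Dom C p" using v s j by simp
  have lt: "local_top ((s \<cdot> p) \<cdot> v)" using v(5) s(2,3) j(4) vc v(2) by simp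
  have "\<not> null (q \<cdot> v)"
  proof
    assume "null (q \<cdot> v)"
    moreover have "(j \<cdot> p) \<cdot> v = j \<cdot> (p \<cdot> v)" by (rule comp_assoc') (use j vc v(2) in simp_all)
    ultimately have "null (j \<cdot> (p \<cdot> v))" using j(8) by simp
    then have "null (p \<cdot> v)" by (rule monoD[OF j(1)]) (use j vc v in simp_all)
    then have "null (s \<cdot> (p \<cdot> v))" by (rule null_comp(1)[rotated -1]) (use s j vc v in simp_all)
    then show False using local_topD(4)[OF lt] s(2,3) j(4) vc v(2) by simp
  qed
  then show thesis by (rule that[OF v(1,2) _ lt, rotated -1]) (use s j vc v in simp_all)
qed

text \<open>\<open>\<top>\<close> is a choice among the greatest elements, so only its being
  greatest is known of it; the identity shows that a greatest element exists.\<close>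

lemma subobjects_top: "X \<in> Obj C \<Longrightarrow> mono_arr C m \<Longrightarrow> Cod C m = X \<Longrightarrow> m .=\<^bsub>subobjects C X\<^esub> \<top>\<^bsub>subobjects C X\<^esub> \<longleftrightarrow> iso_arr C m"
proof -
  assume X: "X \<in> Obj C" and m: "mono_arr C m" "Cod C m = X"
  let ?L = "subobjects C X"
  have iX: "mono_arr C (Ident C X)" using X by (intro iso_arr_mono) simp
  have "greatest ?L (Ident C X) (carrier ?L)"
    unfolding greatest_def using X iX iso_fac[of "Ident C X"] mono_arr_arr by auto
  then have "greatest ?L \<top>\<^bsub>?L\<^esub> (carrier ?L)" unfolding Order.top_def by (rule someI)
  then have t: "mono_arr C \<top>\<^bsub>?L\<^esub>" "Cod C \<top>\<^bsub>?L\<^esub> = X" "\<And>n. mono_arr C n \<Longrightarrow> Cod C n = X \<Longrightarrow> fac n \<top>\<^bsub>?L\<^esub>"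
    unfolding greatest_def by auto
  show ?thesis
  proof
    assume "m .=\<^bsub>?L\<^esub> \<top>\<^bsub>?L\<^esub>"
    then have "fac \<top>\<^bsub>?L\<^esub> m" using t m by simp
    then have "fac (Ident C X) m" using t(3)[OF iX] fac_trans X by fastforce
    then show "iso_arr C m" by (rule fac_ident[OF _ X m(1)])
  next
    assume "iso_arr C m"
    then show "m .=\<^bsub>?L\<^esub> \<top>\<^bsub>?L\<^esub>" using t m iso_fac[of m] mono_arr_arr by simp
  qed
qed

lemma subobjects_bottom: "X \<in> Obj C \<Longrightarrow> mono_arr C m \<Longrightarrow> Cod C m = X \<Longrightarrow> m .=\<^bsub>subobjects C X\<^esub> \<bottom>\<^bsub>subobjects C X\<^esub> \<longleftrightarrow> null m"
proof -
  assume X: "X \<in> Obj C" and m: "mono_arr C m" "Cod C m = X"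
  let ?L = "subobjects C X"
  let ?z = "ker (Ident C X)"
  have z: "?z \<in> Arr C" "mono_arr C ?z" "Cod C ?z = X" "null ?z"
    using X ker_arr[of "Ident C X"] by simp_all
  have "least ?L ?z (carrier ?L)"
    unfolding least_def using z fac_null by auto
  then have "least ?L \<bottom>\<^bsub>?L\<^esub> (carrier ?L)" unfolding bottom_def by (rule someI)
  then have t: "mono_arr C \<bottom>\<^bsub>?L\<^esub>" "Cod C \<bottom>\<^bsub>?L\<^esub> = X" "\<And>n. mono_arr C n \<Longrightarrow> Cod C n = X \<Longrightarrow> fac \<bottom>\<^bsub>?L\<^esub> n"
    unfolding least_def by auto
  have "null \<bottom>\<^bsub>?L\<^esub>" using null_fac[OF t(3)[OF z(2,3)] z(4)] .
  then show ?thesis using t m fac_null_iff by simp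
qed

text \<open>In a local object every proper subobject is killed by \<open>t\<close>, hence lies in
  \<open>ker t\<close>. So \<open>ker t\<close> is the only maximal proper subobject up to equality,
  the radical is \<open>ker t\<close>, and \<open>top_proj\<close> differs from \<open>t\<close> by
  an isomorphism of tops.\<close>

lemma rad_local:
  assumes "local_top t"
  shows "is_cokernel C (rad C (Dom C t)) (top_proj C (Dom C t))" "local_top (top_proj C (Dom C t))"
    "Dom C (top_proj C (Dom C t)) = Dom C t"
proof -
  note t = local_topD[OF assms]
  let ?L = "subobjects C (Dom C t)"
  have X: "Dom C t \<in> Obj C" using t by simp
  let ?k = "ker t"
  have k: "mono_arr C ?k" "?k \<in> Arr C" "Cod C ?k = Dom C t" "null (t \<cdot> ?k)" using t by simp_all
  have kn: "\<not> iso_arr C ?k"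
  proof
    assume "iso_arr C ?k"
    then have "null t" using epiD[OF iso_arr_epi, of ?k t] k t by simp
    then show False using t by simp
  qed
  have below: "fac m ?k" if "mono_arr C m" "Cod C m = Dom C t" "\<not> iso_arr C m" for m
  proof (rule ker_fac[OF _ t(1)])
    show "null (t \<cdot> m)" using t(6)[of m] mono_epi_iso[of m] mono_arr_arr[of m] that by blast
  qed (use that mono_arr_arr in simp_all)
  let ?A = "{m. maximal_proper ?L m}"
  have kA: "?k \<in> ?A"
    unfolding maximal_proper_def using k kn subobjects_top[OF X] below by auto
  have Ak: "fac ?k m" if "m \<in> ?A" for m
  proof -
    have m: "mono_arr C m" "Cod C m = Dom C t" "\<not> iso_arr C m"
      using that subobjects_top[OF X] unfolding maximal_proper_def by auto
    have "?k .=\<^bsub>?L\<^esub> m \<or> ?k .=\<^bsub>?L\<^esub> \<top>\<^bsub>?L\<^esub>"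
      using that k below[OF m] m unfolding maximal_proper_def by simp
    then show ?thesis using subobjects_top[OF X k(1,3)] kn m k by simp
  qed
  have "greatest ?L ?k (Lower ?L ?A)"
    unfolding greatest_def Lower_def using k kA Ak by auto
  then have "greatest ?L (rad C (Dom C t)) (Lower ?L ?A)"
    unfolding rad_def Lattice.inf_def by (rule someI)
  then have r: "mono_arr C (rad C (Dom C t))" "Cod C (rad C (Dom C t)) = Dom C t"
      "fac (rad C (Dom C t)) ?k" "fac ?k (rad C (Dom C t))"
    using k kA Ak unfolding greatest_def Lower_def by auto
  note ra = mono_arr_arr[OF r(1)]
  have "\<exists>q. is_cokernel C (rad C (Dom C t)) q" using cokernels_exist ra by blast
  then show c: "is_cokernel C (rad C (Dom C t)) (top_proj C (Dom C t))"
    unfolding top_proj_def by (rule someI_ex)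
  let ?q = "top_proj C (Dom C t)"
  note q = is_cokernelD[OF c]
  show dq: "Dom C ?q = Dom C t" using q r by simp
  \<comment> \<open>\<open>rad\<close> and \<open>ker t\<close> agree only as subobjects, so each of
    the two quotient maps is shown to kill the kernel of the other; the induced arrows
    \<open>u\<close> and \<open>v\<close> are mutually inverse.\<close>
  have "null (t \<cdot> rad C (Dom C t))"
  proof -
    obtain u where u: "u \<in> Arr C" "Cod C u = Dom C ?k" "?k \<cdot> u = rad C (Dom C t)" using r(3) by (rule facE) blast
    have "null ((t \<cdot> ?k) \<cdot> u)" by (rule null_comp(2)) (use u t k in simp_all)
    moreover have "(t \<cdot> ?k) \<cdot> u = t \<cdot> (?k \<cdot> u)" by (rule comp_assoc') (use u t k in simp_all)
    ultimately show ?thesis using u by simp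
  qed
  then have "\<exists>u \<in> Hom C (Cod C ?q) (Cod C t). u \<cdot> ?q = t" by (rule q(5)[rotated -1]) (use t r in simp_all)
  then obtain u where u: "u \<in> Arr C" "Dom C u = Cod C ?q" "Cod C u = Cod C t" "u \<cdot> ?q = t" by auto
  have "null (?q \<cdot> ?k)"
  proof -
    obtain w where w: "w \<in> Arr C" "Cod C w = Dom C (rad C (Dom C t))" "rad C (Dom C t) \<cdot> w = ?k"
      using r(4) by (rule facE) blast
    have "null ((?q \<cdot> rad C (Dom C t)) \<cdot> w)" by (rule null_comp(2)) (use w q r in simp_all)
    moreover have "(?q \<cdot> rad C (Dom C t)) \<cdot> w = ?q \<cdot> (rad C (Dom C t) \<cdot> w)"
      by (rule comp_assoc') (use w q r in simp_all)
    ultimately show ?thesis using w by simp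
  qed
  then obtain v where v: "v \<in> Arr C" "Dom C v = Cod C t" "Cod C v = Cod C ?q" "v \<cdot> t = ?q"
    by (rule epi_fac[OF _ t(2)]) (use q dq in simp_all)
  have "(v \<cdot> u) \<cdot> ?q = v \<cdot> (u \<cdot> ?q)" by (rule comp_assoc') (use u v q in simp_all)
  also have "\<dots> = Ident C (Cod C ?q) \<cdot> ?q" using u v q by simp
  finally have vu: "v \<cdot> u = Ident C (Cod C ?q)" by (rule epi_arrD[OF q(6), rotated -1]) (use u v q in simp_all)
  have "(u \<cdot> v) \<cdot> t = u \<cdot> (v \<cdot> t)" by (rule comp_assoc') (use u v t in simp_all)
  also have "\<dots> = Ident C (Cod C t) \<cdot> t" using u v t by simp
  finally have uv: "u \<cdot> v = Ident C (Cod C t)" by (rule epi_arrD[OF t(2), rotated -1]) (use u v t in simp_all)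
  have "iso_arr C v" by (rule iso_arrI[of v u]) (use u v uv vu in simp_all)
  then have "local_top (v \<cdot> t)" by (rule local_top_iso[OF assms]) (use v in simp)
  then show "local_top ?q" using v by simp
qed

text \<open>\<open>top_proj\<close> after \<open>e\<close> is an arrow to a simple object, so it
  factors through \<open>top_proj\<close>, and uniquely because \<open>top_proj\<close> is epi: the
  definite description in \<open>top_map\<close> is meaningful.\<close>

lemma top_map_eq:
  assumes "local_top t" "e \<in> Hom C (Dom C t) (Dom C t)"
  shows "top_map C (Dom C t) e \<in> Hom C (top_obj C (Dom C t)) (top_obj C (Dom C t))"
    "top_map C (Dom C t) e \<cdot> top_proj C (Dom C t) = top_proj C (Dom C t) \<cdot> e"
proof -
  let ?q = "top_proj C (Dom C t)"
  note q = rad_local(2,3)[OF assms(1)]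
  note qD = local_topD[OF q(1)]
  obtain h where h: "h \<in> Arr C" "Dom C h = Cod C ?q" "Cod C h = Cod C (?q \<cdot> e)" "h \<cdot> ?q = ?q \<cdot> e"
    by (rule local_top_unique[OF q(1), of "?q \<cdot> e"]) (use assms(2) q(2) qD in auto)
  have "\<exists>!h. h \<in> Hom C (top_obj C (Dom C t)) (top_obj C (Dom C t)) \<and> h \<cdot> ?q = ?q \<cdot> e"
  proof (rule ex1I[of _ h])
    show "h \<in> Hom C (top_obj C (Dom C t)) (top_obj C (Dom C t)) \<and> h \<cdot> ?q = ?q \<cdot> e"
      using h assms(2) qD q by (simp add: top_obj_def)
    fix h' assume h': "h' \<in> Hom C (top_obj C (Dom C t)) (top_obj C (Dom C t)) \<and> h' \<cdot> ?q = ?q \<cdot> e"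
    show "h' = h" by (rule epi_arrD[OF qD(2)]) (use h h' assms(2) qD q in \<open>simp_all add: top_obj_def\<close>)
  qed
  from theI'[OF this] show "top_map C (Dom C t) e \<in> Hom C (top_obj C (Dom C t)) (top_obj C (Dom C t))"
    "top_map C (Dom C t) e \<cdot> top_proj C (Dom C t) = top_proj C (Dom C t) \<cdot> e"
    unfolding top_map_def by blast+
qed

end

section \<open>Distributive subobject lattices\<close>

context abelian_category
begin

lemma hsub_null:
  assumes "f \<in> Arr C" "g \<in> Arr C" "Dom C f = Dom C g" "Cod C f = Cod C g" "null g"
  shows "hsub f g = f"
proof -
  have "hadd C (hsub f g) g = hsub f g" by (rule hadd_null(2)) (use assms in simp_all)
  then show ?thesis using hadd_hsub_cancel(3)[OF assms(1-4)] by (rule trans[OF sym])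
qed

section \<open>Short exact sequences and the arrows of the ext-quiver\<close>

lemma extensionI:
  assumes "mono_arr C f" "epi_arr C g" "Dom C g = Cod C f" "null (g \<cdot> f)"
    "\<And>h. h \<in> Arr C \<Longrightarrow> Cod C h = Dom C g \<Longrightarrow> null (g \<cdot> h) \<Longrightarrow> fac h f"
  shows "(f, g) \<in> extensions C (Cod C g) (Dom C f)"
proof -
  note f = mono_arr_arr[OF assms(1)] and g = epi_arr_arr[OF assms(2)]
  have "is_kernel C g f" by (rule is_kernelI) (use assms(1,3-5) g in auto)
  moreover have "is_cokernel C f g"
  proof (rule is_cokernelI[OF f assms(2,3,4)])
    fix h assume h: "h \<in> Arr C" "Dom C h = Cod C f" "null (h \<cdot> f)"
    \<comment> \<open>\<open>ker g\<close> lies in \<open>f\<close>, so an arrow killing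
      \<open>f\<close> kills \<open>ker g\<close> and descends along the epimorphism
      \<open>g\<close>.\<close>
    have "fac (ker g) f" by (rule assms(5)) (use g in simp_all)
    then obtain u where u: "u \<in> Arr C" "Cod C u = Dom C f" "f \<cdot> u = ker g" by (rule facE) blast
    have "null ((h \<cdot> f) \<cdot> u)" by (rule null_comp(2)) (use h f u in simp_all)
    moreover have "(h \<cdot> f) \<cdot> u = h \<cdot> (f \<cdot> u)" by (rule comp_assoc') (use h f u in simp_all)
    ultimately have "null (h \<cdot> ker g)" using u by simp
    then obtain v where "v \<in> Arr C" "Dom C v = Cod C g" "Cod C v = Cod C h" "v \<cdot> g = h"
      by (rule epi_fac[OF _ assms(2)]) (use h assms in simp_all)
    then show "\<exists>u \<in> Hom C (Cod C g) (Cod C h). u \<cdot> g = h" by (intro bexI[of _ v]) simp_all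
  qed
  ultimately show ?thesis by (simp add: extensions_def)
qed

lemma extensionsD:
  assumes "(f, g) \<in> extensions C T S"
  shows "f \<in> Arr C" "g \<in> Arr C" "Dom C f = S" "Cod C g = T" "Dom C g = Cod C f" "mono_arr C f" "epi_arr C g"
    "null (g \<cdot> f)" "h \<in> Arr C \<Longrightarrow> Cod C h = Cod C f \<Longrightarrow> null (g \<cdot> h) \<Longrightarrow> fac h f"
  using assms is_kernelD[of g f] is_cokernelD[of f g] unfolding extensions_def by auto

text \<open>A nonsplit extension belongs to its own class but not to the split class, so
  \<open>Ext1\<close> has an element other than \<open>Ext1_zero\<close>.\<close>

lemma ext_quiverI:
  assumes "(f, g) \<in> extensions C T S" "simple_obj C S" "simple_obj C T"
    "\<And>s. s \<in> Arr C \<Longrightarrow> Dom C s = T \<Longrightarrow> Cod C s = Dom C g \<Longrightarrow> g \<cdot> s \<noteq> Ident C T"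
  shows "(iso_class C S, iso_class C T) \<in> ext_quiver C"
proof -
  note e = extensionsD[OF assms(1)]
  have "((f, g), (f, g)) \<in> ext_rel C T S"
  proof -
    have "Ident C (Cod C f) \<in> Hom C (Cod C f) (Cod C f)" "Ident C (Cod C f) \<cdot> f = f" "g \<cdot> Ident C (Cod C f) = g"
      using e(1,2,5) by simp_all
    then show ?thesis unfolding ext_rel_def mem_Collect_eq case_prod_conv
      by (intro conjI bexI[of _ "Ident C (Cod C f)"] assms(1))
  qed
  then have r: "(f, g) \<in> ext_rel C T S `` {(f, g)}" by blast
  have q: "ext_rel C T S `` {(f, g)} \<in> Ext1 C T S"
    unfolding Ext1_def using assms(1) by (rule quotientI)
  have z: "(f, g) \<notin> Ext1_zero C T S"
  proof
    assume "(f, g) \<in> Ext1_zero C T S"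
    then obtain s where "s \<in> Hom C T (Dom C g)" "g \<cdot> s = Ident C T" unfolding Ext1_zero_def by blast
    then show False using assms(4)[of s] by simp
  qed
  have "Ext1 C T S \<noteq> {Ext1_zero C T S}"
  proof
    assume "Ext1 C T S = {Ext1_zero C T S}"
    then have "ext_rel C T S `` {(f, g)} = Ext1_zero C T S" using q by simp
    then show False using r z by simp
  qed
  then show ?thesis unfolding ext_quiver_def using assms(2,3) by blast
qed

text \<open>The section \<open>s\<close> yields a retraction \<open>r\<close> of \<open>f\<close> by
  factoring \<open>id - s \<cdot> g\<close> through \<open>f\<close>; then
  \<open>f' \<cdot> r + s' \<cdot> g\<close> maps one extension to the other.\<close>

lemma split_extensions_equiv:
  assumes "(f, g) \<in> extensions C T S" "(f', g') \<in> extensions C T S"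
    "s \<in> Hom C T (Dom C g)" "g \<cdot> s = Ident C T" "s' \<in> Hom C T (Dom C g')" "g' \<cdot> s' = Ident C T"
  shows "((f, g), (f', g')) \<in> ext_rel C T S"
proof -
  note e = extensionsD[OF assms(1)] and e' = extensionsD[OF assms(2)]
  let ?E = "Cod C f"
  have s: "s \<in> Arr C" "Dom C s = T" "Cod C s = ?E" using assms(3) e by simp_all
  have s': "s' \<in> Arr C" "Dom C s' = T" "Cod C s' = Cod C f'" using assms(5) e' by simp_all
  have i: "Ident C ?E \<in> Arr C" "Dom C (Ident C ?E) = ?E" "Cod C (Ident C ?E) = ?E" using e(1) by simp_all
  let ?d = "hsub (Ident C ?E) (s \<cdot> g)"
  have d: "?d \<in> Arr C" "Dom C ?d = ?E" "Cod C ?d = ?E" using e s by simp_all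
  have gsg: "g \<cdot> (s \<cdot> g) = g" using comp_assoc'[of g s g] e(2,4,5) s assms(4) by (simp del: comp_assoc')
  have "g \<cdot> ?d = hsub g g" using e s gsg by (simp add: comp_hsub)
  then have "null (g \<cdot> ?d)" using null_hsub_self e by simp
  then have "fac ?d f" by (rule e(9)[rotated -1]) (use d in simp_all)
  then obtain r where r: "r \<in> Arr C" "Dom C r = ?E" "Cod C r = S" "f \<cdot> r = ?d"
    by (rule facE) (use d e in simp_all)
  have sgf: "null (s \<cdot> (g \<cdot> f))" by (rule null_comp(1)) (use e s in simp_all)
  have rf: "r \<cdot> f = Ident C S"
  proof (rule mono_arrD[OF e(6)])
    have "f \<cdot> (r \<cdot> f) = (f \<cdot> r) \<cdot> f" by (rule comp_assoc'[symmetric]) (use r e in simp_all)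
    also have "\<dots> = hsub f (s \<cdot> (g \<cdot> f))" unfolding r(4) using e s by (simp add: comp_hsub)
    also have "\<dots> = f" by (rule hsub_null[OF _ _ _ _ sgf]) (use e s in simp_all)
    also have "\<dots> = f \<cdot> Ident C S" using e by simp
    finally show "f \<cdot> (r \<cdot> f) = f \<cdot> Ident C S" .
  qed (use r e in auto)
  let ?h = "hadd C (f' \<cdot> r) (s' \<cdot> g)"
  have a: "f' \<cdot> r \<in> Arr C" "Dom C (f' \<cdot> r) = ?E" "Cod C (f' \<cdot> r) = Cod C f'"
    "s' \<cdot> g \<in> Arr C" "Dom C (s' \<cdot> g) = ?E" "Cod C (s' \<cdot> g) = Cod C f'" using e e' r s' by simp_all
  have "?h \<cdot> f = hadd C ((f' \<cdot> r) \<cdot> f) ((s' \<cdot> g) \<cdot> f)" using a e by (simp add: comp_hadd del: comp_assoc')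
  also have "(f' \<cdot> r) \<cdot> f = f'" using e e' r rf by simp
  also have "hadd C f' ((s' \<cdot> g) \<cdot> f) = f'"
  proof (rule hadd_null(2))
    show "null ((s' \<cdot> g) \<cdot> f)" using null_comp(1)[OF _ _ _ e(8), of s'] e s' by simp
  qed (use e e' s' in simp_all)
  finally have h1: "?h \<cdot> f = f'" .
  have "g' \<cdot> ?h = hadd C (g' \<cdot> (f' \<cdot> r)) (g' \<cdot> (s' \<cdot> g))" using a e' by (simp add: comp_hadd del: comp_assoc')
  also have "g' \<cdot> (s' \<cdot> g) = g" using comp_assoc'[of g s' g'] e e' s' assms(6) by (simp del: comp_assoc')
  also have "hadd C (g' \<cdot> (f' \<cdot> r)) g = g"
  proof (rule hadd_null(1))
    show "null (g' \<cdot> (f' \<cdot> r))"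
      using null_comp(2)[OF r(1) _ _ e'(8)] comp_assoc'[of r f' g'] e' r by (simp del: comp_assoc')
  qed (use e e' r in simp_all)
  finally have h2: "g' \<cdot> ?h = g" .
  have "?h \<in> Hom C (Cod C f) (Cod C f')" using a by simp
  then show ?thesis unfolding ext_rel_def mem_Collect_eq case_prod_conv
    by (intro conjI bexI[of _ ?h] assms(1,2) h1 h2)
qed

text \<open>If all extensions split, they are pairwise equivalent, so the quotient has at most the
  one class \<open>Ext1_zero\<close>; the biproduct shows that it does have it.\<close>

lemma nonsplit_extension_exists:
  assumes "Ext1 C T S \<noteq> {Ext1_zero C T S}" "S \<in> Obj C" "T \<in> Obj C"
  shows "\<exists>f g. (f, g) \<in> extensions C T S \<and> (\<forall>s \<in> Hom C T (Dom C g). g \<cdot> s \<noteq> Ident C T)"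
proof (rule ccontr)
  assume neg: "\<not> ?thesis"
  have split: "\<exists>s \<in> Hom C T (Dom C g). g \<cdot> s = Ident C T" if "(f, g) \<in> extensions C T S" for f g
    using neg that by blast
  then have z: "Ext1_zero C T S = extensions C T S" unfolding Ext1_zero_def by blast
  have "x \<in> extensions C T S \<Longrightarrow> ext_rel C T S `` {x} = Ext1_zero C T S" for x
  proof
    assume x: "x \<in> extensions C T S"
    show "ext_rel C T S `` {x} \<subseteq> Ext1_zero C T S" unfolding z ext_rel_def by auto
    show "Ext1_zero C T S \<subseteq> ext_rel C T S `` {x}"
    proof
      fix y assume "y \<in> Ext1_zero C T S"
      then have y: "y \<in> extensions C T S" using z by simp
      obtain f g f' g' where xy: "x = (f, g)" "y = (f', g')" by (metis surj_pair)
      obtain s s' where "s \<in> Hom C T (Dom C g)" "g \<cdot> s = Ident C T" "s' \<in> Hom C T (Dom C g')" "g' \<cdot> s' = Ident C T"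
        using split[of f g] split[of f' g'] x y xy by blast
      then have "(x, y) \<in> ext_rel C T S" using split_extensions_equiv x y unfolding xy by blast
      then show "y \<in> ext_rel C T S `` {x}" by blast
    qed
  qed
  \<comment> \<open>Without any extension the quotient would be empty, and would still differ from
    the singleton of the split class.\<close>
  moreover have "extensions C T S \<noteq> {}"
  proof -
    obtain D i1 i2 p1 p2 where D: "D \<in> Obj C" "i1 \<in> Hom C S D" "i2 \<in> Hom C T D" "p1 \<in> Hom C D S" "p2 \<in> Hom C D T"
      "p1 \<cdot> i1 = Ident C S" "p2 \<cdot> i2 = Ident C T" "p1 \<cdot> i2 = hzero C T S" "p2 \<cdot> i1 = hzero C S T"
      "hadd C (i1 \<cdot> p1) (i2 \<cdot> p2) = Ident C D" by (rule binary_sum[OF assms(2,3)])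
    have "(i1, p2) \<in> extensions C (Cod C p2) (Dom C i1)"
    proof (rule extensionI)
      show "mono_arr C i1" by (rule split_mono[of i1 p1]) (use D in simp_all)
      show "epi_arr C p2" by (rule split_epi[of i2 p2]) (use D in simp_all)
      show "null (p2 \<cdot> i1)" by (rule nullI[OF D(9)]) (rule assms)+
      fix h assume h: "h \<in> Arr C" "Cod C h = Dom C p2" "null (p2 \<cdot> h)"
      have hD: "Cod C h = D" using h D by simp
      have n: "null (i2 \<cdot> (p2 \<cdot> h))" by (rule null_comp(1)) (use h(1,3) hD D in simp_all)
      have "h = hadd C (i1 \<cdot> p1) (i2 \<cdot> p2) \<cdot> h" using D(10) h(1) hD by simp
      also have "\<dots> = hadd C (i1 \<cdot> (p1 \<cdot> h)) (i2 \<cdot> (p2 \<cdot> h))" using D(1-5) h(1) hD by (simp add: comp_hadd)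
      also have "\<dots> = i1 \<cdot> (p1 \<cdot> h)" using n D(1-5) h(1) hD by (simp add: hadd_null)
      finally have "h = i1 \<cdot> (p1 \<cdot> h)" .
      moreover have "fac (i1 \<cdot> (p1 \<cdot> h)) i1" by (rule facI) (use D(1-5) h(1) hD in simp_all)
      ultimately show "fac h i1" by simp
    qed (use D in simp)
    then show ?thesis using D by auto
  qed
  ultimately have "Ext1 C T S = {Ext1_zero C T S}" unfolding Ext1_def quotient_def by auto
  then show False using assms by simp
qed

end

section \<open>Local subobjects of M and join-primeness\<close>

locale distributive_object = length_category C for C :: "('o, 'm, 'z) additive_category_scheme" (structure) +
  fixes M :: 'o
  assumes M_obj: "M \<in> Obj C"
    and distributive: "distributive_lattice (subobjects C M)"
begin

lemma weak_lattice: "weak_lattice (subobjects C M)"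
  using distributive by (simp add: distributive_lattice_def)

definition local_sub where
  "local_sub n t \<longleftrightarrow> mono_arr C n \<and> Cod C n = M \<and> local_top t \<and> Dom C t = Dom C n"

lemma local_subD:
  assumes "local_sub n t"
  shows "mono_arr C n" "n \<in> Arr C" "Cod C n = M" "local_top t" "Dom C t = Dom C n"
    "t \<in> Arr C" "epi_arr C t" "simple_obj C (Cod C t)" "\<not> null t" "\<not> null n"
proof -
  show "mono_arr C n" "n \<in> Arr C" "Cod C n = M" "local_top t" "Dom C t = Dom C n"
    "t \<in> Arr C" "epi_arr C t" "simple_obj C (Cod C t)" "\<not> null t"
    using assms local_topD mono_arr_arr unfolding local_sub_def by blast+
  then show "\<not> null n" using local_topD(5)[of t] mono_null_zero[of n] by auto
qed

definition sub_join where "sub_join y z = y \<squnion>\<^bsub>subobjects C M\<^esub> z"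

lemma sub_join:
  assumes "mono_arr C y" "Cod C y = M" "mono_arr C z" "Cod C z = M"
  shows "mono_arr C (sub_join y z)" "Cod C (sub_join y z) = M" "fac y (sub_join y z)" "fac z (sub_join y z)"
    "mono_arr C w \<Longrightarrow> Cod C w = M \<Longrightarrow> fac y w \<Longrightarrow> fac z w \<Longrightarrow> fac (sub_join y z) w"
proof -
  interpret W: weak_lattice "subobjects C M" by (rule weak_lattice)
  have yz: "y \<in> carrier (subobjects C M)" "z \<in> carrier (subobjects C M)" using assms by simp_all
  show j: "mono_arr C (sub_join y z)" "Cod C (sub_join y z) = M"
    using W.join_closed[OF yz] unfolding sub_join_def by simp_all
  show "fac y (sub_join y z)" using W.join_left[OF yz] j assms unfolding sub_join_def by simp
  show "fac z (sub_join y z)" using W.join_right[OF yz] j assms unfolding sub_join_def by simp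
  assume w: "mono_arr C w" "Cod C w = M" "fac y w" "fac z w"
  show "fac (sub_join y z) w" using W.join_le[of y w z] yz w j assms unfolding sub_join_def by simp
qed

text \<open>Once \<open>n\<close> equals the join of \<open>y\<close> and \<open>z\<close>, both are
  below \<open>n\<close>, so equality with one of them reduces to \<open>fac n y\<close> or
  \<open>fac n z\<close>.\<close>

lemma join_irreducible_iff:
  "join_irreducible (subobjects C M) n \<longleftrightarrow> mono_arr C n \<and> Cod C n = M \<and> \<not> null n \<and>
     (\<forall>y z. mono_arr C y \<longrightarrow> Cod C y = M \<longrightarrow> mono_arr C z \<longrightarrow> Cod C z = M \<longrightarrow>
        fac n (sub_join y z) \<longrightarrow> fac (sub_join y z) n \<longrightarrow> fac n y \<or> fac n z)"
  (is "_ \<longleftrightarrow> ?R")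
proof -
  let ?L = "subobjects C M"
  have "join_irreducible ?L n \<longleftrightarrow> mono_arr C n \<and> Cod C n = M \<and> \<not> null n \<and>
    (\<forall>y \<in> carrier ?L. \<forall>z \<in> carrier ?L. n .=\<^bsub>?L\<^esub> sub_join y z \<longrightarrow> n .=\<^bsub>?L\<^esub> y \<or> n .=\<^bsub>?L\<^esub> z)"
    unfolding join_irreducible_def sub_join_def using subobjects_bottom[OF M_obj, of n] by auto
  also have "\<dots> \<longleftrightarrow> ?R"
  proof (intro conj_cong refl)
    assume n: "mono_arr C n" "Cod C n = M"
    have "n .=\<^bsub>?L\<^esub> y \<longleftrightarrow> fac n y" if "mono_arr C y" "Cod C y = M" "fac y n" for y
      using that n by simp
    moreover have "n .=\<^bsub>?L\<^esub> sub_join y z \<longleftrightarrow> fac n (sub_join y z) \<and> fac (sub_join y z) n"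
      if "mono_arr C y" "Cod C y = M" "mono_arr C z" "Cod C z = M" for y z
      using n sub_join[OF that] by simp
    moreover have "fac y n \<and> fac z n" if "mono_arr C y" "Cod C y = M" "mono_arr C z" "Cod C z = M" "fac (sub_join y z) n" for y z
      using sub_join(3,4)[OF that(1-4)] that(5) fac_trans by blast
    ultimately have "(n .=\<^bsub>?L\<^esub> sub_join y z \<longrightarrow> n .=\<^bsub>?L\<^esub> y \<or> n .=\<^bsub>?L\<^esub> z) \<longleftrightarrow>
        (fac n (sub_join y z) \<longrightarrow> fac (sub_join y z) n \<longrightarrow> fac n y \<or> fac n z)"
      if "mono_arr C y" "Cod C y = M" "mono_arr C z" "Cod C z = M" for y z
      using that by metis
    then show "(\<forall>y \<in> carrier ?L. \<forall>z \<in> carrier ?L. n .=\<^bsub>?L\<^esub> sub_join y z \<longrightarrow> n .=\<^bsub>?L\<^esub> y \<or> n .=\<^bsub>?L\<^esub> z) \<longleftrightarrow>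
      (\<forall>y z. mono_arr C y \<longrightarrow> Cod C y = M \<longrightarrow> mono_arr C z \<longrightarrow> Cod C z = M \<longrightarrow>
        fac n (sub_join y z) \<longrightarrow> fac (sub_join y z) n \<longrightarrow> fac n y \<or> fac n z)"
      by (simp only: Ball_def subobjects_carrier) blast
  qed
  finally show ?thesis .
qed

text \<open>Any simple quotient \<open>t\<close> of the source of \<open>n\<close> works. If
  \<open>t \<cdot> g\<close> is nonzero, the image of \<open>g\<close> and \<open>ker t\<close>
  together span the source; irreducibility says that one of them is everything, and
  \<open>ker t\<close> is proper.\<close>

lemma join_irreducible_local:
  assumes "join_irreducible (subobjects C M) n"
  obtains t where "local_sub n t"
proof -
  have n: "mono_arr C n" "Cod C n = M" "\<not> null n" "n \<in> Arr C"
    using assms mono_arr_arr unfolding join_irreducible_iff by auto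
  have irr: "fac n y \<or> fac n z" if "mono_arr C y" "Cod C y = M" "mono_arr C z" "Cod C z = M"
      "fac n (sub_join y z)" "fac (sub_join y z) n" for y z
    using assms that unfolding join_irreducible_iff by blast
  have nz: "\<not> null (Ident C (Dom C n))" using null_ident_comp(1)[of "Dom C n" n] n by auto
  have "Dom C n \<in> Obj C" using n by simp
  then obtain t where t: "epi_arr C t" "t \<in> Arr C" "Dom C t = Dom C n" "simple_obj C (Cod C t)"
    by (rule simple_quotient[OF _ nz])
  have tn: "\<not> null t" using epi_null_zero[OF t(1)] simple_objD[OF t(4)] by auto
  have "local_top t"
  proof (rule local_topI[OF t(2,4) tn])
    fix g assume g: "g \<in> Arr C" "Cod C g = Dom C t" "\<not> null (t \<cdot> g)"
    obtain j e where j: "mono_arr C j" "epi_arr C e" "j \<in> Arr C" "e \<in> Arr C" "Dom C e = Dom C g"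
      "Cod C j = Cod C g" "Dom C j = Cod C e" "j \<cdot> e = g" by (rule image_factorization[OF g(1)])
    let ?r = "ker t"
    have r: "mono_arr C ?r" "?r \<in> Arr C" "Cod C ?r = Dom C n" "null (t \<cdot> ?r)" using t by simp_all
    have "\<not> null (t \<cdot> j)"
    proof
      assume "null (t \<cdot> j)"
      then have "null ((t \<cdot> j) \<cdot> e)" by (rule null_comp(2)[rotated -1]) (use t j g in simp_all)
      then show False using g(2,3) j(3-8) t by simp
    qed
    then have tj: "epi_arr C (t \<cdot> j)" by (rule simple_epi[rotated -1]) (use t j g in simp_all)
    let ?y = "n \<cdot> j" and ?z = "n \<cdot> ?r"
    have y: "mono_arr C ?y" "Cod C ?y = M" using mono_arr_comp[OF j(1) n(1)] j g t n by simp_all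
    have z: "mono_arr C ?z" "Cod C ?z = M" using mono_arr_comp[OF r(1) n(1)] r n by simp_all
    note s = sub_join[OF y z]
    have "fac ?y n" "fac ?z n" by (rule facI; use j g t n r in simp)+
    then have sn: "fac (sub_join ?y ?z) n" by (rule s(5)[OF n(1,2)])
    \<comment> \<open>An arrow that kills \<open>ker t\<close> factors through \<open>t\<close>; if
      it also kills \<open>j\<close>, it is zero, because \<open>t \<cdot> j\<close> is epi. This is
      applied to the cokernel of the join, composed with \<open>n\<close>.\<close>
    have ns: "fac n (sub_join ?y ?z)"
    proof (rule mono_fac[OF s(1)])
      let ?c = "coker (sub_join ?y ?z)"
      have c: "?c \<in> Arr C" "Dom C ?c = M" using s mono_arr_arr by simp_all
      have cz: "null (?c \<cdot> (n \<cdot> ?r))" and cy: "null (?c \<cdot> (n \<cdot> j))" using s(3,4) by (auto intro: null_coker_fac)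
      have "null ((?c \<cdot> n) \<cdot> ker t)" using cz c n r by simp
      then obtain c' where c': "c' \<in> Arr C" "Dom C c' = Cod C t" "Cod C c' = Cod C (?c \<cdot> n)" "c' \<cdot> t = ?c \<cdot> n"
        by (rule epi_fac[OF _ t(1)]) (use c n t in simp_all)
      have "c' \<cdot> (t \<cdot> j) = (?c \<cdot> n) \<cdot> j" using comp_assoc'[of j t c'] c' t j g by (simp del: comp_assoc')
      also have "\<dots> = ?c \<cdot> (n \<cdot> j)" by (rule comp_assoc') (use c n j g t in simp_all)
      finally have "null (c' \<cdot> (t \<cdot> j))" using cy by simp
      then have "null c'" by (rule epiD[OF tj]) (use c' t j g in simp_all)
      then have "null (c' \<cdot> t)" by (rule null_comp(2)[rotated -1]) (use c' t in simp_all)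
      then show "null (?c \<cdot> n)" using c' by simp
    qed (use n s in simp_all)
    have "fac n ?y \<or> fac n ?z" by (rule irr[OF y z ns sn])
    then show "epi_arr C g"
    proof
      assume "fac n ?y"
      then have "fac (n \<cdot> Ident C (Dom C n)) (n \<cdot> j)" using n by simp
      then have "fac (Ident C (Dom C n)) j" by (rule fac_comp_left_mono) (use n j g t in simp_all)
      then have "iso_arr C j" by (rule fac_ident) (use n j in simp_all)
      then have "epi_arr C (j \<cdot> e)" by (intro epi_arr_comp iso_arr_epi j)
      then show ?thesis using j by simp
    next
      assume "fac n ?z"
      then have "fac (n \<cdot> Ident C (Dom C n)) (n \<cdot> ?r)" using n by simp
      then have "fac (Ident C (Dom C n)) ?r" by (rule fac_comp_left_mono) (use n r in simp_all)
      then have "iso_arr C ?r" by (rule fac_ident) (use n r in simp_all)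
      then have "null t" by (intro epiD[OF iso_arr_epi, of ?r t]) (use r t in simp_all)
      then show ?thesis using tn by simp
    qed
  qed
  then show thesis using that n t unfolding local_sub_def by blast
qed

text \<open>A subobject of a local object that the top map does not kill is epi, hence everything;
  one that it kills lies in the radical.\<close>

lemma local_sub_fac_cases:
  assumes "local_sub n t" and y: "mono_arr C y" "fac y n"
  shows "fac n y \<or> fac y (n \<cdot> ker t)"
proof -
  note n = local_subD[OF assms(1)]
  obtain y' where y': "y' \<in> Arr C" "Dom C y' = Dom C y" "Cod C y' = Dom C n" "n \<cdot> y' = y"
    using y(2) by (rule facE) blast
  have my: "mono_arr C y'" by (rule mono_arr_of_comp[of n y']) (use y' y n in simp_all)
  show ?thesis
  proof (cases "null (t \<cdot> y')")
    case True
    then have "fac y' (ker t)" by (rule ker_fac) (use n y' in simp_all)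
    then have "fac (n \<cdot> y') (n \<cdot> ker t)" by (rule fac_comp_left) (use n in simp_all)
    then show ?thesis using y' by simp
  next
    case False
    then have "epi_arr C y'" by (rule local_topD(6)[OF n(4), rotated -1]) (use n y' in simp_all)
    then have "iso_arr C y'" using my by (intro mono_epi_iso)
    then have "fac (Ident C (Dom C n)) y'" by (rule iso_fac) (use n y' in simp_all)
    then have "fac (n \<cdot> Ident C (Dom C n)) (n \<cdot> y')" by (rule fac_comp_left) (use n y' in simp_all)
    then show ?thesis using n y' by simp
  qed
qed

text \<open>Two proper subobjects of \<open>n\<close> both lie in its radical, and so does their
  join.\<close>

lemma local_join_irreducible:
  assumes "local_sub n t" shows "join_irreducible (subobjects C M) n"
  unfolding join_irreducible_iff
proof (intro conjI allI impI)
  note n = local_subD[OF assms]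
  show "mono_arr C n" "Cod C n = M" "\<not> null n" using n by simp_all
  fix y z assume yz: "mono_arr C y" "Cod C y = M" "mono_arr C z" "Cod C z = M"
    and s1: "fac n (sub_join y z)" and s2: "fac (sub_join y z) n"
  note s = sub_join[OF yz]
  have rk: "mono_arr C (n \<cdot> ker t)" "Cod C (n \<cdot> ker t) = M" using mono_arr_comp[of "ker t" n] n by simp_all
  show "fac n y \<or> fac n z"
  proof (rule ccontr)
    assume "\<not> ?thesis"
    moreover have "fac y n" "fac z n" using s(3,4) s2 fac_trans by blast+
    ultimately have "fac y (n \<cdot> ker t)" "fac z (n \<cdot> ker t)"
      using local_sub_fac_cases[OF assms] yz by blast+
    then have "fac (sub_join y z) (n \<cdot> ker t)" using s(5)[OF rk] by simp
    then have "fac n (n \<cdot> ker t)" using s1 fac_trans by blast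
    then have "fac (n \<cdot> Ident C (Dom C n)) (n \<cdot> ker t)" using n by simp
    then have "fac (Ident C (Dom C n)) (ker t)" by (rule fac_comp_left_mono) (use n in simp_all)
    then have "iso_arr C (ker t)" by (rule fac_ident) (use n in simp_all)
    then have "null t" by (intro epiD[OF iso_arr_epi, of "ker t" t]) (use n in simp_all)
    then show False using n by simp
  qed
qed

text \<open>This is where distributivity enters: \<open>n\<close> is its meet with the join of
  \<open>y\<close> and \<open>z\<close>, hence the join of its meets with \<open>y\<close> and with
  \<open>z\<close>, and join-irreducibility selects one of these.\<close>

lemma local_prime:
  assumes "local_sub n t" "mono_arr C y" "Cod C y = M" "mono_arr C z" "Cod C z = M" "fac n (sub_join y z)"
  shows "fac n y \<or> fac n z"
proof -
  note n = local_subD[OF assms(1)]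
  let ?L = "subobjects C M"
  interpret W: weak_lattice ?L by (rule weak_lattice)
  have c: "n \<in> carrier ?L" "y \<in> carrier ?L" "z \<in> carrier ?L" using n assms by simp_all
  have cj: "y \<squnion>\<^bsub>?L\<^esub> z \<in> carrier ?L" using W.join_closed c by blast
  have m: "n \<sqinter>\<^bsub>?L\<^esub> y \<in> carrier ?L" "n \<sqinter>\<^bsub>?L\<^esub> z \<in> carrier ?L" "n \<sqinter>\<^bsub>?L\<^esub> (y \<squnion>\<^bsub>?L\<^esub> z) \<in> carrier ?L"
    using W.meet_closed c cj by blast+
  have mm: "mono_arr C (n \<sqinter>\<^bsub>?L\<^esub> y)" "Cod C (n \<sqinter>\<^bsub>?L\<^esub> y) = M" "mono_arr C (n \<sqinter>\<^bsub>?L\<^esub> z)" "Cod C (n \<sqinter>\<^bsub>?L\<^esub> z) = M"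
    "mono_arr C (n \<sqinter>\<^bsub>?L\<^esub> (y \<squnion>\<^bsub>?L\<^esub> z))"
    using m by simp_all
  note s = sub_join[OF mm(1-4)]
  have "n \<sqinter>\<^bsub>?L\<^esub> (y \<squnion>\<^bsub>?L\<^esub> z) .=\<^bsub>?L\<^esub> (n \<sqinter>\<^bsub>?L\<^esub> y) \<squnion>\<^bsub>?L\<^esub> (n \<sqinter>\<^bsub>?L\<^esub> z)"
    using distributive c unfolding distributive_lattice_def by blast
  then have e: "fac (n \<sqinter>\<^bsub>?L\<^esub> (y \<squnion>\<^bsub>?L\<^esub> z)) (sub_join (n \<sqinter>\<^bsub>?L\<^esub> y) (n \<sqinter>\<^bsub>?L\<^esub> z))"
    using mm s(1) unfolding sub_join_def by simp
  have "n \<sqsubseteq>\<^bsub>?L\<^esub> n \<sqinter>\<^bsub>?L\<^esub> (y \<squnion>\<^bsub>?L\<^esub> z)"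
    using W.meet_le[of n n "y \<squnion>\<^bsub>?L\<^esub> z"] c cj assms n unfolding sub_join_def by (simp add: fac_refl)
  then have "fac n (n \<sqinter>\<^bsub>?L\<^esub> (y \<squnion>\<^bsub>?L\<^esub> z))" using mm n by simp
  then have n1: "fac n (sub_join (n \<sqinter>\<^bsub>?L\<^esub> y) (n \<sqinter>\<^bsub>?L\<^esub> z))" using e by (rule fac_trans)
  have "fac (n \<sqinter>\<^bsub>?L\<^esub> y) n" "fac (n \<sqinter>\<^bsub>?L\<^esub> z) n"
    using W.meet_left[of n y] W.meet_left[of n z] c mm n by simp_all
  then have n2: "fac (sub_join (n \<sqinter>\<^bsub>?L\<^esub> y) (n \<sqinter>\<^bsub>?L\<^esub> z)) n" using s(5)[of n] n by simp
  have "fac n (n \<sqinter>\<^bsub>?L\<^esub> y) \<or> fac n (n \<sqinter>\<^bsub>?L\<^esub> z)"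
    using local_join_irreducible[OF assms(1)] n1 n2 mm(1-4) unfolding join_irreducible_iff by blast
  moreover have "fac (n \<sqinter>\<^bsub>?L\<^esub> y) y" "fac (n \<sqinter>\<^bsub>?L\<^esub> z) z"
    using W.meet_right[of n y] W.meet_right[of n z] c mm assms by simp_all
  ultimately show ?thesis using fac_trans by blast
qed

text \<open>The image is a nonzero quotient of a local object, so \<open>local_top_quotient\<close>
  makes it local with the same top.\<close>

lemma image_local_sub:
  assumes "local_top t" "f \<in> Arr C" "Dom C f = Dom C t" "Cod C f = M" "\<not> null f"
  obtains n e t' where "local_sub n t'" "epi_arr C e" "e \<in> Arr C" "Dom C e = Dom C f" "Cod C e = Dom C n" "n \<cdot> e = f"
    "t' \<cdot> e = t" "Cod C t' = Cod C t"
proof -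
  obtain n e where n: "mono_arr C n" "epi_arr C e" "n \<in> Arr C" "e \<in> Arr C" "Dom C e = Dom C f"
    "Cod C n = Cod C f" "Dom C n = Cod C e" "n \<cdot> e = f" by (rule image_factorization[OF assms(2)])
  have ne: "\<not> null e" using null_comp(1)[of e n] n assms(5) by auto
  obtain t' where t': "local_top t'" "t' \<in> Arr C" "Dom C t' = Cod C e" "Cod C t' = Cod C t" "t' \<cdot> e = t"
    by (rule local_top_quotient[OF assms(1) n(2) _ ne]) (use n assms in simp_all)
  have "local_sub n t'" using n t' assms(4) by (simp add: local_sub_def)
  then show thesis by (rule that[of n t' e]) (use n t' in simp_all)
qed

text \<open>The image of a nonnull \<open>f\<close> is a local subobject, to which
  \<open>local_prime\<close> applies; a null \<open>f\<close> lies in both.\<close>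

lemma local_prime_arr:
  assumes "local_top t" "f \<in> Arr C" "Dom C f = Dom C t" "mono_arr C y" "Cod C y = M" "mono_arr C z" "Cod C z = M"
    "fac f (sub_join y z)"
  shows "fac f y \<or> fac f z"
proof (cases "null f")
  note s = sub_join[OF assms(4-7)]
  have fM: "Cod C f = M" using facD[OF assms(8)] s by simp
  { case True
    then show ?thesis using fac_null[OF assms(4) True assms(2)] fM assms by simp
  next
    case False
    obtain n e t' where n: "local_sub n t'" "epi_arr C e" "e \<in> Arr C" "Dom C e = Dom C f" "Cod C e = Dom C n" "n \<cdot> e = f"
      by (rule image_local_sub[OF assms(1-3) fM False]) blast
    note nD = local_subD[OF n(1)]
    have "fac n (sub_join y z)" by (rule fac_epi_cancel[OF s(1) n(2)]) (use n nD assms in simp_all)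
    then have "fac n y \<or> fac n z" by (rule local_prime[OF n(1) assms(4-7)])
    moreover have "fac f n" using facI[of n e] n nD by simp
    ultimately show ?thesis using fac_trans by blast }
qed

text \<open>Map a local object \<open>V\<close> onto both subobjects. The image of the sum \<open>V \<rightarrow> M\<close> of the two maps lies in
  \<open>n \<squnion> n'\<close>, hence in \<open>n\<close> or in \<open>n'\<close> because it is join-prime; subtract the corresponding map.\<close>

lemma isomorphic_tops_comparable:
  assumes "local_sub n t" "local_sub n' t'" "isomorphic C (Cod C t) (Cod C t')"
  shows "fac n n' \<or> fac n' n"
proof -
  note n = local_subD[OF assms(1)] and n' = local_subD[OF assms(2)]
  obtain \<theta> where \<theta>: "\<theta> \<in> Arr C" "Dom C \<theta> = Cod C t" "Cod C \<theta> = Cod C t'" "iso_arr C \<theta>"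
    using assms(3) unfolding isomorphic_def by auto
  have \<theta>t: "\<theta> \<cdot> t \<in> Arr C" "Cod C (\<theta> \<cdot> t) = Cod C t'" "Dom C (\<theta> \<cdot> t) = Dom C n" using \<theta> n by simp_all
  \<comment> \<open>\<open>V\<close> is found in the pullback of \<open>t'\<close> along
    \<open>\<theta> \<cdot> t\<close>: a minimal subobject \<open>v\<close> with
    \<open>a \<cdot> v\<close> epi is local, and \<open>b \<cdot> v\<close> is epi as well because
    it is nonzero on the top of \<open>n'\<close>.\<close>
  obtain a b where ab: "epi_arr C a" "a \<in> Arr C" "b \<in> Arr C" "Cod C a = Dom C (\<theta> \<cdot> t)" "Dom C b = Dom C a"
      "Cod C b = Dom C t'" "t' \<cdot> b = (\<theta> \<cdot> t) \<cdot> a"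
    by (rule epi_pullback[OF n'(7) \<theta>t(1,2)])
  have ac: "Cod C a = Dom C t" "Cod C b = Dom C n'" using ab \<theta>t n n' by simp_all
  obtain v where v: "mono_arr C v" "v \<in> Arr C" "Cod C v = Dom C a" "epi_arr C (a \<cdot> v)" "local_top (t \<cdot> (a \<cdot> v))"
    by (rule minimal_cover[OF n(4) ab(1) ac(1)])
  have tav: "\<not> null (t \<cdot> (a \<cdot> v))" using v local_topD by blast
  have "\<not> null (\<theta> \<cdot> (t \<cdot> (a \<cdot> v)))"
    using monoD[OF iso_arr_mono[OF \<theta>(4)], of "t \<cdot> (a \<cdot> v)"] tav \<theta> n ab(2,3) ac v by auto
  moreover have "t' \<cdot> (b \<cdot> v) = \<theta> \<cdot> (t \<cdot> (a \<cdot> v))"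
  proof -
    have "t' \<cdot> (b \<cdot> v) = (t' \<cdot> b) \<cdot> v" by (rule comp_assoc'[symmetric]) (use n' ab(3,5) ac v in simp_all)
    also have "\<dots> = \<theta> \<cdot> (t \<cdot> (a \<cdot> v))" unfolding ab(7) using \<theta> n ab(2) ac v by simp
    finally show ?thesis .
  qed
  ultimately have "\<not> null (t' \<cdot> (b \<cdot> v))" by simp
  then have bv: "epi_arr C (b \<cdot> v)"
    by (rule local_topD(6)[OF n'(4), rotated -1]) (use n' ab(3,5) ac v in simp_all)
  let ?f1 = "n \<cdot> (a \<cdot> v)" and ?f2 = "n' \<cdot> (b \<cdot> v)"
  have f1: "?f1 \<in> Arr C" "Dom C ?f1 = Dom C v" "Cod C ?f1 = M" using n ab(2,3) ac v by simp_all
  have f2: "?f2 \<in> Arr C" "Dom C ?f2 = Dom C v" "Cod C ?f2 = M" using n' ab(2,3,5) ac v by simp_all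
  have fac1: "fac ?f1 n" by (rule facI) (use n ab(2) ac v in simp_all)
  have fac2: "fac ?f2 n'" by (rule facI) (use n' ab(3,5) ac v in simp_all)
  let ?f = "hadd C ?f1 ?f2"
  have f: "?f \<in> Arr C" "Dom C ?f = Dom C v" "Cod C ?f = M" using f1 f2 by simp_all
  note s = sub_join[OF n(1,3) n'(1,3)]
  have "fac ?f1 (sub_join n n')" "fac ?f2 (sub_join n n')" using fac_trans[OF fac1 s(3)] fac_trans[OF fac2 s(4)] .
  then have fs: "fac ?f (sub_join n n')" by (intro fac_hadd) (use s f1 f2 in simp_all)
  have "fac ?f n \<or> fac ?f n'"
    by (rule local_prime_arr[OF v(5) f(1) _ n(1,3) n'(1,3) fs]) (use f n ab(2) ac v in simp)
  then show ?thesis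
  proof
    assume "fac ?f n"
    then have "fac (hsub ?f ?f1) n" by (intro fac_hsub) (use fac1 n f f1 in simp_all)
    then have "fac ?f2 n" using hadd_hsub_cancel(2)[of ?f1 ?f2] f1 f2 by simp
    then have "fac n' n" by (rule fac_epi_cancel[OF n(1) bv]) (use n' ab(3,5) ac v in simp_all)
    then show ?thesis by simp
  next
    assume "fac ?f n'"
    then have "fac (hsub ?f ?f2) n'" by (intro fac_hsub) (use fac2 n' f f2 in simp_all)
    then have "fac ?f1 n'" using hadd_hsub_cancel(1)[of ?f1 ?f2] f1 f2 by simp
    then have "fac n n'" by (rule fac_epi_cancel[OF n'(1) v(4)]) (use n ab(2) ac v in simp_all)
    then show ?thesis by simp
  qed
qed

end

section \<open>Paths in the ext-quiver\<close>

context distributive_object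
begin

lemma local_sub_not_below_rad:
  assumes "local_sub n t" shows "\<not> fac n (n \<cdot> ker t)"
proof
  note n = local_subD[OF assms]
  assume "fac n (n \<cdot> ker t)"
  then have "fac (n \<cdot> Ident C (Dom C n)) (n \<cdot> ker t)" using n by simp
  then have "fac (Ident C (Dom C n)) (ker t)" by (rule fac_comp_left_mono) (use n in simp_all)
  then have "iso_arr C (ker t)" by (rule fac_ident) (use n in simp_all)
  then have "null t" by (intro epiD[OF iso_arr_epi, of "ker t" t]) (use n in simp_all)
  then show False using n by simp
qed

lemma local_sub_isomorphic:
  assumes "local_sub n t" "local_sub n' t'" "fac n n'" "fac n' n"
  shows "isomorphic C (Dom C n) (Dom C n')" "isomorphic C (Cod C t) (Cod C t')"
proof -
  note n = local_subD[OF assms(1)] and n' = local_subD[OF assms(2)]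
  obtain u where u: "iso_arr C u" "u \<in> Arr C" "Dom C u = Dom C n" "Cod C u = Dom C n'" "n' \<cdot> u = n"
    by (rule fac_antisym[OF n(1) n'(1) assms(3,4)])
  show "isomorphic C (Dom C n) (Dom C n')" using isomorphicI[OF u(1)] u by simp
  have tu: "\<not> null (t' \<cdot> u)" using epiD[OF iso_arr_epi[OF u(1)], of t'] n' u by auto
  obtain v where v: "v \<in> Arr C" "Dom C v = Cod C t" "Cod C v = Cod C (t' \<cdot> u)" "\<not> null (t' \<cdot> u) \<Longrightarrow> iso_arr C v"
    by (rule local_top_unique[OF n(4), of "t' \<cdot> u"]) (use u n n' in simp_all)
  then show "isomorphic C (Cod C t) (Cod C t')" using isomorphicI[of v] tu u n' by simp
qed

text \<open>Let \<open>w\<close> be the largest subobject of \<open>rad z\<close> not containing \<open>n\<close> (it exists since \<open>n\<close> is join-prime).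
  The covering hypothesis makes \<open>rad z / w\<close> simple, hence isomorphic to the top of \<open>n\<close>, and \<open>z / w\<close>
  is the nonsplit extension.\<close>

lemma cover_ext_arrow:
  assumes nl: "local_sub n t" and zl: "local_sub z s" and nz: "fac n z" "\<not> fac z n"
    and cover: "\<And>m t'. local_sub m t' \<Longrightarrow> fac n m \<Longrightarrow> fac m z \<Longrightarrow> \<not> fac m n \<Longrightarrow> fac z m"
  shows "(iso_class C (Cod C t), iso_class C (Cod C s)) \<in> ext_quiver C"
proof -
  note n = local_subD[OF nl] and z = local_subD[OF zl]
  let ?r = "ker s"
  let ?\<rho> = "z \<cdot> ?r"
  have r: "mono_arr C ?r" "?r \<in> Arr C" "Cod C ?r = Dom C z" "null (s \<cdot> ?r)" using z by simp_all
  have \<rho>: "mono_arr C ?\<rho>" "?\<rho> \<in> Arr C" "Cod C ?\<rho> = M" "Dom C ?\<rho> = Dom C ?r"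
    using mono_arr_comp[OF r(1) z(1)] r z by simp_all
  have \<rho>z: "fac ?\<rho> z" by (rule facI) (use r z in simp_all)
  have n\<rho>: "fac n ?\<rho>" using local_sub_fac_cases[OF zl n(1) nz(1)] nz by simp
  have zn\<rho>: "\<not> fac z ?\<rho>" by (rule local_sub_not_below_rad[OF zl])
  let ?K = "{w. mono_arr C w \<and> Cod C w = M \<and> fac w ?\<rho> \<and> \<not> fac n w}"
  have "ker (Ident C M) \<in> ?K"
  proof -
    have o: "ker (Ident C M) \<in> Arr C" "mono_arr C (ker (Ident C M))" "Cod C (ker (Ident C M)) = M" "null (ker (Ident C M))"
      using M_obj ker_arr[of "Ident C M"] by simp_all
    then have "fac (ker (Ident C M)) ?\<rho>" using fac_null \<rho> by simp
    moreover have "\<not> fac n (ker (Ident C M))" using null_fac o n by blast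
    ultimately show ?thesis using o by simp
  qed
  then have ne: "?K \<noteq> {}" by blast
  obtain w where w0: "w \<in> ?K" and wmax: "\<And>w'. w' \<in> ?K \<Longrightarrow> fac w w' \<Longrightarrow> fac w' w"
    by (rule maximal_subobject[OF M_obj ne]) auto
  have w: "mono_arr C w" "Cod C w = M" "fac w ?\<rho>" "\<not> fac n w" using w0 by simp_all
  \<comment> \<open>Since \<open>n\<close> is join-prime, joining \<open>w\<close> with
    \<open>y\<close> does not bring in \<open>n\<close>, so maximality of \<open>w\<close> absorbs
    \<open>y\<close>.\<close>
  have absorb: "fac y w" if y: "local_sub y ty" "fac y ?\<rho>" "\<not> fac n y" for y ty
  proof -
    note yD = local_subD[OF y(1)]
    note j = sub_join[OF w(1,2) yD(1,3)]
    have "fac (sub_join w y) ?\<rho>" using j(5)[OF \<rho>(1,3) w(3) y(2)] .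
    moreover have "\<not> fac n (sub_join w y)" using local_prime[OF nl w(1,2) yD(1,3)] w(4) y(3) by blast
    ultimately have "fac (sub_join w y) w" using wmax[of "sub_join w y"] j by blast
    then show ?thesis using j(4) fac_trans by blast
  qed
  obtain w' where w': "w' \<in> Arr C" "Dom C w' = Dom C w" "Cod C w' = Dom C ?r" "?\<rho> \<cdot> w' = w"
    using w(3) by (rule facE) (use \<rho> in simp_all)
  obtain n' where n': "n' \<in> Arr C" "Dom C n' = Dom C n" "Cod C n' = Dom C ?r" "?\<rho> \<cdot> n' = n"
    using n\<rho> by (rule facE) (use \<rho> in simp_all)
  have w'm: "mono_arr C w'" by (rule mono_arr_of_comp[of ?\<rho> w']) (use w w' \<rho> in simp_all)
  let ?q = "coker w'"
  have q: "?q \<in> Arr C" "epi_arr C ?q" "Dom C ?q = Dom C ?r" "null (?q \<cdot> w')" using w' by simp_all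
  have qn': "\<not> null (?q \<cdot> n')"
  proof
    assume "null (?q \<cdot> n')"
    then have "fac n' w'" by (rule mono_fac[OF w'm, rotated -1]) (use n' w' in simp_all)
    then have "fac (?\<rho> \<cdot> n') (?\<rho> \<cdot> w')" by (rule fac_comp_left) (use \<rho> w' in simp_all)
    then show False using w(4) n'(4) w'(4) by simp
  qed
  \<comment> \<open>A local object mapping to \<open>rad z\<close> and not killed in
    \<open>rad z / w\<close> has an image that is not contained in \<open>w\<close>, and by
    \<open>absorb\<close> such an image contains \<open>n\<close>.\<close>
  have big: "\<exists>m e tm. local_sub m tm \<and> epi_arr C e \<and> e \<in> Arr C \<and> Dom C e = Dom C v \<and> Cod C e = Dom C m \<and> m \<cdot> e = ?\<rho> \<cdot> v \<and> fac n m"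
    if v: "v \<in> Arr C" "Cod C v = Dom C ?r" "local_top tv" "Dom C tv = Dom C v" "\<not> null (?q \<cdot> v)" for v tv
  proof -
    have rv: "?\<rho> \<cdot> v \<in> Arr C" "Dom C (?\<rho> \<cdot> v) = Dom C tv" "Cod C (?\<rho> \<cdot> v) = M"
      using v(1,2,4) \<rho> comp_arr[OF v(1) \<rho>(2)] by (simp_all del: comp_assoc')
    have notw: "\<not> fac (?\<rho> \<cdot> v) w"
    proof
      assume "fac (?\<rho> \<cdot> v) w"
      then have "fac (?\<rho> \<cdot> v) (?\<rho> \<cdot> w')" unfolding w'(4) .
      then have "fac v w'" by (rule fac_comp_left_mono) (use v \<rho> w' in simp_all)
      then have "null (?q \<cdot> v)" by (rule null_coker_fac)
      then show False using v by simp
    qed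
    have "\<not> null (?\<rho> \<cdot> v)" using notw fac_null[OF w(1), of "?\<rho> \<cdot> v"] rv w by auto
    then obtain m e tm where m: "local_sub m tm" "epi_arr C e" "e \<in> Arr C" "Dom C e = Dom C (?\<rho> \<cdot> v)" "Cod C e = Dom C m" "m \<cdot> e = ?\<rho> \<cdot> v"
      by (rule image_local_sub[OF v(3) rv]) blast
    note mD = local_subD[OF m(1)]
    have "fac (m \<cdot> e) ?\<rho>" unfolding m(6) by (rule facI) (use \<rho> v in simp_all)
    then have mr: "fac m ?\<rho>" by (rule fac_epi_cancel[OF \<rho>(1) m(2)]) (use m mD in simp_all)
    have "fac n m"
    proof (rule ccontr)
      assume "\<not> fac n m"
      then have "fac m w" by (rule absorb[OF m(1) mr])
      moreover have "fac (m \<cdot> e) m" by (rule facI) (use m mD in simp_all)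
      ultimately have "fac (?\<rho> \<cdot> v) w" unfolding m(6) using fac_trans by blast
      then show False using notw by simp
    qed
    moreover have "Dom C e = Dom C v" using m(4) rv(2) v(4) by simp
    ultimately show ?thesis using m by blast
  qed
  \<comment> \<open>A nonzero \<open>g\<close> into \<open>rad z / w\<close> is tested on a local
    object that lifts to \<open>rad z\<close>; its image there contains \<open>n\<close> by
    \<open>big\<close>, so the preimage \<open>?k\<close> of the image of \<open>g\<close> contains
    \<open>n\<close>.\<close>
  have Qs: "simple_obj C (Cod C ?q)"
  proof (rule simple_objI)
    show "Cod C ?q \<in> Obj C" using q by simp
    show "\<not> null (Ident C (Cod C ?q))"
      using null_ident_comp(2)[of "Cod C ?q" "?q \<cdot> n'"] qn' q n' by auto
    fix g assume g: "g \<in> Arr C" "Cod C g = Cod C ?q" "\<not> null g"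
    let ?c = "coker g"
    have c: "?c \<in> Arr C" "Dom C ?c = Cod C ?q" "null (?c \<cdot> g)" using g by simp_all
    have cq: "?c \<cdot> ?q \<in> Arr C" "Dom C (?c \<cdot> ?q) = Dom C ?r" using c q by simp_all
    obtain p b where p: "epi_arr C p" "p \<in> Arr C" "b \<in> Arr C" "Cod C p = Dom C g" "Dom C b = Dom C p"
      "Cod C b = Dom C ?q" "?q \<cdot> b = g \<cdot> p" by (rule epi_pullback[OF q(2) g(1,2)])
    have bc: "Cod C b = Dom C ?r" using p q by simp
    have "\<not> null (g \<cdot> p)" using epiD[OF p(1), of g] g p by auto
    then have qb: "?q \<cdot> b \<in> Arr C" "\<not> null (?q \<cdot> b)" using p q g by simp_all
    obtain v tv where v: "mono_arr C v" "v \<in> Arr C" "Cod C v = Dom C (?q \<cdot> b)" "local_top tv" "Dom C tv = Dom C v"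
      "\<not> null ((?q \<cdot> b) \<cdot> v)" by (rule local_subobject[OF qb])
    have vc: "Cod C v = Dom C p" using v(3) p(3,5,6) q by simp
    have bv: "b \<cdot> v \<in> Arr C" "Cod C (b \<cdot> v) = Dom C ?r" "Dom C tv = Dom C (b \<cdot> v)" "\<not> null (?q \<cdot> (b \<cdot> v))"
      using v(2,5,6) vc bc p(3,5) q by simp_all
    obtain m e tm where m: "local_sub m tm" "epi_arr C e" "e \<in> Arr C" "Cod C e = Dom C m" "m \<cdot> e = ?\<rho> \<cdot> (b \<cdot> v)" "fac n m"
      using big[OF bv(1,2) v(4) bv(3,4)] by blast
    note mD = local_subD[OF m(1)]
    let ?k = "ker (?c \<cdot> ?q)"
    have k: "mono_arr C ?k" "?k \<in> Arr C" "Cod C ?k = Dom C ?r" "null ((?c \<cdot> ?q) \<cdot> ?k)"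
      using cq ker_arr[OF cq(1)] by (simp_all del: comp_assoc')
    have \<rho>k: "mono_arr C (?\<rho> \<cdot> ?k)" by (rule mono_arr_comp) (use k \<rho> in simp_all)
    have "null ((?c \<cdot> g) \<cdot> (p \<cdot> v))" by (rule null_comp(2)) (use c p v vc g in simp_all)
    moreover have "(?c \<cdot> g) \<cdot> (p \<cdot> v) = ?c \<cdot> (g \<cdot> (p \<cdot> v))" by (rule comp_assoc') (use c p v vc g in simp_all)
    moreover have "g \<cdot> (p \<cdot> v) = ?q \<cdot> (b \<cdot> v)" by (rule comp_cong_left[OF p(7)[symmetric]]) (use c p v vc g q in simp_all)
    moreover have "?c \<cdot> (?q \<cdot> (b \<cdot> v)) = (?c \<cdot> ?q) \<cdot> (b \<cdot> v)" by (rule comp_assoc'[symmetric]) (use c q bv in simp_all)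
    ultimately have "null ((?c \<cdot> ?q) \<cdot> (b \<cdot> v))" by simp
    then have "fac (b \<cdot> v) ?k" by (rule ker_fac) (use cq bv in simp_all)
    then have "fac (?\<rho> \<cdot> (b \<cdot> v)) (?\<rho> \<cdot> ?k)" by (rule fac_comp_left) (use \<rho> k in simp_all)
    then have "fac m (?\<rho> \<cdot> ?k)" unfolding m(5)[symmetric] by (rule fac_epi_cancel[OF \<rho>k m(2)]) (use m mD in simp_all)
    then have "fac (?\<rho> \<cdot> n') (?\<rho> \<cdot> ?k)" unfolding n'(4) using m(6) fac_trans by blast
    then have "fac n' ?k" by (rule fac_comp_left_mono) (use \<rho> k n' in simp_all)
    then obtain x where x: "x \<in> Arr C" "Cod C x = Dom C ?k" "?k \<cdot> x = n'" by (rule facE) blast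
    \<comment> \<open>If \<open>coker g\<close> were nonzero, some local subobject of
      \<open>rad z\<close> would survive in it. Its image contains \<open>n\<close> and, lying in
      the radical, does not contain \<open>z\<close>, so the covering hypothesis puts it inside
      \<open>n\<close>, which is already contained in \<open>?k\<close>.\<close>
    have "null ?c"
    proof (rule ccontr)
      assume "\<not> null ?c"
      then have "\<not> null (?c \<cdot> ?q)" using epiD[OF q(2), of ?c] c by auto
      then obtain y ty where y: "mono_arr C y" "y \<in> Arr C" "Cod C y = Dom C (?c \<cdot> ?q)" "local_top ty" "Dom C ty = Dom C y"
        "\<not> null ((?c \<cdot> ?q) \<cdot> y)" by (rule local_subobject[OF cq(1)])
      have yc: "Cod C y = Dom C ?r" using y cq by simp
      have "\<not> null (?q \<cdot> y)"
      proof
        assume "null (?q \<cdot> y)"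
        then have "null (?c \<cdot> (?q \<cdot> y))" by (rule null_comp(1)[rotated -1]) (use c q y yc in simp_all)
        then show False using y(2,6) c q yc by simp
      qed
      then obtain m' e' tm' where m': "local_sub m' tm'" "epi_arr C e'" "e' \<in> Arr C" "Cod C e' = Dom C m'" "m' \<cdot> e' = ?\<rho> \<cdot> y" "fac n m'"
        using big[OF y(2) yc y(4,5)] by blast
      note mD' = local_subD[OF m'(1)]
      have "fac (m' \<cdot> e') ?\<rho>" unfolding m'(5) by (rule facI) (use \<rho> y yc in simp_all)
      then have mr: "fac m' ?\<rho>" by (rule fac_epi_cancel[OF \<rho>(1) m'(2)]) (use m' mD' in simp_all)
      then have mz: "fac m' z" using \<rho>z fac_trans by blast
      have "\<not> fac z m'" using mr zn\<rho> fac_trans by blast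
      then have "fac m' n" using cover[OF m'(1,6) mz] by blast
      moreover have "fac (m' \<cdot> e') m'" by (rule facI) (use m' mD' in simp_all)
      ultimately have "fac (?\<rho> \<cdot> y) (?\<rho> \<cdot> n')" unfolding n'(4) m'(5) using fac_trans by blast
      then have "fac y n'" by (rule fac_comp_left_mono) (use \<rho> y yc n' in simp_all)
      then have "fac y ?k" using facI[OF k(2) x(1,2)] x(3) fac_trans by simp
      then have "null ((?c \<cdot> ?q) \<cdot> y)"
      proof -
        assume "fac y ?k"
        then obtain u where u: "u \<in> Arr C" "Cod C u = Dom C ?k" "?k \<cdot> u = y" by (rule facE) blast
        have "null (((?c \<cdot> ?q) \<cdot> ?k) \<cdot> u)" by (rule null_comp(2)[OF u(1) _ _ k(4)]) (use cq k u in simp_all)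
        moreover have "((?c \<cdot> ?q) \<cdot> ?k) \<cdot> u = (?c \<cdot> ?q) \<cdot> (?k \<cdot> u)" by (rule comp_assoc') (use cq k u in simp_all)
        ultimately show ?thesis using u by simp
      qed
      then show False using y by simp
    qed
    then show "epi_arr C g" by (rule epi_if_coker_null[OF g(1)])
  qed
  have qnA: "?q \<cdot> n' \<in> Arr C" "Dom C (?q \<cdot> n') = Dom C t" "Cod C (?q \<cdot> n') = Cod C ?q" using q n' n by simp_all
  obtain u where "u \<in> Arr C" "Dom C u = Cod C t" "Cod C u = Cod C (?q \<cdot> n')" "u \<cdot> t = ?q \<cdot> n'"
    "\<not> null (?q \<cdot> n') \<Longrightarrow> iso_arr C u"
    by (rule local_top_unique[OF n(4) qnA(1,2)]) (use Qs qnA in simp_all)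
  then have "isomorphic C (Cod C t) (Cod C ?q)" using isomorphicI[of u] qn' qnA(3) by simp
  then have cls: "iso_class C (Cod C t) = iso_class C (Cod C ?q)"
    using n q by (subst iso_class_eq_iff) simp_all
  \<comment> \<open>This is \<open>w\<close> as a subobject of \<open>z\<close> itself, so
    \<open>?e\<close> is the quotient map \<open>z \<rightarrow> z / w\<close>; \<open>f\<close> and
    \<open>g\<close> are the induced arrows from \<open>rad z / w\<close> and to the top of
    \<open>z\<close>.\<close>
  let ?rw = "?r \<cdot> w'"
  have rw: "?rw \<in> Arr C" "Cod C ?rw = Dom C z" "mono_arr C ?rw" using r w' mono_arr_comp[OF w'm r(1)] by simp_all
  let ?e = "coker ?rw"
  have e: "?e \<in> Arr C" "Dom C ?e = Dom C z" "epi_arr C ?e" "null (?e \<cdot> ?rw)" using rw coker_arr[OF rw(1)] by simp_all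
  have "null ((s \<cdot> ?r) \<cdot> w')" by (rule null_comp(2)[OF _ _ _ r(4)]) (use r w' z in simp_all)
  moreover have "(s \<cdot> ?r) \<cdot> w' = s \<cdot> ?rw" by (rule comp_assoc') (use r w' z in simp_all)
  ultimately have "null (s \<cdot> ?rw)" by simp
  then obtain g where g: "g \<in> Arr C" "Dom C g = Cod C ?e" "Cod C g = Cod C s" "g \<cdot> ?e = s"
    by (rule coker_fac) (use rw z in simp_all)
  have "null ((?e \<cdot> ?r) \<cdot> w')" using e(1,2,4) r w' by simp
  then obtain f where f: "f \<in> Arr C" "Dom C f = Cod C ?q" "Cod C f = Cod C (?e \<cdot> ?r)" "f \<cdot> ?q = ?e \<cdot> ?r"
    by (rule coker_fac) (use e r w' in simp_all)
  have fc: "Cod C f = Cod C ?e" using f e r by simp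
  have eg: "epi_arr C g" by (rule epi_arr_of_comp[of g ?e]) (use g z e in simp_all)
  have "g \<cdot> (f \<cdot> ?q) = s \<cdot> ?r" unfolding f(4) using comp_assoc'[of ?r ?e g] g e r by (simp del: comp_assoc')
  then have "null ((g \<cdot> f) \<cdot> ?q)" using r(4) f(1,2) fc g q by simp
  then have gf: "null (g \<cdot> f)" by (rule epiD[OF q(2)]) (use f(1,2) fc g in simp_all)
  have fm: "mono_arr C f" unfolding mono_iff
  proof (intro conjI ballI impI f(1))
    fix h assume h: "h \<in> Arr C" "Cod C h = Dom C f" "null (f \<cdot> h)"
    obtain p h' where p: "epi_arr C p" "p \<in> Arr C" "h' \<in> Arr C" "Cod C p = Dom C h" "Dom C h' = Dom C p"
      "Cod C h' = Dom C ?q" "?q \<cdot> h' = h \<cdot> p" by (rule epi_pullback[OF q(2) h(1)]) (use h f in simp)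
    have hc: "Cod C h = Cod C ?q" "Cod C h' = Dom C ?r" using h(2) f(2) p(6) q by simp_all
    have "null ((f \<cdot> h) \<cdot> p)" by (rule null_comp(2)[OF _ _ _ h(3)]) (use f(1,2) h(1) hc p(2,4) in simp_all)
    moreover have "(f \<cdot> h) \<cdot> p = f \<cdot> (?q \<cdot> h')" unfolding p(7) by (rule comp_assoc') (use f(1,2) h(1) hc p(2,4) in simp_all)
    moreover have "f \<cdot> (?q \<cdot> h') = ?e \<cdot> (?r \<cdot> h')"
      by (rule comp_cong_left[OF f(4)]) (use f(1,2) hc p(3) q e r in simp_all)
    ultimately have "null (?e \<cdot> (?r \<cdot> h'))" by simp
    then have "fac (?r \<cdot> h') ?rw" by (rule mono_fac[OF rw(3), rotated -1]) (use r hc p rw in simp_all)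
    then have "fac h' w'" by (rule fac_comp_left_mono[OF _ r(1)]) (use r hc p w' in simp_all)
    then have "null (?q \<cdot> h')" by (rule null_coker_fac)
    then have "null (h \<cdot> p)" using p by simp
    then show "null h" by (rule epiD[OF p(1)]) (use h p in simp_all)
  qed
  have ext: "(f, g) \<in> extensions C (Cod C g) (Dom C f)"
  proof (rule extensionI[OF fm eg _ gf])
    show "Dom C g = Cod C f" using g fc by simp
    fix h assume h: "h \<in> Arr C" "Cod C h = Dom C g" "null (g \<cdot> h)"
    obtain p h' where p: "epi_arr C p" "p \<in> Arr C" "h' \<in> Arr C" "Cod C p = Dom C h" "Dom C h' = Dom C p"
      "Cod C h' = Dom C ?e" "?e \<cdot> h' = h \<cdot> p" by (rule epi_pullback[OF e(3) h(1)]) (use h g in simp)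
    have hc: "Cod C h = Cod C ?e" "Cod C h' = Dom C z" using h(2) g p(6) e by simp_all
    have "null ((g \<cdot> h) \<cdot> p)" by (rule null_comp(2)[OF _ _ _ h(3)]) (use g(1,2) h(1) hc p(2,4) in simp_all)
    moreover have "(g \<cdot> h) \<cdot> p = g \<cdot> (?e \<cdot> h')" unfolding p(7) by (rule comp_assoc') (use g(1,2) h(1) hc p(2,4) in simp_all)
    moreover have "g \<cdot> (?e \<cdot> h') = s \<cdot> h'"
      using comp_assoc'[of h' ?e g] g e hc p(3) by (simp del: comp_assoc')
    ultimately have "null (s \<cdot> h')" by simp
    then have "fac h' ?r" by (rule ker_fac) (use z hc p(3) in simp_all)
    then obtain x where x: "x \<in> Arr C" "Cod C x = Dom C ?r" "?r \<cdot> x = h'" by (rule facE) blast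
    have "f \<cdot> (?q \<cdot> x) = ?e \<cdot> (?r \<cdot> x)" by (rule comp_cong_left[OF f(4)]) (use f(1,2) x q e r in simp_all)
    then have "h \<cdot> p = f \<cdot> (?q \<cdot> x)" using x(3) p(7) by simp
    then have "fac (h \<cdot> p) f" using facI[of f "?q \<cdot> x"] f(1,2) q x(1,2) by simp
    then show "fac h f" by (rule fac_epi_cancel[OF fm p(1)]) (use h p in simp_all)
  qed
  have "(iso_class C (Dom C f), iso_class C (Cod C g)) \<in> ext_quiver C"
  proof (rule ext_quiverI[OF ext])
    show "simple_obj C (Dom C f)" "simple_obj C (Cod C g)" using Qs f g z by simp_all
    fix \<sigma> assume \<sigma>: "\<sigma> \<in> Arr C" "Dom C \<sigma> = Cod C g" "Cod C \<sigma> = Dom C g"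
    \<comment> \<open>As a quotient of \<open>z\<close> the middle term is local with top map
      \<open>g\<close>. A section \<open>\<sigma>\<close> is nonzero on that top, hence epi, hence
      inverse to \<open>g\<close>, which would make \<open>f\<close> null.\<close>
    show "g \<cdot> \<sigma> \<noteq> Ident C (Cod C g)"
    proof
      assume gs: "g \<cdot> \<sigma> = Ident C (Cod C g)"
      have en: "\<not> null ?e" using null_comp(1)[of ?e g] g e z(9) by auto
      obtain t' where t': "local_top t'" "t' \<in> Arr C" "Dom C t' = Cod C ?e" "Cod C t' = Cod C s" "t' \<cdot> ?e = s"
        by (rule local_top_quotient[OF z(4) e(3) _ en]) (use e z in simp)
      have "t' = g" by (rule epi_arrD[OF e(3)]) (use t' g in simp_all)
      then have lg: "local_top g" using t' by simp
      have "\<not> null (g \<cdot> \<sigma>)" unfolding gs using simple_objD(2)[OF z(8)] g by simp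
      then have es: "epi_arr C \<sigma>" by (rule local_topD(6)[OF lg \<sigma>(1,3)])
      have "(\<sigma> \<cdot> g) \<cdot> \<sigma> = \<sigma> \<cdot> (g \<cdot> \<sigma>)" by (rule comp_assoc') (use \<sigma> g(1) in simp_all)
      also have "\<dots> = Ident C (Dom C g) \<cdot> \<sigma>" unfolding gs using \<sigma> by simp
      finally have sg: "\<sigma> \<cdot> g = Ident C (Dom C g)" by (rule epi_arrD[OF es, rotated -1]) (use \<sigma> g(1) in simp_all)
      have "null (\<sigma> \<cdot> (g \<cdot> f))" by (rule null_comp(1)[OF _ _ _ gf]) (use \<sigma> g(1,2) f(1) fc in simp_all)
      moreover have "\<sigma> \<cdot> (g \<cdot> f) = (\<sigma> \<cdot> g) \<cdot> f" by (rule comp_assoc'[symmetric]) (use \<sigma> g(1,2) f(1) fc in simp_all)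
      ultimately have "null f" unfolding sg using f(1) fc g by simp
      then show False using mono_null_zero[OF fm] simple_objD(2)[OF Qs] f by simp
    qed
  qed
  then show ?thesis using cls f(2) g(3) by simp
qed

text \<open>Take \<open>m\<close> maximal among the local subobjects strictly below \<open>z\<close>
  whose tops have no path to the top of \<open>z\<close>, and \<open>m'\<close> minimal among the
  local subobjects of \<open>z\<close> strictly above \<open>m\<close>. Then
  \<open>cover_ext_arrow\<close> gives an arrow from the top of \<open>m\<close> to that of
  \<open>m'\<close>, and \<open>m'\<close> either equals \<open>z\<close> or has a path to it by
  maximality of \<open>m\<close>.\<close>

lemma strict_inclusion_path:
  assumes "local_sub n t" "local_sub z s" "fac n z" "\<not> fac z n"
  shows "(iso_class C (Cod C t), iso_class C (Cod C s)) \<in> (ext_quiver C)\<^sup>+"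
proof (rule ccontr)
  assume neg: "\<not> ?thesis"
  let ?bad = "\<lambda>m tm. local_sub m tm \<and> fac m z \<and> \<not> fac z m \<and> (iso_class C (Cod C tm), iso_class C (Cod C s)) \<notin> (ext_quiver C)\<^sup>+"
  have "{m. \<exists>tm. ?bad m tm} \<noteq> {}" using neg assms by blast
  then obtain m where m0: "m \<in> {m. \<exists>tm. ?bad m tm}" and max: "\<And>m'. m' \<in> {m. \<exists>tm. ?bad m tm} \<Longrightarrow> fac m m' \<Longrightarrow> fac m' m"
    by (rule maximal_subobject[OF M_obj]) (use local_subD in blast)+
  obtain tm where m: "local_sub m tm" "fac m z" "\<not> fac z m" "(iso_class C (Cod C tm), iso_class C (Cod C s)) \<notin> (ext_quiver C)\<^sup>+"
    using m0 by blast
  let ?K = "{m'. \<exists>t'. local_sub m' t' \<and> fac m m' \<and> \<not> fac m' m \<and> fac m' z}"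
  have "z \<in> ?K" using assms m fac_refl local_subD(2) by blast
  then have "?K \<noteq> {}" by blast
  then obtain m' where m'0: "m' \<in> ?K" and min: "\<And>k. k \<in> ?K \<Longrightarrow> fac k m' \<Longrightarrow> fac m' k"
    by (rule minimal_subobject[OF M_obj]) (use local_subD in blast)+
  obtain t' where m': "local_sub m' t'" "fac m m'" "\<not> fac m' m" "fac m' z" using m'0 by blast
  have arr: "(iso_class C (Cod C tm), iso_class C (Cod C t')) \<in> ext_quiver C"
  proof (rule cover_ext_arrow[OF m(1) m'(1,2,3)])
    fix k tk assume k: "local_sub k tk" "fac m k" "fac k m'" "\<not> fac k m"
    then have "k \<in> ?K" using m'(4) fac_trans by blast
    then show "fac m' k" using min k by blast
  qed
  show False
  proof (cases "fac z m'")
    case True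
    then have "isomorphic C (Cod C t') (Cod C s)" using local_sub_isomorphic[OF m'(1) assms(2)] m' by blast
    then have "iso_class C (Cod C t') = iso_class C (Cod C s)" using iso_class_eq_iff isomorphic_obj by blast
    then show False using arr m(4) by auto
  next
    case False
    have "(iso_class C (Cod C t'), iso_class C (Cod C s)) \<in> (ext_quiver C)\<^sup>+"
      using max[of m'] m' False by blast
    then show False using arr m(4) by (meson trancl_into_trancl2)
  qed
qed

end

section \<open>Finiteness of the set of join-irreducible subobjects\<close>

context distributive_object
begin

text \<open>Take \<open>u\<close> minimal among the subobjects of \<open>M\<close> above infinitely
  many members. If \<open>u\<close> is join-irreducible, all but at most one of these lie in its
  radical; otherwise \<open>u\<close> is the join of two smaller subobjects and, members being
  join-prime, one of the two is above infinitely many. Either way minimality fails.\<close>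

lemma finitely_many_local_subobjects:
  assumes "\<And>x. x \<in> \<Omega> \<Longrightarrow> \<exists>t. local_sub (i x) t"
    "\<And>x y. x \<in> \<Omega> \<Longrightarrow> y \<in> \<Omega> \<Longrightarrow> fac (i x) (i y) \<Longrightarrow> fac (i y) (i x) \<Longrightarrow> x = y"
  shows "finite \<Omega>"
proof (rule ccontr)
  assume inf: "infinite \<Omega>"
  let ?B = "\<lambda>u. {x \<in> \<Omega>. fac (i x) u}"
  let ?K = "{u. mono_arr C u \<and> Cod C u = M \<and> infinite (?B u)}"
  have iM: "iso_arr C (Ident C M)" using M_obj by simp
  have "fac (i x) (Ident C M)" if "x \<in> \<Omega>" for x
  proof -
    obtain t where "local_sub (i x) t" using assms(1)[OF \<open>x \<in> \<Omega>\<close>] by blast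
    then show ?thesis using iso_fac[OF iM, of "i x"] local_subD(2,3) M_obj by simp
  qed
  then have "?B (Ident C M) = \<Omega>" by blast
  then have "Ident C M \<in> ?K" using inf iso_arr_mono[OF iM] M_obj by simp
  then have ne: "?K \<noteq> {}" by blast
  obtain u where u0: "u \<in> ?K" and min: "\<And>v. v \<in> ?K \<Longrightarrow> fac v u \<Longrightarrow> fac u v"
    by (rule minimal_subobject[OF M_obj ne]) auto
  have u: "mono_arr C u" "Cod C u = M" "infinite (?B u)" using u0 by simp_all
  show False
  proof (cases "join_irreducible (subobjects C M) u")
    case True
    then obtain t where t: "local_sub u t" by (rule join_irreducible_local)
    note uD = local_subD[OF t]
    let ?v = "u \<cdot> ker t"
    have v: "mono_arr C ?v" "Cod C ?v = M" using mono_arr_comp[of "ker t" u] uD by simp_all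
    let ?E = "{x \<in> \<Omega>. fac (i x) u \<and> fac u (i x)}"
    have sub: "?B u \<subseteq> ?E \<union> ?B ?v"
    proof
      fix x assume x: "x \<in> ?B u"
      then obtain tx where "local_sub (i x) tx" using assms(1) by blast
      then have "mono_arr C (i x)" using local_subD by blast
      then show "x \<in> ?E \<union> ?B ?v" using local_sub_fac_cases[OF t, of "i x"] x by blast
    qed
    have "finite ?E"
    proof (cases "?E = {}")
      case False
      then obtain x where x: "x \<in> ?E" by blast
      have "?E \<subseteq> {x}" using x assms(2) fac_trans by blast
      then show ?thesis using finite_subset by blast
    next
      case True
      then show ?thesis by (simp only: finite.emptyI)
    qed
    then have "infinite (?B ?v)" using sub u(3) finite_subset by blast
    then have "fac u ?v" using min[of ?v] v facI[of u "ker t"] uD by simp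
    then show False using local_sub_not_below_rad[OF t] by simp
  next
    case False
    have "\<not> null u"
    proof
      assume n: "null u"
      have "?B u = {}" using assms(1) local_subD(10) null_fac[OF _ n] by blast
      then have "finite (?B u)" by (simp only: finite.emptyI)
      then show False using u(3) by (rule notE[rotated])
    qed
    then obtain y z where yz: "mono_arr C y" "Cod C y = M" "mono_arr C z" "Cod C z = M"
      and s: "fac u (sub_join y z)" "fac (sub_join y z) u" and n: "\<not> fac u y" "\<not> fac u z"
      using False u unfolding join_irreducible_iff by blast
    have le: "fac y u" "fac z u" using sub_join(3,4)[OF yz] s fac_trans by blast+
    have "?B u \<subseteq> ?B y \<union> ?B z"
    proof
      fix x assume x: "x \<in> ?B u"
      then obtain tx where tx: "local_sub (i x) tx" using assms(1) by blast
      have "fac (i x) (sub_join y z)" using x s fac_trans by blast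
      then show "x \<in> ?B y \<union> ?B z" using local_prime[OF tx yz] x by blast
    qed
    then have "infinite (?B y) \<or> infinite (?B z)" using u(3) finite_subset by blast
    then show False using min[of y] min[of z] le yz n by blast
  qed
qed

end

section \<open>Local objects as quotients of the M_x, and projectivity\<close>

locale distributive_generator = distributive_object C M
  for C :: "('o, 'm, 'z) additive_category_scheme" (structure) and M :: 'o +
  assumes ext_acyclic: "acyclic (ext_quiver C)"
    and generator: "X \<in> Obj C \<Longrightarrow>
      \<exists>n D \<iota> \<pi>. direct_sum C {..<n::nat} (\<lambda>_. M) D \<iota> \<pi> \<and> subquotient C X D"
    and top_surjective: "join_irreducible (subobjects C M) n \<Longrightarrow>
      top_map C (Dom C n) ` Hom C (Dom C n) (Dom C n)
        = Hom C (top_obj C (Dom C n)) (top_obj C (Dom C n))"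
begin

text \<open>The two are comparable, and a strict inclusion would give a path of positive length from
  the common vertex to itself. By symmetry, the top determines a local subobject of
  \<open>M\<close>.\<close>

lemma isomorphic_tops_fac:
  assumes "local_sub n t" "local_sub n' t'" "isomorphic C (Cod C t) (Cod C t')"
  shows "fac n n'"
proof (rule ccontr)
  assume neg: "\<not> fac n n'"
  then have "fac n' n" using isomorphic_tops_comparable[OF assms] by blast
  then have "(iso_class C (Cod C t'), iso_class C (Cod C t)) \<in> (ext_quiver C)\<^sup>+"
    using strict_inclusion_path[OF assms(2,1)] neg by blast
  moreover have "iso_class C (Cod C t) = iso_class C (Cod C t')"
    using iso_class_eq_iff isomorphic_obj assms(3) by blast
  ultimately show False using ext_acyclic unfolding acyclic_def by simp
qed

text \<open>(M3) speaks of the chosen \<open>top_proj\<close>; conjugating by the isomorphism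
  \<open>u\<close> of tops transfers it to an arbitrary top map \<open>t\<close>.\<close>

lemma lift_top_endo:
  assumes "local_sub n t" "d \<in> Arr C" "Dom C d = Cod C t" "Cod C d = Cod C t"
  obtains e where "e \<in> Arr C" "Dom C e = Dom C n" "Cod C e = Dom C n" "t \<cdot> e = d \<cdot> t"
proof -
  note n = local_subD[OF assms(1)]
  let ?q = "top_proj C (Dom C n)"
  have qd: "local_top ?q" "Dom C ?q = Dom C n" using rad_local[OF n(4)] n(5) by simp_all
  note q = local_topD[OF qd(1)]
  obtain u where u: "u \<in> Arr C" "Dom C u = Cod C t" "Cod C u = Cod C ?q" "u \<cdot> t = ?q" "\<not> null ?q \<Longrightarrow> iso_arr C u"
    by (rule local_top_unique[OF n(4) q(1)]) (use qd n q in simp_all)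
  have iu: "iso_arr C u" by (rule u(5)[OF q(4)])
  obtain w where w: "w \<in> Arr C" "Dom C w = Cod C u" "Cod C w = Dom C u" "w \<cdot> u = Ident C (Dom C u)"
    using iu by (rule iso_arrE) blast
  let ?d = "u \<cdot> (d \<cdot> w)"
  have "?d \<in> Hom C (top_obj C (Dom C n)) (top_obj C (Dom C n))"
    using u w assms by (simp add: top_obj_def)
  then have "?d \<in> top_map C (Dom C n) ` Hom C (Dom C n) (Dom C n)"
    using top_surjective[OF local_join_irreducible[OF assms(1)]] by simp
  then obtain e where e': "?d = top_map C (Dom C n) e" and e: "e \<in> Hom C (Dom C n) (Dom C n)" by (rule imageE)
  have "?d \<cdot> ?q = ?q \<cdot> e" using top_map_eq(2)[OF n(4), of e] e e' n(5) by simp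
  moreover have "?d \<cdot> ?q = u \<cdot> (d \<cdot> t)"
  proof -
    have "?d \<cdot> ?q = u \<cdot> (d \<cdot> (w \<cdot> ?q))" using u(1-3) w(1-3) assms q(1) by simp
    also have "w \<cdot> ?q = t" unfolding u(4)[symmetric] using comp_assoc'[of t u w] u(1-3) w n by (simp del: comp_assoc')
    finally show ?thesis .
  qed
  moreover have "?q \<cdot> e = u \<cdot> (t \<cdot> e)" unfolding u(4)[symmetric] by (rule comp_assoc') (use u(1-3) n e in simp_all)
  ultimately have "u \<cdot> (t \<cdot> e) = u \<cdot> (d \<cdot> t)" by simp
  then have "t \<cdot> e = d \<cdot> t"
    by (rule mono_arrD[OF iso_arr_mono[OF iu], rotated -1]) (use u(1-3) n e assms in simp_all)
  then show thesis by (rule that[rotated -1]) (use e in simp_all)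
qed

text \<open>The image \<open>m\<close> of a nonzero \<open>n \<cdot> g\<close> is local with the top
  of \<open>n\<close> and contained in \<open>n\<close>, so it equals \<open>n\<close> by
  \<open>isomorphic_tops_fac\<close>. Then \<open>g\<close> is epi and \<open>t\<close> would be
  null.\<close>

lemma null_if_top_null:
  assumes "local_sub n t" "local_top tV" "isomorphic C (Cod C tV) (Cod C t)"
    "g \<in> Arr C" "Dom C g = Dom C tV" "Cod C g = Dom C n" "null (t \<cdot> g)"
  shows "null g"
proof (rule ccontr)
  assume ng: "\<not> null g"
  note n = local_subD[OF assms(1)]
  have "\<not> null (n \<cdot> g)" using monoD[OF n(1), of g] ng assms by blast
  then obtain m e t' where m: "local_sub m t'" "epi_arr C e" "e \<in> Arr C" "Dom C e = Dom C (n \<cdot> g)" "Cod C e = Dom C m"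
    "m \<cdot> e = n \<cdot> g" "Cod C t' = Cod C tV"
    by (rule image_local_sub[OF assms(2), of "n \<cdot> g", rotated -2]) (use n assms in simp_all)
  note mD = local_subD[OF m(1)]
  have nm: "fac n m"
    by (rule isomorphic_tops_fac[OF assms(1) m(1)]) (use assms(3) m(7) isomorphic_sym in simp)
  have "fac (m \<cdot> e) n" unfolding m(6) by (rule facI) (use n assms in simp_all)
  then have "fac m n" by (rule fac_epi_cancel[OF n(1) m(2)]) (use m mD in simp_all)
  then obtain u where u: "iso_arr C u" "u \<in> Arr C" "Dom C u = Dom C m" "Cod C u = Dom C n" "n \<cdot> u = m"
    using fac_antisym[OF mD(1) n(1)] nm by blast
  have "n \<cdot> (u \<cdot> e) = (n \<cdot> u) \<cdot> e" by (rule comp_assoc'[symmetric]) (use u n m(3,5) in simp_all)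
  also have "\<dots> = n \<cdot> g" using u m by simp
  finally have ue: "u \<cdot> e = g"
    by (rule mono_arrD[OF n(1), rotated -1]) (use u(2-4) n m(3-5) assms(4-6) in simp_all)
  have "epi_arr C (u \<cdot> e)" by (rule epi_arr_comp[OF m(2) iso_arr_epi[OF u(1)]]) (use u m in simp)
  then have "epi_arr C g" using ue by simp
  then have "null t" by (rule epiD) (use assms n in simp_all)
  then show False using n by simp
qed

text \<open>A minimal local \<open>V\<close> over the given object embeds into some \<open>M\<^sup>n\<close>. All nonzero components
  \<open>V \<rightarrow> M\<close> have the same image \<open>n\<close>, and by (M3) they differ from one of them, \<open>p\<close>, only by
  endomorphisms of \<open>n\<close>. So \<open>p : V \<rightarrow> n\<close> is a monomorphism.\<close>

lemma local_is_quotient: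
  assumes "local_top t"
  obtains n s p where "local_sub n s" "epi_arr C p" "p \<in> Arr C" "Dom C p = Dom C n" "Cod C p = Dom C t" "isomorphic C (Cod C s) (Cod C t)"
proof -
  note t = local_topD[OF assms]
  have tt: "isomorphic C (Cod C t) (Cod C t)" by (rule isomorphic_refl) (use t in simp)
  have "Dom C t \<in> Obj C" using t by simp
  then obtain k D \<iota> \<pi> m q where D: "direct_sum C {..<k::nat} (\<lambda>_. M) D \<iota> \<pi>"
    and m: "mono_arr C m" "Cod C m = D" and q: "epi_arr C q" "Dom C q = Dom C m" "Cod C q = Dom C t"
    using generator[of "Dom C t"] unfolding subquotient_def by blast
  note dD = direct_sumD[OF D] and mA = mono_arr_arr[OF m(1)] and qA = epi_arr_arr[OF q(1)]
  obtain v where v: "mono_arr C v" "v \<in> Arr C" "Cod C v = Dom C q" "epi_arr C (q \<cdot> v)" "local_top (t \<cdot> (q \<cdot> v))"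
    by (rule minimal_cover[OF assms q(1,3)])
  let ?tV = "t \<cdot> (q \<cdot> v)"
  note tV = local_topD[OF v(5)]
  have tVd: "Dom C ?tV = Dom C v" "Cod C ?tV = Cod C t" using v(2,3) q t qA by simp_all
  let ?F = "m \<cdot> v"
  have F: "?F \<in> Arr C" "Dom C ?F = Dom C v" "Cod C ?F = D" "mono_arr C ?F"
    using mono_arr_comp[OF v(1) m(1)] v(2,3) m mA q by simp_all
  have \<pi>F: "\<pi> l \<cdot> ?F \<in> Arr C" "Dom C (\<pi> l \<cdot> ?F) = Dom C ?tV" "Cod C (\<pi> l \<cdot> ?F) = M" if "l \<in> {..<k}" for l
    using comp_arr[of ?F "\<pi> l"] F dD that tVd by (simp_all del: comp_assoc')
  have "\<exists>l\<in>{..<k}. \<not> null (\<pi> l \<cdot> ?F)"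
  proof (rule ccontr)
    assume neg: "\<not> ?thesis"
    have z: "hzero C (Dom C v) D \<in> Hom C (Dom C v) D" using v dD by simp
    have FH: "?F \<in> Hom C (Dom C v) D" using F by simp
    have "?F = hzero C (Dom C v) D"
    proof (rule direct_sum_ext_right[OF D FH z])
      fix l assume l: "l \<in> {..<k}"
      have "\<pi> l \<cdot> ?F = hzero C (Dom C v) M" by (rule nullD) (use neg \<pi>F[OF l] tVd l in simp_all)
      then show "\<pi> l \<cdot> ?F = \<pi> l \<cdot> hzero C (Dom C v) D" using l dD v by simp
    qed
    then have "null ?F" by (rule nullI) (use v dD in simp_all)
    then show False using mono_null_zero[OF F(4)] F tV(5) tVd by simp
  qed
  then obtain l0 where l0: "l0 \<in> {..<k}" "\<not> null (\<pi> l0 \<cdot> ?F)" by blast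
  obtain n p s where n: "local_sub n s" "epi_arr C p" "p \<in> Arr C" "Dom C p = Dom C (\<pi> l0 \<cdot> ?F)" "Cod C p = Dom C n"
     "n \<cdot> p = \<pi> l0 \<cdot> ?F" "s \<cdot> p = ?tV" "Cod C s = Cod C ?tV"
    by (rule image_local_sub[OF v(5) \<pi>F[OF l0(1)] l0(2)])
  note nD = local_subD[OF n(1)]
  have pd: "Dom C p = Dom C v" using n(4) \<pi>F(2)[OF l0(1)] tVd by simp
  have factor: "\<exists>e \<in> Hom C (Dom C n) (Dom C n). \<pi> l \<cdot> ?F = n \<cdot> (e \<cdot> p)" if l: "l \<in> {..<k}" "\<not> null (\<pi> l \<cdot> ?F)" for l
  proof -
    obtain m2 p2 s2 where m2: "local_sub m2 s2" "epi_arr C p2" "p2 \<in> Arr C" "Dom C p2 = Dom C (\<pi> l \<cdot> ?F)" "Cod C p2 = Dom C m2"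
       "m2 \<cdot> p2 = \<pi> l \<cdot> ?F" "Cod C s2 = Cod C ?tV"
      by (rule image_local_sub[OF v(5) \<pi>F[OF l(1)] l(2)])
    note m2D = local_subD[OF m2(1)]
    have "fac m2 n"
      by (rule isomorphic_tops_fac[OF m2(1) n(1)]) (use tt tVd m2(7) n(8) in simp)
    then have "fac (\<pi> l \<cdot> ?F) n" using facI[of m2 p2] fac_trans m2(3,5,6) m2D(2) by metis
    then obtain f where f: "f \<in> Arr C" "Dom C f = Dom C (\<pi> l \<cdot> ?F)" "Cod C f = Dom C n" "n \<cdot> f = \<pi> l \<cdot> ?F"
      by (rule facE)
    have fd: "Dom C f = Dom C v" using f(2) \<pi>F(2)[OF l(1)] tVd by simp
    obtain d where d: "d \<in> Arr C" "Dom C d = Cod C ?tV" "Cod C d = Cod C (s \<cdot> f)" "d \<cdot> ?tV = s \<cdot> f"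
      by (rule local_top_unique[OF v(5), of "s \<cdot> f"]) (use f(1,3) fd tVd nD in simp_all)
    have dc: "Dom C d = Cod C s" "Cod C d = Cod C s" using d(2,3) n(8) f(1,3) nD by simp_all
    obtain e where e: "e \<in> Arr C" "Dom C e = Dom C n" "Cod C e = Dom C n" "s \<cdot> e = d \<cdot> s"
      by (rule lift_top_endo[OF n(1) d(1) dc])
    \<comment> \<open>\<open>d\<close> is the effect of \<open>f\<close> on the top, and
      \<open>e\<close> is an endomorphism inducing \<open>d\<close> on the top of \<open>n\<close>;
      so the difference vanishes on the top and is null.\<close>
    let ?g = "hsub f (e \<cdot> p)"
    have ep: "e \<cdot> p \<in> Arr C" "Dom C (e \<cdot> p) = Dom C v" "Cod C (e \<cdot> p) = Dom C n" using e n pd by simp_all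
    have g: "?g \<in> Arr C" "Dom C ?g = Dom C v" "Cod C ?g = Dom C n" using f fd ep by simp_all
    have "s \<cdot> (e \<cdot> p) = d \<cdot> (s \<cdot> p)" by (rule comp_cong_left[OF e(4)]) (use e d(1) dc n(3,5) nD in simp_all)
    also have "\<dots> = s \<cdot> f" using n(7) d by simp
    finally have "s \<cdot> ?g = hsub (s \<cdot> f) (s \<cdot> f)"
      using f fd ep nD by (simp add: comp_hsub del: comp_assoc')
    then have "null (s \<cdot> ?g)" using null_hsub_self[of "s \<cdot> f"] f nD by simp
    then have "null ?g"
      by (rule null_if_top_null[OF n(1) v(5), rotated -1]) (use g tVd n(8) tt in simp_all)
    then have "f = e \<cdot> p" by (rule null_hsub_iff[THEN iffD1, rotated -1]) (use f fd ep in simp_all)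
    then have "\<pi> l \<cdot> ?F = n \<cdot> (e \<cdot> p)" using f(4) by simp
    then show ?thesis using e(1-3) by (intro bexI[of _ e]) simp_all
  qed
  \<comment> \<open>Every component of \<open>?F\<close> is null or factors through
    \<open>p\<close>, so whatever \<open>p\<close> kills is killed by the monomorphism
    \<open>?F\<close>.\<close>
  have pm: "mono_arr C p" unfolding mono_iff
  proof (intro conjI ballI impI n(3))
    fix h assume h: "h \<in> Arr C" "Cod C h = Dom C p" "null (p \<cdot> h)"
    have hc: "Cod C h = Dom C v" using h pd by simp
    have Fh: "?F \<cdot> h \<in> Hom C (Dom C h) D" using comp_arr[of h ?F] F h hc by (simp del: comp_assoc')
    have z: "hzero C (Dom C h) D \<in> Hom C (Dom C h) D" using h dD by simp
    have "?F \<cdot> h = hzero C (Dom C h) D"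
    proof (rule direct_sum_ext_right[OF D Fh z])
      fix l assume l: "l \<in> {..<k}"
      have as: "\<pi> l \<cdot> (?F \<cdot> h) = (\<pi> l \<cdot> ?F) \<cdot> h" by (rule comp_assoc'[symmetric]) (use F h hc dD l in simp_all)
      have "null ((\<pi> l \<cdot> ?F) \<cdot> h)"
      proof (cases "null (\<pi> l \<cdot> ?F)")
        case True
        show ?thesis by (rule null_comp(2)[OF h(1) _ _ True]) (use \<pi>F[OF l] tVd hc in simp_all)
      next
        case False
        obtain e where e: "e \<in> Hom C (Dom C n) (Dom C n)" "\<pi> l \<cdot> ?F = n \<cdot> (e \<cdot> p)" using factor[OF l False] by blast
        have "(n \<cdot> (e \<cdot> p)) \<cdot> h = (n \<cdot> e) \<cdot> (p \<cdot> h)" using e(1) n(3,5) nD h by simp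
        moreover have "null ((n \<cdot> e) \<cdot> (p \<cdot> h))" by (rule null_comp(1)[OF _ _ _ h(3)]) (use e(1) n(3,5) nD h in simp_all)
        ultimately show ?thesis unfolding e(2) by simp
      qed
      then have "null (\<pi> l \<cdot> (?F \<cdot> h))" unfolding as .
      then have "\<pi> l \<cdot> (?F \<cdot> h) = hzero C (Dom C h) M" by (rule nullD) (use l dD Fh in simp_all)
      also have "\<dots> = \<pi> l \<cdot> hzero C (Dom C h) D" using l dD h by simp
      finally show "\<pi> l \<cdot> (?F \<cdot> h) = \<pi> l \<cdot> hzero C (Dom C h) D" .
    qed
    then have "null (?F \<cdot> h)" by (rule nullI) (use h dD in simp_all)
    then show "null h" by (rule monoD[OF F(4)]) (use h hc F in simp_all)
  qed
  \<comment> \<open>Hence \<open>V\<close> is isomorphic to the source of \<open>n\<close>, and the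
    minimal cover \<open>q \<cdot> v\<close> becomes the required quotient map.\<close>
  have "iso_arr C p" by (rule mono_epi_iso[OF pm n(2)])
  then obtain p' where p': "p' \<in> Arr C" "Dom C p' = Cod C p" "Cod C p' = Dom C p" "iso_arr C p'" by (rule iso_arrE) blast
  have "epi_arr C ((q \<cdot> v) \<cdot> p')"
    by (rule epi_arr_comp[OF iso_arr_epi[OF p'(4)] v(4)]) (use p' pd v qA in simp)
  then show thesis
    by (rule that[OF n(1)]) (use p' pd v(2,3) qA q n(5,8) tVd tt in simp_all)
qed

lemma local_sub_projective:
  assumes "local_sub n t" shows "projective_obj C (Dom C n)"
  unfolding projective_obj_def
proof (intro conjI allI impI ballI)
  note n = local_subD[OF assms]
  show "Dom C n \<in> Obj C" using n by simp
  fix e f assume e: "epi_arr C e" and f: "f \<in> Hom C (Dom C n) (Cod C e)"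
  note eA = epi_arr_arr[OF e]
  have fA: "f \<in> Arr C" "Cod C f = Cod C e" "Dom C f = Dom C n" using f by simp_all
  obtain b a where b: "epi_arr C b" "b \<in> Arr C" "a \<in> Arr C" "Cod C b = Dom C f" "Dom C a = Dom C b"
      "Cod C a = Dom C e" "e \<cdot> a = f \<cdot> b" by (rule epi_pullback[OF e fA(1,2)])
  have bc: "Cod C b = Dom C t" "Cod C b = Dom C n" using b fA n by simp_all
  obtain v where v: "mono_arr C v" "v \<in> Arr C" "Cod C v = Dom C b" "epi_arr C (b \<cdot> v)" "local_top (t \<cdot> (b \<cdot> v))"
    by (rule minimal_cover[OF n(4) b(1) bc(1)])
  obtain n' s' c where c: "local_sub n' s'" "epi_arr C c" "c \<in> Arr C" "Dom C c = Dom C n'" "Cod C c = Dom C (t \<cdot> (b \<cdot> v))"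
     "isomorphic C (Cod C s') (Cod C (t \<cdot> (b \<cdot> v)))" by (rule local_is_quotient[OF v(5)])
  note n' = local_subD[OF c(1)]
  have cc: "Cod C c = Dom C v" "isomorphic C (Cod C s') (Cod C t)" using c(5,6) n b(2) bc v(2,3) by simp_all
  have "fac n n'" "fac n' n"
    using isomorphic_tops_fac[OF c(1) assms cc(2)] isomorphic_tops_fac[OF assms c(1) isomorphic_sym[OF cc(2)]] by simp_all
  then obtain w where w: "iso_arr C w" "w \<in> Arr C" "Dom C w = Dom C n" "Cod C w = Dom C n'"
    using fac_antisym[OF n(1) n'(1)] by blast
  let ?cw = "c \<cdot> w"
  have cw: "?cw \<in> Arr C" "Dom C ?cw = Dom C n" "Cod C ?cw = Dom C v" "epi_arr C ?cw"
    using epi_arr_comp[OF iso_arr_epi[OF w(1)] c(2)] c w cc by simp_all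
  \<comment> \<open>The local cover \<open>v\<close> inside the pullback is a quotient of some
    \<open>n'\<close> with the same top, which is \<open>n\<close> up to the isomorphism
    \<open>w\<close>; so \<open>?h\<close> is an epic endomorphism of the source of
    \<open>n\<close>.\<close>
  let ?h = "(b \<cdot> v) \<cdot> ?cw"
  have hA: "?h \<in> Arr C" "Dom C ?h = Dom C n" "Cod C ?h = Dom C n"
    using comp_arr[of ?cw "b \<cdot> v"] cw b(2) bc v by (simp_all del: comp_assoc')
  have he: "epi_arr C ?h" by (rule epi_arr_comp[OF cw(4) v(4)]) (use cw b v in simp)
  have thA: "t \<cdot> ?h \<in> Arr C" "Dom C (t \<cdot> ?h) = Dom C t" "Cod C (t \<cdot> ?h) = Cod C t"
    using comp_arr[of ?h t] hA n by (simp_all del: comp_assoc')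
  have thn: "\<not> null (t \<cdot> ?h)" using epiD[OF he, of t] n hA by auto
  \<comment> \<open>\<open>d\<close> is the effect of \<open>?h\<close> on the top, invertible by
    \<open>local_top_unique\<close>. \<open>e'\<close> lifts its inverse by (M3), so
    \<open>e' \<cdot> ?h\<close> and the identity agree on the top and are equal by
    \<open>null_if_top_null\<close>.\<close>
  obtain d where d: "d \<in> Arr C" "Dom C d = Cod C t" "Cod C d = Cod C (t \<cdot> ?h)" "d \<cdot> t = t \<cdot> ?h" "\<not> null (t \<cdot> ?h) \<Longrightarrow> iso_arr C d"
    by (rule local_top_unique[OF n(4) thA(1,2)]) (use thA n in simp_all)
  have di: "iso_arr C d" by (rule d(5)[OF thn])
  obtain d' where d': "d' \<in> Arr C" "Dom C d' = Cod C d" "Cod C d' = Dom C d" "d' \<cdot> d = Ident C (Dom C d)"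
    using di by (rule iso_arrE) blast
  have dc: "Cod C d = Cod C t" using d(3) thA(3) by simp
  have dc': "Dom C d' = Cod C t" "Cod C d' = Cod C t" using d' d(2) dc by simp_all
  obtain e' where e': "e' \<in> Arr C" "Dom C e' = Dom C n" "Cod C e' = Dom C n" "t \<cdot> e' = d' \<cdot> t"
    by (rule lift_top_endo[OF assms d'(1) dc'])
  have e'h: "e' \<cdot> ?h \<in> Arr C" "Dom C (e' \<cdot> ?h) = Dom C n" "Cod C (e' \<cdot> ?h) = Dom C n"
    using comp_arr[of ?h e'] hA e' by (simp_all del: comp_assoc')
  have "t \<cdot> (e' \<cdot> ?h) = d' \<cdot> (t \<cdot> ?h)" by (rule comp_cong_left[OF e'(4)]) (use e' hA n d'(1) dc' in simp_all)
  also have "\<dots> = d' \<cdot> (d \<cdot> t)" using d(4) by simp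
  also have "\<dots> = t" using comp_assoc'[of t d d'] d' d(1,2) n by (simp del: comp_assoc')
  finally have te: "t \<cdot> (e' \<cdot> ?h) = t" .
  have idn: "Ident C (Dom C n) \<in> Arr C" "Dom C (Ident C (Dom C n)) = Dom C n" "Cod C (Ident C (Dom C n)) = Dom C n"
    using n by simp_all
  have "t \<cdot> hsub (e' \<cdot> ?h) (Ident C (Dom C n)) = hsub (t \<cdot> (e' \<cdot> ?h)) (t \<cdot> Ident C (Dom C n))"
    by (rule comp_hsub(1)) (use e'h idn n in simp_all)
  also have "\<dots> = hsub t t" unfolding te using n by simp
  finally have "null (t \<cdot> hsub (e' \<cdot> ?h) (Ident C (Dom C n)))" using null_hsub_self[of t] n by simp
  then have "null (hsub (e' \<cdot> ?h) (Ident C (Dom C n)))"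
    by (rule null_if_top_null[OF assms n(4), rotated -1]) (use e'h idn isomorphic_refl[of "Cod C t"] n in \<open>simp_all del: comp_assoc'\<close>)
  then have e'h1: "e' \<cdot> ?h = Ident C (Dom C n)"
    by (rule null_hsub_iff[THEN iffD1, rotated -1]) (use e'h idn in \<open>simp_all del: comp_assoc'\<close>)
  have "(?h \<cdot> e') \<cdot> ?h = ?h \<cdot> (e' \<cdot> ?h)" by (rule comp_assoc') (use hA e' in simp_all)
  also have "\<dots> = Ident C (Dom C n) \<cdot> ?h" unfolding e'h1 using hA by (simp del: comp_assoc')
  finally have he1: "?h \<cdot> e' = Ident C (Dom C n)"
    by (rule epi_arrD[OF he, rotated -1]) (use hA e' idn comp_arr[of e' ?h] in \<open>simp_all del: comp_assoc'\<close>)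
  \<comment> \<open>Since \<open>?h \<cdot> e'\<close> is the identity, \<open>?x\<close> is a
    section of \<open>b\<close>; following it by the other leg \<open>a\<close> of the pullback
    lifts \<open>f\<close>.\<close>
  let ?x = "v \<cdot> (?cw \<cdot> e')"
  have x: "?x \<in> Arr C" "Dom C ?x = Dom C n" "Cod C ?x = Dom C b"
    using cw v(2,3) e' comp_arr[of e' ?cw] comp_arr[of "?cw \<cdot> e'" v] by (simp_all del: comp_assoc')
  have "e \<cdot> (a \<cdot> ?x) = f \<cdot> (b \<cdot> ?x)" by (rule comp_cong_left[OF b(7)]) (use eA b x fA in \<open>simp_all del: comp_assoc'\<close>)
  also have "b \<cdot> ?x = ?h \<cdot> e'" using b(2) v(2,3) c w cc e' by simp
  finally have "e \<cdot> (a \<cdot> ?x) = f" unfolding he1 using fA by simp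
  moreover have "a \<cdot> ?x \<in> Hom C (Dom C n) (Dom C e)" using comp_arr[of ?x a] x b by (simp del: comp_assoc')
  ultimately show "\<exists>g \<in> Hom C (Dom C n) (Dom C e). e \<cdot> g = f" by blast
qed

end

section \<open>Projective and simple objects\<close>

context length_category
begin

text \<open>The top map is nonzero on one of the two summands, whose injection is then epi; the
  projection to the other summand kills that injection, so the other summand is zero.\<close>

lemma local_indecomposable:
  assumes "local_top t" shows "indecomposable_obj C (Dom C t)"
  unfolding indecomposable_obj_def
proof (intro conjI allI impI)
  note t = local_topD[OF assms]
  show "Dom C t \<in> Obj C" "\<not> zero_obj C (Dom C t)" using t by (simp_all add: zero_obj_iff)
  fix Y \<iota> \<pi> assume d: "direct_sum C {0, 1 :: nat} Y (Dom C t) \<iota> \<pi>"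
  note D = direct_sumD[OF d]
  have zero: "zero_obj C (Y l)" if kl: "k \<in> {0, 1}" "l \<in> {0, 1}" "k \<noteq> l" "\<not> null (t \<cdot> \<iota> k)" for k l
  proof -
    have e: "epi_arr C (\<iota> k)" by (rule t(6)[OF _ _ kl(4)]) (use D kl(1) in simp_all)
    have "\<pi> l \<cdot> \<iota> k = hzero C (Y k) (Y l)" using D(11)[OF kl(2,1)] kl(3) by simp
    then have "null (\<pi> l \<cdot> \<iota> k)" by (rule nullI) (use D(4) kl in simp_all)
    then have "null (\<pi> l)" by (rule epiD[OF e]) (use D(7-10)[OF kl(2)] D(7)[OF kl(1)] in simp_all)
    then have "null (\<pi> l \<cdot> \<iota> l)" by (rule null_comp(2)[rotated -1]) (use D(5-10)[OF kl(2)] in simp_all)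
    then show ?thesis using D(4,11) kl(2) by (simp add: zero_obj_iff)
  qed
  have "\<exists>k \<in> {0, 1}. \<not> null (t \<cdot> \<iota> k)"
  proof (rule ccontr)
    assume neg: "\<not> ?thesis"
    have T: "t \<in> Hom C (Dom C t) (Cod C t)" "hzero C (Dom C t) (Cod C t) \<in> Hom C (Dom C t) (Cod C t)" using t by simp_all
    have "t = hzero C (Dom C t) (Cod C t)"
    proof (rule direct_sum_ext_left[OF d T])
      fix k :: nat assume k: "k \<in> {0, 1}"
      have "t \<cdot> \<iota> k = hzero C (Y k) (Cod C t)" by (rule nullD) (use neg k t D(5-7)[OF k] in auto)
      then show "t \<cdot> \<iota> k = hzero C (Dom C t) (Cod C t) \<cdot> \<iota> k" using D(5-7)[OF k] t by simp
    qed
    then have "null t" by (rule nullI) (use t in simp_all)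
    then show False using t by simp
  qed
  then show "zero_obj C (Y 0) \<or> zero_obj C (Y 1)" using zero[of 0 1] zero[of 1 0] by auto
qed

lemma local_top_epi_isomorphic:
  assumes "local_top t" "local_top t'" "epi_arr C u" "Dom C u = Dom C t" "Cod C u = Dom C t'"
  shows "isomorphic C (Cod C t) (Cod C t')"
proof -
  note t = local_topD[OF assms(1)] and t' = local_topD[OF assms(2)] and u = epi_arr_arr[OF assms(3)]
  have tu: "\<not> null (t' \<cdot> u)" using epiD[OF assms(3), of t'] t' assms by auto
  obtain v where v: "v \<in> Arr C" "Dom C v = Cod C t" "Cod C v = Cod C (t' \<cdot> u)" "v \<cdot> t = t' \<cdot> u" "\<not> null (t' \<cdot> u) \<Longrightarrow> iso_arr C v"
    by (rule local_top_unique[OF assms(1), of "t' \<cdot> u"]) (use u t' assms(3-) in simp_all)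
  show ?thesis using isomorphicI[OF v(5)[OF tu]] v(2,3) u t' assms by simp
qed

text \<open>The section splits off the kernel: \<open>id - s \<cdot> g\<close> factors through
  \<open>ker g\<close> by a retraction \<open>r\<close>, so the domain of \<open>g\<close> is the
  biproduct of its codomain and its kernel, and indecomposability makes the kernel vanish.\<close>

lemma split_epi_indecomposable_iso:
  assumes "indecomposable_obj C (Dom C g)" "g \<in> Arr C" "s \<in> Arr C" "Dom C s = Cod C g" "Cod C s = Dom C g"
    "g \<cdot> s = Ident C (Cod C g)" "\<not> null (Ident C (Cod C g))"
  shows "iso_arr C g"
proof -
  let ?Q = "Dom C g" and ?N = "Cod C g" and ?k = "ker g"
  have o: "?Q \<in> Obj C" "?N \<in> Obj C" using assms by simp_all
  have k: "?k \<in> Arr C" "Cod C ?k = ?Q" "mono_arr C ?k" "null (g \<cdot> ?k)" using assms by simp_all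
  have i: "Ident C ?Q \<in> Arr C" "Dom C (Ident C ?Q) = ?Q" "Cod C (Ident C ?Q) = ?Q" using o by simp_all
  let ?d = "hsub (Ident C ?Q) (s \<cdot> g)"
  have d: "?d \<in> Arr C" "Dom C ?d = ?Q" "Cod C ?d = ?Q" using i assms by simp_all
  have gsg: "g \<cdot> (s \<cdot> g) = g" using comp_assoc'[of g s g] assms(2-6) by (simp del: comp_assoc')
  have "g \<cdot> ?d = hsub g g" using assms(2-5) gsg i by (simp add: comp_hsub)
  then have "null (g \<cdot> ?d)" using null_hsub_self assms by simp
  then have "fac ?d ?k" by (rule ker_fac) (use d assms in simp_all)
  then obtain r where r: "r \<in> Arr C" "Dom C r = ?Q" "Cod C r = Dom C ?k" "?k \<cdot> r = ?d"
    by (rule facE) (use d in simp_all)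
  have rk: "r \<cdot> ?k = Ident C (Dom C ?k)"
  proof (rule mono_arrD[OF k(3)])
    have n: "null (s \<cdot> (g \<cdot> ?k))" by (rule null_comp(1)[OF _ _ _ k(4)]) (use assms k in simp_all)
    have "?k \<cdot> (r \<cdot> ?k) = (?k \<cdot> r) \<cdot> ?k" by (rule comp_assoc'[symmetric]) (use r k in simp_all)
    also have "\<dots> = hsub ?k (s \<cdot> (g \<cdot> ?k))" unfolding r(4) using assms(2-5) k i by (simp add: comp_hsub)
    also have "\<dots> = ?k" by (rule hsub_null[OF _ _ _ _ n]) (use assms(2-5) k in simp_all)
    also have "\<dots> = ?k \<cdot> Ident C (Dom C ?k)" using k by simp
    finally show "?k \<cdot> (r \<cdot> ?k) = ?k \<cdot> Ident C (Dom C ?k)" .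
  qed (use r k in auto)
  have rs: "null (r \<cdot> s)"
  proof (rule monoD[OF k(3)])
    have sgs: "s \<cdot> (g \<cdot> s) = s" using assms(3-6) by simp
    have "?k \<cdot> (r \<cdot> s) = (?k \<cdot> r) \<cdot> s" by (rule comp_assoc'[symmetric]) (use r k assms in simp_all)
    also have "\<dots> = hsub s s" unfolding r(4) using assms(2-5) sgs i by (simp add: comp_hsub)
    finally show "null (?k \<cdot> (r \<cdot> s))" using null_hsub_self assms by simp
  qed (use r assms in simp_all)
  let ?Y = "\<lambda>k::nat. if k = 0 then ?N else Dom C (ker g)"
  let ?\<iota> = "\<lambda>k::nat. if k = 0 then s else ker g" and ?\<pi> = "\<lambda>k::nat. if k = 0 then g else r"
  interpret G: abelian_group "hom_group C ?Q ?Q" by (rule hom_abelian_group) (use o in simp_all)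
  have "(\<Oplus>\<^bsub>hom_group C ?Q ?Q\<^esub>k\<in>{0, 1}. ?\<iota> k \<cdot> ?\<pi> k) = hadd C (s \<cdot> g) (?k \<cdot> r)"
  proof -
    have h: "s \<cdot> g \<in> Hom C ?Q ?Q" "?k \<cdot> r \<in> Hom C ?Q ?Q" using assms(2-5) r k by (simp_all del: in_Hom add: Hom_def)
    have "(\<Oplus>\<^bsub>hom_group C ?Q ?Q\<^esub>k\<in>{1}. ?\<iota> k \<cdot> ?\<pi> k) = ?k \<cdot> r"
      by (subst finsum_hom_delta[of _ _ _ 1]) (use h o in simp_all)
    then show ?thesis
      using G.finsum_insert[of "{1}" "0::nat" "\<lambda>k. ?\<iota> k \<cdot> ?\<pi> k"] h by simp
  qed
  also have "\<dots> = hadd C ?d (s \<cdot> g)" unfolding r(4) by (rule hadd_comm) (use assms(2-5) d in simp_all)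
  also have "\<dots> = Ident C ?Q" by (rule hadd_hsub_cancel(3)) (use assms(2-5) i in simp_all)
  finally have sum: "(\<Oplus>\<^bsub>hom_group C ?Q ?Q\<^esub>k\<in>{0, 1}. ?\<iota> k \<cdot> ?\<pi> k) = Ident C ?Q" .
  have gk: "g \<cdot> ?k = hzero C (Dom C ?k) ?N" by (rule nullD[OF k(4)]) (use assms k in simp_all)
  have rs': "r \<cdot> s = hzero C ?N (Dom C ?k)" by (rule nullD[OF rs]) (use assms r in simp_all)
  have "direct_sum C {0, 1} ?Y ?Q ?\<iota> ?\<pi>"
    unfolding direct_sum_def using sum o k(1,2) assms(2-6) r(1-3) rk rs' gk by auto
  then have "zero_obj C (?Y 0) \<or> zero_obj C (?Y 1)" using assms(1) unfolding indecomposable_obj_def by blast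
  then have "null (Ident C (Dom C ?k))" using assms(7) by (simp add: zero_obj_iff)
  then have "null ?k" by (rule null_ident_comp(1)) (use k in simp_all)
  then have "mono_arr C g" by (rule mono_if_ker_null[OF assms(2)])
  then show ?thesis by (rule mono_split_epi_iso[of g s]) (use assms in simp_all)
qed

text \<open>Let \<open>j\<close> be the image of an arrow that \<open>g\<close> does not kill. If
  \<open>j\<close> did not contain the simple \<open>S\<close>, it would meet \<open>S\<close> in
  zero, so \<open>g \<cdot> j\<close> would be an isomorphism and split \<open>g\<close>. Hence
  \<open>j\<close> contains \<open>S\<close> and maps onto \<open>T\<close>, so it is
  everything.\<close>

lemma nonsplit_extension_local:
  assumes ext: "(f, g) \<in> extensions C T S" and S: "simple_obj C S" and T: "simple_obj C T"
    and ns: "\<forall>s \<in> Hom C T (Dom C g). g \<cdot> s \<noteq> Ident C T"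
  shows "local_top g"
proof (rule local_topI)
  note e = extensionsD[OF ext]
  show "g \<in> Arr C" "simple_obj C (Cod C g)" using e T by simp_all
  show "\<not> null g" using epi_null_zero[OF e(7)] simple_objD(2)[OF T] e by auto
  fix h assume h: "h \<in> Arr C" "Cod C h = Dom C g" "\<not> null (g \<cdot> h)"
  obtain j p where j: "mono_arr C j" "epi_arr C p" "j \<in> Arr C" "p \<in> Arr C" "Dom C p = Dom C h"
    "Cod C j = Cod C h" "Dom C j = Cod C p" "j \<cdot> p = h" by (rule image_factorization[OF h(1)])
  have jc: "Cod C j = Dom C g" "Cod C j = Cod C f" using j h e by simp_all
  have "\<not> null (g \<cdot> j)"
  proof
    assume "null (g \<cdot> j)"
    then have "null ((g \<cdot> j) \<cdot> p)" by (rule null_comp(2)[rotated -1]) (use j(3,4,7) jc e in simp_all)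
    then show False using h(3) j(3,4,7,8) jc(1) e(2) by simp
  qed
  then have gj: "epi_arr C (g \<cdot> j)" by (rule simple_epi[rotated -1]) (use j jc e T in simp_all)
  let ?c = "coker j"
  have c: "?c \<in> Arr C" "Dom C ?c = Dom C g" "null (?c \<cdot> j)" using j jc by simp_all
  have "null (?c \<cdot> f)"
  proof (rule ccontr)
    assume "\<not> null (?c \<cdot> f)"
    then have cf: "mono_arr C (?c \<cdot> f)" by (rule simple_mono[rotated -1]) (use c e S in simp_all)
    have "mono_arr C (g \<cdot> j)" unfolding mono_iff
    proof (intro conjI ballI impI)
      show "g \<cdot> j \<in> Arr C" using e j jc by simp
      fix k assume k: "k \<in> Arr C" "Cod C k = Dom C (g \<cdot> j)" "null ((g \<cdot> j) \<cdot> k)"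
      have kc: "Cod C k = Dom C j" using k(2) e(2) j(3) jc by simp
      have "null (g \<cdot> (j \<cdot> k))" using k(1,3) kc e(2) j(3) jc(1) by simp
      then have "fac (j \<cdot> k) f" by (rule e(9)[rotated -1]) (use k(1) kc j(3) jc in simp_all)
      then obtain x where x: "x \<in> Arr C" "Cod C x = Dom C f" "f \<cdot> x = j \<cdot> k" by (rule facE) blast
      have "(?c \<cdot> f) \<cdot> x = ?c \<cdot> (f \<cdot> x)" by (rule comp_assoc') (use c e x(1,2) in simp_all)
      also have "\<dots> = (?c \<cdot> j) \<cdot> k" unfolding x(3) by (rule comp_assoc'[symmetric]) (use c j(3) jc k(1) kc in simp_all)
      finally have "null ((?c \<cdot> f) \<cdot> x)" using null_comp(2)[OF k(1) _ _ c(3)] c j(3) jc kc by simp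
      then have "null x" by (rule monoD[OF cf]) (use c e x in simp_all)
      then have "null (f \<cdot> x)" by (rule null_comp(1)[rotated -1]) (use e x in simp_all)
      then show "null k" unfolding x(3) by (rule monoD[OF j(1)]) (use k(1) kc in simp_all)
    qed
    then have "iso_arr C (g \<cdot> j)" using gj by (rule mono_epi_iso)
    then obtain w where w: "w \<in> Arr C" "Dom C w = Cod C (g \<cdot> j)" "Cod C w = Dom C (g \<cdot> j)"
      "(g \<cdot> j) \<cdot> w = Ident C (Cod C (g \<cdot> j))" by (rule iso_arrE) blast
    have wd: "Dom C w = T" "Cod C w = Dom C j" using w(2,3) e(2,4) j(3) jc by simp_all
    have "g \<cdot> (j \<cdot> w) = Ident C T" using w(1,4) wd e(2,4) j(3) jc(1) by simp
    moreover have "j \<cdot> w \<in> Hom C T (Dom C g)" using w(1) wd j(3) jc(1) by simp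
    ultimately show False using ns by blast
  qed
  then have "null (?c \<cdot> ker g)"
  proof -
    assume cf: "null (?c \<cdot> f)"
    have "fac (ker g) f" by (rule e(9)) (use e in simp_all)
    then obtain u where u: "u \<in> Arr C" "Cod C u = Dom C f" "f \<cdot> u = ker g" by (rule facE) blast
    have "null ((?c \<cdot> f) \<cdot> u)" by (rule null_comp(2)[OF u(1) _ _ cf]) (use c e u in simp_all)
    moreover have "(?c \<cdot> f) \<cdot> u = ?c \<cdot> (f \<cdot> u)" by (rule comp_assoc') (use c e u(1,2) in simp_all)
    ultimately show ?thesis using u(3) by simp
  qed
  then obtain c' where c': "c' \<in> Arr C" "Dom C c' = Cod C g" "c' \<cdot> g = ?c"
    by (rule epi_fac[OF _ e(7)]) (use c in simp_all)
  have "c' \<cdot> (g \<cdot> j) = ?c \<cdot> j" using comp_assoc'[of j g c'] c' e(2) j(3) jc by (simp del: comp_assoc')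
  then have "null (c' \<cdot> (g \<cdot> j))" using c by simp
  then have "null c'" by (rule epiD[OF gj]) (use c' e(2) j(3) jc in simp_all)
  then have "null (c' \<cdot> g)" by (rule null_comp(2)[rotated -1]) (use c' e in simp_all)
  then have "null ?c" unfolding c'(3) .
  then have "epi_arr C j" by (rule epi_if_coker_null[OF j(3)])
  then have "epi_arr C (j \<cdot> p)" by (rule epi_arr_comp[OF j(2)]) (rule j(7))
  then show "epi_arr C h" using j by simp
qed

end

context category
begin

lemma class_of_eqI:
  assumes "fac m n" "fac n m" "mono_arr C m" "mono_arr C n"
  shows "class_of\<^bsub>subobjects C X\<^esub> m = class_of\<^bsub>subobjects C X\<^esub> n"
  unfolding eq_class_of_def
proof (intro Collect_cong conj_cong refl)
  fix y assume "y \<in> carrier (subobjects C X)"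
  then have "mono_arr C y" by simp
  then show "m .=\<^bsub>subobjects C X\<^esub> y \<longleftrightarrow> n .=\<^bsub>subobjects C X\<^esub> y"
    unfolding subobjects_eq[OF assms(3) \<open>mono_arr C y\<close>] subobjects_eq[OF assms(4) \<open>mono_arr C y\<close>]
    using assms(1,2) fac_trans by blast
qed

end

section \<open>The representatives M_x, their projectivity, tops and order\<close>

locale join_irreducible_family = distributive_generator C M
  for C :: "('o, 'm, 'z) additive_category_scheme" (structure) and M :: 'o +
  fixes \<Omega> :: "'x set" and i :: "'x \<Rightarrow> 'm"
  assumes irreducible: "x \<in> \<Omega> \<Longrightarrow> join_irreducible (subobjects C M) (i x)"
    and representatives: "bij_betw (\<lambda>x. class_of\<^bsub>subobjects C M\<^esub> (i x)) \<Omega>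
      {class_of\<^bsub>subobjects C M\<^esub> n | n. join_irreducible (subobjects C M) n}"
begin

abbreviation P where "P x \<equiv> Dom C (i x)"
abbreviation top_arr where "top_arr x \<equiv> top_proj C (P x)"

lemma local_sub_family: "x \<in> \<Omega> \<Longrightarrow> local_sub (i x) (top_arr x)"
proof -
  assume x: "x \<in> \<Omega>"
  obtain t where t: "local_sub (i x) t" by (rule join_irreducible_local[OF irreducible[OF x]])
  note tD = local_subD[OF t]
  show ?thesis using rad_local(2,3)[OF tD(4)] tD unfolding local_sub_def by simp
qed

lemma P_obj [simp]: "x \<in> \<Omega> \<Longrightarrow> P x \<in> Obj C"
  using local_subD(2)[OF local_sub_family] by simp

lemma family_cover:
  assumes "local_sub n t"
  obtains x where "x \<in> \<Omega>" "fac n (i x)" "fac (i x) n"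
proof -
  have "class_of\<^bsub>subobjects C M\<^esub> n \<in> {class_of\<^bsub>subobjects C M\<^esub> n | n. join_irreducible (subobjects C M) n}"
    using local_join_irreducible[OF assms] by blast
  then have "class_of\<^bsub>subobjects C M\<^esub> n \<in> (\<lambda>x. class_of\<^bsub>subobjects C M\<^esub> (i x)) ` \<Omega>"
    unfolding bij_betw_imp_surj_on[OF representatives] .
  then obtain x where x: "class_of\<^bsub>subobjects C M\<^esub> n = class_of\<^bsub>subobjects C M\<^esub> (i x)" "x \<in> \<Omega>"
    by (rule imageE)
  note xD = local_subD[OF local_sub_family[OF x(2)]]
  show thesis using that[OF x(2)] class_of_eqD[OF x(1) local_subD(1)[OF assms] xD(1,3)] .
qed

lemma family_inj:
  assumes "x \<in> \<Omega>" "y \<in> \<Omega>" "fac (i x) (i y)" "fac (i y) (i x)" shows "x = y"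
proof -
  have "class_of\<^bsub>subobjects C M\<^esub> (i x) = class_of\<^bsub>subobjects C M\<^esub> (i y)"
    by (rule class_of_eqI[OF assms(3,4)]) (use local_subD(1)[OF local_sub_family] assms in blast)+
  then show ?thesis by (rule inj_onD[OF bij_betw_imp_inj_on[OF representatives] _ assms(1,2)])
qed

lemma finite_\<Omega>: "finite \<Omega>"
  by (rule finitely_many_local_subobjects[of \<Omega> i]) (use local_sub_family family_inj in blast)+

lemma family_projective: "x \<in> \<Omega> \<Longrightarrow> projective_obj C (P x)"
  by (rule local_sub_projective[OF local_sub_family])

lemma family_indecomposable:
  assumes "x \<in> \<Omega>" shows "indecomposable_obj C (P x)"
  using local_indecomposable[OF local_subD(4)] local_subD(5) local_sub_family[OF assms] by metis

text \<open>Isomorphic objects have isomorphic tops, and the top determines a local subobject of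
  \<open>M\<close>; so distinct join-irreducible subobjects are not even abstractly
  isomorphic.\<close>

lemma family_isomorphic_inj:
  assumes "x \<in> \<Omega>" "y \<in> \<Omega>" "isomorphic C (P x) (P y)" shows "x = y"
proof -
  note x = local_subD[OF local_sub_family[OF assms(1)]] and y = local_subD[OF local_sub_family[OF assms(2)]]
  obtain u where u: "u \<in> Hom C (P x) (P y)" "iso_arr C u" using assms(3) unfolding isomorphic_def by blast
  have "isomorphic C (Cod C (top_arr x)) (Cod C (top_arr y))"
    by (rule local_top_epi_isomorphic[OF x(4) y(4) iso_arr_epi[OF u(2)]]) (use u x y in simp_all)
  then show ?thesis
    using isomorphic_tops_fac local_sub_family assms isomorphic_sym family_inj by meson
qed

lemma local_quotient_of_family:
  assumes "local_top t"
  obtains x p where "x \<in> \<Omega>" "epi_arr C p" "p \<in> Arr C" "Dom C p = P x" "Cod C p = Dom C t"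
    "isomorphic C (Cod C (top_arr x)) (Cod C t)"
proof -
  obtain n s p where n: "local_sub n s" "epi_arr C p" "p \<in> Arr C" "Dom C p = Dom C n" "Cod C p = Dom C t"
    "isomorphic C (Cod C s) (Cod C t)" by (rule local_is_quotient[OF assms])
  obtain x where x: "x \<in> \<Omega>" "fac n (i x)" "fac (i x) n" by (rule family_cover[OF n(1)])
  note nD = local_subD[OF n(1)] and xD = local_subD[OF local_sub_family[OF x(1)]]
  obtain u where u: "iso_arr C u" "u \<in> Arr C" "Dom C u = P x" "Cod C u = Dom C n"
    using fac_antisym[OF xD(1) nD(1) x(3,2)] by blast
  have "isomorphic C (Cod C (top_arr x)) (Cod C t)"
    using local_sub_isomorphic(2)[OF local_sub_family[OF x(1)] n(1) x(3,2)] n(6) by (rule isomorphic_trans)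
  then show thesis
    by (rule that[OF x(1), of "p \<cdot> u", rotated -1])
      (use epi_arr_comp[OF iso_arr_epi[OF u(1)] n(2)] u n in simp_all)
qed

text \<open>A simple quotient of \<open>Q\<close> is also a quotient of some \<open>P x\<close>.
  Projectivity of \<open>Q\<close> lifts the quotient map to \<open>g : Q \<rightarrow> P x\<close>,
  which is epi because it is nonzero on the top; projectivity of \<open>P x\<close> splits it, and
  indecomposability of \<open>Q\<close> makes it invertible.\<close>

lemma indecomposable_projective_family:
  assumes "indecomposable_obj C Q" "projective_obj C Q"
  shows "\<exists>!x. x \<in> \<Omega> \<and> isomorphic C Q (P x)"
proof -
  have Q: "Q \<in> Obj C" and nz: "\<not> null (Ident C Q)"
    using assms(1) unfolding indecomposable_obj_def zero_obj_iff by auto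
  obtain q where q: "epi_arr C q" "q \<in> Arr C" "Dom C q = Q" "simple_obj C (Cod C q)"
    by (rule simple_quotient[OF Q nz])
  have li: "local_top (Ident C (Cod C q))" by (rule local_top_simple[OF q(4)])
  obtain x p where x: "x \<in> \<Omega>" "epi_arr C p" "p \<in> Arr C" "Dom C p = P x" "Cod C p = Cod C q"
    by (rule local_quotient_of_family[OF li]) (use q in simp_all)
  note xD = local_subD[OF local_sub_family[OF x(1)]]
  have "q \<in> Hom C Q (Cod C p)" using q x by simp
  then have "\<exists>g \<in> Hom C Q (Dom C p). p \<cdot> g = q" using assms(2) x(2) unfolding projective_obj_def by blast
  then obtain g where g: "g \<in> Arr C" "Dom C g = Q" "Cod C g = P x" "p \<cdot> g = q" using x(4) by auto
  obtain u where u: "u \<in> Arr C" "Dom C u = Cod C (top_arr x)" "Cod C u = Cod C p" "u \<cdot> top_arr x = p"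
    by (rule local_top_unique[OF xD(4) x(3)]) (use x q xD in simp_all)
  have qn: "\<not> null q" using epi_null_zero[OF q(1)] simple_objD(2)[OF q(4)] by blast
  have "u \<cdot> (top_arr x \<cdot> g) = q" using comp_assoc'[of g "top_arr x" u] u g(1,3,4) xD by (simp del: comp_assoc')
  then have "\<not> null (top_arr x \<cdot> g)" using null_comp(1)[of "top_arr x \<cdot> g" u] qn u g(1,3) xD by auto
  then have ge: "epi_arr C g" by (rule local_topD(6)[OF xD(4), rotated -1]) (use g xD in simp_all)
  have "Ident C (P x) \<in> Hom C (P x) (Cod C g)" using g x by simp
  then have "\<exists>s \<in> Hom C (P x) (Dom C g). g \<cdot> s = Ident C (P x)"
    using family_projective[OF x(1)] ge unfolding projective_obj_def by blast
  then obtain s where s: "s \<in> Arr C" "Dom C s = P x" "Cod C s = Q" "g \<cdot> s = Ident C (P x)" using g by auto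
  have "\<not> null (Ident C (P x))" using local_topD(5)[OF xD(4)] xD by simp
  then have "iso_arr C g"
    by (intro split_epi_indecomposable_iso[of g s]) (use g(1-3) s assms(1) in simp_all)
  then have iso: "isomorphic C Q (P x)" using isomorphicI[of g] g by simp
  show ?thesis
  proof (rule ex1I[of _ x])
    show "x \<in> \<Omega> \<and> isomorphic C Q (P x)" using x iso by simp
    fix y assume y: "y \<in> \<Omega> \<and> isomorphic C Q (P y)"
    then have "isomorphic C (P y) (P x)" using iso isomorphic_sym isomorphic_trans by blast
    then show "y = x" using family_isomorphic_inj y x by blast
  qed
qed

lemma top_obj_simple: "x \<in> \<Omega> \<Longrightarrow> simple_obj C (top_obj C (P x))"
  using local_subD(8)[OF local_sub_family] by (simp add: top_obj_def)

text \<open>A simple object is local and its own top, so the \<open>P x\<close> mapping onto it has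
  that top.\<close>

lemma simple_is_top:
  assumes "simple_obj C T" shows "\<exists>x\<in>\<Omega>. isomorphic C T (top_obj C (P x))"
proof -
  have li: "local_top (Ident C T)" by (rule local_top_simple[OF assms])
  obtain x where x: "x \<in> \<Omega>" "isomorphic C (Cod C (top_arr x)) (Cod C (Ident C T))"
    by (rule local_quotient_of_family[OF li])
  then have "isomorphic C T (top_obj C (P x))"
    using isomorphic_sym simple_objD(1)[OF assms] by (simp add: top_obj_def)
  then show ?thesis using x by blast
qed

text \<open>The image of \<open>n' \<cdot> b\<close> is a local subobject with the top of
  \<open>n\<close>, so it contains \<open>n\<close>, and it is contained in
  \<open>n'\<close>.\<close>

lemma fac_of_nonzero_hom:
  assumes "local_sub n t" "local_sub n' t'" "b \<in> Hom C (Dom C n) (Dom C n')" "\<not> null b"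
  shows "fac n n'"
proof -
  note n = local_subD[OF assms(1)] and n' = local_subD[OF assms(2)]
  have b: "b \<in> Arr C" "Dom C b = Dom C n" "Cod C b = Dom C n'" using assms(3) by simp_all
  have nb: "n' \<cdot> b \<in> Arr C" "Dom C (n' \<cdot> b) = Dom C t" "Cod C (n' \<cdot> b) = M" using b n n' by simp_all
  have "\<not> null (n' \<cdot> b)" using monoD[OF n'(1), of b] b assms(4) by blast
  then obtain m e s where m: "local_sub m s" "epi_arr C e" "e \<in> Arr C" "Dom C e = Dom C (n' \<cdot> b)" "Cod C e = Dom C m"
    "m \<cdot> e = n' \<cdot> b" "s \<cdot> e = t" "Cod C s = Cod C t" by (rule image_local_sub[OF n(4) nb])
  note mD = local_subD[OF m(1)]
  have "isomorphic C (Cod C t) (Cod C s)" unfolding m(8) by (rule isomorphic_refl) (use n in simp)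
  then have "fac n m" by (rule isomorphic_tops_fac[OF assms(1) m(1)])
  moreover have "fac (m \<cdot> e) n'" unfolding m(6) by (rule facI) (use b n' in simp_all)
  then have "fac m n'" by (rule fac_epi_cancel[OF n'(1) m(2)]) (use m(3,5) mD in simp_all)
  ultimately show ?thesis by (rule fac_trans)
qed

lemma fac_iff_hom_nonzero:
  assumes "x \<in> \<Omega>" "y \<in> \<Omega>"
  shows "fac (i x) (i y) \<longleftrightarrow> Hom C (P x) (P y) \<noteq> {hzero C (P x) (P y)}"
proof
  note x = local_subD[OF local_sub_family[OF assms(1)]] and y = local_subD[OF local_sub_family[OF assms(2)]]
  assume "fac (i x) (i y)"
  then obtain u where u: "u \<in> Arr C" "Dom C u = P x" "Cod C u = P y" "i y \<cdot> u = i x" by (rule facE)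
  have "\<not> null (i y \<cdot> u)" unfolding u(4) by (rule x(10))
  then have "\<not> null u" using null_comp(1)[of u "i y"] u(1,3) y(2) by auto
  then have "u \<noteq> hzero C (P x) (P y)" using assms by auto
  moreover have "u \<in> Hom C (P x) (P y)" using u by simp
  ultimately show "Hom C (P x) (P y) \<noteq> {hzero C (P x) (P y)}" by blast
next
  assume ne: "Hom C (P x) (P y) \<noteq> {hzero C (P x) (P y)}"
  have "hzero C (P x) (P y) \<in> Hom C (P x) (P y)" using assms by simp
  then obtain b where b: "b \<in> Hom C (P x) (P y)" "b \<noteq> hzero C (P x) (P y)" using ne by blast
  have "\<not> null b"
  proof
    assume "null b"
    then have "b = hzero C (P x) (P y)" by (rule nullD) (use b in simp_all)
    then show False using b by simp
  qed
  then show "fac (i x) (i y)" by (rule fac_of_nonzero_hom[OF local_sub_family[OF assms(1)] local_sub_family[OF assms(2)] b(1)])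
qed

text \<open>The middle term of a nonsplit extension is local with the top of \<open>P y\<close>, so
  some \<open>P w\<close> with this top maps onto it, and \<open>i w\<close> is below
  \<open>i y\<close>. The subobject \<open>S\<close> receives a nonzero arrow from
  \<open>P z\<close>, and projectivity lifts its composite into the middle term to a nonzero arrow
  \<open>P z \<rightarrow> P w\<close>.\<close>

lemma ext_arrow_fac:
  assumes "z \<in> \<Omega>" "y \<in> \<Omega>"
    "(iso_class C (top_obj C (P z)), iso_class C (top_obj C (P y))) \<in> ext_quiver C"
  shows "fac (i z) (i y)"
proof -
  note z = local_subD[OF local_sub_family[OF assms(1)]] and y = local_subD[OF local_sub_family[OF assms(2)]]
  obtain S T where ST: "iso_class C (Cod C (top_arr z)) = iso_class C S" "iso_class C (Cod C (top_arr y)) = iso_class C T"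
    "simple_obj C S" "simple_obj C T" "Ext1 C T S \<noteq> {Ext1_zero C T S}"
    using assms(3) unfolding ext_quiver_def top_obj_def by blast
  note S = simple_objD[OF ST(3)] and T = simple_objD[OF ST(4)]
  have zS: "isomorphic C (Cod C (top_arr z)) S" using ST(1) iso_class_eq_iff[of "Cod C (top_arr z)" S] z S by simp
  have yT: "isomorphic C (Cod C (top_arr y)) T" using ST(2) iso_class_eq_iff[of "Cod C (top_arr y)" T] y T by simp
  obtain f g where fg: "(f, g) \<in> extensions C T S" "\<forall>s \<in> Hom C T (Dom C g). g \<cdot> s \<noteq> Ident C T"
    using nonsplit_extension_exists[OF ST(5) S(1) T(1)] by blast
  note e = extensionsD[OF fg(1)]
  have lg: "local_top g" by (rule nonsplit_extension_local[OF fg(1) ST(3,4) fg(2)])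
  obtain w p where w: "w \<in> \<Omega>" "epi_arr C p" "p \<in> Arr C" "Dom C p = P w" "Cod C p = Dom C g"
    "isomorphic C (Cod C (top_arr w)) (Cod C g)" by (rule local_quotient_of_family[OF lg])
  have "isomorphic C (Cod C (top_arr w)) (Cod C (top_arr y))"
    using isomorphic_trans[OF w(6), of "Cod C (top_arr y)"] isomorphic_sym[OF yT] e(4) by simp
  then have wy: "fac (i w) (i y)" by (rule isomorphic_tops_fac[OF local_sub_family[OF w(1)] local_sub_family[OF assms(2)]])
  obtain \<theta> where \<theta>: "\<theta> \<in> Arr C" "Dom C \<theta> = Cod C (top_arr z)" "Cod C \<theta> = S" "iso_arr C \<theta>"
    using zS unfolding isomorphic_def by auto
  let ?a = "f \<cdot> (\<theta> \<cdot> top_arr z)"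
  have a: "?a \<in> Arr C" "Dom C ?a = P z" "Cod C ?a = Cod C p" using \<theta> z e w by simp_all
  have "\<not> null (\<theta> \<cdot> top_arr z)" using monoD[OF iso_arr_mono[OF \<theta>(4)], of "top_arr z"] \<theta> z by auto
  then have an: "\<not> null ?a" using monoD[OF e(6), of "\<theta> \<cdot> top_arr z"] \<theta> z e by auto
  have "?a \<in> Hom C (P z) (Cod C p)" using a by (simp del: comp_arr)
  then obtain b where b: "b \<in> Hom C (P z) (Dom C p)" "p \<cdot> b = ?a"
    using family_projective[OF assms(1)] w(2) unfolding projective_obj_def by blast
  have "\<not> null b"
  proof
    assume "null b"
    then have "null (p \<cdot> b)" by (rule null_comp(1)[rotated -1]) (use b(1) w in simp_all)
    then show False using an b(2) by simp
  qed
  then have "fac (i z) (i w)"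
    using fac_of_nonzero_hom[OF local_sub_family[OF assms(1)] local_sub_family[OF w(1)]] b(1) w(4) by simp
  then show ?thesis using wy by (rule fac_trans)
qed

lemma fac_iff_path:
  assumes "x \<in> \<Omega>" "y \<in> \<Omega>"
  shows "fac (i x) (i y) \<longleftrightarrow>
    (iso_class C (top_obj C (P x)), iso_class C (top_obj C (P y))) \<in> (ext_quiver C)\<^sup>*"
proof
  assume f: "fac (i x) (i y)"
  show "(iso_class C (top_obj C (P x)), iso_class C (top_obj C (P y))) \<in> (ext_quiver C)\<^sup>*"
  proof (cases "fac (i y) (i x)")
    case True
    then show ?thesis using family_inj[OF assms f] by simp
  next
    case False
    then show ?thesis
      using strict_inclusion_path[OF local_sub_family[OF assms(1)] local_sub_family[OF assms(2)] f]
      by (simp add: top_obj_def trancl_into_rtrancl)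
  qed
next
  have tops: "isomorphic C (top_obj C (P x)) (top_obj C (P y))"
    if "x \<in> \<Omega>" "y \<in> \<Omega>" "iso_class C (top_obj C (P x)) = iso_class C (top_obj C (P y))" for x y
    using iso_class_eq_iff[of "top_obj C (P x)" "top_obj C (P y)"] simple_objD(1)[OF top_obj_simple] that by simp
  \<comment> \<open>Vertices are isomorphism classes, so the induction is stated for all
    \<open>y\<close> whose top represents the endpoint; each intermediate vertex is the class of
    some top by \<open>simple_is_top\<close>.\<close>
  have "\<forall>y\<in>\<Omega>. V = iso_class C (top_obj C (P y)) \<longrightarrow> fac (i x) (i y)"
    if "(iso_class C (top_obj C (P x)), V) \<in> (ext_quiver C)\<^sup>*" for V
    using that
  proof (induction rule: rtrancl_induct)
    case base
    show ?case
      using tops[OF assms(1)] isomorphic_tops_fac[OF local_sub_family[OF assms(1)] local_sub_family] unfolding top_obj_def by blast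
  next
    case (step V W)
    show ?case
    proof (intro ballI impI)
      fix y assume y: "y \<in> \<Omega>" "W = iso_class C (top_obj C (P y))"
      obtain S where S: "simple_obj C S" "V = iso_class C S" using step(2) unfolding ext_quiver_def by blast
      obtain z where z: "z \<in> \<Omega>" "isomorphic C S (top_obj C (P z))" using simple_is_top[OF S(1)] by blast
      have "V = iso_class C (top_obj C (P z))"
        using iso_class_eq_iff isomorphic_obj[OF z(2)] z(2) S by blast
      then have "fac (i x) (i z)" "fac (i z) (i y)"
        using step ext_arrow_fac[OF z(1) y(1)] y z by blast+
      then show "fac (i x) (i y)" by (rule fac_trans)
    qed
  qed
  then show "(iso_class C (top_obj C (P x)), iso_class C (top_obj C (P y))) \<in> (ext_quiver C)\<^sup>* \<Longrightarrow> fac (i x) (i y)"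
    using assms by blast
qed

end

section \<open>Finitely presented modules\<close>

text \<open>The quasi-inverse chooses for each \<open>N\<close> an object \<open>Go N\<close> with
  an isomorphism \<open>\<epsilon> N\<close>; fullness supplies \<open>Ga\<close> and
  \<open>\<eta>\<close> as preimages under \<open>Fa\<close>, and identities between arrows of
  \<open>C\<close> are checked after applying the faithful \<open>Fa\<close>.\<close>

lemma (in cat_functor) fully_faithful_equivalence:
  assumes faithful: "\<And>X Y f g. f \<in> Hom C X Y \<Longrightarrow> g \<in> Hom C X Y \<Longrightarrow> Fa f = Fa g \<Longrightarrow> f = g"
    and full: "\<And>X Y h. X \<in> Obj C \<Longrightarrow> Y \<in> Obj C \<Longrightarrow> h \<in> Hom D (Fo X) (Fo Y) \<Longrightarrow> \<exists>f \<in> Hom C X Y. Fa f = h"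
    and ess: "\<And>N. N \<in> Obj D \<Longrightarrow> \<exists>X \<in> Obj C. isomorphic D (Fo X) N"
  shows "category_equivalence C D Fo Fa"
proof -
  have "\<exists>X e e'. X \<in> Obj C \<and> e \<in> Hom D (Fo X) N \<and> e' \<in> Hom D N (Fo X) \<and>
      e' \<cdot>\<^bsub>D\<^esub> e = Ident D (Fo X) \<and> e \<cdot>\<^bsub>D\<^esub> e' = Ident D N" if N: "N \<in> Obj D" for N
  proof -
    obtain X e where X: "X \<in> Obj C" "e \<in> Hom D (Fo X) N" "iso_arr D e"
      using ess[OF N] unfolding isomorphic_def by blast
    obtain e' where "e' \<in> Arr D" "Dom D e' = Cod D e" "Cod D e' = Dom D e"
      "e' \<cdot>\<^bsub>D\<^esub> e = Ident D (Dom D e)" "e \<cdot>\<^bsub>D\<^esub> e' = Ident D (Cod D e)" using X(3) by (rule cod.iso_arrE) blast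
    then have "e' \<in> Hom D N (Fo X)" "e' \<cdot>\<^bsub>D\<^esub> e = Ident D (Fo X)" "e \<cdot>\<^bsub>D\<^esub> e' = Ident D N" using X(2) by simp_all
    then show ?thesis using X by blast
  qed
  then obtain Go \<epsilon> \<delta> where Go0: "\<And>N. N \<in> Obj D \<Longrightarrow> Go N \<in> Obj C \<and> \<epsilon> N \<in> Hom D (Fo (Go N)) N \<and> \<delta> N \<in> Hom D N (Fo (Go N)) \<and>
      \<delta> N \<cdot>\<^bsub>D\<^esub> \<epsilon> N = Ident D (Fo (Go N)) \<and> \<epsilon> N \<cdot>\<^bsub>D\<^esub> \<delta> N = Ident D N" by metis
  have Go: "Go N \<in> Obj C" "\<epsilon> N \<in> Arr D" "Dom D (\<epsilon> N) = Fo (Go N)" "Cod D (\<epsilon> N) = N"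
      "\<delta> N \<in> Arr D" "Dom D (\<delta> N) = N" "Cod D (\<delta> N) = Fo (Go N)"
      "\<delta> N \<cdot>\<^bsub>D\<^esub> \<epsilon> N = Ident D (Fo (Go N))" "\<epsilon> N \<cdot>\<^bsub>D\<^esub> \<delta> N = Ident D N" if "N \<in> Obj D" for N
    using Go0[OF that] by simp_all
  have cancel: "\<epsilon> N \<cdot>\<^bsub>D\<^esub> (\<delta> N \<cdot>\<^bsub>D\<^esub> g) = g" if "N \<in> Obj D" "g \<in> Arr D" "Cod D g = N" for N g
    using cod.comp_assoc'[of g "\<delta> N" "\<epsilon> N"] Go[OF that(1)] that by (simp del: cod.comp_assoc')
  have cancel': "g \<cdot>\<^bsub>D\<^esub> (\<epsilon> N \<cdot>\<^bsub>D\<^esub> \<delta> N) = g" if "N \<in> Obj D" "g \<in> Arr D" "Dom D g = N" for N g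
    using Go[OF that(1)] that by simp
  have Fo: "Fo X \<in> Obj D" if "X \<in> Obj C" for X using obj_map that .
  have Fa: "Fa f \<in> Arr D" "Dom D (Fa f) = Fo (Dom C f)" "Cod D (Fa f) = Fo (Cod C f)" if "f \<in> Arr C" for f
    using arr_map[of f "Dom C f" "Cod C f"] that by simp_all
  define Ga where "Ga h = (SOME f. f \<in> Hom C (Go (Dom D h)) (Go (Cod D h)) \<and>
    Fa f = \<delta> (Cod D h) \<cdot>\<^bsub>D\<^esub> (h \<cdot>\<^bsub>D\<^esub> \<epsilon> (Dom D h)))" for h
  have Ga: "Ga h \<in> Hom C (Go (Dom D h)) (Go (Cod D h))" "Fa (Ga h) = \<delta> (Cod D h) \<cdot>\<^bsub>D\<^esub> (h \<cdot>\<^bsub>D\<^esub> \<epsilon> (Dom D h))"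
    if h: "h \<in> Arr D" for h
  proof -
    have o: "Dom D h \<in> Obj D" "Cod D h \<in> Obj D" using h by simp_all
    have "\<delta> (Cod D h) \<cdot>\<^bsub>D\<^esub> (h \<cdot>\<^bsub>D\<^esub> \<epsilon> (Dom D h)) \<in> Hom D (Fo (Go (Dom D h))) (Fo (Go (Cod D h)))"
      using Go[OF o(1)] Go[OF o(2)] h by simp
    then have "\<exists>f. f \<in> Hom C (Go (Dom D h)) (Go (Cod D h)) \<and> Fa f = \<delta> (Cod D h) \<cdot>\<^bsub>D\<^esub> (h \<cdot>\<^bsub>D\<^esub> \<epsilon> (Dom D h))"
      using full[OF Go(1)[OF o(1)] Go(1)[OF o(2)]] by blast
    from someI_ex[OF this] show "Ga h \<in> Hom C (Go (Dom D h)) (Go (Cod D h))"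
      "Fa (Ga h) = \<delta> (Cod D h) \<cdot>\<^bsub>D\<^esub> (h \<cdot>\<^bsub>D\<^esub> \<epsilon> (Dom D h))" unfolding Ga_def by blast+
  qed
  define \<eta> where "\<eta> X = (SOME f. f \<in> Hom C X (Go (Fo X)) \<and> Fa f = \<delta> (Fo X))" for X
  define \<eta>' where "\<eta>' X = (SOME f. f \<in> Hom C (Go (Fo X)) X \<and> Fa f = \<epsilon> (Fo X))" for X
  have \<eta>: "\<eta> X \<in> Hom C X (Go (Fo X))" "Fa (\<eta> X) = \<delta> (Fo X)" and \<eta>': "\<eta>' X \<in> Hom C (Go (Fo X)) X" "Fa (\<eta>' X) = \<epsilon> (Fo X)"
    if X: "X \<in> Obj C" for X
  proof -
    have "\<exists>f. f \<in> Hom C X (Go (Fo X)) \<and> Fa f = \<delta> (Fo X)"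
      using full[OF X Go(1)[OF Fo[OF X]], of "\<delta> (Fo X)"] Go[OF Fo[OF X]] by auto
    from someI_ex[OF this] show "\<eta> X \<in> Hom C X (Go (Fo X))" "Fa (\<eta> X) = \<delta> (Fo X)" unfolding \<eta>_def by blast+
    have "\<exists>f. f \<in> Hom C (Go (Fo X)) X \<and> Fa f = \<epsilon> (Fo X)"
      using full[OF Go(1)[OF Fo[OF X]] X, of "\<epsilon> (Fo X)"] Go[OF Fo[OF X]] by auto
    from someI_ex[OF this] show "\<eta>' X \<in> Hom C (Go (Fo X)) X" "Fa (\<eta>' X) = \<epsilon> (Fo X)" unfolding \<eta>'_def by blast+
  qed
  have G: "cat_functor D C Go Ga"
  proof (unfold_locales)
    show "Go X \<in> Obj C" if "X \<in> Obj D" for X using Go that by simp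
    show "Ga f \<in> Hom C (Go X) (Go Y)" if "f \<in> Hom D X Y" for f X Y using Ga(1)[of f] that by simp
    show "Ga (Ident D X) = Ident C (Go X)" if X: "X \<in> Obj D" for X
    proof (rule faithful[of _ "Go X" "Go X"])
      show "Ga (Ident D X) \<in> Hom C (Go X) (Go X)" "Ident C (Go X) \<in> Hom C (Go X) (Go X)"
        using Ga(1)[of "Ident D X"] X Go[OF X] by simp_all
      show "Fa (Ga (Ident D X)) = Fa (Ident C (Go X))"
        using Ga(2)[of "Ident D X"] X Go[OF X] map_ident[of "Go X"] by simp
    qed
    show "Ga (g \<cdot>\<^bsub>D\<^esub> f) = Ga g \<cdot>\<^bsub>C\<^esub> Ga f" if f: "f \<in> Hom D X Y" and g: "g \<in> Hom D Y Z" for f g X Y Z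
    proof (rule faithful[of _ "Go X" "Go Z"])
      have o: "X \<in> Obj D" "Y \<in> Obj D" "Z \<in> Obj D" using f g by auto
      have fD: "f \<in> Arr D" "Dom D f = X" "Cod D f = Y" and gD: "g \<in> Arr D" "Dom D g = Y" "Cod D g = Z" using f g by simp_all
      have gf: "g \<cdot>\<^bsub>D\<^esub> f \<in> Arr D" "Dom D (g \<cdot>\<^bsub>D\<^esub> f) = X" "Cod D (g \<cdot>\<^bsub>D\<^esub> f) = Z" using fD gD by simp_all
      have h: "Ga f \<in> Hom C (Go X) (Go Y)" "Ga g \<in> Hom C (Go Y) (Go Z)"
        using Ga(1)[OF fD(1)] Ga(1)[OF gD(1)] fD gD by simp_all
      show "Ga (g \<cdot>\<^bsub>D\<^esub> f) \<in> Hom C (Go X) (Go Z)" using Ga(1)[OF gf(1)] gf by simp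
      show "Ga g \<cdot>\<^bsub>C\<^esub> Ga f \<in> Hom C (Go X) (Go Z)" using h by simp
      note GX = Go[OF o(1)] and GY = Go[OF o(2)] and GZ = Go[OF o(3)]
      have "Fa (Ga g \<cdot>\<^bsub>C\<^esub> Ga f) = Fa (Ga g) \<cdot>\<^bsub>D\<^esub> Fa (Ga f)" by (rule map_comp[OF h])
      also have "\<dots> = (\<delta> Z \<cdot>\<^bsub>D\<^esub> (g \<cdot>\<^bsub>D\<^esub> \<epsilon> Y)) \<cdot>\<^bsub>D\<^esub> (\<delta> Y \<cdot>\<^bsub>D\<^esub> (f \<cdot>\<^bsub>D\<^esub> \<epsilon> X))"
        using Ga(2)[OF fD(1)] Ga(2)[OF gD(1)] fD gD by simp
      also have "\<dots> = \<delta> Z \<cdot>\<^bsub>D\<^esub> (g \<cdot>\<^bsub>D\<^esub> (\<epsilon> Y \<cdot>\<^bsub>D\<^esub> (\<delta> Y \<cdot>\<^bsub>D\<^esub> (f \<cdot>\<^bsub>D\<^esub> \<epsilon> X))))"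
        using GX(2-7) GY(2-7) GZ(2-7) fD gD by simp
      also have "\<epsilon> Y \<cdot>\<^bsub>D\<^esub> (\<delta> Y \<cdot>\<^bsub>D\<^esub> (f \<cdot>\<^bsub>D\<^esub> \<epsilon> X)) = f \<cdot>\<^bsub>D\<^esub> \<epsilon> X"
        by (rule cancel[OF o(2)]) (use GX(2-7) fD in simp_all)
      also have "g \<cdot>\<^bsub>D\<^esub> (f \<cdot>\<^bsub>D\<^esub> \<epsilon> X) = (g \<cdot>\<^bsub>D\<^esub> f) \<cdot>\<^bsub>D\<^esub> \<epsilon> X" using GX(2-7) fD gD by simp
      also have "\<delta> Z \<cdot>\<^bsub>D\<^esub> ((g \<cdot>\<^bsub>D\<^esub> f) \<cdot>\<^bsub>D\<^esub> \<epsilon> X) = Fa (Ga (g \<cdot>\<^bsub>D\<^esub> f))"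
        using Ga(2)[OF gf(1)] gf(2,3) by simp
      finally show "Fa (Ga (g \<cdot>\<^bsub>D\<^esub> f)) = Fa (Ga g \<cdot>\<^bsub>C\<^esub> Ga f)" by simp
    qed
  qed
  have n1: "natural_iso C C id id (Go \<circ> Fo) (Ga \<circ> Fa) \<eta>"
    unfolding natural_iso_def
  proof (intro conjI ballI allI)
    fix X assume X: "X \<in> Obj C"
    note GF = Go[OF Fo[OF X]]
    show "\<eta> X \<in> Hom C (id X) ((Go \<circ> Fo) X)" using \<eta>[OF X] by simp
    have "\<eta>' X \<cdot>\<^bsub>C\<^esub> \<eta> X = Ident C X"
    proof (rule faithful[of _ X X])
      show "\<eta>' X \<cdot>\<^bsub>C\<^esub> \<eta> X \<in> Hom C X X" "Ident C X \<in> Hom C X X" using \<eta>(1)[OF X] \<eta>'(1)[OF X] X by simp_all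
      show "Fa (\<eta>' X \<cdot>\<^bsub>C\<^esub> \<eta> X) = Fa (Ident C X)"
        using map_comp[OF \<eta>(1)[OF X] \<eta>'(1)[OF X]] \<eta>(2)[OF X] \<eta>'(2)[OF X] map_ident[OF X] GF(9) by simp
    qed
    moreover have "\<eta> X \<cdot>\<^bsub>C\<^esub> \<eta>' X = Ident C (Go (Fo X))"
    proof (rule faithful[of _ "Go (Fo X)" "Go (Fo X)"])
      show "\<eta> X \<cdot>\<^bsub>C\<^esub> \<eta>' X \<in> Hom C (Go (Fo X)) (Go (Fo X))" "Ident C (Go (Fo X)) \<in> Hom C (Go (Fo X)) (Go (Fo X))"
        using \<eta>(1)[OF X] \<eta>'(1)[OF X] GF(1) by simp_all
      show "Fa (\<eta> X \<cdot>\<^bsub>C\<^esub> \<eta>' X) = Fa (Ident C (Go (Fo X)))"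
        using map_comp[OF \<eta>'(1)[OF X] \<eta>(1)[OF X]] \<eta>(2)[OF X] \<eta>'(2)[OF X] map_ident[OF GF(1)] GF(8) by simp
    qed
    ultimately show "iso_arr C (\<eta> X)"
      using \<eta>(1)[OF X] \<eta>'(1)[OF X] by (intro dom.iso_arrI[where g = "\<eta>' X"]) simp_all
  next
    fix X Y f assume f: "f \<in> Hom C X Y"
    then have X: "X \<in> Obj C" and Y: "Y \<in> Obj C" by auto
    have fD: "f \<in> Arr C" "Dom C f = X" "Cod C f = Y" using f by simp_all
    note FD = Fa[OF fD(1), unfolded fD(2,3)] and GX = Go[OF Fo[OF X]] and GY = Go[OF Fo[OF Y]]
    have gf: "Ga (Fa f) \<in> Hom C (Go (Fo X)) (Go (Fo Y))" using Ga(1)[OF FD(1)] FD by simp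
    have "\<eta> Y \<cdot>\<^bsub>C\<^esub> f = Ga (Fa f) \<cdot>\<^bsub>C\<^esub> \<eta> X"
    proof (rule faithful[of _ X "Go (Fo Y)"])
      show "\<eta> Y \<cdot>\<^bsub>C\<^esub> f \<in> Hom C X (Go (Fo Y))" using \<eta>(1)[OF Y] fD by simp
      show "Ga (Fa f) \<cdot>\<^bsub>C\<^esub> \<eta> X \<in> Hom C X (Go (Fo Y))" using \<eta>(1)[OF X] gf by simp
      have "Fa (Ga (Fa f) \<cdot>\<^bsub>C\<^esub> \<eta> X) = Fa (Ga (Fa f)) \<cdot>\<^bsub>D\<^esub> \<delta> (Fo X)"
        using map_comp[OF \<eta>(1)[OF X] gf] \<eta>(2)[OF X] by simp
      also have "\<dots> = (\<delta> (Fo Y) \<cdot>\<^bsub>D\<^esub> (Fa f \<cdot>\<^bsub>D\<^esub> \<epsilon> (Fo X))) \<cdot>\<^bsub>D\<^esub> \<delta> (Fo X)"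
        using Ga(2)[OF FD(1)] FD by simp
      also have "\<dots> = \<delta> (Fo Y) \<cdot>\<^bsub>D\<^esub> (Fa f \<cdot>\<^bsub>D\<^esub> (\<epsilon> (Fo X) \<cdot>\<^bsub>D\<^esub> \<delta> (Fo X)))"
        using FD GX(2-7) GY(2-7) by simp
      also have "Fa f \<cdot>\<^bsub>D\<^esub> (\<epsilon> (Fo X) \<cdot>\<^bsub>D\<^esub> \<delta> (Fo X)) = Fa f" by (rule cancel'[OF Fo[OF X] FD(1,2)])
      also have "\<delta> (Fo Y) \<cdot>\<^bsub>D\<^esub> Fa f = Fa (\<eta> Y \<cdot>\<^bsub>C\<^esub> f)" using map_comp[OF f \<eta>(1)[OF Y]] \<eta>(2)[OF Y] by simp
      finally show "Fa (\<eta> Y \<cdot>\<^bsub>C\<^esub> f) = Fa (Ga (Fa f) \<cdot>\<^bsub>C\<^esub> \<eta> X)" by simp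
    qed
    then show "\<eta> Y \<cdot>\<^bsub>C\<^esub> id f = (Ga \<circ> Fa) f \<cdot>\<^bsub>C\<^esub> \<eta> X" by simp
  qed
  have n2: "natural_iso D D (Fo \<circ> Go) (Fa \<circ> Ga) id id \<epsilon>"
    unfolding natural_iso_def
  proof (intro conjI ballI allI)
    fix N assume N: "N \<in> Obj D"
    show "\<epsilon> N \<in> Hom D ((Fo \<circ> Go) N) (id N)" using Go[OF N] by simp
    show "iso_arr D (\<epsilon> N)" by (rule cod.iso_arrI[where g = "\<delta> N"]) (use Go[OF N] in simp_all)
  next
    fix N N' h assume h: "h \<in> Hom D N N'"
    then have N: "N \<in> Obj D" and N': "N' \<in> Obj D" by auto
    have hD: "h \<in> Arr D" "Dom D h = N" "Cod D h = N'" using h by simp_all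
    have "\<epsilon> N' \<cdot>\<^bsub>D\<^esub> Fa (Ga h) = \<epsilon> N' \<cdot>\<^bsub>D\<^esub> (\<delta> N' \<cdot>\<^bsub>D\<^esub> (h \<cdot>\<^bsub>D\<^esub> \<epsilon> N))" using Ga(2)[OF hD(1)] hD by simp
    also have "\<dots> = h \<cdot>\<^bsub>D\<^esub> \<epsilon> N" by (rule cancel[OF N']) (use hD Go[OF N] in simp_all)
    finally show "\<epsilon> N' \<cdot>\<^bsub>D\<^esub> (Fa \<circ> Ga) h = id h \<cdot>\<^bsub>D\<^esub> \<epsilon> N" by simp
  qed
  show ?thesis
    unfolding category_equivalence_def using cat_functor_axioms G n1 n2 by blast
qed

lemma fp_modules_Hom:
  "F \<in> Hom (fp_modules R) N N' \<longleftrightarrow>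
    (\<exists>f. F = (N, f, N') \<and> finitely_presented R N \<and> finitely_presented R N' \<and> f \<in> rmodule_hom R N N')"
  unfolding Hom_def fp_modules_def by auto

lemma fp_modules_simps:
  "Obj (fp_modules R) = {N. finitely_presented R N}"
  "Ident (fp_modules R) N = (N, (\<lambda>x\<in>carrier N. x), N)"
  "(N', g, N'') \<cdot>\<^bsub>fp_modules R\<^esub> (N, f, K) = (N, compose (carrier N) g f, N'')"
  unfolding fp_modules_def by simp_all

lemma rmodule_homD:
  assumes "f \<in> rmodule_hom R N N'"
  shows "x \<in> carrier N \<Longrightarrow> f x \<in> carrier N'" "f \<in> extensional (carrier N)"
    "x \<in> carrier N \<Longrightarrow> y \<in> carrier N \<Longrightarrow> f (x \<oplus>\<^bsub>N\<^esub> y) = f x \<oplus>\<^bsub>N'\<^esub> f y"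
    "x \<in> carrier N \<Longrightarrow> a \<in> carrier R \<Longrightarrow> f (act N x a) = act N' (f x) a"
  using assms unfolding rmodule_hom_def by (auto simp: PiE_def)

lemma rmodule_homI:
  assumes "\<And>x. x \<in> carrier N \<Longrightarrow> f x \<in> carrier N'" "f \<in> extensional (carrier N)"
    "\<And>x y. x \<in> carrier N \<Longrightarrow> y \<in> carrier N \<Longrightarrow> f (x \<oplus>\<^bsub>N\<^esub> y) = f x \<oplus>\<^bsub>N'\<^esub> f y"
    "\<And>x a. x \<in> carrier N \<Longrightarrow> a \<in> carrier R \<Longrightarrow> f (act N x a) = act N' (f x) a"
  shows "f \<in> rmodule_hom R N N'"
  using assms unfolding rmodule_hom_def by (auto simp: PiE_def)

lemma finitely_presented_module: "finitely_presented R N \<Longrightarrow> right_module R N"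
  by (simp add: finitely_presented_def)

lemma rmodule_hom_ident:
  assumes "right_module R N" shows "(\<lambda>x\<in>carrier N. x) \<in> rmodule_hom R N N"
proof -
  interpret right_module R N by (rule assms)
  show ?thesis by (rule rmodule_homI) (simp_all add: act_closed)
qed

lemma rmodule_hom_compose:
  assumes "right_module R N" "f \<in> rmodule_hom R N N'" "g \<in> rmodule_hom R N' N''"
  shows "compose (carrier N) g f \<in> rmodule_hom R N N''"
proof -
  interpret right_module R N by (rule assms(1))
  note f = rmodule_homD[OF assms(2)] and g = rmodule_homD[OF assms(3)]
  show ?thesis
    by (rule rmodule_homI) (simp_all add: compose_eq f g act_closed)
qed

lemma category_fp_modules:
  fixes R :: "('a, 'z) ring_scheme"
  shows "category (fp_modules R :: (('a, 'b) rmodule, _) category)"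
proof
  fix F G K :: "('a, 'b) rmodule \<times> ('b \<Rightarrow> 'b) \<times> ('a, 'b) rmodule" and X Y Z W :: "('a, 'b) rmodule"
  show "Dom (fp_modules R) F \<in> Obj (fp_modules R)" "Cod (fp_modules R) F \<in> Obj (fp_modules R)"
    if "F \<in> Arr (fp_modules R)" using that unfolding fp_modules_def by auto
  show "Ident (fp_modules R) X \<in> Hom (fp_modules R) X X" if "X \<in> Obj (fp_modules R)"
    using that rmodule_hom_ident finitely_presented_module unfolding fp_modules_Hom fp_modules_simps by blast
  show "G \<cdot>\<^bsub>fp_modules R\<^esub> F \<in> Hom (fp_modules R) X Z" if "F \<in> Hom (fp_modules R) X Y" "G \<in> Hom (fp_modules R) Y Z"
    using that rmodule_hom_compose finitely_presented_module unfolding fp_modules_Hom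
    by (fastforce simp: fp_modules_simps)
  show "(K \<cdot>\<^bsub>fp_modules R\<^esub> G) \<cdot>\<^bsub>fp_modules R\<^esub> F = K \<cdot>\<^bsub>fp_modules R\<^esub> (G \<cdot>\<^bsub>fp_modules R\<^esub> F)"
    if "F \<in> Hom (fp_modules R) W X" "G \<in> Hom (fp_modules R) X Y" "K \<in> Hom (fp_modules R) Y Z"
  proof -
    obtain f g k where *: "F = (W, f, X)" "G = (X, g, Y)" "K = (Y, k, Z)" "f \<in> rmodule_hom R W X"
      using \<open>F \<in> _\<close> \<open>G \<in> _\<close> \<open>K \<in> _\<close> unfolding fp_modules_Hom by blast
    have "f \<in> carrier W \<rightarrow> carrier X" using rmodule_homD(1)[OF *(4)] by blast
    then show ?thesis unfolding * fp_modules_simps by (simp add: compose_assoc)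
  qed
  show "Ident (fp_modules R) Y \<cdot>\<^bsub>fp_modules R\<^esub> F = F" if "F \<in> Hom (fp_modules R) X Y"
  proof -
    obtain f where *: "F = (X, f, Y)" "f \<in> rmodule_hom R X Y"
      using \<open>F \<in> _\<close> unfolding fp_modules_Hom by blast
    have "compose (carrier X) (\<lambda>y\<in>carrier Y. y) f = f"
      by (rule extensionalityI[of _ "carrier X"]) (use rmodule_homD[OF *(2)] in \<open>auto simp: compose_eq\<close>)
    then show ?thesis unfolding * fp_modules_simps by simp
  qed
  show "F \<cdot>\<^bsub>fp_modules R\<^esub> Ident (fp_modules R) X = F" if "F \<in> Hom (fp_modules R) X Y"
  proof -
    obtain f where *: "F = (X, f, Y)" "f \<in> rmodule_hom R X Y"
      using \<open>F \<in> _\<close> unfolding fp_modules_Hom by blast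
    have "compose (carrier X) f (\<lambda>y\<in>carrier X. y) = f"
      by (rule extensionalityI[of _ "carrier X"]) (use rmodule_homD[OF *(2)] in \<open>auto simp: compose_eq\<close>)
    then show ?thesis unfolding * fp_modules_simps by simp
  qed
qed

lemma fp_modules_isomorphic:
  assumes "finitely_presented R N" "finitely_presented R N'" "f \<in> rmodule_hom R N N'" "bij_betw f (carrier N) (carrier N')"
  shows "isomorphic (fp_modules R) N N'"
proof -
  interpret N: right_module R N by (rule finitely_presented_module[OF assms(1)])
  note f = rmodule_homD[OF assms(3)]
  let ?g = "\<lambda>y\<in>carrier N'. inv_into (carrier N) f y"
  have gc: "inv_into (carrier N) f y \<in> carrier N" "f (inv_into (carrier N) f y) = y" if "y \<in> carrier N'" for y
    using assms(4) that by (simp_all add: bij_betw_def inv_into_into f_inv_into_f)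
  have gf: "inv_into (carrier N) f (f x) = x" if "x \<in> carrier N" for x
    using assms(4) that by (simp add: bij_betw_def)
  interpret N': right_module R N' by (rule finitely_presented_module[OF assms(2)])
  have g: "?g \<in> rmodule_hom R N' N"
  proof (rule rmodule_homI)
    fix x y assume xy: "x \<in> carrier N'" "y \<in> carrier N'"
    have "f (inv_into (carrier N) f x \<oplus>\<^bsub>N\<^esub> inv_into (carrier N) f y) = x \<oplus>\<^bsub>N'\<^esub> y"
      using f(3) gc xy by simp
    then show "?g (x \<oplus>\<^bsub>N'\<^esub> y) = ?g x \<oplus>\<^bsub>N\<^esub> ?g y"
      using gf[of "inv_into (carrier N) f x \<oplus>\<^bsub>N\<^esub> inv_into (carrier N) f y"] gc xy by simp
  next
    fix x a assume xa: "x \<in> carrier N'" "a \<in> carrier R"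
    have "f (act N (inv_into (carrier N) f x) a) = act N' x a" using f(4) gc xa by simp
    then show "?g (act N' x a) = act N (?g x) a"
      using gf[of "act N (inv_into (carrier N) f x) a"] gc xa N.act_closed N'.act_closed by simp
  qed (use gc in simp_all)
  have "compose (carrier N) ?g f = (\<lambda>x\<in>carrier N. x)"
    by (rule extensionalityI[of _ "carrier N"]) (use gf f(1) in \<open>simp_all add: compose_eq\<close>)
  moreover have "compose (carrier N') f ?g = (\<lambda>x\<in>carrier N'. x)"
    by (rule extensionalityI[of _ "carrier N'"]) (use gc in \<open>simp_all add: compose_eq\<close>)
  ultimately show ?thesis
    unfolding isomorphic_def iso_arr_def using assms(1-3) g
    by (intro bexI[of _ "(N, f, N')"] conjI bexI[of _ "(N', ?g, N)"])
      (auto simp: fp_modules_def Hom_def)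
qed

section \<open>The module category of a progenerator\<close>

text \<open>The axiom provides sums over initial segments of the naturals; an enumeration of
  \<open>I\<close> reindexes them.\<close>

lemma (in abelian_category) finite_direct_sum_exists:
  assumes "finite I" "\<And>k. k \<in> I \<Longrightarrow> X k \<in> Obj C"
  shows "\<exists>D \<iota> \<pi>. direct_sum C I X D \<iota> \<pi>"
proof -
  obtain h where h: "bij_betw h {..<card I} I"
    using ex_bij_betw_nat_finite[OF assms(1)] by (auto simp: atLeast0LessThan)
  define g where "g = inv_into {..<card I} h"
  have g: "bij_betw g I {..<card I}" "\<And>k. k \<in> I \<Longrightarrow> h (g k) = k" "\<And>k. k \<in> I \<Longrightarrow> g k < card I"
    "\<And>k l. k \<in> I \<Longrightarrow> l \<in> I \<Longrightarrow> g k = g l \<longleftrightarrow> k = l"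
    using bij_betw_inv_into[OF h] h unfolding g_def
    by (auto simp: bij_betw_def f_inv_into_f dest: inj_onD)
  have "\<exists>D \<iota> \<pi>. direct_sum C {..<card I} (\<lambda>k. X (h k)) D \<iota> \<pi>"
    using h assms(2) by (intro direct_sums_exist) (auto simp: bij_betw_def)
  then obtain D \<iota> \<pi> where d: "direct_sum C {..<card I} (\<lambda>k. X (h k)) D \<iota> \<pi>" by blast
  note dD = direct_sumD[OF d]
  interpret G: abelian_group "hom_group C D D" by (rule hom_abelian_group) (rule dD(2))+
  have "(\<Oplus>\<^bsub>hom_group C D D\<^esub>k\<in>I. \<iota> (g k) \<cdot> \<pi> (g k)) = (\<Oplus>\<^bsub>hom_group C D D\<^esub>k\<in>g ` I. \<iota> k \<cdot> \<pi> k)"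
    using g(1) dD(5-10) by (intro G.finsum_reindex[symmetric]) (auto simp: bij_betw_def)
  also have "\<dots> = Ident C D" using dD(3) g(1) by (simp add: bij_betw_def)
  finally have s: "(\<Oplus>\<^bsub>hom_group C D D\<^esub>k\<in>I. \<iota> (g k) \<cdot> \<pi> (g k)) = Ident C D" .
  have "direct_sum C I X D (\<iota> \<circ> g) (\<pi> \<circ> g)"
    unfolding direct_sum_def using s dD(2) assms g dD(4-10)[of "g _"] dD(11)[of "g _" "g _"]
    by (simp del: in_Hom add: Hom_def)
  then show ?thesis by blast
qed

text \<open>\<open>generates\<close> says that finitely many arrows from \<open>G\<close> to
  \<open>X\<close> are jointly epic. This avoids naming a power of \<open>G\<close> in the
  assumption; \<open>free_cover\<close> recovers the epimorphism from such a power.\<close>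

locale finite_progenerator = abelian_category C for C :: "('o, 'm, 'z) additive_category_scheme" (structure) +
  fixes \<Omega> :: "'x set" and P :: "'x \<Rightarrow> 'o" and G :: 'o and \<iota> \<pi> :: "'x \<Rightarrow> 'm"
  assumes sum: "direct_sum C \<Omega> P G \<iota> \<pi>"
    and projective: "projective_obj C G"
    and generates: "X \<in> Obj C \<Longrightarrow> \<exists>n e. (\<forall>k<n::nat. e k \<in> Hom C G X) \<and>
      (\<forall>h\<in>Arr C. Dom C h = X \<longrightarrow> (\<forall>k<n. null (h \<cdot> e k)) \<longrightarrow> null h)"
begin

lemmas sumD = direct_sumD[OF sum]

lemma G_obj [simp]: "G \<in> Obj C" by (rule sumD)

abbreviation R where "R \<equiv> hom_ring C \<Omega> P"

text \<open>The isomorphism from the endomorphism ring of \<open>G\<close> onto \<open>R\<close>;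
  the first index is the source and the second the target, as in \<open>hom_ring\<close>.\<close>

definition matrix_of where "matrix_of f = (\<lambda>x\<in>\<Omega>. \<lambda>y\<in>\<Omega>. \<pi> y \<cdot> (f \<cdot> \<iota> x))"

text \<open>The resolution of the identity of \<open>G\<close> is inserted between \<open>v\<close>
  and \<open>u\<close>. Both the matrix product and the module action have this shape.\<close>

lemma sum_insert:
  assumes "u \<in> Hom C G Z" "v \<in> Hom C W G"
  shows "(\<Oplus>\<^bsub>hom_group C W Z\<^esub>y\<in>\<Omega>. (u \<cdot> \<iota> y) \<cdot> (\<pi> y \<cdot> v)) = u \<cdot> v"
proof -
  have o: "Z \<in> Obj C" "W \<in> Obj C" using assms by auto
  have "u \<cdot> v = u \<cdot> ((\<Oplus>\<^bsub>hom_group C G G\<^esub>y\<in>\<Omega>. \<iota> y \<cdot> \<pi> y) \<cdot> v)" using sumD(3) assms by simp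
  also have "(\<Oplus>\<^bsub>hom_group C G G\<^esub>y\<in>\<Omega>. \<iota> y \<cdot> \<pi> y) \<cdot> v = (\<Oplus>\<^bsub>hom_group C W G\<^esub>y\<in>\<Omega>. (\<iota> y \<cdot> \<pi> y) \<cdot> v)"
    using sumD assms by (intro finsum_comp) simp_all
  also have "u \<cdot> \<dots> = (\<Oplus>\<^bsub>hom_group C W Z\<^esub>y\<in>\<Omega>. u \<cdot> ((\<iota> y \<cdot> \<pi> y) \<cdot> v))"
    using sumD assms o by (intro comp_finsum) simp_all
  also have "\<dots> = (\<Oplus>\<^bsub>hom_group C W Z\<^esub>y\<in>\<Omega>. (u \<cdot> \<iota> y) \<cdot> (\<pi> y \<cdot> v))"
    using sumD assms o by (intro finsum_hom_cong) simp_all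
  finally show ?thesis by simp
qed

lemma family_copair:
  assumes "X \<in> Obj C" "\<And>x. x \<in> \<Omega> \<Longrightarrow> b x \<in> Hom C (P x) X"
  shows "\<exists>f \<in> Hom C G X. \<forall>x\<in>\<Omega>. f \<cdot> \<iota> x = b x"
  using direct_sum_copair[OF sum assms(1), of b] assms(2) by blast

lemma family_ext:
  assumes "f \<in> Hom C G X" "g \<in> Hom C G X" "\<And>x. x \<in> \<Omega> \<Longrightarrow> f \<cdot> \<iota> x = g \<cdot> \<iota> x" shows "f = g"
  using direct_sum_ext_left[OF sum assms] .

lemma matrix_of_inj: "inj_on matrix_of (Hom C G G)"
proof (rule inj_onI)
  fix f g assume f: "f \<in> Hom C G G" and g: "g \<in> Hom C G G" and e: "matrix_of f = matrix_of g"
  show "f = g"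
  proof (rule family_ext[OF f g])
    fix x assume x: "x \<in> \<Omega>"
    show "f \<cdot> \<iota> x = g \<cdot> \<iota> x"
    proof (rule direct_sum_ext_right[OF sum, of _ "P x"])
      show "f \<cdot> \<iota> x \<in> Hom C (P x) G" "g \<cdot> \<iota> x \<in> Hom C (P x) G" using f g sumD(5-7)[OF x] by simp_all
      fix y assume y: "y \<in> \<Omega>"
      have "matrix_of f x y = matrix_of g x y" using e by simp
      then show "\<pi> y \<cdot> (f \<cdot> \<iota> x) = \<pi> y \<cdot> (g \<cdot> \<iota> x)" using x y by (simp add: matrix_of_def)
    qed
  qed
qed

lemma matrix_of_surj: "carrier R = matrix_of ` Hom C G G"
proof
  show "matrix_of ` Hom C G G \<subseteq> carrier R"
    using sumD(5-10) by (auto simp: hom_ring_def matrix_of_def)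
  show "carrier R \<subseteq> matrix_of ` Hom C G G"
  proof
    fix a assume "a \<in> carrier R"
    then have a: "a \<in> (\<Pi>\<^sub>E x\<in>\<Omega>. \<Pi>\<^sub>E y\<in>\<Omega>. Hom C (P x) (P y))" by (simp add: hom_ring_def)
    have axy: "a x y \<in> Hom C (P x) (P y)" if "x \<in> \<Omega>" "y \<in> \<Omega>" for x y using PiE_mem[OF PiE_mem[OF a that(1)] that(2)] .
    have "\<exists>b \<in> Hom C (P x) G. \<forall>y\<in>\<Omega>. \<pi> y \<cdot> b = a x y" if x: "x \<in> \<Omega>" for x
      using direct_sum_pair[OF sum sumD(4)[OF x], of "a x"] axy[OF x] by blast
    then obtain b where b: "\<And>x. x \<in> \<Omega> \<Longrightarrow> b x \<in> Hom C (P x) G" "\<And>x y. x \<in> \<Omega> \<Longrightarrow> y \<in> \<Omega> \<Longrightarrow> \<pi> y \<cdot> b x = a x y"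
      by metis
    obtain f where f: "f \<in> Hom C G G" "\<And>x. x \<in> \<Omega> \<Longrightarrow> f \<cdot> \<iota> x = b x"
      using family_copair[OF G_obj, of b] b(1) by blast
    have "a = matrix_of f"
    proof (rule PiE_ext[OF a])
      show "matrix_of f \<in> (\<Pi>\<^sub>E x\<in>\<Omega>. \<Pi>\<^sub>E y\<in>\<Omega>. Hom C (P x) (P y))"
        using f(1) sumD(5-10) by (auto simp: matrix_of_def)
      show "a x = matrix_of f x" if x: "x \<in> \<Omega>" for x
        by (rule extensionalityI[of _ \<Omega>])
          (use PiE_mem[OF a x] x f(2) b(2) in \<open>auto simp: matrix_of_def PiE_def\<close>)
    qed
    then show "a \<in> matrix_of ` Hom C G G" using f by blast
  qed
qed

lemma matrix_of_mult:
  assumes "f \<in> Hom C G G" "g \<in> Hom C G G" shows "matrix_of f \<otimes>\<^bsub>R\<^esub> matrix_of g = matrix_of (f \<cdot> g)"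
proof -
  have "(\<Oplus>\<^bsub>hom_group C (P x) (P z)\<^esub>y\<in>\<Omega>. matrix_of f y z \<cdot> matrix_of g x y) = \<pi> z \<cdot> ((f \<cdot> g) \<cdot> \<iota> x)"
    if x: "x \<in> \<Omega>" and z: "z \<in> \<Omega>" for x z
  proof -
    note X = sumD(4-7)[OF x] and Z = sumD(4,8-10)[OF z]
    have "(\<Oplus>\<^bsub>hom_group C (P x) (P z)\<^esub>y\<in>\<Omega>. matrix_of f y z \<cdot> matrix_of g x y) =
      (\<Oplus>\<^bsub>hom_group C (P x) (P z)\<^esub>y\<in>\<Omega>. ((\<pi> z \<cdot> f) \<cdot> \<iota> y) \<cdot> (\<pi> y \<cdot> (g \<cdot> \<iota> x)))"
      using assms sumD X Z x z by (intro finsum_hom_cong) (simp_all add: matrix_of_def)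
    also have "\<dots> = (\<pi> z \<cdot> f) \<cdot> (g \<cdot> \<iota> x)" using assms X Z by (intro sum_insert) simp_all
    also have "\<dots> = \<pi> z \<cdot> ((f \<cdot> g) \<cdot> \<iota> x)" using assms X Z by simp
    finally show ?thesis .
  qed
  then show ?thesis unfolding hom_ring_def by (auto simp: matrix_of_def intro!: restrict_ext)
qed

lemma matrix_of_one: "\<one>\<^bsub>R\<^esub> = matrix_of (Ident C G)"
  unfolding hom_ring_def using sumD by (auto simp: matrix_of_def intro!: restrict_ext)

text \<open>All modules involved are parametrized by \<open>Hom(G, X)\<close> for some \<open>X\<close>; module axioms and module
  homomorphisms are transported along such a parametrization \<open>E\<close>.\<close>

definition hom_rep where
  "hom_rep N X E \<longleftrightarrow> X \<in> Obj C \<and> inj_on E (Hom C G X) \<and> carrier N = E ` Hom C G X \<and>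
     (\<forall>f\<in>Hom C G X. \<forall>g\<in>Hom C G X. E f \<oplus>\<^bsub>N\<^esub> E g = E (hadd C f g)) \<and> \<zero>\<^bsub>N\<^esub> = E (hzero C G X)"

definition module_rep where
  "module_rep N X E \<longleftrightarrow> hom_rep N X E \<and> (\<forall>f\<in>Hom C G X. \<forall>a\<in>Hom C G G. act N (E f) (matrix_of a) = E (f \<cdot> a))"

lemma hom_repD:
  assumes "hom_rep N X E"
  shows "X \<in> Obj C" "inj_on E (Hom C G X)" "carrier N = E ` Hom C G X" "\<zero>\<^bsub>N\<^esub> = E (hzero C G X)"
    "f \<in> Hom C G X \<Longrightarrow> g \<in> Hom C G X \<Longrightarrow> E f \<oplus>\<^bsub>N\<^esub> E g = E (hadd C f g)"
  using assms unfolding hom_rep_def by simp_all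

lemma hom_rep_abelian_group:
  assumes "hom_rep N X E" shows "abelian_group N"
proof -
  note N = hom_repD[OF assms]
  interpret H: abelian_group "hom_group C G X" by (rule hom_abelian_group) (simp_all add: N)
  have z: "hzero C G X \<in> Hom C G X" using N(1) by simp
  have c: "hadd C f g \<in> Hom C G X" if "f \<in> Hom C G X" "g \<in> Hom C G X" for f g using that by simp
  show ?thesis
  proof (rule abelian_groupI)
    show "\<zero>\<^bsub>N\<^esub> \<in> carrier N" using N(3,4) z by blast
    fix x y assume "x \<in> carrier N" "y \<in> carrier N"
    then obtain f g where f: "f \<in> Hom C G X" "x = E f" and g: "g \<in> Hom C G X" "y = E g" unfolding N(3) by blast
    show "x \<oplus>\<^bsub>N\<^esub> y \<in> carrier N" using N(3,5) f g c by simp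
    show "x \<oplus>\<^bsub>N\<^esub> y = y \<oplus>\<^bsub>N\<^esub> x" using N(5) f g H.a_comm[of f g] by simp
    show "\<zero>\<^bsub>N\<^esub> \<oplus>\<^bsub>N\<^esub> x = x" using N(4) N(5)[OF z f(1)] f H.l_zero[of f] by simp
    show "\<exists>y\<in>carrier N. y \<oplus>\<^bsub>N\<^esub> x = \<zero>\<^bsub>N\<^esub>"
    proof (rule bexI)
      let ?g = "\<ominus>\<^bsub>hom_group C G X\<^esub> f"
      have ng: "?g \<in> Hom C G X" using H.a_inv_closed[of f] f by simp
      then show "E ?g \<in> carrier N" using N(3) by blast
      show "E ?g \<oplus>\<^bsub>N\<^esub> x = \<zero>\<^bsub>N\<^esub>" using N(4) N(5)[OF ng f(1)] f H.l_neg[of f] by simp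
    qed
    fix z assume "z \<in> carrier N"
    then obtain h where h: "h \<in> Hom C G X" "z = E h" unfolding N(3) by blast
    show "(x \<oplus>\<^bsub>N\<^esub> y) \<oplus>\<^bsub>N\<^esub> z = x \<oplus>\<^bsub>N\<^esub> (y \<oplus>\<^bsub>N\<^esub> z)"
      using N(5) f g h c[OF f(1) g(1)] c[OF g(1) h(1)] H.a_assoc[of f g h] by simp
  qed
qed

text \<open>Additively the ring is parametrized like a module, so
  \<open>hom_rep_abelian_group\<close> yields its additive axioms too.\<close>

lemma hom_rep_R: "hom_rep R G matrix_of"
  unfolding hom_rep_def
proof (intro conjI ballI)
  show "matrix_of f \<oplus>\<^bsub>R\<^esub> matrix_of g = matrix_of (hadd C f g)" if "f \<in> Hom C G G" "g \<in> Hom C G G" for f g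
    unfolding hom_ring_def using that sumD(5-10) by (auto simp: matrix_of_def comp_hadd intro!: restrict_ext)
  show "\<zero>\<^bsub>R\<^esub> = matrix_of (hzero C G G)"
    unfolding hom_ring_def using sumD by (auto simp: matrix_of_def intro!: restrict_ext)
qed (simp_all add: matrix_of_inj matrix_of_surj)

lemma ring_R: "ring R"
proof (rule ringI)
  note E = hom_repD[OF hom_rep_R]
  have obt: "\<exists>f \<in> Hom C G G. x = matrix_of f" if "x \<in> carrier R" for x using that unfolding matrix_of_surj by blast
  have I: "Ident C G \<in> Hom C G G" by simp
  show "abelian_group R" by (rule hom_rep_abelian_group[OF hom_rep_R])
  show "monoid R"
  proof (rule monoidI)
    show "\<one>\<^bsub>R\<^esub> \<in> carrier R" unfolding matrix_of_one matrix_of_surj using I by blast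
    fix x y z assume xyz: "x \<in> carrier R" "y \<in> carrier R" "z \<in> carrier R"
    obtain f g h where f: "f \<in> Hom C G G" "x = matrix_of f" and g: "g \<in> Hom C G G" "y = matrix_of g" and h: "h \<in> Hom C G G" "z = matrix_of h"
      using obt xyz by meson
    have fg: "f \<cdot> g \<in> Hom C G G" "g \<cdot> h \<in> Hom C G G" using f g h by simp_all
    show "x \<otimes>\<^bsub>R\<^esub> y \<in> carrier R" unfolding f g matrix_of_mult[OF f(1) g(1)] matrix_of_surj using fg by blast
    show "(x \<otimes>\<^bsub>R\<^esub> y) \<otimes>\<^bsub>R\<^esub> z = x \<otimes>\<^bsub>R\<^esub> (y \<otimes>\<^bsub>R\<^esub> z)"
      unfolding f g h matrix_of_mult[OF f(1) g(1)] matrix_of_mult[OF g(1) h(1)] matrix_of_mult[OF fg(1) h(1)] matrix_of_mult[OF f(1) fg(2)]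
      using f g h by simp
    show "\<one>\<^bsub>R\<^esub> \<otimes>\<^bsub>R\<^esub> x = x" "x \<otimes>\<^bsub>R\<^esub> \<one>\<^bsub>R\<^esub> = x"
      unfolding f matrix_of_one matrix_of_mult[OF I f(1)] matrix_of_mult[OF f(1) I] using f by simp_all
  qed
  fix x y z assume xyz: "x \<in> carrier R" "y \<in> carrier R" "z \<in> carrier R"
  obtain f g h where f: "f \<in> Hom C G G" "x = matrix_of f" and g: "g \<in> Hom C G G" "y = matrix_of g" and h: "h \<in> Hom C G G" "z = matrix_of h"
    using obt xyz by meson
  have fg: "hadd C f g \<in> Hom C G G" "f \<cdot> h \<in> Hom C G G" "g \<cdot> h \<in> Hom C G G" "h \<cdot> f \<in> Hom C G G" "h \<cdot> g \<in> Hom C G G"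
    using f g h by simp_all
  show "(x \<oplus>\<^bsub>R\<^esub> y) \<otimes>\<^bsub>R\<^esub> z = x \<otimes>\<^bsub>R\<^esub> z \<oplus>\<^bsub>R\<^esub> y \<otimes>\<^bsub>R\<^esub> z"
    unfolding f g h E(5)[OF f(1) g(1)] matrix_of_mult[OF fg(1) h(1)] matrix_of_mult[OF f(1) h(1)] matrix_of_mult[OF g(1) h(1)] E(5)[OF fg(2,3)]
    using f g h by (simp add: comp_hadd)
  show "z \<otimes>\<^bsub>R\<^esub> (x \<oplus>\<^bsub>R\<^esub> y) = z \<otimes>\<^bsub>R\<^esub> x \<oplus>\<^bsub>R\<^esub> z \<otimes>\<^bsub>R\<^esub> y"
    unfolding f g h E(5)[OF f(1) g(1)] matrix_of_mult[OF h(1) fg(1)] matrix_of_mult[OF h(1) f(1)] matrix_of_mult[OF h(1) g(1)] E(5)[OF fg(4,5)]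
    using f g h by (simp add: comp_hadd)
qed

lemma module_repD:
  assumes "module_rep N X E"
  shows "hom_rep N X E" "f \<in> Hom C G X \<Longrightarrow> a \<in> Hom C G G \<Longrightarrow> act N (E f) (matrix_of a) = E (f \<cdot> a)"
  using assms unfolding module_rep_def by simp_all

lemma module_rep_right_module:
  assumes "module_rep N X E" shows "right_module R N"
proof -
  note N = hom_repD[OF module_repD(1)[OF assms]] and ac = module_repD(2)[OF assms]
  note E = hom_repD[OF hom_rep_R]
  interpret R: ring R by (rule ring_R)
  interpret N: abelian_group N by (rule hom_rep_abelian_group[OF module_repD(1)[OF assms]])
  have I: "Ident C G \<in> Hom C G G" by simp
  show ?thesis
  proof (unfold_locales)
    fix x y a b assume xy: "x \<in> carrier N" "y \<in> carrier N" and ab: "a \<in> carrier R" "b \<in> carrier R"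
    obtain f g where f: "f \<in> Hom C G X" "x = E f" and g: "g \<in> Hom C G X" "y = E g" using xy unfolding N(3) by blast
    obtain c d where c: "c \<in> Hom C G G" "a = matrix_of c" and d: "d \<in> Hom C G G" "b = matrix_of d" using ab unfolding matrix_of_surj by blast
    have m: "f \<cdot> c \<in> Hom C G X" "g \<cdot> c \<in> Hom C G X" "f \<cdot> d \<in> Hom C G X" "hadd C f g \<in> Hom C G X" "hadd C c d \<in> Hom C G G" "c \<cdot> d \<in> Hom C G G"
      using f g c d by simp_all
    show "act N x a \<in> carrier N" unfolding f c ac[OF f(1) c(1)] N(3) using m by blast
    show "act N (x \<oplus>\<^bsub>N\<^esub> y) a = act N x a \<oplus>\<^bsub>N\<^esub> act N y a"
      unfolding f g c N(5)[OF f(1) g(1)] ac[OF m(4) c(1)] ac[OF f(1) c(1)] ac[OF g(1) c(1)] N(5)[OF m(1,2)]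
      using f g c by (simp add: comp_hadd)
    show "act N x (a \<oplus>\<^bsub>R\<^esub> b) = act N x a \<oplus>\<^bsub>N\<^esub> act N x b"
      unfolding f c d E(5)[OF c(1) d(1)] ac[OF f(1) m(5)] ac[OF f(1) c(1)] ac[OF f(1) d(1)] N(5)[OF m(1,3)]
      using f c d by (simp add: comp_hadd)
    show "act N x (a \<otimes>\<^bsub>R\<^esub> b) = act N (act N x a) b"
      unfolding f c d matrix_of_mult[OF c(1) d(1)] ac[OF f(1) m(6)] ac[OF f(1) c(1)] ac[OF m(1) d(1)]
      using f c d by simp
  next
    fix x assume "x \<in> carrier N"
    then obtain f where f: "f \<in> Hom C G X" "x = E f" unfolding N(3) by blast
    show "act N x \<one>\<^bsub>R\<^esub> = x"
      unfolding f matrix_of_one ac[OF f(1) I] using f by simp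
  qed
qed

definition family_of where "family_of f = Inl (\<lambda>x\<in>\<Omega>. f \<cdot> \<iota> x)"

lemma hom_module_rep:
  assumes X: "X \<in> Obj C"
  shows "module_rep (hom_module C \<Omega> P X :: ('x \<Rightarrow> 'x \<Rightarrow> 'm, ('x \<Rightarrow> 'm) + 'u) rmodule) X family_of"
  unfolding module_rep_def hom_rep_def
proof (intro conjI ballI)
  let ?N = "hom_module C \<Omega> P X :: ('x \<Rightarrow> 'x \<Rightarrow> 'm, ('x \<Rightarrow> 'm) + 'u) rmodule"
  show "inj_on (family_of :: _ \<Rightarrow> ('x \<Rightarrow> 'm) + 'u) (Hom C G X)"
  proof (rule inj_onI)
    fix f g assume f: "f \<in> Hom C G X" and g: "g \<in> Hom C G X" and e: "(family_of f :: ('x \<Rightarrow> 'm) + 'u) = family_of g"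
    show "f = g"
    proof (rule family_ext[OF f g])
      fix x assume x: "x \<in> \<Omega>"
      have "(\<lambda>x\<in>\<Omega>. f \<cdot> \<iota> x) x = (\<lambda>x\<in>\<Omega>. g \<cdot> \<iota> x) x" using e by (simp add: family_of_def)
      then show "f \<cdot> \<iota> x = g \<cdot> \<iota> x" using x by simp
    qed
  qed
  show "carrier ?N = family_of ` Hom C G X"
  proof
    show "family_of ` Hom C G X \<subseteq> carrier ?N"
      using sumD(5-7) by (auto simp: hom_module_def family_of_def)
    show "carrier ?N \<subseteq> family_of ` Hom C G X"
    proof
      fix \<phi> assume "\<phi> \<in> carrier ?N"
      then obtain b where b: "b \<in> (\<Pi>\<^sub>E x\<in>\<Omega>. Hom C (P x) X)" "\<phi> = Inl b" by (auto simp: hom_module_def)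
      obtain f where f: "f \<in> Hom C G X" "\<And>x. x \<in> \<Omega> \<Longrightarrow> f \<cdot> \<iota> x = b x"
        using family_copair[OF X, of b] PiE_mem[OF b(1)] by blast
      have "(\<lambda>x\<in>\<Omega>. f \<cdot> \<iota> x) = b"
        by (rule extensionalityI[of _ \<Omega>]) (use f(2) b(1) in \<open>auto simp: PiE_def\<close>)
      then show "\<phi> \<in> family_of ` Hom C G X" using b f(1) unfolding family_of_def by blast
    qed
  qed
  show "family_of f \<oplus>\<^bsub>?N\<^esub> family_of g = family_of (hadd C f g)" if "f \<in> Hom C G X" "g \<in> Hom C G X" for f g
    unfolding hom_module_def using that sumD(5-7) by (auto simp: family_of_def comp_hadd intro!: restrict_ext)
  show "\<zero>\<^bsub>?N\<^esub> = family_of (hzero C G X)"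
    unfolding hom_module_def using X sumD by (auto simp: family_of_def intro!: restrict_ext)
  show "act ?N (family_of f) (matrix_of a) = family_of (f \<cdot> a)" if f: "f \<in> Hom C G X" and a: "a \<in> Hom C G G" for f a
  proof -
    have "(\<Oplus>\<^bsub>hom_group C (P x) X\<^esub>y\<in>\<Omega>. (\<lambda>x\<in>\<Omega>. f \<cdot> \<iota> x) y \<cdot> matrix_of a x y) = (f \<cdot> a) \<cdot> \<iota> x" if x: "x \<in> \<Omega>" for x
    proof -
      have "(\<Oplus>\<^bsub>hom_group C (P x) X\<^esub>y\<in>\<Omega>. (\<lambda>x\<in>\<Omega>. f \<cdot> \<iota> x) y \<cdot> matrix_of a x y) =
        (\<Oplus>\<^bsub>hom_group C (P x) X\<^esub>y\<in>\<Omega>. (f \<cdot> \<iota> y) \<cdot> (\<pi> y \<cdot> (a \<cdot> \<iota> x)))"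
        using f a sumD x X by (intro finsum_hom_cong) (simp_all add: matrix_of_def)
      also have "\<dots> = f \<cdot> (a \<cdot> \<iota> x)" using f a sumD(5-7)[OF x] by (intro sum_insert) simp_all
      finally show ?thesis using f a sumD(5-7)[OF x] by simp
    qed
    then show ?thesis unfolding hom_module_def by (auto simp: family_of_def intro!: restrict_ext)
  qed
qed (rule X)

text \<open>The free module of rank \<open>n\<close> is the value of \<open>Hom(G, -)\<close> at the
  \<open>n\<close>-th power of \<open>G\<close>: an arrow from \<open>G\<close> into
  \<open>D\<close> is the tuple of its components, each an endomorphism of \<open>G\<close>.\<close>

lemma free_module_rep:
  assumes d: "direct_sum C {..<n} (\<lambda>_. G) D j r"
  shows "module_rep (free_rmodule R n) D (\<lambda>w. \<lambda>k\<in>{..<n}. matrix_of (r k \<cdot> w))"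
  unfolding module_rep_def hom_rep_def
proof (intro conjI ballI)
  note dD = direct_sumD[OF d]
  let ?E = "\<lambda>w. \<lambda>k\<in>{..<n}. matrix_of (r k \<cdot> w)"
  show D: "D \<in> Obj C" by (rule dD)
  have rw: "r k \<cdot> w \<in> Hom C G G" if "k < n" "w \<in> Hom C G D" for k w using dD(8-10)[of k] that by simp
  show "inj_on ?E (Hom C G D)"
  proof (rule inj_onI)
    fix v w assume v: "v \<in> Hom C G D" and w: "w \<in> Hom C G D" and e: "?E v = ?E w"
    show "v = w"
    proof (rule direct_sum_ext_right[OF d v w])
      fix k assume k: "k \<in> {..<n}"
      have "?E v k = ?E w k" using e by simp
      then have "matrix_of (r k \<cdot> v) = matrix_of (r k \<cdot> w)" using k by simp
      then show "r k \<cdot> v = r k \<cdot> w" by (rule inj_onD[OF matrix_of_inj]) (use rw[OF _ v] rw[OF _ w] k in simp_all)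
    qed
  qed
  show "carrier (free_rmodule R n) = ?E ` Hom C G D"
  proof
    show "?E ` Hom C G D \<subseteq> carrier (free_rmodule R n)"
      using rw by (auto simp: free_rmodule_def matrix_of_surj simp del: in_Hom)
    show "carrier (free_rmodule R n) \<subseteq> ?E ` Hom C G D"
    proof
      fix v assume "v \<in> carrier (free_rmodule R n)"
      then have v: "v \<in> {..<n} \<rightarrow>\<^sub>E matrix_of ` Hom C G G" by (simp add: free_rmodule_def matrix_of_surj)
      have "\<forall>k\<in>{..<n}. \<exists>a\<in>Hom C G G. v k = matrix_of a" using PiE_mem[OF v] by blast
      then obtain a where a: "\<And>k. k \<in> {..<n} \<Longrightarrow> a k \<in> Hom C G G" "\<And>k. k \<in> {..<n} \<Longrightarrow> v k = matrix_of (a k)" by metis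
      obtain w where w: "w \<in> Hom C G D" "\<And>k. k \<in> {..<n} \<Longrightarrow> r k \<cdot> w = a k"
        using direct_sum_pair[OF d G_obj, of a] a(1) by blast
      have "v = ?E w" by (rule extensionalityI[of _ "{..<n}"]) (use v w(2) a(2) in \<open>auto simp: PiE_def\<close>)
      then show "v \<in> ?E ` Hom C G D" using w(1) by blast
    qed
  qed
  show "?E v \<oplus>\<^bsub>free_rmodule R n\<^esub> ?E w = ?E (hadd C v w)" if v: "v \<in> Hom C G D" and w: "w \<in> Hom C G D" for v w
  proof -
    have "matrix_of (r k \<cdot> v) \<oplus>\<^bsub>R\<^esub> matrix_of (r k \<cdot> w) = matrix_of (r k \<cdot> hadd C v w)" if k: "k < n" for k
      using hom_repD(5)[OF hom_rep_R rw[OF k v] rw[OF k w]] v w dD(8-10)[of k] k by (simp add: comp_hadd)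
    then show ?thesis by (auto simp: free_rmodule_def intro!: restrict_ext)
  qed
  show "\<zero>\<^bsub>free_rmodule R n\<^esub> = ?E (hzero C G D)"
    using hom_repD(4)[OF hom_rep_R] dD(8-10) by (auto simp: free_rmodule_def intro!: restrict_ext)
  show "act (free_rmodule R n) (?E f) (matrix_of a) = ?E (f \<cdot> a)" if f: "f \<in> Hom C G D" and a: "a \<in> Hom C G G" for f a
  proof -
    have "matrix_of (r k \<cdot> f) \<otimes>\<^bsub>R\<^esub> matrix_of a = matrix_of (r k \<cdot> (f \<cdot> a))" if k: "k < n" for k
      using matrix_of_mult[OF rw[OF k f] a] f a dD(8-10)[of k] k by simp
    then show ?thesis by (auto simp: free_rmodule_def intro!: restrict_ext)
  qed
qed

end

section \<open>Exactness, fullness and essential surjectivity of Hom(G, -)\<close>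

context finite_progenerator
begin

lemma lift_G:
  assumes "epi_arr C e" "w \<in> Hom C G (Cod C e)"
  shows "\<exists>u \<in> Hom C G (Dom C e). e \<cdot> u = w"
  using projective assms unfolding projective_obj_def by blast

lemma null_if_null_on_G:
  assumes "q \<in> Arr C" "\<And>w. w \<in> Hom C G (Dom C q) \<Longrightarrow> null (q \<cdot> w)"
  shows "null q"
proof -
  have "Dom C q \<in> Obj C" using assms by simp
  then obtain n e where e: "\<forall>k<n::nat. e k \<in> Hom C G (Dom C q)"
      "\<forall>h\<in>Arr C. Dom C h = Dom C q \<longrightarrow> (\<forall>k<n. null (h \<cdot> e k)) \<longrightarrow> null h"
    using generates by blast
  have "\<forall>k<n. null (q \<cdot> e k)" using e(1) assms(2) by blast
  then show ?thesis using e(2) assms(1) by blast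
qed

lemma eq_if_eq_on_G:
  assumes "f \<in> Hom C X Y" "g \<in> Hom C X Y" "\<And>w. w \<in> Hom C G X \<Longrightarrow> f \<cdot> w = g \<cdot> w"
  shows "f = g"
proof -
  have "null (hsub f g)"
  proof (rule null_if_null_on_G)
    show "hsub f g \<in> Arr C" using assms by simp
    fix w assume "w \<in> Hom C G (Dom C (hsub f g))"
    then have w: "w \<in> Hom C G X" using assms by simp
    have "hsub f g \<cdot> w = hsub (f \<cdot> w) (g \<cdot> w)" using assms(1,2) w by (simp add: comp_hsub)
    also have "\<dots> = hsub (g \<cdot> w) (g \<cdot> w)" using assms(3)[OF w] by simp
    finally show "null (hsub f g \<cdot> w)" using null_hsub_self[of "g \<cdot> w"] assms(2) w by simp
  qed
  then show ?thesis by (rule null_hsub_iff[THEN iffD1, rotated -1]) (use assms in simp_all)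
qed

text \<open>The jointly epic arrows from \<open>generates\<close> are assembled into a single arrow
  from a power of \<open>G\<close>.\<close>

lemma free_cover:
  assumes "X \<in> Obj C"
  obtains n D j r e where "direct_sum C {..<n::nat} (\<lambda>_. G) D j r" "e \<in> Hom C D X" "epi_arr C e"
proof -
  obtain n e where e: "\<forall>k<n::nat. e k \<in> Hom C G X"
      "\<forall>h\<in>Arr C. Dom C h = X \<longrightarrow> (\<forall>k<n. null (h \<cdot> e k)) \<longrightarrow> null h"
    using generates[OF assms] by blast
  obtain D j r where d: "direct_sum C {..<n} (\<lambda>_. G) D j r" using direct_sums_exist[of n "\<lambda>_. G"] by auto
  note dD = direct_sumD[OF d]
  obtain f where f: "f \<in> Hom C D X" "\<And>k. k \<in> {..<n} \<Longrightarrow> f \<cdot> j k = e k"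
    using direct_sum_copair[OF d assms, of e] e(1) by blast
  have "epi_arr C f" unfolding epi_iff
  proof (intro conjI ballI impI)
    show "f \<in> Arr C" using f by simp
    fix h assume h: "h \<in> Arr C" "Dom C h = Cod C f" "null (h \<cdot> f)"
    have "null (h \<cdot> e k)" if k: "k < n" for k
    proof -
      have "h \<cdot> e k = (h \<cdot> f) \<cdot> j k" using f(2)[of k] f(1) h(1,2) dD(5-7)[of k] k by simp
      moreover have "null ((h \<cdot> f) \<cdot> j k)"
        by (rule null_comp(2)[OF _ _ _ h(3)]) (use f(1) h(1,2) dD(5-7)[of k] k in simp_all)
      ultimately show ?thesis by simp
    qed
    moreover have "Dom C h = X" using h f by simp
    ultimately show "null h" using e(2) h(1) by blast
  qed
  then show thesis using that d f(1) by blast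
qed

text \<open>Exactness of \<open>Hom(G, -)\<close> at the target of \<open>h\<close>: an arrow killed
  by \<open>coker h\<close> lies in the image of \<open>h\<close>, and projectivity lifts it along
  the epic part.\<close>

lemma fac_image:
  assumes "h \<in> Arr C" "w \<in> Hom C G (Cod C h)" "null (coker h \<cdot> w)"
  shows "\<exists>u \<in> Hom C G (Dom C h). h \<cdot> u = w"
proof -
  obtain m e where m: "mono_arr C m" "epi_arr C e" "m \<in> Arr C" "e \<in> Arr C" "Dom C e = Dom C h"
    "Cod C m = Cod C h" "Dom C m = Cod C e" "m \<cdot> e = h" by (rule image_factorization[OF assms(1)])
  have w: "w \<in> Arr C" "Dom C w = G" "Cod C w = Cod C h" using assms(2) by simp_all
  have "null ((coker m \<cdot> m) \<cdot> e)" by (rule null_comp(2)) (use m in simp_all)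
  then have "null (coker m \<cdot> h)" using m(3,4,7) m(8)[symmetric] comp_assoc'[of e m "coker m"] by simp
  then obtain c where c: "c \<in> Arr C" "Dom C c = Cod C (coker h)" "c \<cdot> coker h = coker m"
    by (rule coker_fac) (use m assms in simp_all)
  have "null (c \<cdot> (coker h \<cdot> w))" by (rule null_comp(1)[OF _ _ _ assms(3)]) (use c w assms in simp_all)
  moreover have "c \<cdot> (coker h \<cdot> w) = coker m \<cdot> w"
    using comp_assoc'[of w "coker h" c] c w assms(1) by (simp del: comp_assoc')
  ultimately have "null (coker m \<cdot> w)" by simp
  then have "fac w m" by (rule mono_fac[OF m(1), rotated -1]) (use w m in simp_all)
  then obtain v where v: "v \<in> Arr C" "Dom C v = Dom C w" "Cod C v = Dom C m" "m \<cdot> v = w" by (rule facE)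
  have "v \<in> Hom C G (Cod C e)" using v w m by simp
  then obtain u where u: "u \<in> Hom C G (Dom C e)" "e \<cdot> u = v" using lift_G[OF m(2)] by blast
  have "(m \<cdot> e) \<cdot> u = m \<cdot> (e \<cdot> u)" by (rule comp_assoc') (use u(1) m in simp_all)
  then have "h \<cdot> u = w" using u(2) v(4) m(8) by simp
  moreover have "u \<in> Hom C G (Dom C h)" using u(1) m(5) by simp
  ultimately show ?thesis by blast
qed

text \<open>Homomorphisms of right modules over the endomorphism ring of \<open>G\<close>, stated on
  the hom-sets themselves so that the coding by matrices and families does not interfere.\<close>

definition G_linear where
  "G_linear X Y \<psi> \<longleftrightarrow> (\<forall>f\<in>Hom C G X. \<psi> f \<in> Hom C G Y) \<and>
     (\<forall>f\<in>Hom C G X. \<forall>g\<in>Hom C G X. \<psi> (hadd C f g) = hadd C (\<psi> f) (\<psi> g)) \<and>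
     (\<forall>f\<in>Hom C G X. \<forall>a\<in>Hom C G G. \<psi> (f \<cdot> a) = \<psi> f \<cdot> a)"

lemma G_linearD:
  assumes "G_linear X Y \<psi>"
  shows "f \<in> Hom C G X \<Longrightarrow> \<psi> f \<in> Hom C G Y"
    "f \<in> Hom C G X \<Longrightarrow> g \<in> Hom C G X \<Longrightarrow> \<psi> (hadd C f g) = hadd C (\<psi> f) (\<psi> g)"
    "f \<in> Hom C G X \<Longrightarrow> a \<in> Hom C G G \<Longrightarrow> \<psi> (f \<cdot> a) = \<psi> f \<cdot> a"
  using assms unfolding G_linear_def by blast+

lemma G_linear_zero:
  assumes "G_linear X Y \<psi>" "X \<in> Obj C" "Y \<in> Obj C"
  shows "\<psi> (hzero C G X) = hzero C G Y"
proof -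
  have z: "hzero C G X \<in> Hom C G X" "hzero C G G \<in> Hom C G G" using assms by simp_all
  note p = G_linearD(1)[OF assms(1) z(1)]
  \<comment> \<open>The zero arrow is a multiple of the zero endomorphism of \<open>G\<close>, so
    preservation of zero follows from linearity over the ring.\<close>
  have "hzero C G X = hzero C G X \<cdot> hzero C G G" using assms by simp
  then have "\<psi> (hzero C G X) = \<psi> (hzero C G X \<cdot> hzero C G G)" by (rule arg_cong)
  also have "\<dots> = \<psi> (hzero C G X) \<cdot> hzero C G G" by (rule G_linearD(3)[OF assms(1) z])
  also have "\<dots> = hzero C G Y" using p by simp
  finally show ?thesis .
qed

text \<open>As for a free module, \<open>\<psi>\<close> is determined by its values at the
  injections \<open>j k\<close>, and the arrow with these components represents it.\<close>

lemma G_linear_free: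
  assumes d: "direct_sum C {..<n::nat} (\<lambda>_. G) D j r" and Y: "Y \<in> Obj C" and \<psi>: "G_linear D Y \<psi>"
  shows "\<exists>g \<in> Hom C D Y. \<forall>w\<in>Hom C G D. \<psi> w = g \<cdot> w"
proof -
  note dD = direct_sumD[OF d] and L = G_linearD[OF \<psi>]
  have jH: "j k \<in> Hom C G D" if "k \<in> {..<n}" for k using dD(5-7)[OF that] by simp
  have \<psi>j: "\<psi> (j k) \<in> Hom C G Y" if "k \<in> {..<n}" for k using L(1)[OF jH[OF that]] .
  let ?g = "\<Oplus>\<^bsub>hom_group C D Y\<^esub>k\<in>{..<n}. \<psi> (j k) \<cdot> r k"
  have g: "?g \<in> Hom C D Y" by (rule direct_sum_copair(1)[OF d Y \<psi>j])
  have "\<psi> w = ?g \<cdot> w" if w: "w \<in> Hom C G D" for w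
  proof -
    have rw: "r k \<cdot> w \<in> Hom C G G" if "k \<in> {..<n}" for k using dD(8-10)[OF that] w by simp
    interpret A: abelian_group "hom_group C G D" by (rule hom_abelian_group) (simp_all add: dD)
    interpret B: abelian_group "hom_group C G Y" by (rule hom_abelian_group) (simp_all add: Y)
    have jrw: "j k \<cdot> (r k \<cdot> w) \<in> Hom C G D" if "k \<in> {..<n}" for k using jH[OF that] rw[OF that] by simp
    have \<psi>jrw: "\<psi> (j k) \<cdot> (r k \<cdot> w) \<in> Hom C G Y" if "k \<in> {..<n}" for k using \<psi>j[OF that] rw[OF that] by simp
    have part: "\<psi> (\<Oplus>\<^bsub>hom_group C G D\<^esub>k\<in>K. j k \<cdot> (r k \<cdot> w)) = (\<Oplus>\<^bsub>hom_group C G Y\<^esub>k\<in>K. \<psi> (j k) \<cdot> (r k \<cdot> w))"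
      if "finite K" "K \<subseteq> {..<n}" for K
      using that
    proof (induction K)
      case empty
      then show ?case using G_linear_zero[OF \<psi> dD(2) Y] by simp
    next
      case (insert a K)
      have a: "a \<in> {..<n}" and K: "K \<subseteq> {..<n}" using insert by simp_all
      have f1: "(\<lambda>k. j k \<cdot> (r k \<cdot> w)) \<in> K \<rightarrow> carrier (hom_group C G D)" "j a \<cdot> (r a \<cdot> w) \<in> carrier (hom_group C G D)"
        using jrw K a by (auto simp del: in_Hom)
      have f2: "(\<lambda>k. \<psi> (j k) \<cdot> (r k \<cdot> w)) \<in> K \<rightarrow> carrier (hom_group C G Y)" "\<psi> (j a) \<cdot> (r a \<cdot> w) \<in> carrier (hom_group C G Y)"
        using \<psi>jrw K a by (auto simp del: in_Hom)
      have s: "(\<Oplus>\<^bsub>hom_group C G D\<^esub>k\<in>K. j k \<cdot> (r k \<cdot> w)) \<in> Hom C G D" using A.finsum_closed[OF f1(1)] by simp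
      have e1: "(\<Oplus>\<^bsub>hom_group C G D\<^esub>k\<in>insert a K. j k \<cdot> (r k \<cdot> w)) = hadd C (j a \<cdot> (r a \<cdot> w)) (\<Oplus>\<^bsub>hom_group C G D\<^esub>k\<in>K. j k \<cdot> (r k \<cdot> w))"
        using A.finsum_insert[OF insert(1,2) f1] by simp
      have e2: "(\<Oplus>\<^bsub>hom_group C G Y\<^esub>k\<in>insert a K. \<psi> (j k) \<cdot> (r k \<cdot> w)) = hadd C (\<psi> (j a) \<cdot> (r a \<cdot> w)) (\<Oplus>\<^bsub>hom_group C G Y\<^esub>k\<in>K. \<psi> (j k) \<cdot> (r k \<cdot> w))"
        using B.finsum_insert[OF insert(1,2) f2] by simp
      show ?case unfolding e1 e2 L(2)[OF jrw[OF a] s] L(3)[OF jH[OF a] rw[OF a]] insert.IH[OF K] ..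
    qed
    have "w = (\<Oplus>\<^bsub>hom_group C D D\<^esub>k\<in>{..<n}. j k \<cdot> r k) \<cdot> w" using dD(3) w by simp
    also have "\<dots> = (\<Oplus>\<^bsub>hom_group C G D\<^esub>k\<in>{..<n}. (j k \<cdot> r k) \<cdot> w)" using dD w by (intro finsum_comp) simp_all
    also have "\<dots> = (\<Oplus>\<^bsub>hom_group C G D\<^esub>k\<in>{..<n}. j k \<cdot> (r k \<cdot> w))" using dD w by (intro finsum_hom_cong) simp_all
    finally have "\<psi> w = \<psi> (\<Oplus>\<^bsub>hom_group C G D\<^esub>k\<in>{..<n}. j k \<cdot> (r k \<cdot> w))" by (rule arg_cong)
    also have "\<dots> = (\<Oplus>\<^bsub>hom_group C G Y\<^esub>k\<in>{..<n}. \<psi> (j k) \<cdot> (r k \<cdot> w))" by (rule part) simp_all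
    also have "\<dots> = (\<Oplus>\<^bsub>hom_group C G Y\<^esub>k\<in>{..<n}. (\<psi> (j k) \<cdot> r k) \<cdot> w)"
    proof (rule finsum_hom_cong)
      show "\<psi> (j k) \<cdot> (r k \<cdot> w) = (\<psi> (j k) \<cdot> r k) \<cdot> w" "(\<psi> (j k) \<cdot> r k) \<cdot> w \<in> Hom C G Y" if "k \<in> {..<n}" for k
        using \<psi>j[OF that] dD(8-10)[OF that] w by simp_all
    qed (simp_all add: Y)
    also have "\<dots> = ?g \<cdot> w"
    proof (rule finsum_comp[symmetric])
      show "\<psi> (j k) \<cdot> r k \<in> Hom C D Y" if "k \<in> {..<n}" for k using \<psi>j[OF that] dD(8-10)[OF that] by simp
    qed (use w Y in simp_all)
    finally show ?thesis .
  qed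
  then show ?thesis using g by blast
qed

text \<open>On an epic cover \<open>e\<close> of \<open>X\<close> by a power of \<open>G\<close> the
  map is represented by some \<open>g\<close>. Testing on \<open>G\<close> shows that
  \<open>g\<close> kills \<open>ker e\<close>, so \<open>g\<close> descends to \<open>X\<close>; as
  every arrow \<open>G \<rightarrow> X\<close> lifts along \<open>e\<close>, the descended arrow
  represents \<open>\<psi>\<close>.\<close>

lemma G_linear_representable:
  assumes X: "X \<in> Obj C" and Y: "Y \<in> Obj C" and \<psi>: "G_linear X Y \<psi>"
  shows "\<exists>g \<in> Hom C X Y. \<forall>w\<in>Hom C G X. \<psi> w = g \<cdot> w"
proof -
  obtain n D j r e where d: "direct_sum C {..<n::nat} (\<lambda>_. G) D j r" and e: "e \<in> Hom C D X" "epi_arr C e"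
    by (rule free_cover[OF X])
  note dD = direct_sumD[OF d] and L = G_linearD[OF \<psi>]
  have eD: "e \<in> Arr C" "Dom C e = D" "Cod C e = X" using e by simp_all
  have ew: "e \<cdot> w \<in> Hom C G X" if "w \<in> Hom C G D" for w using that eD by simp
  have "G_linear D Y (\<lambda>w. \<psi> (e \<cdot> w))"
    unfolding G_linear_def
  proof (intro conjI ballI)
    fix f assume f: "f \<in> Hom C G D"
    show "\<psi> (e \<cdot> f) \<in> Hom C G Y" using L(1)[OF ew[OF f]] .
    show "\<psi> (e \<cdot> hadd C f g) = hadd C (\<psi> (e \<cdot> f)) (\<psi> (e \<cdot> g))" if g: "g \<in> Hom C G D" for g
    proof -
      have "e \<cdot> hadd C f g = hadd C (e \<cdot> f) (e \<cdot> g)" using f g eD by (simp add: comp_hadd)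
      then show ?thesis using L(2)[OF ew[OF f] ew[OF g]] by simp
    qed
    show "\<psi> (e \<cdot> (f \<cdot> a)) = \<psi> (e \<cdot> f) \<cdot> a" if a: "a \<in> Hom C G G" for a
      using L(3)[OF ew[OF f] a] f a eD by simp
  qed
  from G_linear_free[OF d Y this]
  obtain g where g: "g \<in> Hom C D Y" "\<And>w. w \<in> Hom C G D \<Longrightarrow> \<psi> (e \<cdot> w) = g \<cdot> w" by blast
  have gD: "g \<in> Arr C" "Dom C g = D" "Cod C g = Y" using g(1) by simp_all
  have k: "ker e \<in> Arr C" "Cod C (ker e) = D" "null (e \<cdot> ker e)" using eD by simp_all
  have "null (g \<cdot> ker e)"
  proof (rule null_if_null_on_G)
    show "g \<cdot> ker e \<in> Arr C" using gD k by simp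
    fix w assume "w \<in> Hom C G (Dom C (g \<cdot> ker e))"
    then have w: "w \<in> Arr C" "Dom C w = G" "Cod C w = Dom C (ker e)" using gD k by simp_all
    have kw: "ker e \<cdot> w \<in> Hom C G D" using w k by simp
    have "null ((e \<cdot> ker e) \<cdot> w)" by (rule null_comp(2)[OF _ _ _ k(3)]) (use w k eD in simp_all)
    moreover have "(e \<cdot> ker e) \<cdot> w = e \<cdot> (ker e \<cdot> w)" by (rule comp_assoc') (use w k eD in simp_all)
    ultimately have "null (e \<cdot> (ker e \<cdot> w))" by simp
    then have "e \<cdot> (ker e \<cdot> w) = hzero C G X" by (rule nullD) (use w k eD in simp_all)
    then have "g \<cdot> (ker e \<cdot> w) = hzero C G Y" using g(2)[OF kw] G_linear_zero[OF \<psi> X Y] by simp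
    then have "null (g \<cdot> (ker e \<cdot> w))" by (rule nullI) (simp_all add: Y)
    then show "null ((g \<cdot> ker e) \<cdot> w)" using gD k w by simp
  qed
  then obtain h where h: "h \<in> Arr C" "Dom C h = Cod C e" "Cod C h = Cod C g" "h \<cdot> e = g"
    by (rule epi_fac[OF _ e(2)]) (use gD eD in simp_all)
  have hH: "h \<in> Hom C X Y" using h gD eD by simp
  moreover have "\<psi> w = h \<cdot> w" if w: "w \<in> Hom C G X" for w
  proof -
    have "w \<in> Hom C G (Cod C e)" using w eD by simp
    then obtain u where u: "u \<in> Hom C G (Dom C e)" "e \<cdot> u = w" using lift_G[OF e(2)] by blast
    have uD: "u \<in> Hom C G D" using u eD by simp
    have "\<psi> w = g \<cdot> u" using g(2)[OF uD] u(2) by simp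
    also have "\<dots> = h \<cdot> (e \<cdot> u)" unfolding h(4)[symmetric] by (rule comp_assoc') (use uD h eD in simp_all)
    finally show ?thesis using u(2) by simp
  qed
  ultimately show ?thesis by blast
qed

lemma induced_hom:
  assumes N: "module_rep N X E" and N': "module_rep N' Y E'" and g: "g \<in> Hom C X Y"
  shows "\<exists>\<phi> \<in> rmodule_hom R N N'. \<forall>w\<in>Hom C G X. \<phi> (E w) = E' (g \<cdot> w)"
proof -
  note n = hom_repD[OF module_repD(1)[OF N]] and n' = hom_repD[OF module_repD(1)[OF N']]
  define \<phi> where "\<phi> = (\<lambda>v\<in>carrier N. E' (g \<cdot> inv_into (Hom C G X) E v))"
  have \<phi>: "\<phi> (E w) = E' (g \<cdot> w)" if "w \<in> Hom C G X" for w
    unfolding \<phi>_def using that n(3) inv_into_f_f[OF n(2) that] by simp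
  have gw: "g \<cdot> w \<in> Hom C G Y" if "w \<in> Hom C G X" for w using that g by simp
  have "\<phi> \<in> rmodule_hom R N N'"
  proof (rule rmodule_homI)
    show "\<phi> \<in> extensional (carrier N)" unfolding \<phi>_def by simp
    fix x assume "x \<in> carrier N"
    then obtain v where v: "v \<in> Hom C G X" "x = E v" unfolding n(3) by blast
    show "\<phi> x \<in> carrier N'" unfolding v(2) \<phi>[OF v(1)] n'(3) using gw[OF v(1)] by blast
    show "\<phi> (x \<oplus>\<^bsub>N\<^esub> y) = \<phi> x \<oplus>\<^bsub>N'\<^esub> \<phi> y" if "y \<in> carrier N" for y
    proof -
      obtain w where w: "w \<in> Hom C G X" "y = E w" using \<open>y \<in> carrier N\<close> unfolding n(3) by blast
      have h: "hadd C v w \<in> Hom C G X" using v w by simp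
      show ?thesis unfolding v(2) w(2) n(5)[OF v(1) w(1)] \<phi>[OF v(1)] \<phi>[OF w(1)] \<phi>[OF h] n'(5)[OF gw[OF v(1)] gw[OF w(1)]]
        using v(1) w(1) g by (simp add: comp_hadd)
    qed
    show "\<phi> (act N x a) = act N' (\<phi> x) a" if "a \<in> carrier R" for a
    proof -
      obtain b where b: "b \<in> Hom C G G" "a = matrix_of b" using \<open>a \<in> carrier R\<close> unfolding matrix_of_surj by blast
      have h: "v \<cdot> b \<in> Hom C G X" using v b by simp
      show ?thesis unfolding v(2) b(2) module_repD(2)[OF N v(1) b(1)] \<phi>[OF h] \<phi>[OF v(1)] module_repD(2)[OF N' gw[OF v(1)] b(1)]
        using v(1) b(1) g by simp
    qed
  qed
  then show ?thesis using \<phi> by blast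
qed

text \<open>Injectivity of \<open>E'\<close> lets \<open>\<phi>\<close> be read as a
  \<open>G_linear\<close> map of hom-sets, which is then composition with an arrow. This gives
  fullness.\<close>

lemma hom_represented:
  assumes N: "module_rep N X E" and N': "module_rep N' Y E'" and \<phi>: "\<phi> \<in> rmodule_hom R N N'"
  shows "\<exists>g \<in> Hom C X Y. \<forall>w\<in>Hom C G X. \<phi> (E w) = E' (g \<cdot> w)"
proof -
  note n = hom_repD[OF module_repD(1)[OF N]] and n' = hom_repD[OF module_repD(1)[OF N']]
  note p = rmodule_homD[OF \<phi>]
  have "\<forall>w\<in>Hom C G X. \<exists>v\<in>Hom C G Y. \<phi> (E w) = E' v" using p(1) n(3) n'(3) by blast
  then obtain \<psi> where \<psi>: "\<And>w. w \<in> Hom C G X \<Longrightarrow> \<psi> w \<in> Hom C G Y" "\<And>w. w \<in> Hom C G X \<Longrightarrow> \<phi> (E w) = E' (\<psi> w)" by metis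
  have Ec: "E w \<in> carrier N" if "w \<in> Hom C G X" for w using that n(3) by blast
  have "G_linear X Y \<psi>" unfolding G_linear_def
  proof (intro conjI ballI)
    fix f assume f: "f \<in> Hom C G X"
    show "\<psi> f \<in> Hom C G Y" by (rule \<psi>(1)[OF f])
    show "\<psi> (hadd C f g) = hadd C (\<psi> f) (\<psi> g)" if g: "g \<in> Hom C G X" for g
    proof (rule inj_onD[OF n'(2)])
      have h: "hadd C f g \<in> Hom C G X" using f g by simp
      show "\<psi> (hadd C f g) \<in> Hom C G Y" by (rule \<psi>(1)[OF h])
      show "hadd C (\<psi> f) (\<psi> g) \<in> Hom C G Y" using \<psi>(1)[OF f] \<psi>(1)[OF g] by simp
      have "E' (\<psi> (hadd C f g)) = \<phi> (E f \<oplus>\<^bsub>N\<^esub> E g)" using \<psi>(2)[OF h] n(5)[OF f g] by simp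
      also have "\<dots> = E' (\<psi> f) \<oplus>\<^bsub>N'\<^esub> E' (\<psi> g)" using p(3)[OF Ec[OF f] Ec[OF g]] \<psi>(2)[OF f] \<psi>(2)[OF g] by simp
      also have "\<dots> = E' (hadd C (\<psi> f) (\<psi> g))" by (rule n'(5)[OF \<psi>(1)[OF f] \<psi>(1)[OF g]])
      finally show "E' (\<psi> (hadd C f g)) = E' (hadd C (\<psi> f) (\<psi> g))" .
    qed
    show "\<psi> (f \<cdot> a) = \<psi> f \<cdot> a" if a: "a \<in> Hom C G G" for a
    proof (rule inj_onD[OF n'(2)])
      have h: "f \<cdot> a \<in> Hom C G X" using f a by simp
      have ar: "matrix_of a \<in> carrier R" unfolding matrix_of_surj using a by blast
      show "\<psi> (f \<cdot> a) \<in> Hom C G Y" by (rule \<psi>(1)[OF h])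
      show "\<psi> f \<cdot> a \<in> Hom C G Y" using \<psi>(1)[OF f] a by simp
      have "E' (\<psi> (f \<cdot> a)) = \<phi> (act N (E f) (matrix_of a))" using \<psi>(2)[OF h] module_repD(2)[OF N f a] by simp
      also have "\<dots> = act N' (E' (\<psi> f)) (matrix_of a)" using p(4)[OF Ec[OF f] ar] \<psi>(2)[OF f] by simp
      also have "\<dots> = E' (\<psi> f \<cdot> a)" by (rule module_repD(2)[OF N' \<psi>(1)[OF f] a])
      finally show "E' (\<psi> (f \<cdot> a)) = E' (\<psi> f \<cdot> a)" .
    qed
  qed
  from G_linear_representable[OF n(1) n'(1) this] \<psi>(2) show ?thesis by fastforce
qed

lemma rep_hom_ext:
  assumes N: "module_rep N X E" and "\<phi> \<in> rmodule_hom R N N'" "\<phi>' \<in> rmodule_hom R N N'"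
    "\<And>w. w \<in> Hom C G X \<Longrightarrow> \<phi> (E w) = \<phi>' (E w)"
  shows "\<phi> = \<phi>'"
proof (rule extensionalityI[of _ "carrier N"])
  show "\<phi> \<in> extensional (carrier N)" "\<phi>' \<in> extensional (carrier N)"
    using rmodule_homD(2)[OF assms(2)] rmodule_homD(2)[OF assms(3)] .
  fix x assume "x \<in> carrier N"
  then obtain w where "x = E w" "w \<in> Hom C G X"
    unfolding hom_repD(3)[OF module_repD(1)[OF N]] by (rule imageE)
  then show "\<phi> x = \<phi>' x" using assms(4)[of w] by (simp only:)
qed

text \<open>A cover of \<open>X\<close> by a power of \<open>G\<close> and a second one of its
  kernel give a presentation; projectivity of \<open>G\<close> turns both epimorphisms into
  surjections on hom-sets.\<close>

lemma rep_finitely_presented: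
  assumes N: "module_rep N X E" shows "finitely_presented R N"
  unfolding finitely_presented_def
proof (intro conjI)
  note n = hom_repD[OF module_repD(1)[OF N]]
  show "right_module R N" by (rule module_rep_right_module[OF N])
  obtain n D j r e where d: "direct_sum C {..<n::nat} (\<lambda>_. G) D j r" and e: "e \<in> Hom C D X" "epi_arr C e"
    by (rule free_cover[OF n(1)])
  have eD: "e \<in> Arr C" "Dom C e = D" "Cod C e = X" using e by simp_all
  have k: "ker e \<in> Arr C" "Cod C (ker e) = D" "null (e \<cdot> ker e)" "Dom C (ker e) \<in> Obj C" using eD by simp_all
  obtain m D' j' r' c where d': "direct_sum C {..<m::nat} (\<lambda>_. G) D' j' r'" and c: "c \<in> Hom C D' (Dom C (ker e))" "epi_arr C c"
    by (rule free_cover[OF k(4)])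
  have cD: "c \<in> Arr C" "Dom C c = D'" "Cod C c = Dom C (ker e)" using c by simp_all
  let ?F = "free_rmodule R n" and ?F' = "free_rmodule R m"
  let ?E = "\<lambda>w. \<lambda>k\<in>{..<n}. matrix_of (r k \<cdot> w)" and ?E' = "\<lambda>w. \<lambda>k\<in>{..<m}. matrix_of (r' k \<cdot> w)"
  note F = free_module_rep[OF d] and F' = free_module_rep[OF d']
  note fr = hom_repD[OF module_repD(1)[OF F]] and fr' = hom_repD[OF module_repD(1)[OF F']]
  have kc: "ker e \<cdot> c \<in> Hom C D' D" using k cD by simp
  obtain g where g: "g \<in> rmodule_hom R ?F' ?F" "\<And>w. w \<in> Hom C G D' \<Longrightarrow> g (?E' w) = ?E ((ker e \<cdot> c) \<cdot> w)"
    using induced_hom[OF F' F kc] by blast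
  obtain p where p: "p \<in> rmodule_hom R ?F N" "\<And>w. w \<in> Hom C G D \<Longrightarrow> p (?E w) = E (e \<cdot> w)"
    using induced_hom[OF F N e(1)] by blast
  have z: "hzero C G X \<in> Hom C G X" using n(1) by simp
  have ew: "e \<cdot> w \<in> Hom C G X" if "w \<in> Hom C G D" for w using that eD by simp
  have "p ` carrier ?F = carrier N"
  proof
    show "p ` carrier ?F \<subseteq> carrier N" using rmodule_homD(1)[OF p(1)] by blast
    show "carrier N \<subseteq> p ` carrier ?F"
    proof
      fix x assume "x \<in> carrier N"
      then obtain w where w: "w \<in> Hom C G X" "x = E w" unfolding n(3) by blast
      have "w \<in> Hom C G (Cod C e)" using w eD by simp
      then obtain u where u: "u \<in> Hom C G (Dom C e)" "e \<cdot> u = w" using lift_G[OF e(2)] by blast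
      have uD: "u \<in> Hom C G D" using u eD by simp
      have "x = p (?E u)" using p(2)[OF uD] u(2) w(2) by simp
      then show "x \<in> p ` carrier ?F" unfolding fr(3) using uD by blast
    qed
  qed
  moreover have "g ` carrier ?F' = {v \<in> carrier ?F. p v = \<zero>\<^bsub>N\<^esub>}"
  proof
    show "g ` carrier ?F' \<subseteq> {v \<in> carrier ?F. p v = \<zero>\<^bsub>N\<^esub>}"
    proof
      fix v assume "v \<in> g ` carrier ?F'"
      then obtain w where w: "w \<in> Hom C G D'" "v = g (?E' w)" unfolding fr'(3) by blast
      have h: "(ker e \<cdot> c) \<cdot> w \<in> Hom C G D" using w(1) kc by simp
      have "null ((e \<cdot> ker e) \<cdot> (c \<cdot> w))" by (rule null_comp(2)[OF _ _ _ k(3)]) (use k eD cD w(1) in simp_all)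
      moreover have "(e \<cdot> ker e) \<cdot> (c \<cdot> w) = e \<cdot> ((ker e \<cdot> c) \<cdot> w)" using k(1,2) eD cD w(1) by simp
      ultimately have "null (e \<cdot> ((ker e \<cdot> c) \<cdot> w))" by simp
      then have "e \<cdot> ((ker e \<cdot> c) \<cdot> w) = hzero C G X" by (rule nullD) (use ew[OF h] in simp_all)
      then have "p v = \<zero>\<^bsub>N\<^esub>" unfolding w(2) g(2)[OF w(1)] p(2)[OF h] n(4) by simp
      moreover have "v \<in> carrier ?F" unfolding w(2) g(2)[OF w(1)] fr(3) using h by blast
      ultimately show "v \<in> {v \<in> carrier ?F. p v = \<zero>\<^bsub>N\<^esub>}" by simp
    qed
    show "{v \<in> carrier ?F. p v = \<zero>\<^bsub>N\<^esub>} \<subseteq> g ` carrier ?F'"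
    proof
      fix v assume "v \<in> {v \<in> carrier ?F. p v = \<zero>\<^bsub>N\<^esub>}"
      then have v: "v \<in> carrier ?F" "p v = \<zero>\<^bsub>N\<^esub>" by simp_all
      obtain w where w: "w \<in> Hom C G D" "v = ?E w" using v(1) unfolding fr(3) by blast
      have "E (e \<cdot> w) = E (hzero C G X)" using v(2) p(2)[OF w(1)] w(2) n(4) by simp
      then have "e \<cdot> w = hzero C G X" by (rule inj_onD[OF n(2)]) (rule ew[OF w(1)], rule z)
      then have "null (e \<cdot> w)" by (rule nullI) (simp_all add: n)
      then have "fac w (ker e)" by (rule ker_fac) (use w(1) eD in simp_all)
      then obtain x where x: "x \<in> Arr C" "Dom C x = Dom C w" "Cod C x = Dom C (ker e)" "ker e \<cdot> x = w" by (rule facE)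
      have "x \<in> Hom C G (Cod C c)" using x w(1) cD by simp
      then obtain u where u: "u \<in> Hom C G (Dom C c)" "c \<cdot> u = x" using lift_G[OF c(2)] by blast
      have uD: "u \<in> Hom C G D'" using u cD by simp
      have "(ker e \<cdot> c) \<cdot> u = ker e \<cdot> (c \<cdot> u)" by (rule comp_assoc') (use uD cD k in simp_all)
      then have "(ker e \<cdot> c) \<cdot> u = w" using u(2) x(4) by simp
      then have "v = g (?E' u)" using g(2)[OF uD] w(2) by simp
      then show "v \<in> g ` carrier ?F'" unfolding fr'(3) using uD by blast
    qed
  qed
  ultimately show "\<exists>m n. \<exists>g \<in> rmodule_hom R (free_rmodule R m) (free_rmodule R n).
        \<exists>p \<in> rmodule_hom R (free_rmodule R n) N.
          p ` carrier (free_rmodule R n) = carrier N \<and>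
          g ` carrier (free_rmodule R m) = {v \<in> carrier (free_rmodule R n). p v = \<zero>\<^bsub>N\<^esub>}"
    using g(1) p(1) by blast
qed

text \<open>The map of free modules in a presentation of \<open>N\<close> comes from an arrow
  \<open>h\<close> between powers of \<open>G\<close>, and \<open>X\<close> is its cokernel. The
  conclusion covers every module represented by \<open>X\<close>, so it does not depend on how
  \<open>Hom(G, X)\<close> is coded.\<close>

lemma finitely_presented_rep:
  assumes "finitely_presented R N"
  obtains X where "X \<in> Obj C"
    "\<And>N' :: ('x \<Rightarrow> 'x \<Rightarrow> 'm, 'b) rmodule. \<And>E. module_rep N' X E \<Longrightarrow> \<exists>\<alpha> \<in> rmodule_hom R N' N. bij_betw \<alpha> (carrier N') (carrier N)"
proof -
  interpret N: right_module R N by (rule finitely_presented_module[OF assms])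
  obtain m n g p where g: "g \<in> rmodule_hom R (free_rmodule R m) (free_rmodule R n)"
    and p: "p \<in> rmodule_hom R (free_rmodule R n) N" and psurj: "p ` carrier (free_rmodule R n) = carrier N"
    and ex: "g ` carrier (free_rmodule R m) = {v \<in> carrier (free_rmodule R n). p v = \<zero>\<^bsub>N\<^esub>}"
    using assms unfolding finitely_presented_def by (elim conjE exE bexE)
  obtain D j r where d: "direct_sum C {..<n} (\<lambda>_. G) D j r" using direct_sums_exist[of n "\<lambda>_. G"] by auto
  obtain D' j' r' where d': "direct_sum C {..<m} (\<lambda>_. G) D' j' r'" using direct_sums_exist[of m "\<lambda>_. G"] by auto
  let ?F = "free_rmodule R n" and ?F' = "free_rmodule R m"
  let ?E = "\<lambda>w. \<lambda>k\<in>{..<n}. matrix_of (r k \<cdot> w)" and ?E' = "\<lambda>w. \<lambda>k\<in>{..<m}. matrix_of (r' k \<cdot> w)"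
  note F = free_module_rep[OF d] and F' = free_module_rep[OF d']
  note fr = hom_repD[OF module_repD(1)[OF F]] and fr' = hom_repD[OF module_repD(1)[OF F']]
  note P = rmodule_homD[OF p]
  obtain h where h: "h \<in> Hom C D' D" "\<And>w. w \<in> Hom C G D' \<Longrightarrow> g (?E' w) = ?E (h \<cdot> w)"
    using hom_represented[OF F' F g] by blast
  have hD: "h \<in> Arr C" "Dom C h = D'" "Cod C h = D" using h by simp_all
  let ?q = "coker h" let ?X = "Cod C ?q"
  have q: "?q \<in> Arr C" "Dom C ?q = D" "epi_arr C ?q" "null (?q \<cdot> h)" using hD by simp_all
  \<comment> \<open>The kernel of \<open>p\<close> is the image of \<open>g\<close>, which consists
    of the arrows that factor through \<open>h\<close>; by \<open>fac_image\<close> these are the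
    ones killed by the cokernel.\<close>
  have kernel: "p (?E w) = \<zero>\<^bsub>N\<^esub> \<longleftrightarrow> null (?q \<cdot> w)" if w: "w \<in> Hom C G D" for w
  proof
    assume "p (?E w) = \<zero>\<^bsub>N\<^esub>"
    moreover have "?E w \<in> carrier ?F" unfolding fr(3) using w by (rule imageI)
    ultimately have "?E w \<in> g ` carrier ?F'" unfolding ex by (intro CollectI conjI)
    then obtain v where v: "?E w = g v" "v \<in> carrier ?F'" by (rule imageE)
    obtain u where u': "v = ?E' u" and u1: "u \<in> Hom C G D'" using v(2) unfolding fr'(3) by (rule imageE)
    have u: "u \<in> Hom C G D'" "?E w = g (?E' u)" using u1 v(1) unfolding u' .
    have hu: "h \<cdot> u \<in> Hom C G D" using u hD by simp
    have "w = h \<cdot> u" by (rule inj_onD[OF fr(2) _ w hu]) (use u(2) h(2)[OF u(1)] in simp)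
    then have "?q \<cdot> w = (?q \<cdot> h) \<cdot> u" using q hD u(1) by simp
    moreover have "null ((?q \<cdot> h) \<cdot> u)" by (rule null_comp(2)[OF _ _ _ q(4)]) (use q hD u(1) in simp_all)
    ultimately show "null (?q \<cdot> w)" by simp
  next
    assume n: "null (?q \<cdot> w)"
    have "w \<in> Hom C G (Cod C h)" unfolding hD(3) by (rule w)
    then have "\<exists>u \<in> Hom C G (Dom C h). h \<cdot> u = w" by (rule fac_image[OF hD(1) _ n])
    then obtain u where u: "u \<in> Hom C G D'" "h \<cdot> u = w" unfolding hD(2) by (rule bexE)
    have "?E w = g (?E' u)" using h(2)[OF u(1)] u(2) by simp
    moreover have "?E' u \<in> carrier ?F'" unfolding fr'(3) using u(1) by (rule imageI)
    ultimately have "?E w \<in> g ` carrier ?F'" by (rule image_eqI)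
    then show "p (?E w) = \<zero>\<^bsub>N\<^esub>" unfolding ex by simp
  qed
  have Ec: "?E w \<in> carrier ?F" if "w \<in> Hom C G D" for w unfolding fr(3) using that by (rule imageI)
  have same: "p (?E v) = p (?E w) \<longleftrightarrow> ?q \<cdot> v = ?q \<cdot> w" if v: "v \<in> Hom C G D" and w: "w \<in> Hom C G D" for v w
  proof -
    have s: "hsub v w \<in> Hom C G D" using v w by simp
    have "hadd C (hsub v w) w = v" by (rule hadd_hsub_cancel(3)) (use v w in simp_all)
    then have "?E v = ?E (hsub v w) \<oplus>\<^bsub>?F\<^esub> ?E w" using fr(5)[OF s w] by simp
    then have e: "p (?E v) = p (?E (hsub v w)) \<oplus>\<^bsub>N\<^esub> p (?E w)" using P(3)[OF Ec[OF s] Ec[OF w]] by simp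
    have c: "p (?E (hsub v w)) \<in> carrier N" "p (?E w) \<in> carrier N" using P(1)[OF Ec[OF s]] P(1)[OF Ec[OF w]] .
    have "p (?E v) = p (?E w) \<longleftrightarrow> p (?E (hsub v w)) = \<zero>\<^bsub>N\<^esub>"
      unfolding e using N.N.add.r_cancel_one[OF c(2) c(1)] by simp
    also have "\<dots> \<longleftrightarrow> null (?q \<cdot> hsub v w)" by (rule kernel[OF s])
    also have "?q \<cdot> hsub v w = hsub (?q \<cdot> v) (?q \<cdot> w)" using v w q by (simp add: comp_hsub)
    also have "null \<dots> \<longleftrightarrow> ?q \<cdot> v = ?q \<cdot> w" by (rule null_hsub_iff) (use v w q in simp_all)
    finally show ?thesis .
  qed
  show thesis
  proof (rule that)
    show X: "?X \<in> Obj C" using q by simp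
    fix N' :: "('x \<Rightarrow> 'x \<Rightarrow> 'm, 'b) rmodule" and E
    assume N': "module_rep N' ?X E"
    note n' = hom_repD[OF module_repD(1)[OF N']]
    have qw: "?q \<cdot> w \<in> Hom C G ?X" if "w \<in> Hom C G D" for w using that q by simp
    have lift: "\<exists>w \<in> Hom C G D. x = E (?q \<cdot> w)" if "x \<in> carrier N'" for x
    proof -
      obtain v where v: "x = E v" "v \<in> Hom C G ?X"
        using \<open>x \<in> carrier N'\<close> unfolding n'(3) by (rule imageE)
      obtain u where u: "u \<in> Hom C G (Dom C ?q)" "?q \<cdot> u = v" using lift_G[OF q(3) v(2)] by (rule bexE)
      then show ?thesis using v(1) q(2) by (intro bexI[of _ u]) simp_all
    qed
    define l where "l x = (SOME w. w \<in> Hom C G D \<and> x = E (?q \<cdot> w))" for x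
    have l: "l x \<in> Hom C G D" "x = E (?q \<cdot> l x)" if "x \<in> carrier N'" for x
      using someI_ex[OF lift[OF that, unfolded Bex_def]] unfolding l_def by blast+
    \<comment> \<open>On \<open>E (?q \<cdot> w)\<close> this is \<open>p (?E w)\<close>: by
      \<open>same\<close> the value does not depend on the chosen lift \<open>l x\<close>, and the
      same equivalence makes \<open>\<alpha>\<close> injective.\<close>
    define \<alpha> where "\<alpha> = (\<lambda>x\<in>carrier N'. p (?E (l x)))"
    have qc: "E (?q \<cdot> w) \<in> carrier N'" if "w \<in> Hom C G D" for w unfolding n'(3) using qw[OF that] by (rule imageI)
    have \<alpha>: "\<alpha> (E (?q \<cdot> w)) = p (?E w)" if w: "w \<in> Hom C G D" for w
    proof -
      note lw = l[OF qc[OF w]]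
      have "?q \<cdot> l (E (?q \<cdot> w)) = ?q \<cdot> w"
        by (rule inj_onD[OF n'(2) lw(2)[symmetric] qw[OF lw(1)] qw[OF w]])
      then show ?thesis unfolding \<alpha>_def using same[OF l(1)[OF qc[OF w]] w] qc[OF w] by simp
    qed
    have "\<alpha> \<in> rmodule_hom R N' N"
    proof (rule rmodule_homI)
      show "\<alpha> \<in> extensional (carrier N')" unfolding \<alpha>_def by simp
      fix x assume x: "x \<in> carrier N'"
      obtain v where v: "v \<in> Hom C G D" "x = E (?q \<cdot> v)" using lift[OF x] by (rule bexE)
      show "\<alpha> x \<in> carrier N" unfolding v(2) \<alpha>[OF v(1)] using P(1)[OF Ec[OF v(1)]] .
      show "\<alpha> (x \<oplus>\<^bsub>N'\<^esub> y) = \<alpha> x \<oplus>\<^bsub>N\<^esub> \<alpha> y" if "y \<in> carrier N'" for y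
      proof -
        obtain w where w: "w \<in> Hom C G D" "y = E (?q \<cdot> w)" using lift[OF \<open>y \<in> carrier N'\<close>] by (rule bexE)
        have a: "hadd C v w \<in> Hom C G D" using v(1) w(1) by simp
        have "E (?q \<cdot> v) \<oplus>\<^bsub>N'\<^esub> E (?q \<cdot> w) = E (?q \<cdot> hadd C v w)"
          unfolding n'(5)[OF qw[OF v(1)] qw[OF w(1)]] using v(1) w(1) q by (simp add: comp_hadd)
        then show ?thesis unfolding v(2) w(2) using \<alpha>[OF a] \<alpha>[OF v(1)] \<alpha>[OF w(1)] fr(5)[OF v(1) w(1)] P(3)[OF Ec[OF v(1)] Ec[OF w(1)]]
          by simp
      qed
      show "\<alpha> (act N' x a) = act N (\<alpha> x) a" if "a \<in> carrier R" for a
      proof -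
        obtain b where b: "b \<in> Hom C G G" "a = matrix_of b" using \<open>a \<in> carrier R\<close> unfolding matrix_of_surj by blast
        have vb: "v \<cdot> b \<in> Hom C G D" using v(1) b(1) by simp
        have "act N' (E (?q \<cdot> v)) (matrix_of b) = E (?q \<cdot> (v \<cdot> b))"
          unfolding module_repD(2)[OF N' qw[OF v(1)] b(1)] using v(1) b(1) q by simp
        then show ?thesis
          using \<alpha>[OF vb] \<alpha>[OF v(1)] module_repD(2)[OF F v(1) b(1)] P(4)[OF Ec[OF v(1)] that] v(2) b(2) by simp
      qed
    qed
    moreover have "bij_betw \<alpha> (carrier N') (carrier N)"
    proof (rule bij_betw_imageI)
      show "inj_on \<alpha> (carrier N')"
      proof (rule inj_onI)
        fix x y assume x: "x \<in> carrier N'" and y: "y \<in> carrier N'" and e: "\<alpha> x = \<alpha> y"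
        obtain v where v: "v \<in> Hom C G D" "x = E (?q \<cdot> v)" using lift[OF x] by (rule bexE)
        obtain w where w: "w \<in> Hom C G D" "y = E (?q \<cdot> w)" using lift[OF y] by (rule bexE)
        have "p (?E v) = p (?E w)" using e \<alpha>[OF v(1)] \<alpha>[OF w(1)] v(2) w(2) by simp
        then show "x = y" using same[OF v(1) w(1)] v(2) w(2) by simp
      qed
      show "\<alpha> ` carrier N' = carrier N"
      proof
        show "\<alpha> ` carrier N' \<subseteq> carrier N" using rmodule_homD(1)[OF calculation] by blast
        show "carrier N \<subseteq> \<alpha> ` carrier N'"
        proof
          fix y assume "y \<in> carrier N"
          then obtain f where f: "y = p f" "f \<in> carrier ?F" unfolding psurj[symmetric] by (rule imageE)
          obtain w where w: "f = ?E w" "w \<in> Hom C G D" using f(2) unfolding fr(3) by (rule imageE)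
          have "y = \<alpha> (E (?q \<cdot> w))" unfolding \<alpha>[OF w(2)] f(1) w(1) ..
          then show "y \<in> \<alpha> ` carrier N'" using qc[OF w(2)] by (rule image_eqI)
        qed
      qed
    qed
    ultimately show "\<exists>\<alpha> \<in> rmodule_hom R N' N. bij_betw \<alpha> (carrier N') (carrier N)" by blast
  qed
qed

text \<open>The explicit map on families agrees on its carrier with the homomorphism from
  \<open>induced_hom\<close>; both are extensional, so they are equal.\<close>

lemma hom_module_map_rep:
  fixes Fo defines "Fo \<equiv> hom_module C \<Omega> P :: 'o \<Rightarrow> ('x \<Rightarrow> 'x \<Rightarrow> 'm, ('x \<Rightarrow> 'm) + 'u) rmodule"
  assumes f: "f \<in> Hom C X Y"
  obtains \<phi> where "hom_module_map C \<Omega> P f = (Fo X, \<phi>, Fo Y)" "\<phi> \<in> rmodule_hom R (Fo X) (Fo Y)"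
    "\<And>w. w \<in> Hom C G X \<Longrightarrow> \<phi> (family_of w) = family_of (f \<cdot> w)"
proof -
  have X: "X \<in> Obj C" and Y: "Y \<in> Obj C" using f by auto
  note rX = hom_module_rep[OF X, where 'u = 'u] and rY = hom_module_rep[OF Y, where 'u = 'u]
  note n = hom_repD[OF module_repD(1)[OF rX]]
  let ?\<phi> = "\<lambda>\<phi>\<in>carrier (Fo X). Inl (\<lambda>x\<in>\<Omega>. f \<cdot> projl \<phi> x) :: ('x \<Rightarrow> 'm) + 'u"
  have e: "?\<phi> (family_of w) = family_of (f \<cdot> w)" if w: "w \<in> Hom C G X" for w
  proof -
    have "family_of w \<in> carrier (Fo X)" unfolding Fo_def n(3) using w by blast
    then show ?thesis using f w sumD(5-7) by (auto simp: family_of_def intro!: restrict_ext)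
  qed
  obtain \<phi>' where \<phi>': "\<phi>' \<in> rmodule_hom R (Fo X) (Fo Y)" "\<And>w. w \<in> Hom C G X \<Longrightarrow> \<phi>' (family_of w) = family_of (f \<cdot> w)"
    using induced_hom[OF rX rY f] unfolding Fo_def by blast
  have "?\<phi> = \<phi>'"
  proof (rule extensionalityI[of _ "carrier (Fo X)"])
    fix x assume "x \<in> carrier (Fo X)"
    then obtain w where "w \<in> Hom C G X" "x = family_of w" unfolding Fo_def n(3) by blast
    then show "?\<phi> x = \<phi>' x" using e \<phi>'(2) by metis
  qed (use rmodule_homD(2)[OF \<phi>'(1)] in simp_all)
  then show thesis using that[of ?\<phi>] \<phi>'(1) e f unfolding hom_module_map_def Fo_def by simp
qed

text \<open>Faithfulness comes from \<open>G\<close> being a generator, fullness from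
  \<open>hom_represented\<close>, and essential surjectivity from
  \<open>finitely_presented_rep\<close>.\<close>

theorem hom_module_equivalence:
  "category_equivalence C (fp_modules R :: (('x \<Rightarrow> 'x \<Rightarrow> 'm, ('x \<Rightarrow> 'm) + 'u) rmodule, _) category)
    (hom_module C \<Omega> P) (hom_module_map C \<Omega> P)"
proof -
  let ?D = "fp_modules R :: (('x \<Rightarrow> 'x \<Rightarrow> 'm, ('x \<Rightarrow> 'm) + 'u) rmodule, _) category"
  let ?Fo = "hom_module C \<Omega> P :: 'o \<Rightarrow> ('x \<Rightarrow> 'x \<Rightarrow> 'm, ('x \<Rightarrow> 'm) + 'u) rmodule"
  let ?Fa = "hom_module_map C \<Omega> P :: 'm \<Rightarrow> ('x \<Rightarrow> 'x \<Rightarrow> 'm, ('x \<Rightarrow> 'm) + 'u) rmodule \<times> _"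
  interpret D: category ?D by (rule category_fp_modules)
  have rp: "module_rep (?Fo X) X family_of" if "X \<in> Obj C" for X using hom_module_rep[OF that] .
  have fp: "finitely_presented R (?Fo X)" if "X \<in> Obj C" for X using rep_finitely_presented[OF rp[OF that]] .
  have Fa: "\<exists>\<phi>. ?Fa f = (?Fo X, \<phi>, ?Fo Y) \<and> \<phi> \<in> rmodule_hom R (?Fo X) (?Fo Y) \<and> (\<forall>w\<in>Hom C G X. \<phi> (family_of w) = family_of (f \<cdot> w))"
    if "f \<in> Hom C X Y" for f X Y by (rule hom_module_map_rep[OF that, where 'u = 'u]) blast
  interpret F: cat_functor C ?D ?Fo ?Fa
  proof (unfold_locales)
    show "?Fo X \<in> Obj ?D" if "X \<in> Obj C" for X using fp[OF that] by (simp add: fp_modules_simps)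
    show "?Fa f \<in> Hom ?D (?Fo X) (?Fo Y)" if f: "f \<in> Hom C X Y" for f X Y
    proof -
      have "X \<in> Obj C" "Y \<in> Obj C" using f by auto
      then show ?thesis using Fa[OF f] fp unfolding fp_modules_Hom by blast
    qed
    show "?Fa (Ident C X) = Ident ?D (?Fo X)" if X: "X \<in> Obj C" for X
    proof -
      have "Ident C X \<in> Hom C X X" using X by simp
      then obtain \<phi> where \<phi>: "?Fa (Ident C X) = (?Fo X, \<phi>, ?Fo X)" "\<phi> \<in> rmodule_hom R (?Fo X) (?Fo X)"
        "\<And>w. w \<in> Hom C G X \<Longrightarrow> \<phi> (family_of w) = family_of (Ident C X \<cdot> w)" using Fa by blast
      have "\<phi> = (\<lambda>x\<in>carrier (?Fo X). x)"
      proof (rule rep_hom_ext[OF rp[OF X] \<phi>(2) rmodule_hom_ident[OF module_rep_right_module[OF rp[OF X]]]])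
        fix w assume w: "w \<in> Hom C G X"
        then have "family_of w \<in> carrier (?Fo X)" unfolding hom_repD(3)[OF module_repD(1)[OF rp[OF X]]] by blast
        then show "\<phi> (family_of w) = (\<lambda>x\<in>carrier (?Fo X). x) (family_of w)" using \<phi>(3)[OF w] w by simp
      qed
      then show ?thesis using \<phi>(1) by (simp add: fp_modules_simps)
    qed
    show "?Fa (g \<cdot> f) = ?Fa g \<cdot>\<^bsub>?D\<^esub> ?Fa f" if f: "f \<in> Hom C X Y" and g: "g \<in> Hom C Y Z" for f g X Y Z
    proof -
      have X: "X \<in> Obj C" using f by auto
      have gf: "g \<cdot> f \<in> Hom C X Z" using f g by simp
      obtain \<phi> where \<phi>: "?Fa f = (?Fo X, \<phi>, ?Fo Y)" "\<phi> \<in> rmodule_hom R (?Fo X) (?Fo Y)"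
        "\<And>w. w \<in> Hom C G X \<Longrightarrow> \<phi> (family_of w) = family_of (f \<cdot> w)" using Fa[OF f] by blast
      obtain \<gamma> where \<gamma>: "?Fa g = (?Fo Y, \<gamma>, ?Fo Z)" "\<gamma> \<in> rmodule_hom R (?Fo Y) (?Fo Z)"
        "\<And>w. w \<in> Hom C G Y \<Longrightarrow> \<gamma> (family_of w) = family_of (g \<cdot> w)" using Fa[OF g] by blast
      obtain \<chi> where \<chi>: "?Fa (g \<cdot> f) = (?Fo X, \<chi>, ?Fo Z)" "\<chi> \<in> rmodule_hom R (?Fo X) (?Fo Z)"
        "\<And>w. w \<in> Hom C G X \<Longrightarrow> \<chi> (family_of w) = family_of ((g \<cdot> f) \<cdot> w)" using Fa[OF gf] by blast
      have "\<chi> = compose (carrier (?Fo X)) \<gamma> \<phi>"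
      proof (rule rep_hom_ext[OF rp[OF X] \<chi>(2) rmodule_hom_compose[OF module_rep_right_module[OF rp[OF X]] \<phi>(2) \<gamma>(2)]])
        fix w assume w: "w \<in> Hom C G X"
        then have c: "family_of w \<in> carrier (?Fo X)" unfolding hom_repD(3)[OF module_repD(1)[OF rp[OF X]]] by blast
        have fw: "f \<cdot> w \<in> Hom C G Y" using f w by simp
        show "\<chi> (family_of w) = compose (carrier (?Fo X)) \<gamma> \<phi> (family_of w)"
          using \<chi>(3)[OF w] \<phi>(3)[OF w] \<gamma>(3)[OF fw] c f g w by (simp add: compose_eq)
      qed
      then show ?thesis using \<phi>(1) \<gamma>(1) \<chi>(1) by (simp add: fp_modules_simps)
    qed
  qed
  show ?thesis
  proof (rule F.fully_faithful_equivalence)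
    fix X Y f g assume f: "f \<in> Hom C X Y" and g: "g \<in> Hom C X Y" and e: "?Fa f = ?Fa g"
    have Y: "Y \<in> Obj C" using f by auto
    show "f = g"
    proof (rule eq_if_eq_on_G[OF f g])
      fix w assume w: "w \<in> Hom C G X"
      have "(family_of (f \<cdot> w) :: ('x \<Rightarrow> 'm) + 'u) = family_of (g \<cdot> w)" using Fa[OF f] Fa[OF g] e w by auto
      then show "f \<cdot> w = g \<cdot> w"
        by (rule inj_onD[OF hom_repD(2)[OF module_repD(1)[OF rp[OF Y]]]]) (use f g w in simp_all)
    qed
  next
    fix X Y h assume X: "X \<in> Obj C" and Y: "Y \<in> Obj C" and "h \<in> Hom ?D (?Fo X) (?Fo Y)"
    then obtain \<phi> where h: "h = (?Fo X, \<phi>, ?Fo Y)" and \<phi>: "\<phi> \<in> rmodule_hom R (?Fo X) (?Fo Y)"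
      unfolding fp_modules_Hom by blast
    obtain f where f: "f \<in> Hom C X Y" "\<And>w. w \<in> Hom C G X \<Longrightarrow> \<phi> (family_of w) = family_of (f \<cdot> w)"
      using hom_represented[OF rp[OF X] rp[OF Y] \<phi>] by blast
    obtain \<phi>' where \<phi>': "?Fa f = (?Fo X, \<phi>', ?Fo Y)" "\<phi>' \<in> rmodule_hom R (?Fo X) (?Fo Y)"
        "\<And>w. w \<in> Hom C G X \<Longrightarrow> \<phi>' (family_of w) = family_of (f \<cdot> w)" using Fa[OF f(1)] by blast
    have "\<phi>' = \<phi>" by (rule rep_hom_ext[OF rp[OF X] \<phi>'(2) \<phi>]) (use \<phi>'(3) f(2) in simp)
    then show "\<exists>f \<in> Hom C X Y. ?Fa f = h" using f(1) \<phi>'(1) h by blast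
  next
    fix N assume "N \<in> Obj ?D"
    then have N: "finitely_presented R N" by (simp add: fp_modules_simps)
    obtain X where X: "X \<in> Obj C" "\<And>N' :: ('x \<Rightarrow> 'x \<Rightarrow> 'm, ('x \<Rightarrow> 'm) + 'u) rmodule. \<And>E. module_rep N' X E \<Longrightarrow> \<exists>\<alpha> \<in> rmodule_hom R N' N. bij_betw \<alpha> (carrier N') (carrier N)"
      by (rule finitely_presented_rep[OF N, where 'b = "('x \<Rightarrow> 'm) + 'u"]) blast
    obtain \<alpha> where "\<alpha> \<in> rmodule_hom R (?Fo X) N" "bij_betw \<alpha> (carrier (?Fo X)) (carrier N)"
      using X(2)[OF rp[OF X(1)]] by blast
    then have "isomorphic ?D (?Fo X) N" by (rule fp_modules_isomorphic[OF fp[OF X(1)] N])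
    then show "\<exists>X \<in> Obj C. isomorphic ?D (?Fo X) N" using X(1) by blast
  qed
qed

end

section \<open>The main theorem\<close>

context join_irreducible_family
begin

text \<open>Take a maximal subobject \<open>u\<close> of \<open>X\<close> generated by finitely many
  arrows from \<open>G\<close>. If \<open>u\<close> were proper, some local subobject would not be
  contained in it; being a quotient of a \<open>P x\<close>, it is the image of an arrow from
  \<open>G\<close>, and adding this arrow would enlarge \<open>u\<close>.\<close>

lemma family_generates:
  assumes sum: "direct_sum C \<Omega> P G \<iota> \<pi>" and X: "X \<in> Obj C"
  shows "\<exists>n e. (\<forall>k<n::nat. e k \<in> Hom C G X) \<and>
    (\<forall>h\<in>Arr C. Dom C h = X \<longrightarrow> (\<forall>k<n. null (h \<cdot> e k)) \<longrightarrow> null h)"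
proof -
  note D = direct_sumD[OF sum]
  \<comment> \<open>\<open>u\<close> lies in the sum of the images of the \<open>e k\<close>,
    expressed by test arrows \<open>h\<close> so that no finite sum of images has to be
    formed.\<close>
  let ?gen = "\<lambda>n e u. (\<forall>k<n::nat. e k \<in> Hom C G X) \<and>
    (\<forall>h\<in>Arr C. Dom C h = X \<longrightarrow> (\<forall>k<n. null (h \<cdot> e k)) \<longrightarrow> null (h \<cdot> u))"
  let ?K = "{u. mono_arr C u \<and> Cod C u = X \<and> (\<exists>n e. ?gen n e u)}"
  let ?z = "ker (Ident C X)"
  have z: "?z \<in> Arr C" "mono_arr C ?z" "Cod C ?z = X" "null ?z" using X ker_arr[of "Ident C X"] by simp_all
  have "null (h \<cdot> ?z)" if "h \<in> Arr C" "Dom C h = X" for h by (rule null_comp(1)) (use z that in simp_all)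
  then have "?gen 0 (\<lambda>_. ?z) ?z" by blast
  then have "?z \<in> ?K" using z by blast
  then have ne: "?K \<noteq> {}" by blast
  obtain u where u0: "u \<in> ?K" and max: "\<And>v. v \<in> ?K \<Longrightarrow> fac u v \<Longrightarrow> fac v u"
    by (rule maximal_subobject[OF X ne]) auto
  obtain n :: nat and e where u: "mono_arr C u" "Cod C u = X" and e: "\<And>k. k < n \<Longrightarrow> e k \<in> Hom C G X"
    and gen: "\<And>h. h \<in> Arr C \<Longrightarrow> Dom C h = X \<Longrightarrow> (\<And>k. k < n \<Longrightarrow> null (h \<cdot> e k)) \<Longrightarrow> null (h \<cdot> u)"
    using u0 by blast
  have uA: "u \<in> Arr C" using u mono_arr_arr by blast
  let ?q = "coker u"
  have q: "?q \<in> Arr C" "Dom C ?q = X" using uA u by simp_all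
  have "null ?q"
  proof (rule ccontr)
    assume "\<not> null ?q"
    then obtain v t where v: "mono_arr C v" "v \<in> Arr C" "Cod C v = Dom C ?q" "local_top t" "Dom C t = Dom C v" "\<not> null (?q \<cdot> v)"
      by (rule local_subobject[OF q(1)])
    obtain x p where x: "x \<in> \<Omega>" "epi_arr C p" "p \<in> Arr C" "Dom C p = P x" "Cod C p = Dom C t"
      by (rule local_quotient_of_family[OF v(4)])
    note Dx = D(5-10)[OF x(1)]
    have "epi_arr C (\<pi> x)" by (rule split_epi[of "\<iota> x"]) (use Dx D(11)[OF x(1) x(1)] in simp_all)
    then have p\<pi>: "epi_arr C (p \<cdot> \<pi> x)" by (rule epi_arr_comp[OF _ x(2)]) (use Dx x in simp)
    let ?c = "v \<cdot> (p \<cdot> \<pi> x)"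
    have c: "?c \<in> Arr C" "Dom C ?c = G" "Cod C ?c = X" using v x Dx q by simp_all
    obtain S i1 i2 p1 p2 where S: "S \<in> Obj C" "i1 \<in> Hom C (Dom C u) S" "i2 \<in> Hom C G S" "p1 \<in> Hom C S (Dom C u)" "p2 \<in> Hom C S G"
      "p1 \<cdot> i1 = Ident C (Dom C u)" "p2 \<cdot> i2 = Ident C G" "p1 \<cdot> i2 = hzero C G (Dom C u)" "p2 \<cdot> i1 = hzero C (Dom C u) G"
      by (rule binary_sum[of "Dom C u" G]) (use uA D in simp_all)
    have SA: "i1 \<in> Arr C" "Dom C i1 = Dom C u" "Cod C i1 = S" "i2 \<in> Arr C" "Dom C i2 = G" "Cod C i2 = S"
      "p1 \<in> Arr C" "Dom C p1 = S" "Cod C p1 = Dom C u" "p2 \<in> Arr C" "Dom C p2 = S" "Cod C p2 = G" using S by simp_all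
    let ?f1 = "u \<cdot> p1" and ?f2 = "?c \<cdot> p2"
    have f1: "?f1 \<in> Arr C" "Dom C ?f1 = S" "Cod C ?f1 = X" using uA u SA by simp_all
    have f2: "?f2 \<in> Arr C" "Dom C ?f2 = S" "Cod C ?f2 = X" using comp_arr[of p2 ?c] c SA by (simp_all del: comp_assoc')
    \<comment> \<open>The arrow from the biproduct of the source of \<open>u\<close> and
      \<open>G\<close> with components \<open>u\<close> and \<open>?c\<close>; its image
      \<open>j\<close> serves as the sum of \<open>u\<close> and the image of
      \<open>?c\<close>.\<close>
    let ?F = "hadd C ?f1 ?f2"
    have F: "?F \<in> Arr C" "Dom C ?F = S" "Cod C ?F = X" using f1 f2 by (simp_all del: comp_assoc')
    have Fi1: "?F \<cdot> i1 = u"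
    proof -
      have "?F \<cdot> i1 = hadd C (?f1 \<cdot> i1) (?f2 \<cdot> i1)" by (rule comp_hadd(2)) (use f1 f2 SA in \<open>simp_all del: comp_assoc'\<close>)
      also have "?f1 \<cdot> i1 = u \<cdot> (p1 \<cdot> i1)" by (rule comp_assoc') (use uA SA in simp_all)
      also have "?f2 \<cdot> i1 = ?c \<cdot> (p2 \<cdot> i1)" by (rule comp_assoc') (use c SA in \<open>simp_all del: comp_assoc'\<close>)
      also have "u \<cdot> (p1 \<cdot> i1) = u" using S(6) uA by simp
      also have "hadd C u (?c \<cdot> (p2 \<cdot> i1)) = u"
      proof (rule hadd_null(2))
        show "null (?c \<cdot> (p2 \<cdot> i1))" by (rule null_comp(1)[OF _ _ _ nullI[OF S(9)]]) (use c SA uA D(2) in \<open>simp_all del: comp_assoc'\<close>)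
      qed (use uA c SA u comp_arr[of "p2 \<cdot> i1" ?c] in \<open>simp_all del: comp_assoc'\<close>)
      finally show ?thesis .
    qed
    have Fi2: "?F \<cdot> i2 = ?c"
    proof -
      have "?F \<cdot> i2 = hadd C (?f1 \<cdot> i2) (?f2 \<cdot> i2)" by (rule comp_hadd(2)) (use f1 f2 SA in \<open>simp_all del: comp_assoc'\<close>)
      also have "?f1 \<cdot> i2 = u \<cdot> (p1 \<cdot> i2)" by (rule comp_assoc') (use uA SA in simp_all)
      also have "?f2 \<cdot> i2 = ?c \<cdot> (p2 \<cdot> i2)" by (rule comp_assoc') (use c SA in \<open>simp_all del: comp_assoc'\<close>)
      also have "?c \<cdot> (p2 \<cdot> i2) = ?c" unfolding S(7) by (rule ident_comp(2)[OF c(1,2)])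
      also have "hadd C (u \<cdot> (p1 \<cdot> i2)) ?c = ?c"
      proof (rule hadd_null(1))
        show "null (u \<cdot> (p1 \<cdot> i2))" by (rule null_comp(1)[OF _ _ _ nullI[OF S(8)]]) (use SA uA D in simp_all)
      qed (use uA c SA u in \<open>simp_all del: comp_assoc'\<close>)
      finally show ?thesis .
    qed
    obtain j r where j: "mono_arr C j" "epi_arr C r" "j \<in> Arr C" "r \<in> Arr C" "Dom C r = Dom C ?F"
      "Cod C j = Cod C ?F" "Dom C j = Cod C r" "j \<cdot> r = ?F" by (rule image_factorization[OF F(1)])
    have Fj: "fac ?F j" using facI[of j r] j(3,4,7,8) by simp
    have uj: "fac u j" and cj: "fac ?c j"
      using fac_comp[OF Fj SA(1)] fac_comp[OF Fj SA(4)] SA F unfolding Fi1 Fi2 by simp_all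
    have "?gen (Suc n) (e(n := ?c)) j"
    proof (intro conjI allI impI ballI)
      fix k assume "k < Suc n"
      then show "(e(n := ?c)) k \<in> Hom C G X" using e[of k] c by (cases "k = n") (simp_all del: comp_assoc')
    next
      fix h assume h: "h \<in> Arr C" "Dom C h = X" and all: "\<forall>k<Suc n. null (h \<cdot> (e(n := ?c)) k)"
      have "null (h \<cdot> e k)" if "k < n" for k using all[rule_format, of k] that by simp
      then have hu: "null (h \<cdot> u)" using gen[OF h] by blast
      have hc: "null (h \<cdot> ?c)" using all[rule_format, of n] by simp
      have "h \<cdot> ?F = hadd C (h \<cdot> ?f1) (h \<cdot> ?f2)" by (rule comp_hadd(1)) (use f1 f2 h in \<open>simp_all del: comp_assoc'\<close>)
      moreover have "null (hadd C (h \<cdot> ?f1) (h \<cdot> ?f2))"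
      proof (rule null_hadd)
        have "null ((h \<cdot> u) \<cdot> p1)" by (rule null_comp(2)[OF _ _ _ hu]) (use h uA u SA in simp_all)
        then show "null (h \<cdot> ?f1)" using h uA u SA by simp
        have "null ((h \<cdot> ?c) \<cdot> p2)" by (rule null_comp(2)[OF _ _ _ hc]) (use h c SA comp_arr[of ?c h] in \<open>simp_all del: comp_assoc'\<close>)
        moreover have "(h \<cdot> ?c) \<cdot> p2 = h \<cdot> ?f2" by (rule comp_assoc') (use h c SA in \<open>simp_all del: comp_assoc'\<close>)
        ultimately show "null (h \<cdot> ?f2)" by simp
      qed (use f1 f2 h comp_arr[of ?f2 h] in \<open>simp_all del: comp_assoc'\<close>)
      ultimately have "null (h \<cdot> (j \<cdot> r))" unfolding j(8) by simp
      then have "null ((h \<cdot> j) \<cdot> r)" using h j(3,4,6,7) F(3) by simp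
      then show "null (h \<cdot> j)" by (rule epiD[OF j(2)]) (use h j F in simp_all)
    qed
    moreover have "Cod C j = X" using j(6) F(3) by simp
    ultimately have "j \<in> ?K" using j(1) by blast
    then have "fac j u" using max uj by blast
    then have "fac ?c u" using cj fac_trans by blast
    then have "null (?q \<cdot> ?c)" by (rule null_coker_fac)
    then have "null ((?q \<cdot> v) \<cdot> (p \<cdot> \<pi> x))" using q v x Dx by simp
    then have "null (?q \<cdot> v)" by (rule epiD[OF p\<pi>]) (use q v x Dx in simp_all)
    then show False using v by simp
  qed
  then have eu: "epi_arr C u" by (rule epi_if_coker_null[OF uA])
  have "null h" if h: "h \<in> Arr C" "Dom C h = X" "\<forall>k<n. null (h \<cdot> e k)" for h
  proof -
    have "null (h \<cdot> u)" using gen[OF h(1,2)] h(3) by blast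
    then show "null h" by (rule epiD[OF eu]) (use h u in simp_all)
  qed
  then show ?thesis using e by blast
qed

lemma direct_sum_projective:
  assumes sum: "direct_sum C \<Omega> P G \<iota> \<pi>"
  shows "projective_obj C G"
  unfolding projective_obj_def
proof (intro conjI allI impI ballI)
  note D = direct_sumD[OF sum]
  show "G \<in> Obj C" by (rule D)
  fix e f assume e: "epi_arr C e" and f: "f \<in> Hom C G (Cod C e)"
  note eA = epi_arr_arr[OF e]
  have "\<exists>g \<in> Hom C (P x) (Dom C e). e \<cdot> g = f \<cdot> \<iota> x" if x: "x \<in> \<Omega>" for x
  proof -
    have "f \<cdot> \<iota> x \<in> Hom C (P x) (Cod C e)" using f D(5-7)[OF x] by simp
    then show ?thesis using family_projective[OF x] e unfolding projective_obj_def by blast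
  qed
  then obtain g where g: "\<And>x. x \<in> \<Omega> \<Longrightarrow> g x \<in> Hom C (P x) (Dom C e)" "\<And>x. x \<in> \<Omega> \<Longrightarrow> e \<cdot> g x = f \<cdot> \<iota> x" by metis
  let ?g = "\<Oplus>\<^bsub>hom_group C G (Dom C e)\<^esub>x\<in>\<Omega>. g x \<cdot> \<pi> x"
  have o: "Dom C e \<in> Obj C" using eA by simp
  have gH: "?g \<in> Hom C G (Dom C e)" by (rule direct_sum_copair(1)[OF sum o g(1)])
  have eg: "e \<cdot> ?g \<in> Hom C G (Cod C e)" using gH eA by simp
  have "e \<cdot> ?g = f"
  proof (rule direct_sum_ext_left[OF sum eg f])
    fix x assume x: "x \<in> \<Omega>"
    have "(e \<cdot> ?g) \<cdot> \<iota> x = e \<cdot> (?g \<cdot> \<iota> x)" by (rule comp_assoc') (use gH eA D(5-7)[OF x] in simp_all)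
    also have "?g \<cdot> \<iota> x = g x" by (rule direct_sum_copair(2)[OF sum o g(1) x])
    finally show "(e \<cdot> ?g) \<cdot> \<iota> x = f \<cdot> \<iota> x" using g(2)[OF x] by simp
  qed
  then show "\<exists>g \<in> Hom C G (Dom C e). e \<cdot> g = f" using gH by blast
qed

lemma family_equivalence:
  "category_equivalence C
    (fp_modules (hom_ring C \<Omega> P) :: (('x \<Rightarrow> 'x \<Rightarrow> 'm, ('x \<Rightarrow> 'm) + 'u) rmodule, _) category)
    (hom_module C \<Omega> P) (hom_module_map C \<Omega> P)"
proof -
  obtain G \<iota> \<pi> where sum: "direct_sum C \<Omega> P G \<iota> \<pi>"
    using finite_direct_sum_exists[OF finite_\<Omega>, of P] P_obj by blast
  interpret finite_progenerator C \<Omega> P G \<iota> \<pi>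
    by unfold_locales (rule sum, rule direct_sum_projective[OF sum], rule family_generates[OF sum])
  show ?thesis by (rule hom_module_equivalence)
qed

end

theorem theorem1p2:
  fixes C :: "('o, 'm, 'z) additive_category_scheme"
    and M :: 'o
    and \<Omega> :: "'x set"
    and i :: "'x \<Rightarrow> 'm"
  defines "L \<equiv> subobjects C M"
    and "P \<equiv> (\<lambda>x. Dom C (i x))"
    and "S \<equiv> (\<lambda>x. top_obj C (Dom C (i x)))"
  assumes "length_category C"
    and "M \<in> Obj C"
    and M1: "acyclic (ext_quiver C)"
    and M2a: "distributive_lattice L"
    and M2b: "\<And>X. X \<in> Obj C \<Longrightarrow>
      \<exists>n D \<iota> \<pi>. direct_sum C {..<n::nat} (\<lambda>_. M) D \<iota> \<pi> \<and> subquotient C X D"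
    and M3: "\<And>n. join_irreducible L n \<Longrightarrow>
      top_map C (Dom C n) ` Hom C (Dom C n) (Dom C n)
        = Hom C (top_obj C (Dom C n)) (top_obj C (Dom C n))"
    and \<Omega>_irreducible: "\<And>x. x \<in> \<Omega> \<Longrightarrow> join_irreducible L (i x)"
    and \<Omega>_bij: "bij_betw (\<lambda>x. class_of\<^bsub>L\<^esub> (i x)) \<Omega> {class_of\<^bsub>L\<^esub> n | n. join_irreducible L n}"
  shows "(\<forall>x \<in> \<Omega>. indecomposable_obj C (P x) \<and> projective_obj C (P x)) \<and>
    (\<forall>Q. indecomposable_obj C Q \<and> projective_obj C Q \<longrightarrow> (\<exists>!x. x \<in> \<Omega> \<and> isomorphic C Q (P x))) \<and>
    (\<forall>x \<in> \<Omega>. simple_obj C (S x)) \<and>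
    (\<forall>T. simple_obj C T \<longrightarrow> (\<exists>x \<in> \<Omega>. isomorphic C T (S x))) \<and>
    category_equivalence C
      (fp_modules (hom_ring C \<Omega> P) ::
        (('x \<Rightarrow> 'x \<Rightarrow> 'm, ('x \<Rightarrow> 'm) + 'u) rmodule, _) category)
      (hom_module C \<Omega> P) (hom_module_map C \<Omega> P) \<and>
    (\<forall>x \<in> \<Omega>. \<forall>y \<in> \<Omega>.
      (i x \<sqsubseteq>\<^bsub>L\<^esub> i y \<longleftrightarrow> Hom C (P x) (P y) \<noteq> {hzero C (P x) (P y)}) \<and>
      (Hom C (P x) (P y) \<noteq> {hzero C (P x) (P y)} \<longleftrightarrow>
        (iso_class C (S x), iso_class C (S y)) \<in> (ext_quiver C)\<^sup>*))"
proof -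
  interpret length_category C by fact
  interpret F: join_irreducible_family C M \<Omega> i
    by unfold_locales (use \<open>M \<in> Obj C\<close> M1 M2a M2b M3 \<Omega>_irreducible \<Omega>_bij in \<open>simp_all only: L_def\<close>)
  have order: "(i x \<sqsubseteq>\<^bsub>L\<^esub> i y \<longleftrightarrow> Hom C (P x) (P y) \<noteq> {hzero C (P x) (P y)}) \<and>
      (Hom C (P x) (P y) \<noteq> {hzero C (P x) (P y)} \<longleftrightarrow>
        (iso_class C (S x), iso_class C (S y)) \<in> (ext_quiver C)\<^sup>*)" if "x \<in> \<Omega>" "y \<in> \<Omega>" for x y
  proof -
    have "i x \<sqsubseteq>\<^bsub>L\<^esub> i y \<longleftrightarrow> fac (i x) (i y)"
      unfolding L_def by (rule subobjects_le) (rule F.local_subD(1)[OF F.local_sub_family[OF that(1)]], rule F.local_subD(1)[OF F.local_sub_family[OF that(2)]])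
    then show ?thesis
      using F.fac_iff_hom_nonzero[OF that] F.fac_iff_path[OF that] unfolding P_def S_def by blast
  qed
  show ?thesis
  proof (intro conjI)
    show "\<forall>x \<in> \<Omega>. indecomposable_obj C (P x) \<and> projective_obj C (P x)"
      unfolding P_def using F.family_indecomposable F.family_projective by blast
    show "\<forall>Q. indecomposable_obj C Q \<and> projective_obj C Q \<longrightarrow> (\<exists>!x. x \<in> \<Omega> \<and> isomorphic C Q (P x))"
      unfolding P_def using F.indecomposable_projective_family by blast
    show "\<forall>x \<in> \<Omega>. simple_obj C (S x)"
      unfolding S_def using F.top_obj_simple by blast
    show "\<forall>T. simple_obj C T \<longrightarrow> (\<exists>x \<in> \<Omega>. isomorphic C T (S x))"
      unfolding S_def using F.simple_is_top by blast
    show "category_equivalence C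
      (fp_modules (hom_ring C \<Omega> P) ::
        (('x \<Rightarrow> 'x \<Rightarrow> 'm, ('x \<Rightarrow> 'm) + 'u) rmodule, _) category)
      (hom_module C \<Omega> P) (hom_module_map C \<Omega> P)"
      unfolding P_def by (rule F.family_equivalence)
  qed (use order in blast)
qed

end
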